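(* Suppose $p_0=1$ (normal case), and that the Hamiltonian $H$, its flow $\mathcal H$ and the Lagrangian submanifold $\Lambda$ satisfy Assumptions (A1), (A2), (A3) of the context. Let $\Phi:\mathcal U\to\mathbb R$ be $$\Phi(t,x)=\beta(x)+\theta\bigl(t,(\pi\mathcal H_t)^{-1}(x)\bigr).$$ If there exists a neighbourhood $\mathcal O'$ of $(\widehat T,\widehat x_f)$ in $\mathbb R\times N_f$ (in $\{\widehat T\}\times N_f$ when the final time is fixed) such that $(\widehat T,\widehat x_f)$ is a minimiser of $\Phi$ restricted to $\mathcal O'$, then $(\widehat T,\widehat\xi,\widehat\upsilon)$ is a strong local minimiser.
   Context: **Problem.** $M$ is an $n$-dimensional connected paracompact smooth manifold (with a Riemannian distance), $N_0,N_f\subseteq M$ are smooth connected embedded submanifolds, $U\subseteq\mathbb R^m$. The functions $c_0,c_f,f^0$ and the control-dependent vector field $f$ are defined on open sets and are $C^\infty$. Minimise $$J(T,\xi,\upsilon)=c_0(\xi(0))+c_f(\xi(T))+\int_0^T f^0(\xi(t),\upsilon(t))\,dt$$ subject to $\dot\xi(t)=f(\xi(t),\upsilon(t))$ for a.e. $t\in[0,T]$, $\xi(t)\in M$, $\xi(0)\in N_0$, $\xi(T)\in N_f$, $\upsilon\in L^\infty([0,T],U)$. The final time $T$ is either fixed or variable. A pair $(\xi,\upsilon)$ satisfying all these constraints is admissible; $\xi$ is then an admissible trajectory and $\upsilon$ an associated control. **Strong local minimiser.** The reference admissible trajectory $\widehat\xi$ (triple $(\widehat T,\widehat\xi,\widehat\upsilon)$)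 is a strong local minimiser if there are neighbourhoods, in $\mathbb R\times M$, $\mathcal V$ of the graph $\Gamma_{\widehat\xi}$ of $\widehat\xi$ and $\mathcal W$ of $(\widehat T,\widehat\xi(\widehat T))$ such that $\widehat\xi$ is a minimiser of $J$ among all admissible trajectories $\xi$ with $\Gamma_\xi\subset\mathcal V$ and $(T,\xi(T))\in\mathcal W$, independently of the associated control. **Symplectic notation.** $\pi:T^*M\to M$ is the cotangent bundle, $\boldsymbol s$ the Liouville form $\boldsymbol s(\ell)=\ell\circ\pi_*$, $\boldsymbol\sigma=d\boldsymbol s$. For a time-dependent Hamiltonian $H_t$ the Hamiltonian vector field $\overrightarrow{H}_t$ is defined by $\langle dH_t(\ell),\cdot\rangle=\boldsymbol\sigma_\ell(\cdot,\overrightarrow{H}_t(\ell))$. The flow of $\dot\lambda=\overrightarrow{H}_t(\lambda)$, $\lambda(0)=\ell$, is $\mathcal H(t,\ell)=\mathcal H_t(\ell)$. **Reference extremal (PMP).** A reference admissible triple $(\widehat T,\widehat\xi,\widehat\upsilon)$ is given, $\widehat x_0=\widehat\xi(0)$, $\widehat x_f=\widehat\xi(\widehat T)$. With $p_0\in\{0,1\}$ let $F(\ell,u)=\langle\ell,f(\pi\ell,u)\rangle-p_0f^0(\pi\ell,u)$, $\widehat F_t(\ell)=F(\ell,\widehat\upsilon(t))$, $F_{\max}(\ell)=\sup_{u\in U}F(\ell,u)$ (possibly $+\infty$). It is assumed that there is a non-trivial couple $(p_0,\widehat\lambda)$, with $\widehat\lambda:[0,\widehat T]\to T^*M$, $\pi\circ\widehat\lambda=\widehat\xi$,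 such that $\dot{\widehat\lambda}(t)=\overrightarrow{\widehat F}_t(\widehat\lambda(t))$ a.e., $\widehat\lambda(0)=p_0\,dc_0(\widehat x_0)$ on $T_{\widehat x_0}N_0$, $\widehat\lambda(\widehat T)=-p_0\,dc_f(\widehat x_f)$ on $T_{\widehat x_f}N_f$, and $\widehat F_t(\widehat\lambda(t))=\max_{u\in U}F(\widehat\lambda(t),u)=F_{\max}(\widehat\lambda(t))$; moreover $\widehat F_t(\widehat\lambda(t))$ is constant, and zero when $T$ is variable. Put $\widehat\ell_0=\widehat\lambda(0)$, $\widehat\ell_f=\widehat\lambda(\widehat T)$. Let $\alpha,\beta$ be smooth functions on $M$, locally defined near $\widehat x_0$ and $\widehat x_f$ respectively, with $\alpha=p_0c_0$ on $N_0$, $d\alpha(\widehat x_0)=\widehat\ell_0$, $\beta=p_0c_f$ on $N_f$, $d\beta(\widehat x_f)=-\widehat\ell_f$ (where $\beta$ is evaluated, points are understood to lie in its domain). $\Lambda\subset T^*M$ is the graph of $d\alpha$ on a contractible neighbourhood of $\widehat x_0$. **Lipschitz–Carathéodory.** For an open interval $J$ and finite-dimensional Riemannian smooth manifolds $X,Y$, a map $G:J\times X\to Y$ is Lipschitz–Carathéodory if: for a.e. $t$, $G(t,\cdot)$ is locally Lipschitz; for each $x$, $G(\cdot,x)$ is bounded measurable; for each compact $K\subseteq X$ there is an essentially bounded measurable $m$ with $d_Y(G(t,x),G(t,y))\le m(t)d_X(x,y)$ for $x,y\in K$. **Assumptions on $H$.** $J\supset[0,\widehat T]$ is an open interval, $\mathcal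 O\subseteq T^*M$ is open, $\mathcal O\supset\Lambda$, and $H:J\times\mathcal O\to\mathbb R$ is a time-dependent Hamiltonian. (A1) The flow $(t,\ell)\in J\times\Lambda\mapsto\mathcal H(t,\ell)\in T^*M$ is well defined and Lipschitz continuous, and the function $(t,\ell)\in J\times\Lambda\mapsto\langle\mathcal H_t(\ell),\pi_*\overrightarrow H_t\circ\mathcal H_t(\ell)\rangle-H_t\circ\mathcal H_t(\ell)$ is Lipschitz–Carathéodory. (A2) $H_t(\mathcal H_t(\ell))\ge F_{\max}(\mathcal H_t(\ell))$ for $(t,\ell)\in J\times\Lambda$; and for a.e. $t\in[0,\widehat T]$, $H_t(\widehat\lambda(t))=\widehat F_t(\widehat\lambda(t))=F_{\max}(\widehat\lambda(t))$ and $\overrightarrow H_t(\widehat\lambda(t))=\overrightarrow{\widehat F}_t(\widehat\lambda(t))$. (Consequently $\mathcal H_t(\widehat\ell_0)=\widehat\lambda(t)$ on $[0,\widehat T]$.) Fix a compact interval $I=[0,T_1]\subset J$ with $T_1>\widehat T$; $\Lambda$ is replaced by its intersection with a suitable open neighbourhood of $\widehat\ell_0$ so that $\mathcal H$ is defined on $I\times\Lambda$ and the flow of $\overrightarrow{\widehat F}_t$ is defined on $[0,\widehat T]\times\Lambda$. (A3) The map $(t,\ell)\in I\times\Lambda\mapsto(t,\pi\mathcal H_t(\ell))\in I\times M$ is bi-Lipschitz (Lipschitz with Lipschitz inverse) from $I\times\Lambda$ onto an open set $\mathcal U$ of $I\times M$ containing the graph of $\widehat\xi$. **The function $\theta$.**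 $\theta(t,\ell)=\alpha(\pi\ell)+\int_0^t\bigl(\langle\mathcal H_s(\ell),\pi_*\overrightarrow H_s\circ\mathcal H_s(\ell)\rangle-H_s\circ\mathcal H_s(\ell)\bigr)ds$. *)

theory Defs
  imports "HOL-Analysis.Analysis"
begin

section \<open>Smooth manifolds\<close>

text \<open>\<open>C k\<close> and \<open>C\<close>-infinity maps; the set is always open when these are used, so the unrestricted
  Frechet derivative at its points only depends on the values of the map on the set.\<close>

fun Ck_on :: "nat \<Rightarrow> 'a::euclidean_space set \<Rightarrow> ('a \<Rightarrow> 'b::real_normed_vector) \<Rightarrow> bool" where
  "Ck_on 0 S f \<longleftrightarrow> continuous_on S f"
| "Ck_on (Suc k) S f \<longleftrightarrow>
     (\<forall>x\<in>S. f differentiable (at x)) \<and> (\<forall>v. Ck_on k S (\<lambda>x. frechet_derivative f (at x) v))"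

definition smooth_on :: "'a::euclidean_space set \<Rightarrow> ('a \<Rightarrow> 'b::real_normed_vector) \<Rightarrow> bool" where
  "smooth_on S f \<longleftrightarrow> (\<forall>k. Ck_on k S f)"

text \<open>A chart is a pair of its domain and its coordinate map (arbitrary outside the domain).  The
  dimension of a manifold is \<open>DIM('e)\<close>.  The smooth structure is the one generated by the given atlas,
  which need not be maximal.\<close>

type_synonym ('a, 'e) chart = "'a set \<times> ('a \<Rightarrow> 'e)"

definition chart_inv :: "('a, 'e) chart \<Rightarrow> 'e \<Rightarrow> 'a" where
  "chart_inv c = inv_into (fst c) (snd c)"

definition smooth_atlas :: "'a set \<Rightarrow> ('a, 'e::euclidean_space) chart set \<Rightarrow> bool" where
  "smooth_atlas X A \<longleftrightarrow>
     (\<Union>c\<in>A. fst c) = X \<and>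
     (\<forall>c\<in>A. inj_on (snd c) (fst c) \<and> open (snd c ` fst c)) \<and>
     (\<forall>c\<in>A. \<forall>d\<in>A. open (snd c ` (fst c \<inter> fst d)) \<and>
        smooth_on (snd c ` (fst c \<inter> fst d)) (snd d \<circ> chart_inv c))"

definition mtop :: "'a set \<Rightarrow> ('a, 'e::euclidean_space) chart set \<Rightarrow> 'a topology" where
  "mtop X A = topology (\<lambda>W. W \<subseteq> X \<and> (\<forall>c\<in>A. open (snd c ` (W \<inter> fst c))))"

lemma openin_mtop:
  assumes "smooth_atlas X A"
  shows "openin (mtop X A) W \<longleftrightarrow> W \<subseteq> X \<and> (\<forall>c\<in>A. open (snd c ` (W \<inter> fst c)))"
proof -
  have inj: "inj_on (snd c) (fst c)" if "c \<in> A" for c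
    using assms that by (auto simp: smooth_atlas_def)
  have "istopology (\<lambda>W. W \<subseteq> X \<and> (\<forall>c\<in>A. open (snd c ` (W \<inter> fst c))))"
    unfolding istopology_def
  proof (intro conjI allI impI ballI)
    fix S T c
    assume S: "S \<subseteq> X \<and> (\<forall>c\<in>A. open (snd c ` (S \<inter> fst c)))"
      and T: "T \<subseteq> X \<and> (\<forall>c\<in>A. open (snd c ` (T \<inter> fst c)))"
    show "S \<inter> T \<subseteq> X" using S by blast
    assume c: "c \<in> A"
    have "snd c ` (S \<inter> T \<inter> fst c) = snd c ` (S \<inter> fst c) \<inter> snd c ` (T \<inter> fst c)"
      using inj[OF c] unfolding inj_on_def by blast
    then show "open (snd c ` (S \<inter> T \<inter> fst c))" using S T c by auto
  next
    fix K
    assume K: "\<forall>S\<in>K. S \<subseteq> X \<and> (\<forall>c\<in>A. open (snd c ` (S \<inter> fst c)))"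
    show "\<Union>K \<subseteq> X" using K by blast
    fix c assume c: "c \<in> A"
    have "snd c ` (\<Union>K \<inter> fst c) = (\<Union>S\<in>K. snd c ` (S \<inter> fst c))" by blast
    then show "open (snd c ` (\<Union>K \<inter> fst c))" using K c by auto
  qed
  then show ?thesis by (simp add: mtop_def topology_inverse')
qed

definition paracompact_space :: "'a topology \<Rightarrow> bool" where
  "paracompact_space \<tau> \<longleftrightarrow>
     (\<forall>\<C>. (\<forall>C\<in>\<C>. openin \<tau> C) \<and> \<Union>\<C> = topspace \<tau> \<longrightarrow>
       (\<exists>\<B>. (\<forall>B\<in>\<B>. openin \<tau> B \<and> (\<exists>C\<in>\<C>. B \<subseteq> C)) \<and> \<Union>\<B> = topspace \<tau> \<and>
         (\<forall>x\<in>topspace \<tau>. \<exists>W. openin \<tau> W \<and> x \<in> W \<and> finite {B \<in> \<B>. B \<inter> W \<noteq> {}})))"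

definition smooth_manifold :: "'a set \<Rightarrow> ('a, 'e::euclidean_space) chart set \<Rightarrow> bool" where
  "smooth_manifold X A \<longleftrightarrow> smooth_atlas X A \<and> Hausdorff_space (mtop X A) \<and>
     connected_space (mtop X A) \<and> paracompact_space (mtop X A)"

definition smooth_fun ::
    "('a, 'e::euclidean_space) chart set \<Rightarrow> 'a set \<Rightarrow> ('a \<Rightarrow> 'b::real_normed_vector) \<Rightarrow> bool" where
  "smooth_fun A W h \<longleftrightarrow> (\<forall>c\<in>A. smooth_on (snd c ` (fst c \<inter> W)) (h \<circ> chart_inv c))"


subsection \<open>Tangent vectors, differentials and one-forms\<close>

text \<open>A tangent vector at \<open>p\<close> is the family of its components in all the charts around \<open>p\<close>, which are
  related by the derivatives of the chart transitions (and set to zero for all other charts).\<close>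

type_synonym ('a, 'e) tvec = "('a, 'e) chart \<Rightarrow> 'e"

definition tangent_space :: "('a, 'e::euclidean_space) chart set \<Rightarrow> 'a \<Rightarrow> ('a, 'e) tvec set" where
  "tangent_space A p = {v.
     (\<forall>c\<in>A. \<forall>d\<in>A. p \<in> fst c \<and> p \<in> fst d \<longrightarrow>
        v d = frechet_derivative (snd d \<circ> chart_inv c) (at (snd c p)) (v c)) \<and>
     (\<forall>c. \<not> (c \<in> A \<and> p \<in> fst c) \<longrightarrow> v c = 0)}"

definition coord_vec ::
    "('a, 'e::euclidean_space) chart set \<Rightarrow> ('a, 'e) chart \<Rightarrow> 'a \<Rightarrow> 'e \<Rightarrow> ('a, 'e) tvec" where
  "coord_vec A c p w = (\<lambda>d. if d \<in> A \<and> p \<in> fst d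
     then frechet_derivative (snd d \<circ> chart_inv c) (at (snd c p)) w else 0)"

text \<open>Below, objects are computed in an arbitrarily chosen chart around the base point; the results do
  not depend on it.\<close>

definition chart_at :: "('a, 'e) chart set \<Rightarrow> 'a \<Rightarrow> ('a, 'e) chart" where
  "chart_at A p = (SOME c. c \<in> A \<and> p \<in> fst c)"

definition differentiable_at ::
    "('a, 'e::euclidean_space) chart set \<Rightarrow> ('a \<Rightarrow> real) \<Rightarrow> 'a \<Rightarrow> bool" where
  "differentiable_at A h p \<longleftrightarrow>
     (h \<circ> chart_inv (chart_at A p)) differentiable (at (snd (chart_at A p) p))"

definition diff_fun ::
    "('a, 'e::euclidean_space) chart set \<Rightarrow> ('a \<Rightarrow> real) \<Rightarrow> 'a \<Rightarrow> ('a, 'e) tvec \<Rightarrow> real" where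
  "diff_fun A h p v =
     frechet_derivative (h \<circ> chart_inv (chart_at A p)) (at (snd (chart_at A p) p)) (v (chart_at A p))"

definition push_forward ::
    "('a, 'e::euclidean_space) chart set \<Rightarrow> ('b, 'd::euclidean_space) chart set \<Rightarrow> ('a \<Rightarrow> 'b) \<Rightarrow>
     'a \<Rightarrow> ('a, 'e) tvec \<Rightarrow> ('b, 'd) tvec" where
  "push_forward A B \<phi> p v = (\<lambda>d. if d \<in> B \<and> \<phi> p \<in> fst d
     then frechet_derivative (snd d \<circ> \<phi> \<circ> chart_inv (chart_at A p)) (at (snd (chart_at A p) p))
            (v (chart_at A p))
     else 0)"

text \<open>Exterior derivative of a one-form \<open>\<omega>\<close>: in a chart, \<open>d\<omega>(v,w) = D\<^sub>v(\<omega>(w)) - D\<^sub>w(\<omega>(v))\<close>, where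
  \<open>v\<close> and \<open>w\<close> are extended to vector fields with constant components.\<close>

definition ext_deriv ::
    "('a, 'e::euclidean_space) chart set \<Rightarrow> ('a \<Rightarrow> ('a, 'e) tvec \<Rightarrow> real) \<Rightarrow>
     'a \<Rightarrow> ('a, 'e) tvec \<Rightarrow> ('a, 'e) tvec \<Rightarrow> real" where
  "ext_deriv A \<omega> p v w =
     (let c = chart_at A p;
          comp = (\<lambda>z y. \<omega> (chart_inv c y) (coord_vec A c (chart_inv c y) z))
      in frechet_derivative (comp (w c)) (at (snd c p)) (v c)
         - frechet_derivative (comp (v c)) (at (snd c p)) (w c))"


subsection \<open>Curves\<close>

definition has_velocity ::
    "('a, 'e::euclidean_space) chart set \<Rightarrow> (real \<Rightarrow> 'a) \<Rightarrow> real set \<Rightarrow> real \<Rightarrow> ('a, 'e) tvec \<Rightarrow> bool" where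
  "has_velocity A \<gamma> S t v \<longleftrightarrow> v \<in> tangent_space A (\<gamma> t) \<and>
     (\<forall>c\<in>A. \<gamma> t \<in> fst c \<longrightarrow> ((snd c \<circ> \<gamma>) has_vector_derivative v c) (at t within S))"

definition abs_continuous :: "real \<Rightarrow> real \<Rightarrow> (real \<Rightarrow> 'b::real_normed_vector) \<Rightarrow> bool" where
  "abs_continuous a b f \<longleftrightarrow>
     (\<forall>\<epsilon>>0. \<exists>\<delta>>0. \<forall>(n::nat) r s.
        (\<forall>i<n. a \<le> r i \<and> r i \<le> s i \<and> s i \<le> b) \<and>
        (\<forall>i<n. \<forall>j<n. i \<noteq> j \<longrightarrow> {r i<..<s i} \<inter> {r j<..<s j} = {}) \<and>
        (\<Sum>i<n. s i - r i) < \<delta> \<longrightarrow>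
        (\<Sum>i<n. norm (f (s i) - f (r i))) < \<epsilon>)"

definition ac_curve ::
    "'a set \<Rightarrow> ('a, 'e::euclidean_space) chart set \<Rightarrow> real set \<Rightarrow> (real \<Rightarrow> 'a) \<Rightarrow> bool" where
  "ac_curve X A S \<gamma> \<longleftrightarrow> continuous_map (top_of_set S) (mtop X A) \<gamma> \<and>
     (\<forall>c\<in>A. \<forall>a b. {a..b} \<subseteq> S \<and> \<gamma> ` {a..b} \<subseteq> fst c \<longrightarrow> abs_continuous a b (snd c \<circ> \<gamma>))"

definition C1_curve ::
    "'a set \<Rightarrow> ('a, 'e::euclidean_space) chart set \<Rightarrow> real \<Rightarrow> real \<Rightarrow> (real \<Rightarrow> 'a) \<Rightarrow>
     (real \<Rightarrow> ('a, 'e) tvec) \<Rightarrow> bool" where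
  "C1_curve X A a b \<gamma> v \<longleftrightarrow> continuous_map (top_of_set {a..b}) (mtop X A) \<gamma> \<and>
     (\<forall>t\<in>{a..b}. has_velocity A \<gamma> {a..b} t (v t)) \<and>
     (\<forall>c\<in>A. continuous_on {t \<in> {a..b}. \<gamma> t \<in> fst c} (\<lambda>t. v t c))"


subsection \<open>Embedded submanifolds\<close>

definition embedded_submanifold ::
    "'a set \<Rightarrow> ('a, 'e::euclidean_space) chart set \<Rightarrow> 'a set \<Rightarrow> bool" where
  "embedded_submanifold X A N \<longleftrightarrow> N \<subseteq> X \<and>
     (\<exists>k. \<forall>p\<in>N. \<exists>c L. smooth_atlas X (insert c A) \<and> p \<in> fst c \<and> subspace L \<and> dim L = k \<and>
        snd c ` (N \<inter> fst c) = {y \<in> snd c ` fst c. y - snd c p \<in> L})"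

definition submanifold_tangent_space ::
    "'a set \<Rightarrow> ('a, 'e::euclidean_space) chart set \<Rightarrow> 'a set \<Rightarrow> 'a \<Rightarrow> ('a, 'e) tvec set" where
  "submanifold_tangent_space X A N p =
     {v. \<exists>\<gamma> w e. 0 < e \<and> C1_curve X A (-e) e \<gamma> w \<and> \<gamma> ` {-e..e} \<subseteq> N \<and> \<gamma> 0 = p \<and> w 0 = v}"


subsection \<open>Riemannian metrics and distances\<close>

text \<open>Vectors are families indexed by charts, so the linear operations on them are written out.\<close>

definition riemannian_metric ::
    "'a set \<Rightarrow> ('a, 'e::euclidean_space) chart set \<Rightarrow>
     ('a \<Rightarrow> ('a, 'e) tvec \<Rightarrow> ('a, 'e) tvec \<Rightarrow> real) \<Rightarrow> bool" where
  "riemannian_metric X A g \<longleftrightarrow>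
     (\<forall>p\<in>X. \<forall>u\<in>tangent_space A p. \<forall>v\<in>tangent_space A p.
        g p u v = g p v u \<and>
        (u \<noteq> (\<lambda>c. 0) \<longrightarrow> 0 < g p u u) \<and>
        (\<forall>w\<in>tangent_space A p. \<forall>r s.
           g p (\<lambda>c. r *\<^sub>R u c + s *\<^sub>R v c) w = r * g p u w + s * g p v w)) \<and>
     (\<forall>c\<in>A. \<forall>y z. smooth_on (snd c ` fst c)
        (\<lambda>q. g (chart_inv c q) (coord_vec A c (chart_inv c q) y) (coord_vec A c (chart_inv c q) z)))"

text \<open>\<open>pw_C1_path X A g p q l\<close>: there is a piecewise \<open>C\<^sup>1\<close> curve of length \<open>l\<close> from \<open>p\<close> to \<open>q\<close>.\<close>

inductive pw_C1_path ::
    "'a set \<Rightarrow> ('a, 'e::euclidean_space) chart set \<Rightarrow>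
     ('a \<Rightarrow> ('a, 'e) tvec \<Rightarrow> ('a, 'e) tvec \<Rightarrow> real) \<Rightarrow> 'a \<Rightarrow> 'a \<Rightarrow> real \<Rightarrow> bool"
  for X A g where
  piece: "a \<le> b \<Longrightarrow> C1_curve X A a b \<gamma> v \<Longrightarrow>
     pw_C1_path X A g (\<gamma> a) (\<gamma> b) (integral {a..b} (\<lambda>t. sqrt (g (\<gamma> t) (v t) (v t))))"
| concat: "pw_C1_path X A g p q l \<Longrightarrow> pw_C1_path X A g q r m \<Longrightarrow> pw_C1_path X A g p r (l + m)"

definition riem_dist ::
    "'a set \<Rightarrow> ('a, 'e::euclidean_space) chart set \<Rightarrow>
     ('a \<Rightarrow> ('a, 'e) tvec \<Rightarrow> ('a, 'e) tvec \<Rightarrow> real) \<Rightarrow> 'a \<Rightarrow> 'a \<Rightarrow> real" where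
  "riem_dist X A g p q = Inf {l. pw_C1_path X A g p q l}"

definition lipschitz_wrt ::
    "('a \<Rightarrow> 'a \<Rightarrow> real) \<Rightarrow> ('b \<Rightarrow> 'b \<Rightarrow> real) \<Rightarrow> 'a set \<Rightarrow> ('a \<Rightarrow> 'b) \<Rightarrow> bool" where
  "lipschitz_wrt d1 d2 S h \<longleftrightarrow> (\<exists>L\<ge>0. \<forall>x\<in>S. \<forall>y\<in>S. d2 (h x) (h y) \<le> L * d1 x y)"

definition lipschitz_caratheodory ::
    "real set \<Rightarrow> 'x topology \<Rightarrow> ('x \<Rightarrow> 'x \<Rightarrow> real) \<Rightarrow> (real \<Rightarrow> 'x \<Rightarrow> 'y::metric_space) \<Rightarrow> bool" where
  "lipschitz_caratheodory J \<tau> d G \<longleftrightarrow>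
     (AE t in lebesgue. t \<in> J \<longrightarrow>
        (\<forall>x\<in>topspace \<tau>. \<exists>W. openin \<tau> W \<and> x \<in> W \<and> lipschitz_wrt d dist W (G t))) \<and>
     (\<forall>x\<in>topspace \<tau>. (\<lambda>t. G t x) \<in> borel_measurable (lebesgue_on J) \<and> bounded ((\<lambda>t. G t x) ` J)) \<and>
     (\<forall>K. compactin \<tau> K \<longrightarrow>
        (\<exists>m. m \<in> borel_measurable (lebesgue_on J) \<and>
           (\<exists>B. AE t in lebesgue. t \<in> J \<longrightarrow> \<bar>m t\<bar> \<le> B) \<and>
           (AE t in lebesgue. t \<in> J \<longrightarrow> (\<forall>x\<in>K. \<forall>y\<in>K. dist (G t x) (G t y) \<le> m t * d x y))))"


section \<open>The cotangent bundle\<close>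

text \<open>Covectors are linear functionals on the tangent space, set to zero outside of it; a point of the
  cotangent bundle is a pair of a base point and a covector, so that the bundle projection is
  \<^const>\<open>fst\<close>.\<close>

type_synonym ('a, 'e) covec = "'a \<times> (('a, 'e) tvec \<Rightarrow> real)"

definition cotangent_space ::
    "('a, 'e::euclidean_space) chart set \<Rightarrow> 'a \<Rightarrow> (('a, 'e) tvec \<Rightarrow> real) set" where
  "cotangent_space A p = {l.
     (\<forall>u\<in>tangent_space A p. \<forall>v\<in>tangent_space A p. \<forall>r s.
        l (\<lambda>c. r *\<^sub>R u c + s *\<^sub>R v c) = r * l u + s * l v) \<and>
     (\<forall>v. v \<notin> tangent_space A p \<longrightarrow> l v = 0)}"

definition cot_bundle :: "'a set \<Rightarrow> ('a, 'e::euclidean_space) chart set \<Rightarrow> ('a, 'e) covec set" where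
  "cot_bundle X A = {(x, l). x \<in> X \<and> l \<in> cotangent_space A x}"

text \<open>The usual coordinates \<open>(q, p)\<close>, where the \<open>b\<close>-component of \<open>p\<close> is the value of the covector on
  the \<open>b\<close>-th coordinate vector.\<close>

definition cot_chart ::
    "('a, 'e::euclidean_space) chart set \<Rightarrow> ('a, 'e) chart \<Rightarrow> (('a, 'e) covec, 'e \<times> 'e) chart" where
  "cot_chart A c =
     (cot_bundle (fst c) A,
      \<lambda>\<l>. (snd c (fst \<l>), \<Sum>b\<in>Basis. snd \<l> (coord_vec A c (fst \<l>) b) *\<^sub>R b))"

definition cot_atlas ::
    "('a, 'e::euclidean_space) chart set \<Rightarrow> (('a, 'e) covec, 'e \<times> 'e) chart set" where
  "cot_atlas A = cot_chart A ` A"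

abbreviation cot_top ::
    "'a set \<Rightarrow> ('a, 'e::euclidean_space) chart set \<Rightarrow> ('a, 'e) covec topology" where
  "cot_top X A \<equiv> mtop (cot_bundle X A) (cot_atlas A)"

definition diff_covec ::
    "('a, 'e::euclidean_space) chart set \<Rightarrow> ('a \<Rightarrow> real) \<Rightarrow> 'a \<Rightarrow> ('a, 'e) covec" where
  "diff_covec A h x = (x, \<lambda>v. if v \<in> tangent_space A x then diff_fun A h x v else 0)"

abbreviation bundle_push ::
    "('a, 'e::euclidean_space) chart set \<Rightarrow> ('a, 'e) covec \<Rightarrow> (('a, 'e) covec, 'e \<times> 'e) tvec \<Rightarrow>
     ('a, 'e) tvec" where
  "bundle_push A \<equiv> push_forward (cot_atlas A) A fst"

definition liouville ::
    "('a, 'e::euclidean_space) chart set \<Rightarrow> ('a, 'e) covec \<Rightarrow> (('a, 'e) covec, 'e \<times> 'e) tvec \<Rightarrow> real" where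
  "liouville A \<l> V = snd \<l> (bundle_push A \<l> V)"

definition symplectic ::
    "('a, 'e::euclidean_space) chart set \<Rightarrow> ('a, 'e) covec \<Rightarrow> (('a, 'e) covec, 'e \<times> 'e) tvec \<Rightarrow>
     (('a, 'e) covec, 'e \<times> 'e) tvec \<Rightarrow> real" where
  "symplectic A = ext_deriv (cot_atlas A) (liouville A)"

definition ham_vec ::
    "('a, 'e::euclidean_space) chart set \<Rightarrow> (('a, 'e) covec \<Rightarrow> real) \<Rightarrow> ('a, 'e) covec \<Rightarrow>
     (('a, 'e) covec, 'e \<times> 'e) tvec" where
  "ham_vec A h \<l> = (THE V. V \<in> tangent_space (cot_atlas A) \<l> \<and>
     (\<forall>W\<in>tangent_space (cot_atlas A) \<l>. diff_fun (cot_atlas A) h \<l> W = symplectic A \<l> W V))"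

text \<open>Caratheodory solutions, on the interval \<open>S\<close>, of the Hamiltonian system of \<open>H\<close> on \<open>Q\<close>.\<close>

definition ham_solution ::
    "'a set \<Rightarrow> ('a, 'e::euclidean_space) chart set \<Rightarrow> ('a, 'e) covec set \<Rightarrow>
     (real \<Rightarrow> ('a, 'e) covec \<Rightarrow> real) \<Rightarrow> real set \<Rightarrow> (real \<Rightarrow> ('a, 'e) covec) \<Rightarrow> bool" where
  "ham_solution X A Q H S \<mu> \<longleftrightarrow>
     ac_curve (cot_bundle X A) (cot_atlas A) S \<mu> \<and> \<mu> ` S \<subseteq> Q \<and>
     (AE t in lebesgue. t \<in> S \<longrightarrow>
        differentiable_at (cot_atlas A) (H t) (\<mu> t) \<and>
        has_velocity (cot_atlas A) \<mu> S t (ham_vec A (H t) (\<mu> t)))"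

text \<open>\<open>\<H>\<close> is the flow of \<open>H\<close> on \<open>J \<times> \<Lambda>\<close>: existence and uniqueness of the solutions.  No regularity is
  required of \<open>H\<close> except that its Hamiltonian vector field exists along the flow.\<close>

definition is_ham_flow ::
    "'a set \<Rightarrow> ('a, 'e::euclidean_space) chart set \<Rightarrow> ('a, 'e) covec set \<Rightarrow>
     (real \<Rightarrow> ('a, 'e) covec \<Rightarrow> real) \<Rightarrow> real set \<Rightarrow> ('a, 'e) covec set \<Rightarrow>
     (real \<Rightarrow> ('a, 'e) covec \<Rightarrow> ('a, 'e) covec) \<Rightarrow> bool" where
  "is_ham_flow X A Q H J \<Lambda> \<H> \<longleftrightarrow>
     (\<forall>\<l>\<in>\<Lambda>. \<H> 0 \<l> = \<l> \<and> ham_solution X A Q H J (\<lambda>t. \<H> t \<l>) \<and>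
        (\<forall>t\<in>J. differentiable_at (cot_atlas A) (H t) (\<H> t \<l>)) \<and>
        (\<forall>S \<mu>. is_interval S \<and> 0 \<in> S \<and> S \<subseteq> J \<and> ham_solution X A Q H S \<mu> \<and> \<mu> 0 = \<l> \<longrightarrow>
           (\<forall>t\<in>S. \<mu> t = \<H> t \<l>)))"

definition action_density ::
    "('a, 'e::euclidean_space) chart set \<Rightarrow> (real \<Rightarrow> ('a, 'e) covec \<Rightarrow> real) \<Rightarrow>
     (real \<Rightarrow> ('a, 'e) covec \<Rightarrow> ('a, 'e) covec) \<Rightarrow> real \<Rightarrow> ('a, 'e) covec \<Rightarrow> real" where
  "action_density A H \<H> t \<l> =
     snd (\<H> t \<l>) (bundle_push A (\<H> t \<l>) (ham_vec A (H t) (\<H> t \<l>))) - H t (\<H> t \<l>)"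


section \<open>The optimal control problem\<close>

text \<open>\<open>final_time = None\<close> means that the final time is variable, \<open>final_time = Some T\<close> that it is fixed
  to be \<open>T\<close>.\<close>

record ('m, 'e, 'u) control_problem =
  mfd :: "'m set"
  atl :: "('m, 'e) chart set"
  init_mfd :: "'m set"
  final_mfd :: "'m set"
  ctrl :: "'u set"
  dom_init :: "'m set"
  init_cost :: "'m \<Rightarrow> real"
  dom_final :: "'m set"
  final_cost :: "'m \<Rightarrow> real"
  dom_dyn :: "('m \<times> 'u) set"
  run_cost :: "'m \<Rightarrow> 'u \<Rightarrow> real"
  vfield :: "'m \<Rightarrow> 'u \<Rightarrow> ('m, 'e) tvec"
  final_time :: "real option"

definition problem_data ::
    "('m, 'e::euclidean_space, 'u::euclidean_space) control_problem \<Rightarrow> bool" where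
  "problem_data P \<longleftrightarrow>
     smooth_manifold (mfd P) (atl P) \<and>
     embedded_submanifold (mfd P) (atl P) (init_mfd P) \<and>
     connectedin (mtop (mfd P) (atl P)) (init_mfd P) \<and>
     embedded_submanifold (mfd P) (atl P) (final_mfd P) \<and>
     connectedin (mtop (mfd P) (atl P)) (final_mfd P) \<and>
     openin (mtop (mfd P) (atl P)) (dom_init P) \<and> init_mfd P \<subseteq> dom_init P \<and>
     smooth_fun (atl P) (dom_init P) (init_cost P) \<and>
     openin (mtop (mfd P) (atl P)) (dom_final P) \<and> final_mfd P \<subseteq> dom_final P \<and>
     smooth_fun (atl P) (dom_final P) (final_cost P) \<and>
     openin (prod_topology (mtop (mfd P) (atl P)) euclidean) (dom_dyn P) \<and>
     mfd P \<times> ctrl P \<subseteq> dom_dyn P \<and>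
     (\<forall>(x, u)\<in>dom_dyn P. vfield P x u \<in> tangent_space (atl P) x) \<and>
     (\<forall>c\<in>atl P.
        let D = {(y, u). y \<in> snd c ` fst c \<and> (chart_inv c y, u) \<in> dom_dyn P} in
        smooth_on D (\<lambda>(y, u). run_cost P (chart_inv c y) u) \<and>
        smooth_on D (\<lambda>(y, u). vfield P (chart_inv c y) u c))"

text \<open>Integrability of the running cost is part of admissibility, so that the cost is defined.\<close>

definition admissible ::
    "('m, 'e::euclidean_space, 'u::euclidean_space) control_problem \<Rightarrow> real \<Rightarrow> (real \<Rightarrow> 'm) \<Rightarrow>
     (real \<Rightarrow> 'u) \<Rightarrow> bool" where
  "admissible P T \<xi> \<upsilon> \<longleftrightarrow>
     0 < T \<and> (\<forall>\<tau>. final_time P = Some \<tau> \<longrightarrow> T = \<tau>) \<and>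
     \<upsilon> \<in> borel_measurable (lebesgue_on {0..T}) \<and>
     (\<exists>B. AE t in lebesgue. t \<in> {0..T} \<longrightarrow> norm (\<upsilon> t) \<le> B) \<and>
     (AE t in lebesgue. t \<in> {0..T} \<longrightarrow> \<upsilon> t \<in> ctrl P) \<and>
     ac_curve (mfd P) (atl P) {0..T} \<xi> \<and>
     (AE t in lebesgue. t \<in> {0..T} \<longrightarrow> has_velocity (atl P) \<xi> {0..T} t (vfield P (\<xi> t) (\<upsilon> t))) \<and>
     \<xi> 0 \<in> init_mfd P \<and> \<xi> T \<in> final_mfd P \<and>
     set_integrable lebesgue {0..T} (\<lambda>t. run_cost P (\<xi> t) (\<upsilon> t))"

definition cost ::
    "('m, 'e::euclidean_space, 'u::euclidean_space) control_problem \<Rightarrow> real \<Rightarrow> (real \<Rightarrow> 'm) \<Rightarrow>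
     (real \<Rightarrow> 'u) \<Rightarrow> real" where
  "cost P T \<xi> \<upsilon> = init_cost P (\<xi> 0) + final_cost P (\<xi> T) +
     (LINT t:{0..T}|lebesgue. run_cost P (\<xi> t) (\<upsilon> t))"

definition strong_local_minimiser ::
    "('m, 'e::euclidean_space, 'u::euclidean_space) control_problem \<Rightarrow> real \<Rightarrow> (real \<Rightarrow> 'm) \<Rightarrow>
     (real \<Rightarrow> 'u) \<Rightarrow> bool" where
  "strong_local_minimiser P T\<^sub>h \<xi>\<^sub>h \<upsilon>\<^sub>h \<longleftrightarrow>
     admissible P T\<^sub>h \<xi>\<^sub>h \<upsilon>\<^sub>h \<and>
     (\<exists>\<V> \<W>. openin (prod_topology euclideanreal (mtop (mfd P) (atl P))) \<V> \<and>
        openin (prod_topology euclideanreal (mtop (mfd P) (atl P))) \<W> \<and>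
        (\<lambda>t. (t, \<xi>\<^sub>h t)) ` {0..T\<^sub>h} \<subseteq> \<V> \<and> (T\<^sub>h, \<xi>\<^sub>h T\<^sub>h) \<in> \<W> \<and>
        (\<forall>T \<xi> \<upsilon>. admissible P T \<xi> \<upsilon> \<and> (\<lambda>t. (t, \<xi> t)) ` {0..T} \<subseteq> \<V> \<and> (T, \<xi> T) \<in> \<W> \<longrightarrow>
           cost P T\<^sub>h \<xi>\<^sub>h \<upsilon>\<^sub>h \<le> cost P T \<xi> \<upsilon>))"

definition pre_ham ::
    "('m, 'e::euclidean_space, 'u::euclidean_space) control_problem \<Rightarrow> real \<Rightarrow> ('m, 'e) covec \<Rightarrow>
     'u \<Rightarrow> real" where
  "pre_ham P p\<^sub>0 \<l> u = snd \<l> (vfield P (fst \<l>) u) - p\<^sub>0 * run_cost P (fst \<l>) u"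

definition max_ham ::
    "('m, 'e::euclidean_space, 'u::euclidean_space) control_problem \<Rightarrow> real \<Rightarrow> ('m, 'e) covec \<Rightarrow>
     ereal" where
  "max_ham P p\<^sub>0 \<l> = (SUP u\<in>ctrl P. ereal (pre_ham P p\<^sub>0 \<l> u))"

definition ref_ham ::
    "('m, 'e::euclidean_space, 'u::euclidean_space) control_problem \<Rightarrow> real \<Rightarrow> (real \<Rightarrow> 'u) \<Rightarrow>
     real \<Rightarrow> ('m, 'e) covec \<Rightarrow> real" where
  "ref_ham P p\<^sub>0 \<upsilon> t \<l> = pre_ham P p\<^sub>0 \<l> (\<upsilon> t)"

definition pmp_extremal ::
    "('m, 'e::euclidean_space, 'u::euclidean_space) control_problem \<Rightarrow> real \<Rightarrow> (real \<Rightarrow> 'm) \<Rightarrow>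
     (real \<Rightarrow> 'u) \<Rightarrow> real \<Rightarrow> (real \<Rightarrow> ('m, 'e) covec) \<Rightarrow> bool" where
  "pmp_extremal P T \<xi> \<upsilon> p\<^sub>0 \<mu> \<longleftrightarrow>
     p\<^sub>0 \<in> {0, 1} \<and> (p\<^sub>0 \<noteq> 0 \<or> (\<exists>t\<in>{0..T}. snd (\<mu> t) \<noteq> (\<lambda>v. 0))) \<and>
     (\<forall>t\<in>{0..T}. fst (\<mu> t) = \<xi> t) \<and>
     ham_solution (mfd P) (atl P) (cot_bundle (mfd P) (atl P)) (ref_ham P p\<^sub>0 \<upsilon>) {0..T} \<mu> \<and>
     (\<forall>v\<in>submanifold_tangent_space (mfd P) (atl P) (init_mfd P) (\<xi> 0).
        snd (\<mu> 0) v = p\<^sub>0 * diff_fun (atl P) (init_cost P) (\<xi> 0) v) \<and>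
     (\<forall>v\<in>submanifold_tangent_space (mfd P) (atl P) (final_mfd P) (\<xi> T).
        snd (\<mu> T) v = - p\<^sub>0 * diff_fun (atl P) (final_cost P) (\<xi> T) v) \<and>
     (AE t in lebesgue. t \<in> {0..T} \<longrightarrow> ereal (ref_ham P p\<^sub>0 \<upsilon> t (\<mu> t)) = max_ham P p\<^sub>0 (\<mu> t)) \<and>
     (\<exists>k. (AE t in lebesgue. t \<in> {0..T} \<longrightarrow> ref_ham P p\<^sub>0 \<upsilon> t (\<mu> t) = k) \<and>
        (final_time P = None \<longrightarrow> k = 0))"


subsection \<open>The assumptions on the Hamiltonian\<close>

text \<open>In the sequel \<open>d\<close> is a distance on the cotangent bundle; subsets carry the restricted distance.\<close>

definition assumption_A1 ::
    "'m set \<Rightarrow> ('m, 'e::euclidean_space) chart set \<Rightarrow> (('m, 'e) covec \<Rightarrow> ('m, 'e) covec \<Rightarrow> real) \<Rightarrow>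
     real set \<Rightarrow> ('m, 'e) covec set \<Rightarrow> ('m, 'e) covec set \<Rightarrow> (real \<Rightarrow> ('m, 'e) covec \<Rightarrow> real) \<Rightarrow>
     (real \<Rightarrow> ('m, 'e) covec \<Rightarrow> ('m, 'e) covec) \<Rightarrow> bool" where
  "assumption_A1 X A d J Q \<Lambda> H \<H> \<longleftrightarrow>
     is_ham_flow X A Q H J \<Lambda> \<H> \<and>
     lipschitz_wrt (prod_dist dist d) d (J \<times> \<Lambda>) (\<lambda>(t, \<l>). \<H> t \<l>) \<and>
     lipschitz_caratheodory J (subtopology (cot_top X A) \<Lambda>) d (action_density A H \<H>)"

definition assumption_A2 ::
    "('m, 'e::euclidean_space, 'u::euclidean_space) control_problem \<Rightarrow> real \<Rightarrow> (real \<Rightarrow> 'u) \<Rightarrow> real \<Rightarrow>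
     (real \<Rightarrow> ('m, 'e) covec) \<Rightarrow> real set \<Rightarrow> ('m, 'e) covec set \<Rightarrow> ('m, 'e) covec set \<Rightarrow>
     (real \<Rightarrow> ('m, 'e) covec \<Rightarrow> real) \<Rightarrow> (real \<Rightarrow> ('m, 'e) covec \<Rightarrow> ('m, 'e) covec) \<Rightarrow> bool" where
  "assumption_A2 P T \<upsilon> p\<^sub>0 \<mu> J Q \<Lambda> H \<H> \<longleftrightarrow>
     (\<forall>t\<in>J. \<forall>\<l>\<in>\<Lambda>. max_ham P p\<^sub>0 (\<H> t \<l>) \<le> ereal (H t (\<H> t \<l>))) \<and>
     (AE t in lebesgue. t \<in> {0..T} \<longrightarrow>
        \<mu> t \<in> Q \<and>
        H t (\<mu> t) = ref_ham P p\<^sub>0 \<upsilon> t (\<mu> t) \<and>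
        ereal (ref_ham P p\<^sub>0 \<upsilon> t (\<mu> t)) = max_ham P p\<^sub>0 (\<mu> t) \<and>
        differentiable_at (cot_atlas (atl P)) (H t) (\<mu> t) \<and>
        ham_vec (atl P) (H t) (\<mu> t) = ham_vec (atl P) (ref_ham P p\<^sub>0 \<upsilon> t) (\<mu> t))"

definition flow_image ::
    "real set \<Rightarrow> ('m, 'e) covec set \<Rightarrow> (real \<Rightarrow> ('m, 'e) covec \<Rightarrow> ('m, 'e) covec) \<Rightarrow> (real \<times> 'm) set" where
  "flow_image I \<Lambda> \<H> = (\<lambda>(t, \<l>). (t, fst (\<H> t \<l>))) ` (I \<times> \<Lambda>)"

text \<open>Here \<open>d\<close> and \<open>d'\<close> are the distances on the manifold and on its cotangent bundle.\<close>

definition assumption_A3 ::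
    "'m set \<Rightarrow> ('m, 'e::euclidean_space) chart set \<Rightarrow> ('m \<Rightarrow> 'm \<Rightarrow> real) \<Rightarrow>
     (('m, 'e) covec \<Rightarrow> ('m, 'e) covec \<Rightarrow> real) \<Rightarrow> real \<Rightarrow> (real \<Rightarrow> 'm) \<Rightarrow> real set \<Rightarrow>
     ('m, 'e) covec set \<Rightarrow> (real \<Rightarrow> ('m, 'e) covec \<Rightarrow> ('m, 'e) covec) \<Rightarrow> bool" where
  "assumption_A3 X A d d' T \<xi> I \<Lambda> \<H> \<longleftrightarrow>
     (let \<Psi> = (\<lambda>(t, \<l>). (t, fst (\<H> t \<l>))); \<U> = flow_image I \<Lambda> \<H> in
       inj_on \<Psi> (I \<times> \<Lambda>) \<and>
       lipschitz_wrt (prod_dist dist d') (prod_dist dist d) (I \<times> \<Lambda>) \<Psi> \<and>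
       lipschitz_wrt (prod_dist dist d) (prod_dist dist d') \<U> (inv_into (I \<times> \<Lambda>) \<Psi>) \<and>
       openin (subtopology (prod_topology euclideanreal (mtop X A)) (I \<times> X)) \<U> \<and>
       (\<lambda>t. (t, \<xi> t)) ` {0..T} \<subseteq> \<U>)"

definition theta ::
    "('m, 'e::euclidean_space) chart set \<Rightarrow> ('m \<Rightarrow> real) \<Rightarrow> (real \<Rightarrow> ('m, 'e) covec \<Rightarrow> real) \<Rightarrow>
     (real \<Rightarrow> ('m, 'e) covec \<Rightarrow> ('m, 'e) covec) \<Rightarrow> real \<Rightarrow> ('m, 'e) covec \<Rightarrow> real" where
  "theta A \<alpha> H \<H> t \<l> = \<alpha> (fst \<l>) + (LINT s:{0..t}|lebesgue. action_density A H \<H> s \<l>)"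

definition Phi ::
    "('m, 'e::euclidean_space) chart set \<Rightarrow> ('m \<Rightarrow> real) \<Rightarrow> ('m \<Rightarrow> real) \<Rightarrow>
     (real \<Rightarrow> ('m, 'e) covec \<Rightarrow> real) \<Rightarrow> (real \<Rightarrow> ('m, 'e) covec \<Rightarrow> ('m, 'e) covec) \<Rightarrow>
     ('m, 'e) covec set \<Rightarrow> real \<times> 'm \<Rightarrow> real" where
  "Phi A \<alpha> \<beta> H \<H> \<Lambda> = (\<lambda>(t, x).
     \<beta> x + theta A \<alpha> H \<H> t (inv_into \<Lambda> (\<lambda>\<l>. fst (\<H> t \<l>)) x))"

end

theory Submission
  imports Defs
begin

text \<open>
  The function \<open>S (t, x) = \<theta> (t, (\<pi> \<H>\<^sub>t)\<^sup>-\<^sup>1 x)\<close> on \<open>\<U>\<close> is a verification function. Formally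
  its differential in \<open>x\<close> is the covector \<open>\<H>\<^sub>t (\<ell>)\<close> over \<open>x\<close>, and \<open>\<partial>\<^sub>t S = - H\<^sub>t\<close>; as \<open>H\<^sub>t\<close> dominates
  \<open>\<langle>p, f (x, u)\<rangle> - f\<^sup>0 (x, u)\<close>, the function \<open>S\<close> grows along an admissible trajectory at most at the rate of
  the running cost, and exactly at this rate along the reference trajectory. Since \<open>S = \<alpha> = c\<^sub>0\<close> at
  time zero on \<open>N\<^sub>0\<close> and \<open>\<beta> = c\<^sub>f\<close> on \<open>N\<^sub>f\<close>, the cost of an admissible trajectory is at least the value
  of \<open>\<Phi>\<close> at its end point, with equality for the reference, and a local minimum of \<open>\<Phi>\<close> gives a strong
  local minimiser.

  The flow is only Lipschitz and \<open>H\<close> is known to be differentiable only along it, so \<open>S\<close> need not be differentiable, and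
  the argument is carried out on increments. It rests on the following facts.

  The action expansion (\<open>theta_expansion\<close>): in a cotangent chart with coordinates \<open>(q, p)\<close>, the
  difference \<open>\<theta> (t, \<ell>') - \<theta> (t, \<ell>)\<close> is \<open>p \<bullet> (q' - q)\<close> up to a small multiple of the distance of
  the initial points. For smooth flows this is the classical identity \<open>d\<theta>\<^sub>t = \<H>\<^sub>t\<^sup>* \<^bold>s\<close> on \<open>\<Lambda>\<close>. Here \<open>\<Lambda>\<close> is
  joined by segments to get a strip of solutions depending on one parameter \<open>s\<close>, and the derivative in
  \<open>s\<close> is replaced by difference quotients: after an integration by parts in time, \<open>action_expansion\<close>
  needs that the first order expansion of \<open>H\<close> along the strip holds and that the velocities of a
  Lipschitz family are continuous in mean under translations of \<open>s\<close>.

  The growth along a trajectory (\<open>lift_good\<close>, \<open>lift_bad\<close>): at almost every time \<open>t\<close> the growth of the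
  action between two near times is compared with the one along the single integral curve of the flow
  that passes over \<open>\<xi> t\<close> at time \<open>t\<close>, with the control frozen at the value \<open>\<upsilon> t\<close>. Then only continuous functions of time
  have to be compared with \<open>H\<close>. At the exceptional times the growth is still bounded by the elapsed time and the
  displacement of \<open>\<xi>\<close>. As \<open>\<xi>\<close> is absolutely continuous, these times do not matter
  (\<open>increment_le_integral\<close>), and \<open>lifted_action_le\<close> follows.

  The assumptions speak of Riemannian distances. Charts turn them into Euclidean estimates, because the
  coordinates are locally bi-Lipschitz (\<open>riem_dist_upper\<close>, \<open>riem_dist_lower\<close>); and the cotangent charts are
  symplectic, so that the Hamiltonian vector field has its usual coordinate form (\<open>ham_vec_eq\<close>).
\<close>

section \<open>Increments bounded by integrals\<close>

text \<open>Absolute continuity in terms of tagged divisions, the form in which it is used with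
  gauges.\<close>

lemma abs_continuous_sum:
  fixes w :: "real \<Rightarrow> 'b::real_normed_vector"
  assumes "abs_continuous a b w" "\<epsilon> > 0"
  obtains \<delta> where "\<delta> > 0"
    "\<And>p. \<lbrakk>p tagged_partial_division_of {a..b}; (\<Sum>(x,k)\<in>p. measure lborel k) < \<delta>\<rbrakk> \<Longrightarrow>
       (\<Sum>(x,k)\<in>p. norm (w (Sup k) - w (Inf k))) < \<epsilon>"
proof -
  obtain \<delta> where \<delta>: "\<delta> > 0"
    "\<And>(n::nat) r s. (\<forall>i<n. a \<le> r i \<and> r i \<le> s i \<and> s i \<le> b) \<Longrightarrow>
        (\<forall>i<n. \<forall>j<n. i \<noteq> j \<longrightarrow> {r i<..<s i} \<inter> {r j<..<s j} = {}) \<Longrightarrow>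
        (\<Sum>i<n. s i - r i) < \<delta> \<Longrightarrow> (\<Sum>i<n. norm (w (s i) - w (r i))) < \<epsilon>"
    using assms unfolding abs_continuous_def by meson
  show ?thesis
  proof (rule that[OF \<delta>(1)])
    fix p :: "(real \<times> real set) set"
    assume p: "p tagged_partial_division_of {a..b}" and small: "(\<Sum>(x,k)\<in>p. measure lborel k) < \<delta>"
    have fin: "finite p" using tagged_partial_division_ofD(1)[OF p] .
    obtain h where h: "bij_betw h {..<card p} p"
      using ex_bij_betw_nat_finite[OF fin] by (metis atLeast0LessThan)
    define r s where "r i = Inf (snd (h i))" and "s i = Sup (snd (h i))" for i
    have hp: "(fst (h i), snd (h i)) \<in> p" if "i < card p" for i
      using h that by (auto simp: bij_betw_def)
    have cb: "\<exists>u v. u \<le> v \<and> snd (h i) = {u..v} \<and> a \<le> u \<and> v \<le> b" if i: "i < card p" for i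
    proof -
      obtain u v where uv: "snd (h i) = cbox u v"
        using tagged_partial_division_ofD(4)[OF p hp[OF i]] by blast
      have "fst (h i) \<in> {u..v}" "{u..v} \<subseteq> {a..b}"
        using tagged_partial_division_ofD(2,3)[OF p hp[OF i]] uv by (simp_all only: box_real)
      then have "u \<le> v" "a \<le> u" "v \<le> b" by auto
      then show ?thesis using uv unfolding box_real by blast
    qed
    have eq: "snd (h i) = {r i..s i}" "r i \<le> s i" "a \<le> r i" "s i \<le> b" if i: "i < card p" for i
    proof -
      obtain u v where uv: "u \<le> v" "snd (h i) = {u..v}" "a \<le> u" "v \<le> b" using cb[OF i] by blast
      then have "r i = u" "s i = v" by (simp_all add: r_def s_def)
      then show "snd (h i) = {r i..s i}" "r i \<le> s i" "a \<le> r i" "s i \<le> b" using uv by simp_all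
    qed
    have disj: "{r i<..<s i} \<inter> {r j<..<s j} = {}" if "i < card p" "j < card p" "i \<noteq> j" for i j
    proof -
      have "h i \<noteq> h j" using h that by (auto simp: bij_betw_def inj_on_def)
      then have "(fst (h i), snd (h i)) \<noteq> (fst (h j), snd (h j))" by simp
      then have "interior (snd (h i)) \<inter> interior (snd (h j)) = {}"
        using tagged_partial_division_ofD(5)[OF p hp[OF that(1)] hp[OF that(2)]] by blast
      then show ?thesis using eq that by simp
    qed
    have "(\<Sum>i<card p. s i - r i) = (\<Sum>i<card p. measure lborel (snd (h i)))"
      using eq by (intro sum.cong) auto
    also have "\<dots> = (\<Sum>z\<in>p. measure lborel (snd z))"
      using sum.reindex_bij_betw[OF h, of "\<lambda>z. measure lborel (snd z)"] by simp
    finally have "(\<Sum>i<card p. s i - r i) < \<delta>" using small by (simp add: case_prod_beta)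
    then have "(\<Sum>i<card p. norm (w (s i) - w (r i))) < \<epsilon>"
      using eq disj by (intro \<delta>(2)) auto
    also have "(\<Sum>i<card p. norm (w (s i) - w (r i))) =
        (\<Sum>z\<in>p. norm (w (Sup (snd z)) - w (Inf (snd z))))"
      using sum.reindex_bij_betw[OF h, of "\<lambda>z. norm (w (Sup (snd z)) - w (Inf (snd z)))"]
      by (simp add: r_def s_def)
    finally show "(\<Sum>(x,k)\<in>p. norm (w (Sup k) - w (Inf k))) < \<epsilon>" by (simp add: case_prod_beta)
  qed
qed

text \<open>The intervals of a partial division overlap only in their end points.\<close>

lemma content_partial_division_le:
  assumes p: "p tagged_partial_division_of {a..b::real}" and U: "U \<in> lmeasurable"
    and sub: "\<And>x k. (x,k) \<in> p \<Longrightarrow> k \<subseteq> U"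
  shows "(\<Sum>(x,k)\<in>p. measure lborel k) \<le> measure lebesgue U"
proof -
  have fin: "finite p" using tagged_partial_division_ofD(1)[OF p] .
  have box: "\<exists>u v. snd z = cbox u v" if "z \<in> p" for z
    using tagged_partial_division_ofD(4)[OF p, of "fst z" "snd z"] that by auto
  have "(\<Sum>(x,k)\<in>p. measure lborel k) = (\<Sum>z\<in>p. measure lebesgue (snd z))"
  proof (rule sum.cong, simp)
    fix z assume "z \<in> p"
    then obtain u v where "snd z = cbox u v" using box by blast
    then show "(case z of (x, k) \<Rightarrow> measure lborel k) = measure lebesgue (snd z)"
      by (simp add: case_prod_beta measure_completion)
  qed
  also have "\<dots> = measure lebesgue (\<Union>z\<in>p. snd z)"
  proof (rule measure_negligible_finite_Union_image[symmetric, OF fin])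
    show "snd z \<in> lmeasurable" if zp: "z \<in> p" for z
    proof -
      obtain u v where "snd z = cbox u v"
        using box[OF zp] by blast
      then show ?thesis by simp
    qed
    show "pairwise (\<lambda>z y. negligible (snd z \<inter> snd y)) p"
    proof (rule pairwiseI)
      fix z y assume z: "z \<in> p" "y \<in> p" "z \<noteq> y"
      obtain u v where 1: "snd z = cbox u v"
        using box z by blast
      obtain u' v' where 2: "snd y = cbox u' v'"
        using box z by blast
      have i: "interior (snd z) \<inter> interior (snd y) = {}"
        using tagged_partial_division_ofD(5)[OF p, of "fst z" "snd z" "fst y" "snd y"] z
        by (auto simp: prod_eq_iff)
      have "snd z \<inter> snd y \<subseteq> frontier (snd z) \<union> frontier (snd y)"
        using i 1 2 by (auto simp: frontier_def)
      moreover have "negligible (frontier (snd z) \<union> frontier (snd y))"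
        using 1 2 by (simp add: negligible_convex_frontier negligible_Un)
      ultimately show "negligible (snd z \<inter> snd y)" using negligible_subset by blast
    qed
  qed
  also have "\<dots> \<le> measure lebesgue U"
  proof (rule measure_mono_fmeasurable)
    show "(\<Union>z\<in>p. snd z) \<subseteq> U" using sub by fastforce
    show "(\<Union>z\<in>p. snd z) \<in> sets lebesgue"
    proof (rule sets.finite_UN[OF fin])
      fix z assume "z \<in> p"
      then obtain u v where "snd z = cbox u v"
        using box by blast
      then show "snd z \<in> sets lebesgue" by simp
    qed
  qed (rule U)
  finally show ?thesis .
qed

lemma tagged_partial_division_real:
  assumes "p tagged_partial_division_of {a..b::real}" "(x, k) \<in> p"
  shows "k = {Inf k..Sup k}" "a \<le> Inf k" "Inf k \<le> x" "x \<le> Sup k" "Sup k \<le> b"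
    "measure lborel k = Sup k - Inf k"
proof -
  obtain u v where uv: "k = cbox u v" using tagged_partial_division_ofD(4)[OF assms] by blast
  have x: "x \<in> k" "k \<subseteq> {a..b}" using tagged_partial_division_ofD(2,3)[OF assms] by auto
  then have "u \<le> v" using uv by auto
  then have "Inf k = u" "Sup k = v" using uv by auto
  then show "k = {Inf k..Sup k}" "a \<le> Inf k" "Inf k \<le> x" "x \<le> Sup k" "Sup k \<le> b"
    "measure lborel k = Sup k - Inf k"
    using uv x \<open>u \<le> v\<close> by auto
qed

text \<open>A fundamental theorem of calculus for upper bounds on increments, proved by summing over a
  division that is fine for a gauge. The exceptional points are sorted by their constants \<open>C\<close>;
  those with \<open>C \<le> k\<close> are covered by an open set so small that, by absolute continuity of
  \<open>w\<close>, they contribute at most \<open>e / 2\<^sup>k\<close> to the sum.\<close>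

lemma increment_le_integral:
  fixes F g :: "real \<Rightarrow> real" and w :: "real \<Rightarrow> 'b::real_normed_vector"
  assumes ab: "a \<le> b" and g: "(g has_integral I) {a..b}" and N: "negligible N"
    and w: "abs_continuous a b w"
    and good: "\<And>t e. \<lbrakk>t \<in> {a..b} - N; e > 0\<rbrakk> \<Longrightarrow>
      \<exists>d>0. \<forall>u v. a \<le> u \<and> u \<le> t \<and> t \<le> v \<and> v \<le> b \<and> v - u < d \<longrightarrow> F v - F u \<le> (g t + e) * (v - u)"
    and bad: "\<And>t. t \<in> {a..b} \<inter> N \<Longrightarrow>
      \<exists>C. \<exists>d>0. \<forall>u v. a \<le> u \<and> u \<le> t \<and> t \<le> v \<and> v \<le> b \<and> v - u < d \<longrightarrow>
         F v - F u \<le> C * ((v - u) + norm (w v - w u))"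
  shows "F b - F a \<le> I"
proof -
  have key: "F b - F a \<le> I + e * (b - a + 3)" if e: "e > 0" for e
  proof -
    define g0 where "g0 t = (if t \<in> N then 0 else g t)" for t
    have "(g0 has_integral I) {a..b}"
      by (rule has_integral_spike[OF N _ g]) (auto simp: g0_def)
    then obtain \<gamma>1 where \<gamma>1: "gauge \<gamma>1"
      "\<And>p. p tagged_division_of {a..b} \<Longrightarrow> \<gamma>1 fine p \<Longrightarrow>
        norm ((\<Sum>(x,k)\<in>p. measure lborel k *\<^sub>R g0 x) - I) < e"
      unfolding has_integral_real using e by meson
    obtain d1 where d1: "\<And>t. t \<in> {a..b} - N \<Longrightarrow> d1 t > 0"
      "\<And>t u v. \<lbrakk>t \<in> {a..b} - N; a \<le> u; u \<le> t; t \<le> v; v \<le> b; v - u < d1 t\<rbrakk> \<Longrightarrow>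
         F v - F u \<le> (g t + e) * (v - u)"
      using good[OF _ e] by metis
    obtain C d2 where d2: "\<And>t. t \<in> {a..b} \<inter> N \<Longrightarrow> d2 t > 0"
      "\<And>t u v. \<lbrakk>t \<in> {a..b} \<inter> N; a \<le> u; u \<le> t; t \<le> v; v \<le> b; v - u < d2 t\<rbrakk> \<Longrightarrow>
         F v - F u \<le> C t * ((v - u) + norm (w v - w u))"
      using bad by metis
    define K where "K t = nat \<lceil>C t\<rceil>" for t
    have CK: "C t \<le> real (K t)" for t unfolding K_def by linarith
    define N' where "N' k = {t \<in> {a..b} \<inter> N. K t = k}" for k
    have N'neg: "negligible (N' k)" for k
      by (rule negligible_subset[OF N]) (auto simp: N'_def)
    \<comment> \<open>Multiplied by the constant \<open>k\<close>, the errors \<open>\<epsilon> k\<close> are still summable with sum at most \<open>2 * e\<close>.\<close>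
    define \<epsilon> where "\<epsilon> k = e / (2 ^ k * (real k + 1))" for k :: nat
    have \<epsilon>: "\<epsilon> k > 0" for k using e by (simp add: \<epsilon>_def)
    have "\<exists>\<delta>>0. \<forall>p. p tagged_partial_division_of {a..b} \<longrightarrow> (\<Sum>(x,k)\<in>p. measure lborel k) < \<delta> \<longrightarrow>
       (\<Sum>(x,k)\<in>p. norm (w (Sup k) - w (Inf k))) < \<epsilon> k / 2" for k
      by (rule abs_continuous_sum[OF w, of "\<epsilon> k / 2"]) (use \<epsilon>[of k] in auto)
    then obtain \<delta> where \<delta>: "\<And>k. \<delta> k > 0"
      "\<And>k p. p tagged_partial_division_of {a..b} \<Longrightarrow> (\<Sum>(x,k)\<in>p. measure lborel k) < \<delta> k \<Longrightarrow>
       (\<Sum>(x,k)\<in>p. norm (w (Sup k) - w (Inf k))) < \<epsilon> k / 2"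
      by metis
    have "\<exists>U. open U \<and> N' k \<subseteq> U \<and> U \<in> lmeasurable \<and> measure lebesgue U < min (\<delta> k) (\<epsilon> k / 2)" for k
    proof -
      have pos: "min (\<delta> k) (\<epsilon> k / 2) > 0" using \<delta>(1)[of k] \<epsilon>[of k] by simp
      have nn: "N' k \<in> null_sets lebesgue" using N'neg by (simp add: negligible_iff_null_sets)
      obtain U where U: "open U" "N' k \<subseteq> U" "U - N' k \<in> lmeasurable"
          "emeasure lebesgue (U - N' k) < ennreal (min (\<delta> k) (\<epsilon> k / 2))"
        using sets_lebesgue_outer_open[OF _ pos, of "N' k"] nn by (metis null_setsD2)
      have Us: "U \<in> sets lebesgue" using U(1) by auto
      have em: "emeasure lebesgue U = emeasure lebesgue (U - N' k)"
        using emeasure_Diff_null_set[OF nn Us] by simp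
      then have "U \<in> lmeasurable"
        using U Us by (intro fmeasurableI) (auto intro: less_trans simp: ennreal_less_top)
      moreover have "measure lebesgue U < min (\<delta> k) (\<epsilon> k / 2)"
      proof -
        have "measure lebesgue U = enn2real (emeasure lebesgue (U - N' k))"
          by (simp add: em measure_def)
        also have "\<dots> < min (\<delta> k) (\<epsilon> k / 2)"
          using U(4) pos by (metis emeasure_eq_ennreal_measure ennreal_less_iff enn2real_ennreal
              measure_nonneg less_top_ennreal ennreal_less_top less_trans top.not_eq_extremum)
        finally show ?thesis .
      qed
      ultimately show ?thesis using U by blast
    qed
    then obtain U where U: "\<And>k. open (U k)" "\<And>k. N' k \<subseteq> U k" "\<And>k. U k \<in> lmeasurable"
      "\<And>k. measure lebesgue (U k) < min (\<delta> k) (\<epsilon> k / 2)" by metis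
    define r where "r t = (if t \<in> {a..b} then if t \<in> N then d2 t / 2 else d1 t / 2 else 1)" for t
    have r: "r t > 0" for t using d1(1) d2(1) by (auto simp: r_def)
    \<comment> \<open>An interval tagged by an exceptional point must lie in the open set chosen for its class.\<close>
    define \<gamma> where "\<gamma> t = \<gamma>1 t \<inter> ball t (r t) \<inter> (if t \<in> {a..b} \<inter> N then U (K t) else UNIV)" for t
    have "gauge \<gamma>"
    proof (rule gaugeI)
      fix t
      show "t \<in> \<gamma> t" using \<gamma>1(1) r U(2)[of "K t"] by (auto simp: \<gamma>_def gauge_def N'_def)
      show "open (\<gamma> t)" using \<gamma>1(1) U(1) by (auto simp: \<gamma>_def gauge_def)
    qed
    then obtain p where p: "p tagged_division_of {a..b}" "\<gamma> fine p"
      using fine_division_exists_real by blast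
    have pp: "p tagged_partial_division_of {a..b}" using p(1) by (simp add: tagged_division_of_def)
    have fin: "finite p" using tagged_partial_division_ofD(1)[OF pp] .
    note rl = tagged_partial_division_real[OF pp]
    have fine: "k \<subseteq> \<gamma> x" if "(x,k) \<in> p" for x k using p(2) that by (auto simp: fine_def)
    have near: "Sup k - Inf k < 2 * r x" if "(x,k) \<in> p" for x k
    proof -
      have "Inf k \<in> {Inf k..Sup k}" "Sup k \<in> {Inf k..Sup k}" using rl(3,4)[OF that] by auto
      then have "Inf k \<in> k" "Sup k \<in> k" using rl(1)[OF that] by simp_all
      then have "Inf k \<in> ball x (r x)" "Sup k \<in> ball x (r x)"
        using fine[OF that] by (auto simp: \<gamma>_def)
      then show ?thesis by (auto simp: dist_real_def)
    qed
    define B where "B = {z \<in> p. fst z \<in> N}"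
    have xab: "x \<in> {a..b}" if "(x,k) \<in> p" for x k using rl(2-5)[OF that] by auto
    have "F b - F a = (\<Sum>(x,k)\<in>p. F (Sup k) - F (Inf k))"
      by (rule additive_tagged_division_1[OF ab p(1), symmetric])
    also have "\<dots> = (\<Sum>(x,k)\<in>p - B. F (Sup k) - F (Inf k)) + (\<Sum>(x,k)\<in>B. F (Sup k) - F (Inf k))"
      using fin by (subst sum.subset_diff[of B p]) (auto simp: B_def)
    also have "(\<Sum>(x,k)\<in>p - B. F (Sup k) - F (Inf k)) \<le> (\<Sum>(x,k)\<in>p - B. measure lborel k * (g0 x + e))"
    proof (rule sum_mono, clarify)
      fix x k assume xk: "(x,k) \<in> p" "(x,k) \<notin> B"
      then have "x \<notin> N" by (simp add: B_def)
      then show "F (Sup k) - F (Inf k) \<le> measure lborel k * (g0 x + e)"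
        using d1(2)[of x "Inf k" "Sup k"] rl(2-6)[OF xk(1)] near[OF xk(1)] xab[OF xk(1)]
        by (simp add: g0_def r_def mult.commute)
    qed
    also have "\<dots> \<le> (\<Sum>(x,k)\<in>p. measure lborel k * (g0 x + e))"
    proof (rule sum_mono2[OF fin])
      show "p - B \<subseteq> p" by auto
      show "0 \<le> (case z of (x, k) \<Rightarrow> measure lborel k * (g0 x + e))" if "z \<in> p - (p - B)" for z
        using that e by (auto simp: B_def g0_def case_prod_beta)
    qed
    also have "\<dots> = (\<Sum>(x,k)\<in>p. measure lborel k *\<^sub>R g0 x) + e * (b - a)"
    proof -
      have "(\<Sum>(x,k)\<in>p. measure lborel k) = (\<Sum>(x,k)\<in>p. Sup k - Inf k)"
        using rl(6) by (intro sum.cong) auto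
      also have "\<dots> = b - a"
        using additive_tagged_division_1[OF ab p(1), of "\<lambda>x. x"] by simp
      finally have "(\<Sum>(x,k)\<in>p. measure lborel k) = b - a" .
      moreover have "(\<Sum>(x,k)\<in>p. measure lborel k * (g0 x + e)) = (\<Sum>(x,k)\<in>p. measure lborel k *\<^sub>R g0 x) + (\<Sum>(x,k)\<in>p. measure lborel k) * e"
        unfolding sum_distrib_right sum.distrib[symmetric]
        by (rule sum.cong) (auto simp: algebra_simps)
      ultimately show ?thesis by simp
    qed
    also have "(\<Sum>(x,k)\<in>p. measure lborel k *\<^sub>R g0 x) \<le> I + e"
    proof -
      have "\<gamma>1 fine p" using fine unfolding fine_def \<gamma>_def by blast
      then show ?thesis using \<gamma>1(2)[OF p(1)] by (auto simp: abs_less_iff)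
    qed
    also have "(\<Sum>(x,k)\<in>B. F (Sup k) - F (Inf k)) \<le> 2 * e"
    proof -
      define n where "n = Suc (Max (insert 0 ((\<lambda>z. K (fst z)) ` p)))"
      have Kn: "K (fst z) < n" if "z \<in> p" for z
        using that fin unfolding n_def by (intro le_imp_less_Suc Max_ge) auto
      define Bk where "Bk j = {z \<in> B. K (fst z) = j}" for j
      have finB: "finite B" using fin by (simp add: B_def)
      have Bsub: "Bk j \<subseteq> p" for j by (auto simp: Bk_def B_def)
      have Bkp: "Bk j tagged_partial_division_of {a..b}" for j
        using tagged_partial_division_subset[OF pp Bsub] .
      have part: "(\<Sum>(x,k)\<in>Bk j. F (Sup k) - F (Inf k)) \<le> e / 2 ^ j" for j
      proof -
        have inU: "k \<subseteq> U j" if "(x,k) \<in> Bk j" for x k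
          using fine[of x k] that xab[of x k] by (auto simp: Bk_def B_def \<gamma>_def split: if_splits)
        have c: "(\<Sum>(x,k)\<in>Bk j. measure lborel k) < min (\<delta> j) (\<epsilon> j / 2)"
          by (rule le_less_trans[OF content_partial_division_le[OF Bkp U(3) inU] U(4)])
        then have v: "(\<Sum>(x,k)\<in>Bk j. norm (w (Sup k) - w (Inf k))) < \<epsilon> j / 2"
          by (intro \<delta>(2)[OF Bkp]) auto
        have "(\<Sum>(x,k)\<in>Bk j. F (Sup k) - F (Inf k)) \<le>
            (\<Sum>(x,k)\<in>Bk j. real j * (measure lborel k + norm (w (Sup k) - w (Inf k))))"
        proof (rule sum_mono, clarify)
          fix x k assume xk: "(x,k) \<in> Bk j"
          then have xp: "(x,k) \<in> p" "x \<in> N" "K x = j" by (auto simp: Bk_def B_def)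
          have "F (Sup k) - F (Inf k) \<le> C x * ((Sup k - Inf k) + norm (w (Sup k) - w (Inf k)))"
            using d2(2)[of x "Inf k" "Sup k"] rl(2-6)[OF xp(1)] near[OF xp(1)] xab[OF xp(1)] xp(2)
            by (simp add: r_def)
          also have "\<dots> \<le> real j * ((Sup k - Inf k) + norm (w (Sup k) - w (Inf k)))"
            using CK[of x] rl(2-6)[OF xp(1)] xp(3) by (intro mult_right_mono) auto
          finally show "F (Sup k) - F (Inf k) \<le> real j * (measure lborel k + norm (w (Sup k) - w (Inf k)))"
            using rl(6)[OF xp(1)] by simp
        qed
        also have "\<dots> = real j * ((\<Sum>(x,k)\<in>Bk j. measure lborel k) + (\<Sum>(x,k)\<in>Bk j. norm (w (Sup k) - w (Inf k))))"
          unfolding sum.distrib[symmetric] sum_distrib_left by (rule sum.cong) auto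
        also have "\<dots> \<le> real j * \<epsilon> j"
          using c v by (intro mult_left_mono) auto
        also have "real j * \<epsilon> j = e / 2 ^ j * (real j / (real j + 1))"
          by (simp add: \<epsilon>_def)
        also have "\<dots> \<le> e / 2 ^ j * 1"
          using e by (intro mult_left_mono) (auto simp: field_simps)
        also have "\<dots> = e / 2 ^ j" by simp
        finally show ?thesis .
      qed
      have "(\<Sum>(x,k)\<in>B. F (Sup k) - F (Inf k)) = (\<Sum>j<n. \<Sum>(x,k)\<in>Bk j. F (Sup k) - F (Inf k))"
        unfolding Bk_def
        by (rule sum.group[symmetric, OF finB]) (use Kn in \<open>auto simp: B_def\<close>)
      also have "\<dots> \<le> (\<Sum>j<n. e / 2 ^ j)" by (rule sum_mono) (rule part)
      also have "\<dots> = e * (\<Sum>j<n. (1/2) ^ j)" by (simp add: sum_distrib_left power_divide)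
      also have "(\<Sum>j<n. (1/2::real) ^ j) \<le> 2"
        by (simp add: sum_gp_strict)
      finally show ?thesis using e by simp
    qed
    finally show ?thesis by (simp add: algebra_simps)
  qed
  show ?thesis
  proof (rule field_le_epsilon)
    fix e :: real assume "e > 0"
    then have "F b - F a \<le> I + e / (b - a + 3) * (b - a + 3)" using ab by (intro key) auto
    then show "F b - F a \<le> I + e" using ab by simp
  qed
qed

lemma abs_continuous_const: "abs_continuous a b (\<lambda>_. c)"
  by (auto simp: abs_continuous_def intro: exI[of _ 1])

text \<open>Apply \<open>increment_le_integral\<close> to \<open>h\<close> and to \<open>- h\<close>, with a
  constant \<open>w\<close>.\<close>

lemma lipschitz_of_AE_bound:
  fixes h :: "real \<Rightarrow> real"
  assumes ab: "a \<le> b" and N: "negligible N"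
    and good: "\<And>t. t \<in> {a..b} - N \<Longrightarrow>
       \<exists>d>0. \<forall>s\<in>{a..b}. \<bar>s - t\<bar> < d \<longrightarrow> \<bar>h s - h t\<bar> \<le> C * \<bar>s - t\<bar>"
    and bad: "\<And>t. t \<in> {a..b} \<Longrightarrow>
       \<exists>K. \<exists>d>0. \<forall>s\<in>{a..b}. \<bar>s - t\<bar> < d \<longrightarrow> \<bar>h s - h t\<bar> \<le> K * \<bar>s - t\<bar>"
  shows "\<bar>h b - h a\<bar> \<le> C * (b - a)"
proof -
  have main: "F b - F a \<le> C * (b - a)"
    if F: "\<And>s t. \<bar>F s - F t\<bar> = \<bar>h s - h t\<bar>" for F :: "real \<Rightarrow> real"
  proof (rule increment_le_integral[OF ab _ N abs_continuous_const[of _ _ "0::real"]])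
    show "((\<lambda>_. C) has_integral C * (b - a)) {a..b}"
      using has_integral_const_real[of C a b] ab by (simp add: mult.commute)
    have two: "F v - F u \<le> K * (v - u)"
      if s: "\<forall>s\<in>{a..b}. \<bar>s - t\<bar> < d \<longrightarrow> \<bar>h s - h t\<bar> \<le> K * \<bar>s - t\<bar>"
        and uv: "a \<le> u" "u \<le> t" "t \<le> v" "v \<le> b" "v - u < d" for K d t u v
    proof -
      have "\<bar>F v - F t\<bar> \<le> K * (v - t)" "\<bar>F u - F t\<bar> \<le> K * (t - u)"
        using s[rule_format, of v] s[rule_format, of u] uv F by auto
      then have "F v - F u \<le> K * (v - t) + K * (t - u)" by linarith
      then show ?thesis by (simp add: algebra_simps)
    qed
    fix t
    show "\<exists>d>0. \<forall>u v. a \<le> u \<and> u \<le> t \<and> t \<le> v \<and> v \<le> b \<and> v - u < d \<longrightarrow> F v - F u \<le> (C + e) * (v - u)"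
      if te: "t \<in> {a..b} - N" "e > 0" for e
    proof -
      obtain d where d: "d > 0" "\<forall>s\<in>{a..b}. \<bar>s - t\<bar> < d \<longrightarrow> \<bar>h s - h t\<bar> \<le> C * \<bar>s - t\<bar>"
        using good[OF te(1)] by blast
      show ?thesis
      proof (intro exI[of _ d] conjI allI impI)
        fix u v assume uv: "a \<le> u \<and> u \<le> t \<and> t \<le> v \<and> v \<le> b \<and> v - u < d"
        have "F v - F u \<le> C * (v - u)" using two[OF d(2)] uv by blast
        also have "\<dots> \<le> (C + e) * (v - u)" using uv te by (intro mult_right_mono) auto
        finally show "F v - F u \<le> (C + e) * (v - u)" .
      qed (rule d(1))
    qed
    show "\<exists>K. \<exists>d>0. \<forall>u v. a \<le> u \<and> u \<le> t \<and> t \<le> v \<and> v \<le> b \<and> v - u < d \<longrightarrow>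
         F v - F u \<le> K * ((v - u) + norm (0 - 0::real))"
      if t: "t \<in> {a..b} \<inter> N"
    proof -
      obtain K d where "d > 0" "\<forall>s\<in>{a..b}. \<bar>s - t\<bar> < d \<longrightarrow> \<bar>h s - h t\<bar> \<le> K * \<bar>s - t\<bar>"
        using bad t by blast
      then have "F v - F u \<le> K * ((v - u) + norm (0 - 0::real))" "d > 0"
        if "a \<le> u \<and> u \<le> t \<and> t \<le> v \<and> v \<le> b \<and> v - u < d" for u v
        using two[of t d K u v] that by auto
      then show ?thesis using \<open>d > 0\<close> by blast
    qed
  qed
  show ?thesis using main[of h] main[of "\<lambda>s. - h s"] by (simp add: abs_if abs_minus_commute)
qed

section \<open>Conservation of the action form along a flow\<close>

lemma straddle_derivative:
  fixes F :: "real \<Rightarrow> real"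
  assumes "(F has_vector_derivative D) (at t within {a..b})" "t \<in> {a..b}" "e > 0"
  shows "\<exists>d>0. \<forall>u v. a \<le> u \<and> u \<le> t \<and> t \<le> v \<and> v \<le> b \<and> v - u < d \<longrightarrow> F v - F u \<le> (D + e) * (v - u)"
proof -
  obtain d where d: "d > 0"
    "\<And>y. y \<in> {a..b} \<Longrightarrow> norm (y - t) < d \<Longrightarrow> norm (F y - F t - (y - t) *\<^sub>R D) \<le> e * norm (y - t)"
    using assms unfolding has_vector_derivative_def has_derivative_within_alt by blast
  show ?thesis
  proof (intro exI[of _ d] conjI allI impI)
    fix u v assume uv: "a \<le> u \<and> u \<le> t \<and> t \<le> v \<and> v \<le> b \<and> v - u < d"
    have "\<bar>F v - F t - (v - t) * D\<bar> \<le> e * (v - t)" "\<bar>F u - F t - (u - t) * D\<bar> \<le> e * (t - u)"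
      using d(2)[of v] d(2)[of u] uv by auto
    then have "F v - F u \<le> (v - t) * D - (u - t) * D + (e * (v - t) + e * (t - u))" by linarith
    also have "\<dots> = (D + e) * (v - u)" by (simp add: algebra_simps)
    finally show "F v - F u \<le> (D + e) * (v - u)" .
  qed (rule d(1))
qed

text \<open>The bound on increments is applied to \<open>F\<close> and to \<open>- F\<close>; at the
  exceptional times the Lipschitz bound suffices.\<close>

lemma integral_derivative_lipschitz:
  fixes F g :: "real \<Rightarrow> real"
  assumes ab: "a \<le> b" and g: "integrable (lebesgue_on {a..b}) g"
    and lip: "\<And>u v. \<lbrakk>a \<le> u; u \<le> v; v \<le> b\<rbrakk> \<Longrightarrow> \<bar>F v - F u\<bar> \<le> C * (v - u)"
    and deriv: "AE t in lebesgue_on {a..b}. (F has_vector_derivative g t) (at t within {a..b})"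
  shows "integral\<^sup>L (lebesgue_on {a..b}) g = F b - F a"
proof -
  define N where "N = {t \<in> {a..b}. \<not> (F has_vector_derivative g t) (at t within {a..b})}"
  have N: "negligible N"
  proof -
    have "AE t in lebesgue. t \<in> {a..b} \<longrightarrow> (F has_vector_derivative g t) (at t within {a..b})"
      using deriv AE_restrict_space_iff[of "{a..b}" lebesgue] by simp
    then have "{t \<in> space lebesgue. \<not> (t \<in> {a..b} \<longrightarrow> (F has_vector_derivative g t) (at t within {a..b}))}
        \<in> null_sets lebesgue"
      by (simp only: completion.AE_iff_null_sets)
    moreover have "{t \<in> space lebesgue. \<not> (t \<in> {a..b} \<longrightarrow> (F has_vector_derivative g t) (at t within {a..b}))} = N"
      unfolding N_def by auto
    ultimately have "N \<in> null_sets lebesgue" by simp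
    then show ?thesis by (simp add: negligible_iff_null_sets)
  qed
  have hi: "(g has_integral integral\<^sup>L (lebesgue_on {a..b}) g) {a..b}"
    using has_integral_integral_lebesgue_on[OF g] by simp
  have one: "F' b - F' a \<le> I"
    if "(g' has_integral I) {a..b}"
      "\<And>t. t \<in> {a..b} - N \<Longrightarrow> (F' has_vector_derivative g' t) (at t within {a..b})"
      "\<And>u v. \<lbrakk>a \<le> u; u \<le> v; v \<le> b\<rbrakk> \<Longrightarrow> F' v - F' u \<le> C * (v - u)" for F' g' I
  proof (rule increment_le_integral[OF ab that(1) N abs_continuous_const[of _ _ "0::real"]])
    fix t assume t: "t \<in> {a..b} \<inter> N"
    show "\<exists>C. \<exists>d>0. \<forall>u v. a \<le> u \<and> u \<le> t \<and> t \<le> v \<and> v \<le> b \<and> v - u < d \<longrightarrow>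
         F' v - F' u \<le> C * ((v - u) + norm (0 - 0::real))"
      by (rule exI[of _ C], rule exI[of _ 1]) (use that(3) in auto)
  qed (use straddle_derivative that(2) in blast)
  have "F b - F a \<le> integral\<^sup>L (lebesgue_on {a..b}) g"
    by (rule one[OF hi]) (use lip in \<open>auto simp: N_def abs_le_iff\<close>)
  moreover have "- F b - - F a \<le> - integral\<^sup>L (lebesgue_on {a..b}) g"
  proof (rule one[OF has_integral_neg[OF hi]])
    show "((\<lambda>t. - F t) has_vector_derivative - g t) (at t within {a..b})" if "t \<in> {a..b} - N" for t
      using that by (intro has_vector_derivative_minus) (auto simp: N_def)
    show "- F v - - F u \<le> C * (v - u)" if "a \<le> u" "u \<le> v" "v \<le> b" for u v
      using lip[OF that] by (auto simp: abs_le_iff)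
  qed
  ultimately show ?thesis by linarith
qed

text \<open>Approximate the first argument by step functions.\<close>

lemma borel_measurable_caratheodory:
  fixes f :: "real \<Rightarrow> 'a \<Rightarrow> real"
  assumes meas: "\<And>s. f s \<in> borel_measurable M"
    and cont: "\<And>t. t \<in> space M \<Longrightarrow> continuous_on UNIV (\<lambda>s. f s t)"
  shows "(\<lambda>(s, t). f s t) \<in> borel_measurable (borel \<Otimes>\<^sub>M M)"
proof -
  define r where "r n s = real_of_int \<lfloor>s * real (Suc n)\<rfloor> / real (Suc n)" for n s
  have r: "(\<lambda>n. r n s) \<longlonglongrightarrow> s" for s
  proof (rule LIMSEQ_I)
    fix e :: real assume "e > 0"
    then obtain N where N: "inverse (real (Suc N)) < e" using reals_Archimedean by blast
    show "\<exists>N. \<forall>n\<ge>N. norm (r n s - s) < e"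
    proof (intro exI[of _ N] allI impI)
      fix n assume n: "N \<le> n"
      have "\<bar>s * real (Suc n) - real_of_int \<lfloor>s * real (Suc n)\<rfloor>\<bar> < 1" by linarith
      then have "\<bar>(s * real (Suc n) - real_of_int \<lfloor>s * real (Suc n)\<rfloor>) / real (Suc n)\<bar> < 1 / real (Suc n)"
        unfolding abs_divide by (intro divide_strict_right_mono[THEN order_less_le_trans]) auto
      moreover have "(s * real (Suc n) - real_of_int \<lfloor>s * real (Suc n)\<rfloor>) / real (Suc n) = s - r n s"
        by (simp add: r_def diff_divide_distrib)
      moreover have "1 / real (Suc n) \<le> inverse (real (Suc N))" using n by (simp add: field_simps)
      ultimately have "\<bar>s - r n s\<bar> < e" using N by linarith
      then show "norm (r n s - s) < e" by (simp add: abs_minus_commute)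
    qed
  qed
  have l: "(\<lambda>n. f (r n (fst z)) (snd z)) \<longlonglongrightarrow> f (fst z) (snd z)"
    if "z \<in> space (borel \<Otimes>\<^sub>M M)" for z
  proof -
    have "isCont (\<lambda>s. f s (snd z)) (fst z)"
      using cont[of "snd z"] that by (auto simp: space_pair_measure continuous_on_eq_continuous_at)
    then show ?thesis by (rule isCont_tendsto_compose[OF _ r])
  qed
  have m: "(\<lambda>z. f (r n (fst z)) (snd z)) \<in> borel_measurable (borel \<Otimes>\<^sub>M M)" for n
  proof -
    have "(\<lambda>z. (\<lambda>i::int. f (real_of_int i / real (Suc n)) (snd z)) (\<lfloor>fst z * real (Suc n)\<rfloor>))
        \<in> borel_measurable (borel \<Otimes>\<^sub>M M)"
    proof (rule measurable_compose_countable[where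
          f = "\<lambda>(i::int) z. f (real_of_int i / real (Suc n)) (snd z)" and g = "\<lambda>z. \<lfloor>fst z * real (Suc n)\<rfloor>"])
      show "(\<lambda>z. f (real_of_int i / real (Suc n)) (snd z)) \<in> borel_measurable (borel \<Otimes>\<^sub>M M)" for i
        by (rule measurable_compose[OF measurable_snd meas])
      show "(\<lambda>z. \<lfloor>fst z * real (Suc n)\<rfloor>) \<in> measurable (borel \<Otimes>\<^sub>M M) (count_space UNIV)"
        by measurable
    qed
    then show ?thesis by (simp add: r_def)
  qed
  have "(\<lambda>z. f (fst z) (snd z)) \<in> borel_measurable (borel \<Otimes>\<^sub>M M)"
    by (rule borel_measurable_LIMSEQ_real[where u = "\<lambda>n z. f (r n (fst z)) (snd z)"]) (fact l m)+
  then show ?thesis by (simp add: case_prod_beta')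
qed

text \<open>After a shift of the variable of integration, the integral is a difference of the mean values of
  \<open>f\<close> over small intervals to the right of \<open>b\<close> and of \<open>a\<close>.\<close>

lemma tendsto_integral_difference_quotient:
  fixes f :: "real \<Rightarrow> real"
  assumes f: "continuous_on UNIV f" and ab: "a \<le> b"
  shows "(\<lambda>n. integral {a..b} (\<lambda>s. real (Suc n) * (f (s + 1 / real (Suc n)) - f s))) \<longlonglongrightarrow> f b - f a"
proof -
  define \<Phi> where "\<Phi> x = integral {a..x} f" for x
  have io: "f integrable_on {u..v}" for u v
    by (intro integrable_continuous_real continuous_on_subset[OF f]) auto
  have d: "(\<lambda>n. real (Suc n) * (\<Phi> (c + 1 / real (Suc n)) - \<Phi> c)) \<longlonglongrightarrow> f c" if "a \<le> c" for c
  proof -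
    have "(\<Phi> has_real_derivative f c) (at c within {a..c+1})"
      unfolding \<Phi>_def
      by (rule integral_has_real_derivative) (use that continuous_on_subset[OF f] in auto)
    then have "((\<lambda>y. (\<Phi> y - \<Phi> c) / (y - c)) \<longlongrightarrow> f c) (at c within {a..c+1})"
      by (simp add: has_field_derivative_iff)
    moreover have "filterlim (\<lambda>n. c + 1 / real (Suc n)) (at c within {a..c+1}) sequentially"
    proof -
      have "(\<lambda>n. c + 1 / real (Suc n)) \<longlonglongrightarrow> c + 0"
        by (intro tendsto_add tendsto_const LIMSEQ_Suc[OF lim_1_over_n])
      moreover have "c + 1 / real (Suc n) \<in> {a..c+1}" for n
        using \<open>a \<le> c\<close> by (auto intro: add_increasing2)
      ultimately show ?thesis
        by (auto simp: filterlim_at intro!: always_eventually)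
    qed
    ultimately have "(\<lambda>n. (\<Phi> (c + 1 / real (Suc n)) - \<Phi> c) / (c + 1 / real (Suc n) - c)) \<longlonglongrightarrow> f c"
      by (rule filterlim_compose)
    then show ?thesis by (simp add: mult.commute)
  qed
  have eq: "integral {a..b} (\<lambda>s. real (Suc n) * (f (s + 1 / real (Suc n)) - f s)) =
      real (Suc n) * (\<Phi> (b + 1 / real (Suc n)) - \<Phi> b) - real (Suc n) * (\<Phi> (a + 1 / real (Suc n)) - \<Phi> a)" for n
  proof -
    define \<epsilon> where "\<epsilon> = 1 / real (Suc n)"
    have e: "\<epsilon> > 0" by (simp add: \<epsilon>_def)
    have 1: "integral {a..b} (\<lambda>s. f (s + \<epsilon>)) = integral {a+\<epsilon>..b+\<epsilon>} f"
      using integral_shift_Icc_real[of a b f \<epsilon>] by (simp add: o_def add.commute)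
    have 2: "integral {a+\<epsilon>..b+\<epsilon>} f = \<Phi> (b+\<epsilon>) - \<Phi> (a+\<epsilon>)"
      unfolding \<Phi>_def using Henstock_Kurzweil_Integration.integral_combine[of a "a+\<epsilon>" "b+\<epsilon>" f] io e ab by simp
    have 3: "\<Phi> a = 0" "\<Phi> b = integral {a..b} f" by (simp_all add: \<Phi>_def)
    have "(\<lambda>s. f (s + \<epsilon>)) integrable_on {a..b}"
      by (intro integrable_continuous_real continuous_intros continuous_on_compose2[OF f]) auto
    then have "integral {a..b} (\<lambda>s. real (Suc n) * (f (s + \<epsilon>) - f s)) =
        real (Suc n) * (integral {a..b} (\<lambda>s. f (s + \<epsilon>)) - integral {a..b} f)"
      using io by (simp add: Henstock_Kurzweil_Integration.integral_diff)
    also have "\<dots> = real (Suc n) * (\<Phi> (b+\<epsilon>) - \<Phi> b) - real (Suc n) * (\<Phi> (a+\<epsilon>) - \<Phi> a)"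
      unfolding 1 2 3 right_diff_distrib by simp
    finally show ?thesis unfolding \<epsilon>_def .
  qed
  show ?thesis unfolding eq by (rule tendsto_diff[OF d[OF ab] d[OF order_refl]])
qed

definition forward_quotient :: "(real \<Rightarrow> real \<Rightarrow> 'e::real_normed_vector) \<Rightarrow> nat \<Rightarrow> real \<Rightarrow> real \<Rightarrow> 'e" where
  "forward_quotient f n s t = real (Suc n) *\<^sub>R (f s (t + 1 / real (Suc n)) - f s t)"

definition shift_quotient :: "(real \<Rightarrow> real \<Rightarrow> 'e::real_normed_vector) \<Rightarrow> nat \<Rightarrow> real \<Rightarrow> real \<Rightarrow> 'e" where
  "shift_quotient f n s t = real (Suc n) *\<^sub>R (f (s + 1 / real (Suc n)) t - f s t)"

text \<open>The value is cut off where the difference quotients do not converge, so that it is jointly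
  measurable and bounded everywhere.\<close>

definition velocity :: "real \<Rightarrow> (real \<Rightarrow> real \<Rightarrow> 'e::euclidean_space) \<Rightarrow> real \<Rightarrow> real \<Rightarrow> 'e" where
  "velocity L f s t = (let v = lim (\<lambda>n. forward_quotient f n s t) in if norm v \<le> L then v else 0)"

locale lipschitz_strip =
  fixes f :: "real \<Rightarrow> real \<Rightarrow> 'e::euclidean_space" and L :: real
  assumes L: "L \<ge> 0"
    and lip: "norm (f s t - f s' t') \<le> L * (\<bar>s - s'\<bar> + \<bar>t - t'\<bar>)"
begin

lemma continuous: "continuous_on UNIV (\<lambda>z. f (fst z) (snd z))"
proof (rule continuous_onI)
  fix x :: "real \<times> real" and e :: real assume "e > 0"
  show "\<exists>d>0. \<forall>x'\<in>UNIV. dist x' x < d \<longrightarrow> dist (f (fst x') (snd x')) (f (fst x) (snd x)) \<le> e"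
  proof (intro exI[of _ "e / (2 * (L + 1))"] conjI ballI impI)
    fix y :: "real \<times> real" assume y: "dist y x < e / (2 * (L + 1))"
    have "\<bar>fst y - fst x\<bar> \<le> dist y x" "\<bar>snd y - snd x\<bar> \<le> dist y x"
      using dist_fst_le[of y x] dist_snd_le[of y x] by (auto simp: dist_real_def)
    then have "\<bar>fst y - fst x\<bar> + \<bar>snd y - snd x\<bar> \<le> 2 * (e / (2 * (L + 1)))" using y by linarith
    then have "L * (\<bar>fst y - fst x\<bar> + \<bar>snd y - snd x\<bar>) \<le> L * (2 * (e / (2 * (L + 1))))"
      using L by (rule mult_left_mono)
    also have "\<dots> \<le> e" using L \<open>e > 0\<close> by (simp add: field_simps)
    finally show "dist (f (fst y) (snd y)) (f (fst x) (snd x)) \<le> e"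
      using lip[of "fst y" "snd y" "fst x" "snd x"] by (simp add: dist_norm)
  qed (use L \<open>e > 0\<close> in auto)
qed

lemma continuous_compose [continuous_intros]:
  assumes "continuous_on S g" "continuous_on S h"
  shows "continuous_on S (\<lambda>x. f (g x) (h x))"
proof -
  have "continuous_on S ((\<lambda>z. f (fst z) (snd z)) \<circ> (\<lambda>x. (g x, h x)))"
    by (intro continuous_on_compose continuous_on_Pair assms continuous_on_subset[OF continuous] subset_UNIV)
  then show ?thesis by (simp add: o_def)
qed

lemma measurable_compose2 [measurable (raw)]:
  assumes [measurable]: "g \<in> borel_measurable M" "h \<in> borel_measurable M"
  shows "(\<lambda>x. f (g x) (h x)) \<in> borel_measurable M"
proof -
  have "(\<lambda>z. f (fst z) (snd z)) \<in> borel_measurable borel"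
    by (rule borel_measurable_continuous_onI[OF continuous])
  from measurable_compose[OF borel_measurable_Pair[OF assms] this] show ?thesis by simp
qed

lemma forward_quotient_measurable [measurable (raw)]:
  assumes [measurable]: "g \<in> borel_measurable M" "h \<in> borel_measurable M"
  shows "(\<lambda>x. forward_quotient f n (g x) (h x)) \<in> borel_measurable M"
  unfolding forward_quotient_def by measurable

lemma velocity_measurable [measurable (raw)]:
  assumes [measurable]: "g \<in> borel_measurable M" "h \<in> borel_measurable M"
  shows "(\<lambda>x. velocity L f (g x) (h x)) \<in> borel_measurable M"
  unfolding velocity_def Let_def by measurable

lemma velocity_bounded: "norm (velocity L f s t) \<le> L"
  using L by (simp add: velocity_def Let_def)

lemma forward_quotient_bounded: "norm (forward_quotient f n s t) \<le> L"
proof -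
  have "norm (forward_quotient f n s t) \<le> real (Suc n) * (L * (\<bar>s - s\<bar> + \<bar>t + 1 / real (Suc n) - t\<bar>))"
    unfolding forward_quotient_def norm_scaleR by (intro mult_mono lip) (use L in auto)
  then show ?thesis by simp
qed

lemma shift_quotient_bounded: "norm (shift_quotient f n s t) \<le> L"
proof -
  have "norm (shift_quotient f n s t) \<le> real (Suc n) * (L * (\<bar>s + 1 / real (Suc n) - s\<bar> + \<bar>t - t\<bar>))"
    unfolding shift_quotient_def norm_scaleR by (intro mult_mono lip) (use L in auto)
  then show ?thesis by simp
qed

lemma forward_quotient_tendsto:
  assumes d: "((\<lambda>t. f s t) has_vector_derivative v) (at t within {t0..t1})" and t: "t0 \<le> t" "t < t1"
  shows "(\<lambda>n. forward_quotient f n s t) \<longlonglongrightarrow> v"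
proof (rule LIMSEQ_I)
  fix e :: real assume e: "e > 0"
  obtain d where d: "d > 0"
    "\<And>y. y \<in> {t0..t1} \<Longrightarrow> norm (y - t) < d \<Longrightarrow> norm (f s y - f s t - (y - t) *\<^sub>R v) \<le> e / 2 * norm (y - t)"
    using d e unfolding has_vector_derivative_def has_derivative_within_alt
    by (meson half_gt_zero)
  obtain N where N: "inverse (real (Suc N)) < min d (t1 - t)"
    using reals_Archimedean[of "min d (t1 - t)"] d(1) t by auto
  show "\<exists>N. \<forall>n\<ge>N. norm (forward_quotient f n s t - v) < e"
  proof (intro exI[of _ N] allI impI)
    fix n assume n: "N \<le> n"
    define \<epsilon> where "\<epsilon> = 1 / real (Suc n)"
    have "\<epsilon> \<le> inverse (real (Suc N))" using n by (simp add: \<epsilon>_def field_simps)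
    then have \<epsilon>: "\<epsilon> > 0" "\<epsilon> < d" "\<epsilon> < t1 - t" using N by (auto simp: \<epsilon>_def)
    have 1: "norm (f s (t + \<epsilon>) - f s t - \<epsilon> *\<^sub>R v) \<le> e / 2 * \<epsilon>"
      using d(2)[of "t + \<epsilon>"] \<epsilon> t by simp
    have "forward_quotient f n s t - v = (1 / \<epsilon>) *\<^sub>R (f s (t + \<epsilon>) - f s t - \<epsilon> *\<^sub>R v)"
      using \<epsilon> by (simp add: forward_quotient_def \<epsilon>_def scaleR_diff_right)
    then have "norm (forward_quotient f n s t - v) = (1 / \<epsilon>) * norm (f s (t + \<epsilon>) - f s t - \<epsilon> *\<^sub>R v)"
      using \<epsilon> by simp
    also have "\<dots> \<le> (1 / \<epsilon>) * (e / 2 * \<epsilon>)" using 1 \<epsilon> by (intro mult_left_mono) auto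
    also have "\<dots> < e" using \<epsilon> e by simp
    finally show "norm (forward_quotient f n s t - v) < e" .
  qed
qed

lemma velocity_eq:
  assumes d: "((\<lambda>t. f s t) has_vector_derivative v) (at t within {t0..t1})" and t: "t0 \<le> t" "t < t1"
  shows "velocity L f s t = v" "norm v \<le> L"
proof -
  note l = forward_quotient_tendsto[OF assms]
  show nv: "norm v \<le> L"
    by (rule LIMSEQ_le_const2[OF tendsto_norm[OF l]]) (use forward_quotient_bounded in auto)
  show "velocity L f s t = v" using limI[OF l] nv by (simp add: velocity_def)
qed

text \<open>The velocity is approximated in mean, uniformly with respect to translations, by difference
  quotients in time, and those are continuous in \<open>s\<close>.\<close>

lemma velocity_translation:
  assumes t01: "t0 \<le> t1" and ab: "a \<le> b"
    and diff: "\<And>s. AE t in lebesgue_on {t0..t1}. \<exists>v. ((\<lambda>t. f s t) has_vector_derivative v) (at t within {t0..t1})"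
  shows "(\<lambda>n. \<integral>s. (\<integral>t. norm (velocity L f (s + 1 / real (Suc n)) t - velocity L f s t) \<partial>lebesgue_on {t0..t1})
            \<partial>lebesgue_on {a..b}) \<longlonglongrightarrow> 0"
proof -
  define MT where "MT = lebesgue_on {t0..t1}"
  define V where "V = velocity L f"
  interpret MT: finite_measure MT unfolding MT_def by (rule finite_measure_lebesgue_on) simp
  have idT [measurable]: "(\<lambda>t. t) \<in> borel_measurable MT"
    unfolding MT_def by (intro measurable_restrict_space1 measurable_completion) simp
  have Vm [measurable (raw)]: "(\<lambda>x. V (g x) (h x)) \<in> borel_measurable M"
    if [measurable]: "g \<in> borel_measurable M" "h \<in> borel_measurable M" for g h and M :: "'x measure"
    unfolding V_def by measurable
  have Vb: "norm (V s t) \<le> L" for s t unfolding V_def by (rule velocity_bounded)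
  define \<omega> where "\<omega> m s = (\<integral>t. norm (V s t - forward_quotient f m s t) \<partial>MT)" for m s
  define \<psi> where "\<psi> n s = (\<integral>t. norm (V (s + 1 / real (Suc n)) t - V s t) \<partial>MT)" for n s
  have \<omega>m [measurable]: "\<omega> m \<in> borel_measurable borel" for m
    unfolding \<omega>_def by (rule MT.borel_measurable_lebesgue_integral) measurable
  have \<psi>m [measurable]: "\<psi> n \<in> borel_measurable borel" for n
    unfolding \<psi>_def by (rule MT.borel_measurable_lebesgue_integral) measurable
  define B where "B = 2 * L * measure MT (space MT)"
  have bnd: "0 \<le> (\<integral>t. norm (g t) \<partial>MT) \<and> (\<integral>t. norm (g t) \<partial>MT) \<le> B"
    if "\<And>t. norm (g t) \<le> 2 * L" and [measurable]: "g \<in> borel_measurable MT" for g :: "real \<Rightarrow> 'e"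
  proof
    have "(\<integral>t. norm (g t) \<partial>MT) \<le> (\<integral>t. 2 * L \<partial>MT)"
      by (rule integral_mono) (use that in \<open>auto intro!: MT.integrable_const_bound[of _ "2 * L"]\<close>)
    then show "(\<integral>t. norm (g t) \<partial>MT) \<le> B" by (simp add: B_def mult_ac)
  qed simp
  have \<omega>b: "0 \<le> \<omega> m s \<and> \<omega> m s \<le> B" for m s
    unfolding \<omega>_def
  proof (rule bnd)
    show "norm (V s t - forward_quotient f m s t) \<le> 2 * L" for t
      using norm_triangle_ineq4[of "V s t" "forward_quotient f m s t"] Vb[of s t]
        forward_quotient_bounded[of m s t] by linarith
  qed measurable
  have \<psi>b: "0 \<le> \<psi> m s \<and> \<psi> m s \<le> B" for m s
    unfolding \<psi>_def
  proof (rule bnd)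
    show "norm (V (s + 1 / real (Suc m)) t - V s t) \<le> 2 * L" for t
      using norm_triangle_ineq4[of "V (s + 1 / real (Suc m)) t" "V s t"] Vb[of s t]
        Vb[of "s + 1 / real (Suc m)" t] by linarith
  qed measurable
  have \<omega>0: "(\<lambda>m. \<omega> m s) \<longlonglongrightarrow> 0" for s
  proof -
    have "(\<lambda>m. \<integral>t. norm (V s t - forward_quotient f m s t) \<partial>MT) \<longlonglongrightarrow> (\<integral>t. 0 \<partial>MT)"
    proof (rule integral_dominated_convergence[where w = "\<lambda>_. 2 * L"])
      have "AE t in MT. t \<noteq> t1 \<and> t \<in> {t0..t1}"
      proof -
        have "AE t in lebesgue. t \<noteq> t1" by (simp add: AE_completion AE_lborel_singleton)
        then show ?thesis unfolding MT_def by (subst AE_restrict_space_iff) auto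
      qed
      then show "AE t in MT. (\<lambda>m. norm (V s t - forward_quotient f m s t)) \<longlonglongrightarrow> 0"
        using diff[of s, folded MT_def]
      proof eventually_elim
        case (elim t)
        then obtain v where v: "((\<lambda>t. f s t) has_vector_derivative v) (at t within {t0..t1})" by blast
        then have "(\<lambda>m. V s t - forward_quotient f m s t) \<longlonglongrightarrow> v - v"
          using elim velocity_eq(1)[OF v] unfolding V_def
          by (intro tendsto_diff forward_quotient_tendsto[OF v]) auto
        then show ?case by (simp add: tendsto_norm_zero)
      qed
      show "AE t in MT. norm (norm (V s t - forward_quotient f m s t)) \<le> 2 * L" for m
      proof (rule AE_I2)
        fix t
        show "norm (norm (V s t - forward_quotient f m s t)) \<le> 2 * L"
          using norm_triangle_ineq4[of "V s t" "forward_quotient f m s t"] Vb[of s t]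
            forward_quotient_bounded[of m s t] by simp
      qed
    qed (simp_all, measurable)
    then show ?thesis by (simp add: \<omega>_def)
  qed
  have intb: "integrable (lebesgue_on {c..d}) g"
    if "\<And>s. 0 \<le> g s \<and> g s \<le> B" and [measurable]: "g \<in> borel_measurable borel"
    for g :: "real \<Rightarrow> real" and c d :: real
  proof -
    interpret S: finite_measure "lebesgue_on {c..d}" by (rule finite_measure_lebesgue_on) simp
    have "g \<in> borel_measurable (lebesgue_on {c..d})"
      by (intro measurable_restrict_space1 measurable_completion) simp
    then show ?thesis using that by (intro S.integrable_const_bound[of _ B]) auto
  qed
  have \<Omega>: "(\<lambda>m. \<integral>s. \<omega> m s \<partial>lebesgue_on {a..b+1}) \<longlonglongrightarrow> 0"
  proof -
    interpret S: finite_measure "lebesgue_on {a..b+1}" by (rule finite_measure_lebesgue_on) simp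
    have "(\<lambda>m. \<integral>s. \<omega> m s \<partial>lebesgue_on {a..b+1}) \<longlonglongrightarrow> (\<integral>s. 0 \<partial>lebesgue_on {a..b+1})"
      by (rule integral_dominated_convergence[where w = "\<lambda>_. B"])
         (use \<omega>b \<omega>0 in \<open>auto intro!: measurable_restrict_space1 measurable_completion\<close>)
    then show ?thesis by simp
  qed
  have \<psi>le: "\<psi> n s \<le> \<omega> m (s + 1 / real (Suc n)) + \<omega> m s + 2 * real (Suc m) * L / real (Suc n) * measure MT (space MT)" for n m s
  proof -
    let ?s = "s + 1 / real (Suc n)"
    have q: "norm (forward_quotient f m ?s t - forward_quotient f m s t) \<le> 2 * real (Suc m) * L / real (Suc n)" for t
    proof -
      have "forward_quotient f m ?s t - forward_quotient f m s t = real (Suc m) *\<^sub>R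
          ((f ?s (t + 1 / real (Suc m)) - f s (t + 1 / real (Suc m))) - (f ?s t - f s t))"
        by (simp add: forward_quotient_def scaleR_diff_right)
      moreover have "norm ((f ?s (t + 1 / real (Suc m)) - f s (t + 1 / real (Suc m))) - (f ?s t - f s t))
          \<le> L * (1 / real (Suc n)) + L * (1 / real (Suc n))"
        using lip[of ?s "t + 1 / real (Suc m)" s "t + 1 / real (Suc m)"] lip[of ?s t s t]
        by (intro order_trans[OF norm_triangle_ineq4 add_mono]) auto
      ultimately have "norm (forward_quotient f m ?s t - forward_quotient f m s t) \<le>
          real (Suc m) * (L * (1 / real (Suc n)) + L * (1 / real (Suc n)))"
        by (simp only: norm_scaleR abs_of_nat) (intro mult_left_mono, auto)
      moreover have "M * (L * x + L * x) = 2 * M * L * x" for M x :: real by (simp add: algebra_simps)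
      ultimately have "norm (forward_quotient f m ?s t - forward_quotient f m s t) \<le>
          2 * real (Suc m) * L * (1 / real (Suc n))"
        by (simp only:)
      then show ?thesis by (simp only: times_divide_eq_right mult_1_right)
    qed
    have i: "integrable MT (\<lambda>t. norm (V s t - forward_quotient f m s t))" for s m
    proof (rule MT.integrable_const_bound[of _ "2 * L"])
      show "AE t in MT. norm (norm (V s t - forward_quotient f m s t)) \<le> 2 * L"
      proof (rule AE_I2)
        fix t
        show "norm (norm (V s t - forward_quotient f m s t)) \<le> 2 * L"
          using norm_triangle_ineq4[of "V s t" "forward_quotient f m s t"] Vb[of s t]
            forward_quotient_bounded[of m s t] by simp
      qed
    qed measurable
    have "\<psi> n s \<le> (\<integral>t. norm (V ?s t - forward_quotient f m ?s t) + norm (V s t - forward_quotient f m s t)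
        + 2 * real (Suc m) * L / real (Suc n) \<partial>MT)"
      unfolding \<psi>_def
    proof (rule integral_mono')
      show "norm (V ?s t - V s t) \<le> norm (V ?s t - forward_quotient f m ?s t)
          + norm (V s t - forward_quotient f m s t) + 2 * real (Suc m) * L / real (Suc n)" for t
      proof -
        have "V ?s t - V s t = (V ?s t - forward_quotient f m ?s t) - (V s t - forward_quotient f m s t)
            + (forward_quotient f m ?s t - forward_quotient f m s t)" by simp
        then show ?thesis using q[of t]
          by (smt (verit) norm_triangle_ineq norm_triangle_ineq4)
      qed
    qed (use i L in auto)
    also have "\<dots> = \<omega> m ?s + \<omega> m s + 2 * real (Suc m) * L / real (Suc n) * measure MT (space MT)"
      using i by (simp add: \<omega>_def)
    finally show ?thesis .
  qed
  define \<mu>T where "\<mu>T = measure MT (space MT)"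
  have main: "(\<integral>s. \<psi> n s \<partial>lebesgue_on {a..b}) \<le> 2 * (\<integral>s. \<omega> m s \<partial>lebesgue_on {a..b+1})
      + 2 * real (Suc m) * L * \<mu>T * (b - a) * (1 / real (Suc n))" for n m
  proof -
    define \<epsilon> where "\<epsilon> = 1 / real (Suc n)"
    have e: "0 < \<epsilon>" "\<epsilon> \<le> 1" by (auto simp: \<epsilon>_def)
    note le = lebesgue_integral_eq_integral[OF intb]
    have im: "(\<lambda>s. \<omega> m s) integrable_on {c..d}" for c d
      using intb[OF \<omega>b \<omega>m, of c d m] integrable_on_lebesgue_on by fastforce
    have nn: "0 \<le> \<omega> m s" for s using \<omega>b by simp
    have sh: "integral {a..b} (\<lambda>s. \<omega> m (s + \<epsilon>)) = integral {a+\<epsilon>..b+\<epsilon>} (\<omega> m)"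
      using integral_shift_Icc_real[of a b "\<omega> m" \<epsilon>] by (simp add: o_def add.commute)
    have i1: "integrable (lebesgue_on {a..b}) (\<lambda>s. \<omega> m (s + \<epsilon>))"
      using \<omega>b by (intro intb) auto
    have i2: "integrable (lebesgue_on {a..b}) (\<omega> m)" using \<omega>b by (intro intb) auto
    interpret S: finite_measure "lebesgue_on {a..b}" by (rule finite_measure_lebesgue_on) simp
    have "(\<integral>s. \<psi> n s \<partial>lebesgue_on {a..b}) \<le> (\<integral>s. \<omega> m (s + \<epsilon>) + \<omega> m s + 2 * real (Suc m) * L * \<epsilon> * \<mu>T \<partial>lebesgue_on {a..b})"
    proof (rule integral_mono)
      show "integrable (lebesgue_on {a..b}) (\<psi> n)" using \<psi>b by (intro intb) auto
      show "integrable (lebesgue_on {a..b}) (\<lambda>s. \<omega> m (s + \<epsilon>) + \<omega> m s + 2 * real (Suc m) * L * \<epsilon> * \<mu>T)"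
        using i1 i2 by auto
      show "\<psi> n s \<le> \<omega> m (s + \<epsilon>) + \<omega> m s + 2 * real (Suc m) * L * \<epsilon> * \<mu>T" for s
        using \<psi>le[of n s m] by (simp add: \<epsilon>_def \<mu>T_def)
    qed
    also have "\<dots> = (\<integral>s. \<omega> m (s + \<epsilon>) \<partial>lebesgue_on {a..b}) + (\<integral>s. \<omega> m s \<partial>lebesgue_on {a..b})
        + 2 * real (Suc m) * L * \<epsilon> * \<mu>T * (b - a)"
      using i1 i2 ab by (simp add: measure_restrict_space)
    also have "(\<integral>s. \<omega> m (s + \<epsilon>) \<partial>lebesgue_on {a..b}) = integral {a+\<epsilon>..b+\<epsilon>} (\<omega> m)"
      using lebesgue_integral_eq_integral[OF i1] sh by simp
    also have "\<dots> \<le> integral {a..b+1} (\<omega> m)"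
      using e by (intro integral_subset_le im) (use nn in auto)
    also have "(\<integral>s. \<omega> m s \<partial>lebesgue_on {a..b}) = integral {a..b} (\<omega> m)"
      using lebesgue_integral_eq_integral[OF i2] by simp
    also have "\<dots> \<le> integral {a..b+1} (\<omega> m)"
      by (intro integral_subset_le im) (use nn in auto)
    also have "integral {a..b+1} (\<omega> m) = (\<integral>s. \<omega> m s \<partial>lebesgue_on {a..b+1})"
      using lebesgue_integral_eq_integral[OF intb[OF \<omega>b \<omega>m]] by simp
    finally have "(\<integral>s. \<psi> n s \<partial>lebesgue_on {a..b}) \<le> (\<integral>s. \<omega> m s \<partial>lebesgue_on {a..b+1})
        + (\<integral>s. \<omega> m s \<partial>lebesgue_on {a..b+1}) + 2 * real (Suc m) * L * \<epsilon> * \<mu>T * (b - a)" by simp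
    moreover have "2 * real (Suc m) * L * \<epsilon> * \<mu>T * (b - a) = 2 * real (Suc m) * L * \<mu>T * (b - a) * \<epsilon>"
      by (simp only: mult_ac)
    ultimately show ?thesis unfolding \<epsilon>_def[symmetric] by linarith
  qed
  show ?thesis unfolding V_def[symmetric] MT_def[symmetric] \<psi>_def[symmetric]
  proof (rule LIMSEQ_I)
    fix e :: real assume e: "e > 0"
    obtain m where m: "norm ((\<integral>s. \<omega> m s \<partial>lebesgue_on {a..b+1}) - 0) < e / 4"
      using LIMSEQ_D[OF \<Omega>, of "e / 4"] e by auto
    define C where "C = 2 * real (Suc m) * L * \<mu>T * (b - a)"
    have "(\<lambda>n. C * (1 / real (Suc n))) \<longlonglongrightarrow> C * 0"
      by (intro tendsto_mult tendsto_const LIMSEQ_Suc[OF lim_1_over_n])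
    then obtain N where N: "\<And>n. n \<ge> N \<Longrightarrow> norm (C * (1 / real (Suc n)) - C * 0) < e / 4"
      using LIMSEQ_D[of _ "C * 0" "e / 4"] e by (metis zero_less_divide_iff zero_less_numeral)
    show "\<exists>N. \<forall>n\<ge>N. norm ((\<integral>s. \<psi> n s \<partial>lebesgue_on {a..b}) - 0) < e"
    proof (intro exI[of _ N] allI impI)
      fix n assume "N \<le> n"
      then have "\<bar>C * (1 / real (Suc n))\<bar> < e / 4" using N by fastforce
      moreover have "0 \<le> (\<integral>s. \<psi> n s \<partial>lebesgue_on {a..b})" using \<psi>b by simp
      ultimately show "norm ((\<integral>s. \<psi> n s \<partial>lebesgue_on {a..b}) - 0) < e"
        using main[of n m, folded C_def] m e unfolding real_norm_def by linarith
    qed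
  qed
qed

end

lemma borel_measurable_AE_lebesgue_on:
  fixes f g :: "real \<Rightarrow> real"
  assumes f: "f \<in> borel_measurable (lebesgue_on S)" and S: "S \<in> sets lebesgue"
    and ae: "AE x in lebesgue_on S. f x = g x"
  shows "g \<in> borel_measurable (lebesgue_on S)"
proof -
  have "(\<lambda>x. if x \<in> S then f x else 0) \<in> borel_measurable lebesgue"
    using f S by (simp add: borel_measurable_if)
  moreover have "AE x in lebesgue. (if x \<in> S then f x else 0) = (if x \<in> S then g x else 0)"
    using ae AE_restrict_space_iff[of S lebesgue "\<lambda>x. f x = g x"] S by auto
  ultimately have "(\<lambda>x. if x \<in> S then g x else 0) \<in> borel_measurable lebesgue"
    by (rule borel_measurable_AE)
  then show ?thesis using S by (simp add: borel_measurable_if)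
qed

text \<open>With this, bounds on difference quotients need only be imposed for rational increments, which
  makes them measurable conditions.\<close>

lemma ball_of_rat_dense:
  fixes g :: "real \<Rightarrow> real"
  assumes g: "continuous_on UNIV g" and "\<And>r::rat. \<bar>of_rat r\<bar> < \<delta> \<Longrightarrow> g (of_rat r) \<le> 0" and r: "\<bar>r\<bar> < \<delta>"
  shows "g r \<le> 0"
proof (rule ccontr)
  assume "\<not> g r \<le> 0"
  define U where "U = {x. g x > 0} \<inter> {-\<delta><..<\<delta>}"
  have "open {x. g x > 0}" using g by (intro open_Collect_less continuous_intros)
  then have "open U" by (auto simp: U_def)
  moreover have "r \<in> U" using r \<open>\<not> g r \<le> 0\<close> by (auto simp: U_def)
  ultimately obtain e where e: "e > 0" "ball r e \<subseteq> U" using open_contains_ball by blast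
  obtain q where q: "r < of_rat q" "of_rat q < r + e" using of_rat_dense[of r "r + e"] e by auto
  then have "of_rat q \<in> U" using e by (auto simp: subset_iff dist_real_def)
  then have "\<bar>of_rat q :: real\<bar> < \<delta>" "g (of_rat q) > 0" unfolding U_def abs_less_iff by auto
  then show False using assms(2)[of q] by linarith
qed

text \<open>A family of solutions \<open>(Q s, P s)\<close> of a Hamiltonian system. The value of the
  Hamiltonian along the family is \<open>h s t\<close>, and \<open>Hq\<close>, \<open>Hp\<close> are its
  partial derivatives there; nothing is known about the Hamiltonian away from the family.\<close>

locale ham_strip = Q: lipschitz_strip Q L + P: lipschitz_strip P L
  for Q P :: "real \<Rightarrow> real \<Rightarrow> 'e::euclidean_space" and L +
  fixes h :: "real \<Rightarrow> real \<Rightarrow> real" and Hq Hp :: "real \<Rightarrow> real \<Rightarrow> 'e" and t0 t1 :: real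
  assumes t01: "t0 \<le> t1"
    and h_diff: "\<And>s t \<eta>. \<lbrakk>t \<in> {t0..t1}; \<eta> > 0\<rbrakk> \<Longrightarrow> \<exists>d>0. \<forall>s'. \<bar>s' - s\<bar> < d \<longrightarrow>
        \<bar>h s' t - h s t - (Hq s t \<bullet> (Q s' t - Q s t) + Hp s t \<bullet> (P s' t - P s t))\<bar> \<le> \<eta> * \<bar>s' - s\<bar>"
    and flow: "\<And>s. AE t in lebesgue_on {t0..t1}.
        ((\<lambda>t. Q s t) has_vector_derivative Hp s t) (at t within {t0..t1}) \<and>
        ((\<lambda>t. P s t) has_vector_derivative - Hq s t) (at t within {t0..t1})"
    and G_int: "\<And>s. integrable (lebesgue_on {t0..t1}) (\<lambda>t. P s t \<bullet> Hp s t - h s t)"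
begin

definition "MT = lebesgue_on {t0..t1}"
abbreviation "qd \<equiv> velocity L Q"
abbreviation "pd \<equiv> velocity L P"
definition "C = 2 * L\<^sup>2 + 1"

lemma finite_measure_MT: "finite_measure MT"
  unfolding MT_def by (rule finite_measure_lebesgue_on) simp

lemma space_MT: "space MT = {t0..t1}" by (simp add: MT_def)

lemma id_MT [measurable]: "(\<lambda>t. t) \<in> borel_measurable MT"
  unfolding MT_def by (intro measurable_restrict_space1 measurable_completion) simp

lemma L0: "L \<ge> 0" by (rule Q.L)

lemma local_lipschitz_h:
  assumes t: "t \<in> {t0..t1}" and B: "norm (Hq s t) \<le> B" "norm (Hp s t) \<le> B"
  shows "\<exists>d>0. \<forall>s'. \<bar>s' - s\<bar> < d \<longrightarrow> \<bar>h s' t - h s t\<bar> \<le> (2 * B * L + 1) * \<bar>s' - s\<bar>"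
proof -
  obtain d where d: "d > 0" "\<And>s'. \<bar>s' - s\<bar> < d \<Longrightarrow>
        \<bar>h s' t - h s t - (Hq s t \<bullet> (Q s' t - Q s t) + Hp s t \<bullet> (P s' t - P s t))\<bar> \<le> 1 * \<bar>s' - s\<bar>"
    using h_diff[OF t, of 1 s] by auto
  show ?thesis
  proof (intro exI[of _ d] conjI allI impI)
    fix s' assume s': "\<bar>s' - s\<bar> < d"
    have "B \<ge> 0" using B(1) norm_ge_zero order_trans by blast
    have "\<bar>Hq s t \<bullet> (Q s' t - Q s t)\<bar> \<le> B * (L * \<bar>s' - s\<bar>)"
      using Cauchy_Schwarz_ineq2[of "Hq s t" "Q s' t - Q s t"] Q.lip[of s' t s t] \<open>B \<ge> 0\<close>
        mult_mono[OF B(1), of "norm (Q s' t - Q s t)" "L * \<bar>s' - s\<bar>"] by simp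
    moreover have "\<bar>Hp s t \<bullet> (P s' t - P s t)\<bar> \<le> B * (L * \<bar>s' - s\<bar>)"
      using Cauchy_Schwarz_ineq2[of "Hp s t" "P s' t - P s t"] P.lip[of s' t s t] \<open>B \<ge> 0\<close>
        mult_mono[OF B(2), of "norm (P s' t - P s t)" "L * \<bar>s' - s\<bar>"] by simp
    ultimately have "\<bar>h s' t - h s t\<bar> \<le> B * (L * \<bar>s' - s\<bar>) + B * (L * \<bar>s' - s\<bar>) + 1 * \<bar>s' - s\<bar>"
      using d(2)[OF s'] by linarith
    then show "\<bar>h s' t - h s t\<bar> \<le> (2 * B * L + 1) * \<bar>s' - s\<bar>" by (simp add: algebra_simps)
  qed (rule d(1))
qed

lemma h_continuous: "t \<in> {t0..t1} \<Longrightarrow> continuous_on UNIV (\<lambda>s. h s t)"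
proof (rule continuous_at_imp_continuous_on, rule ballI)
  fix s assume t: "t \<in> {t0..t1}"
  obtain d where d: "d > 0" and le: "\<And>s'. \<bar>s' - s\<bar> < d \<Longrightarrow>
      \<bar>h s' t - h s t\<bar> \<le> (2 * max (norm (Hq s t)) (norm (Hp s t)) * L + 1) * \<bar>s' - s\<bar>"
    using local_lipschitz_h[OF t, of s "max (norm (Hq s t)) (norm (Hp s t))"] by auto
  show "isCont (\<lambda>s. h s t) s"
    unfolding isCont_def
  proof (rule Lim_transform_bound[where g = "\<lambda>s'. (2 * max (norm (Hq s t)) (norm (Hp s t)) * L + 1) * \<bar>s' - s\<bar>", of "\<lambda>s'. h s' t - h s t", THEN Lim_null[THEN iffD2]])
    show "\<forall>\<^sub>F s' in at s. norm (h s' t - h s t) \<le> norm ((2 * max (norm (Hq s t)) (norm (Hp s t)) * L + 1) * \<bar>s' - s\<bar>)"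
      unfolding eventually_at using d le by (intro exI[of _ d]) (fastforce simp: dist_real_def intro: order_trans[OF _ abs_ge_self])
    have "((\<lambda>s'. (2 * max (norm (Hq s t)) (norm (Hp s t)) * L + 1) * \<bar>s' - s\<bar>) \<longlongrightarrow> (2 * max (norm (Hq s t)) (norm (Hp s t)) * L + 1) * \<bar>s - s\<bar>) (at s)"
      by (intro tendsto_intros)
    then show "((\<lambda>s'. (2 * max (norm (Hq s t)) (norm (Hp s t)) * L + 1) * \<bar>s' - s\<bar>) \<longlongrightarrow> 0) (at s)" by simp
  qed
qed

lemma flow_velocity:
  "AE t in MT. ((\<lambda>t. Q s t) has_vector_derivative qd s t) (at t within {t0..t1}) \<and>
     ((\<lambda>t. P s t) has_vector_derivative pd s t) (at t within {t0..t1}) \<and>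
     qd s t = Hp s t \<and> pd s t = - Hq s t \<and> norm (Hp s t) \<le> L \<and> norm (Hq s t) \<le> L"
proof -
  have "AE t in MT. t \<noteq> t1 \<and> t \<in> {t0..t1}"
  proof -
    have "AE t in lebesgue. t \<noteq> t1" by (simp add: AE_completion AE_lborel_singleton)
    then show ?thesis unfolding MT_def by (subst AE_restrict_space_iff) auto
  qed
  then show ?thesis using flow[of s, folded MT_def]
  proof eventually_elim
    case (elim t)
    then have t: "t0 \<le> t" "t < t1" by auto
    note q = Q.velocity_eq[OF conjunct1[OF elim(2)] t] and p = P.velocity_eq[OF conjunct2[OF elim(2)] t]
    show ?case using elim(2) q p by simp
  qed
qed

text \<open>Up to the velocities, \<open>h\<close> is the action density, which is integrable.\<close>

lemma h_measurable: "(\<lambda>t. h s t) \<in> borel_measurable MT"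
proof -
  have "(\<lambda>t. P s t \<bullet> Hp s t - h s t) \<in> borel_measurable MT"
    using G_int unfolding MT_def by (rule borel_measurable_integrable)
  then have "(\<lambda>t. P s t \<bullet> qd s t - (P s t \<bullet> Hp s t - h s t)) \<in> borel_measurable MT"
    by measurable
  then show ?thesis unfolding MT_def
  proof (rule borel_measurable_AE_lebesgue_on)
    show "AE t in lebesgue_on {t0..t1}. P s t \<bullet> qd s t - (P s t \<bullet> Hp s t - h s t) = h s t"
      using flow_velocity[of s] unfolding MT_def by eventually_elim auto
  qed simp
qed

lemma h_measurable_pair: "(\<lambda>z. h (fst z) (snd z)) \<in> borel_measurable (borel \<Otimes>\<^sub>M MT)"
  using borel_measurable_caratheodory[of h MT] h_measurable h_continuous
  by (simp add: space_MT case_prod_beta')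

lemma h_measurable_compose:
  assumes [measurable]: "g \<in> borel_measurable N"
  shows "(\<lambda>z. h (g (fst z)) (snd z)) \<in> borel_measurable (N \<Otimes>\<^sub>M MT)"
proof -
  have "(\<lambda>z. (g (fst z), snd z)) \<in> measurable (N \<Otimes>\<^sub>M MT) (borel \<Otimes>\<^sub>M MT)" by measurable
  from measurable_compose[OF this h_measurable_pair] show ?thesis by simp
qed

text \<open>By Fubini, for almost every \<open>t\<close> the derivative of \<open>h\<close> in
  \<open>s\<close> is bounded for almost every \<open>s\<close>, while the difference quotients are bounded
  near every \<open>s\<close>. This gives the dominating constant for \<open>defect\<close>.\<close>

lemma h_lipschitz: "AE t in MT. \<forall>s s'. \<bar>h s' t - h s t\<bar> \<le> C * \<bar>s' - s\<bar>"
proof -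
  interpret MT: finite_measure MT by (rule finite_measure_MT)
  interpret pair_sigma_finite lborel MT ..
  \<comment> \<open>A countable form of the bound on the difference quotients at \<open>s\<close>, to which Fubini applies.\<close>
  define R where "R s t \<longleftrightarrow> (\<exists>n::nat. \<forall>r::rat. \<bar>of_rat r\<bar> < 1 / real (Suc n) \<longrightarrow>
      \<bar>h (s + of_rat r) t - h s t\<bar> \<le> C * \<bar>of_rat r\<bar>)" for s t
  have "AE t in MT. R s t" for s
    using flow_velocity[of s] AE_space
  proof eventually_elim
    case (elim t)
    then obtain d where d: "d > 0" "\<And>s'. \<bar>s' - s\<bar> < d \<Longrightarrow> \<bar>h s' t - h s t\<bar> \<le> (2 * L * L + 1) * \<bar>s' - s\<bar>"
      using local_lipschitz_h[of t s L] by (auto simp: space_MT)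
    obtain n where n: "inverse (real (Suc n)) < d" using reals_Archimedean d(1) by blast
    show ?case unfolding R_def
    proof (intro exI[of _ n] allI impI)
      fix r :: rat assume r: "\<bar>of_rat r\<bar> < 1 / real (Suc n)"
      then have "\<bar>s + of_rat r - s\<bar> < d" using n unfolding inverse_eq_divide by linarith
      from d(2)[OF this] show "\<bar>h (s + of_rat r) t - h s t\<bar> \<le> C * \<bar>of_rat r\<bar>"
        by (simp add: C_def power2_eq_square mult.assoc)
    qed
  qed
  then have "AE s in lborel. AE t in MT. R s t" by simp
  moreover have "{z \<in> space (lborel \<Otimes>\<^sub>M MT). R (fst z) (snd z)} \<in> sets (lborel \<Otimes>\<^sub>M MT)"
  proof -
    have [measurable]: "(\<lambda>z. h (fst z + c) (snd z)) \<in> borel_measurable (lborel \<Otimes>\<^sub>M MT)" for c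
      by (rule h_measurable_compose[of "\<lambda>x. x + c"]) simp
    have [measurable]: "(\<lambda>z. h (fst z) (snd z)) \<in> borel_measurable (lborel \<Otimes>\<^sub>M MT)"
      by (rule h_measurable_compose[of "\<lambda>x. x"]) simp
    show ?thesis unfolding R_def by measurable
  qed
  ultimately have "AE t in MT. AE s in lborel. R s t" using AE_commute by blast
  then show ?thesis using AE_space
  proof eventually_elim
    case (elim t)
    then have t: "t \<in> {t0..t1}" by (simp add: space_MT)
    have cont: "continuous_on UNIV (\<lambda>s. h s t)" by (rule h_continuous[OF t])
    have "AE s in lebesgue. R s t" using elim(1) by (rule AE_completion)
    then have "{s \<in> space lebesgue. \<not> R s t} \<in> null_sets lebesgue"
      by (simp only: completion.AE_iff_null_sets)
    then have N: "negligible {s. \<not> R s t}" by (simp add: negligible_iff_null_sets)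
    have le: "\<bar>h s' t - h s t\<bar> \<le> C * (s' - s)" if "s \<le> s'" for s s'
    proof (rule lipschitz_of_AE_bound[OF that N])
      fix x assume "x \<in> {s..s'} - {s. \<not> R s t}"
      then obtain n :: nat where n: "\<And>r::rat. \<bar>of_rat r\<bar> < 1 / real (Suc n) \<Longrightarrow>
          \<bar>h (x + of_rat r) t - h x t\<bar> \<le> C * \<bar>of_rat r\<bar>" unfolding R_def by blast
      show "\<exists>d>0. \<forall>y\<in>{s..s'}. \<bar>y - x\<bar> < d \<longrightarrow> \<bar>h y t - h x t\<bar> \<le> C * \<bar>y - x\<bar>"
      proof (intro exI[of _ "1 / real (Suc n)"] conjI ballI impI)
        fix y assume y: "\<bar>y - x\<bar> < 1 / real (Suc n)"
        have "continuous_on UNIV (\<lambda>r. \<bar>h (x + r) t - h x t\<bar> - C * \<bar>r\<bar>)"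
          by (intro continuous_intros continuous_on_compose2[OF cont]) auto
        from ball_of_rat_dense[OF this _ y] show "\<bar>h y t - h x t\<bar> \<le> C * \<bar>y - x\<bar>"
          using n by simp
      qed simp
    next
      fix x assume "x \<in> {s..s'}"
      show "\<exists>K. \<exists>d>0. \<forall>y\<in>{s..s'}. \<bar>y - x\<bar> < d \<longrightarrow> \<bar>h y t - h x t\<bar> \<le> K * \<bar>y - x\<bar>"
        using local_lipschitz_h[OF t, of x "max (norm (Hq x t)) (norm (Hp x t))"] by auto
    qed
    show ?case
    proof (intro allI)
      fix s s' show "\<bar>h s' t - h s t\<bar> \<le> C * \<bar>s' - s\<bar>"
        using le[of s s'] le[of s' s] by (cases "s \<le> s'") (auto simp: abs_minus_commute)
    qed
  qed
qed

text \<open>The failure of the identity \<open>d\<theta> = p \<bullet> dq\<close> to be transported from time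
  \<open>t0\<close> to time \<open>t1\<close>, for the pair of parameters \<open>s\<close> and
  \<open>s'\<close>.\<close>

definition gain :: "real \<Rightarrow> real \<Rightarrow> real" where
  "gain s s' = (\<integral>t. P s' t \<bullet> Hp s' t - h s' t \<partial>MT) - (\<integral>t. P s t \<bullet> Hp s t - h s t \<partial>MT)
     - (P s t1 \<bullet> (Q s' t1 - Q s t1) - P s t0 \<bullet> (Q s' t0 - Q s t0))"

text \<open>The failure of the first order expansion of \<open>h\<close> at \<open>s\<close>, divided by the
  increment of \<open>s\<close>.\<close>

definition defect :: "nat \<Rightarrow> real \<Rightarrow> real \<Rightarrow> real" where
  "defect n s t = qd s t \<bullet> shift_quotient P n s t - pd s t \<bullet> shift_quotient Q n s t - shift_quotient h n s t"

definition drift :: "nat \<Rightarrow> real \<Rightarrow> real \<Rightarrow> real" where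
  "drift n s t = shift_quotient P n s t \<bullet> (qd (s + 1 / real (Suc n)) t - qd s t)"

lemma shift_quotient_measurable [measurable (raw)]:
  assumes [measurable]: "g \<in> borel_measurable N" "k \<in> borel_measurable N"
  shows "(\<lambda>x. shift_quotient Q n (g x) (k x)) \<in> borel_measurable N"
    "(\<lambda>x. shift_quotient P n (g x) (k x)) \<in> borel_measurable N"
  unfolding shift_quotient_def by measurable

lemma shift_quotient_h_measurable:
  assumes [measurable]: "g \<in> borel_measurable N"
  shows "(\<lambda>z. shift_quotient h n (g (fst z)) (snd z)) \<in> borel_measurable (N \<Otimes>\<^sub>M MT)"
proof -
  have [measurable]: "(\<lambda>z. h (g (fst z) + 1 / real (Suc n)) (snd z)) \<in> borel_measurable (N \<Otimes>\<^sub>M MT)"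
    by (rule h_measurable_compose[of "\<lambda>x. g x + 1 / real (Suc n)"]) measurable
  have [measurable]: "(\<lambda>z. h (g (fst z)) (snd z)) \<in> borel_measurable (N \<Otimes>\<^sub>M MT)"
    by (rule h_measurable_compose) measurable
  show ?thesis unfolding shift_quotient_def by measurable
qed

lemma P_bounded:
  assumes "t \<in> {t0..t1}"
  shows "norm (P s t) \<le> norm (P s t0) + L * (t1 - t0)"
proof -
  have "norm (P s t - P s t0) \<le> L * (t1 - t0)"
    using P.lip[of s t s t0] assms mult_left_mono[OF _ L0, of "t - t0" "t1 - t0"] by fastforce
  then show ?thesis using norm_triangle_sub[of "P s t" "P s t0"] by linarith
qed

text \<open>Integration by parts in time of \<open>P s t \<bullet> (Q s' t - Q s t)\<close>: the boundary
  terms are those of \<open>gain\<close>.\<close>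

lemma gain_eq:
  "integrable MT (\<lambda>t. P s' t \<bullet> qd s' t - P s t \<bullet> qd s' t - (h s' t - h s t) - pd s t \<bullet> (Q s' t - Q s t))"
  "(\<integral>t. P s' t \<bullet> qd s' t - P s t \<bullet> qd s' t - (h s' t - h s t) - pd s t \<bullet> (Q s' t - Q s t) \<partial>MT) = gain s s'"
proof -
  interpret MT: finite_measure MT by (rule finite_measure_MT)
  define F where "F t = P s t \<bullet> (Q s' t - Q s t)" for t
  define g where "g t = pd s t \<bullet> (Q s' t - Q s t) + P s t \<bullet> (qd s' t - qd s t)" for t
  define Bp where "Bp = norm (P s t0) + L * (t1 - t0)"
  have Bp0: "Bp \<ge> 0" using L0 t01 by (simp add: Bp_def)
  have dQ: "norm (Q s' t - Q s t) \<le> L * \<bar>s' - s\<bar>" for t using Q.lip[of s' t s t] by simp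
  have gm: "g \<in> borel_measurable MT" unfolding g_def by measurable
  have gi: "integrable MT g"
  proof (rule MT.integrable_const_bound[OF _ gm])
    show "AE t in MT. norm (g t) \<le> L * (L * \<bar>s' - s\<bar>) + Bp * (2 * L)"
    proof (rule AE_I2)
      fix t assume "t \<in> space MT"
      then have t: "t \<in> {t0..t1}" by (simp add: space_MT)
      have "\<bar>pd s t \<bullet> (Q s' t - Q s t)\<bar> \<le> L * (L * \<bar>s' - s\<bar>)"
        by (rule order_trans[OF Cauchy_Schwarz_ineq2 mult_mono]) (use P.velocity_bounded dQ L0 in auto)
      moreover have "norm (qd s' t - qd s t) \<le> 2 * L"
        using norm_triangle_ineq4[of "qd s' t" "qd s t"] Q.velocity_bounded[of s' t] Q.velocity_bounded[of s t]
        by linarith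
      then have "\<bar>P s t \<bullet> (qd s' t - qd s t)\<bar> \<le> Bp * (2 * L)"
        by (intro order_trans[OF Cauchy_Schwarz_ineq2 mult_mono]) (use P_bounded[OF t, of s] Bp0 in \<open>auto simp: Bp_def\<close>)
      ultimately show "norm (g t) \<le> L * (L * \<bar>s' - s\<bar>) + Bp * (2 * L)" unfolding g_def real_norm_def by linarith
    qed
  qed
  have gF: "(\<integral>t. g t \<partial>MT) = F t1 - F t0"
    unfolding MT_def
  proof (rule integral_derivative_lipschitz[OF t01 gi[unfolded MT_def]])
    show "\<bar>F v - F u\<bar> \<le> (L * (L * \<bar>s' - s\<bar>) + Bp * (2 * L)) * (v - u)" if uv: "t0 \<le> u" "u \<le> v" "v \<le> t1" for u v
    proof -
      have "F v - F u = (P s v - P s u) \<bullet> (Q s' v - Q s v) + P s u \<bullet> ((Q s' v - Q s' u) - (Q s v - Q s u))"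
        by (simp add: F_def inner_diff_left inner_diff_right)
      moreover have "\<bar>(P s v - P s u) \<bullet> (Q s' v - Q s v)\<bar> \<le> (L * (v - u)) * (L * \<bar>s' - s\<bar>)"
        by (rule order_trans[OF Cauchy_Schwarz_ineq2 mult_mono]) (use P.lip[of s v s u] dQ[of v] L0 uv in auto)
      moreover have "norm ((Q s' v - Q s' u) - (Q s v - Q s u)) \<le> 2 * (L * (v - u))"
        using norm_triangle_ineq4[of "Q s' v - Q s' u" "Q s v - Q s u"] Q.lip[of s' v s' u] Q.lip[of s v s u] uv
        by simp
      then have "\<bar>P s u \<bullet> ((Q s' v - Q s' u) - (Q s v - Q s u))\<bar> \<le> Bp * (2 * (L * (v - u)))"
        by (intro order_trans[OF Cauchy_Schwarz_ineq2 mult_mono]) (use P_bounded[of u s] Bp0 uv in \<open>auto simp: Bp_def\<close>)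
      ultimately have "\<bar>F v - F u\<bar> \<le> (L * (v - u)) * (L * \<bar>s' - s\<bar>) + Bp * (2 * (L * (v - u)))" by linarith
      also have "\<dots> = (L * (L * \<bar>s' - s\<bar>) + Bp * (2 * L)) * (v - u)" by (simp add: algebra_simps)
      finally show ?thesis .
    qed
    show "AE t in lebesgue_on {t0..t1}. (F has_vector_derivative g t) (at t within {t0..t1})"
      unfolding MT_def[symmetric] using flow_velocity[of s] flow_velocity[of s']
    proof eventually_elim
      case (elim t)
      have d1: "((\<lambda>t. Q s' t - Q s t) has_vector_derivative qd s' t - qd s t) (at t within {t0..t1})"
        using elim by (intro has_vector_derivative_diff) auto
      have d2: "((\<lambda>t. P s t) has_vector_derivative pd s t) (at t within {t0..t1})" using elim by auto
      have "((\<lambda>t. P s t \<bullet> (Q s' t - Q s t)) has_derivative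
          (\<lambda>x. P s t \<bullet> (x *\<^sub>R (qd s' t - qd s t)) + (x *\<^sub>R pd s t) \<bullet> (Q s' t - Q s t))) (at t within {t0..t1})"
        using has_derivative_inner[OF d2[unfolded has_vector_derivative_def] d1[unfolded has_vector_derivative_def]] .
      then show ?case
        unfolding has_vector_derivative_def F_def g_def by (simp add: algebra_simps)
    qed
  qed
  have Gi: "integrable MT (\<lambda>t. P s t \<bullet> Hp s t - h s t)" for s using G_int by (simp add: MT_def)
  define Y where "Y t = P s' t \<bullet> qd s' t - P s t \<bullet> qd s' t - (h s' t - h s t) - pd s t \<bullet> (Q s' t - Q s t)" for t
  have Ym: "Y \<in> borel_measurable MT"
    unfolding Y_def using h_measurable[of s, measurable] h_measurable[of s', measurable] by measurable
  define Z where "Z t = (P s' t \<bullet> Hp s' t - h s' t) - (P s t \<bullet> Hp s t - h s t) - g t" for t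
  have Zi: "integrable MT Z" unfolding Z_def using Gi gi by auto
  have ae: "AE t in MT. Z t = Y t"
    using flow_velocity[of s] flow_velocity[of s']
  proof eventually_elim
    case (elim t)
    then have "Hp s t = qd s t" "Hp s' t = qd s' t" by simp_all
    then show ?case by (simp add: Z_def Y_def g_def inner_diff_right)
  qed
  have Yi: "integrable MT Y" using integrable_cong_AE_imp[OF Zi Ym] ae by (simp add: eq_commute)
  have "(\<integral>t. Y t \<partial>MT) = (\<integral>t. Z t \<partial>MT)"
    by (rule integral_cong_AE) (use Ym Zi ae in \<open>auto simp: eq_commute\<close>)
  also have "\<dots> = gain s s'" unfolding Z_def using Gi gi gF by (simp add: gain_def F_def)
  finally show "(\<integral>t. P s' t \<bullet> qd s' t - P s t \<bullet> qd s' t - (h s' t - h s t) - pd s t \<bullet> (Q s' t - Q s t) \<partial>MT) = gain s s'"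
    by (simp add: Y_def)
  show "integrable MT (\<lambda>t. P s' t \<bullet> qd s' t - P s t \<bullet> qd s' t - (h s' t - h s t) - pd s t \<bullet> (Q s' t - Q s t))"
    using Yi by (simp add: Y_def[abs_def])
qed

lemma defect_bounded: "AE t in MT. \<forall>n s. \<bar>defect n s t\<bar> \<le> 2 * L\<^sup>2 + C"
  using h_lipschitz
proof eventually_elim
  case (elim t)
  show ?case
  proof (intro allI)
    fix n s
    have "\<bar>shift_quotient h n s t\<bar> \<le> real (Suc n) * (C * (1 / real (Suc n)))"
      using elim[rule_format, of "s + 1 / real (Suc n)" s] unfolding shift_quotient_def
      by (simp only: real_scaleR_def abs_mult abs_of_nat) (intro mult_left_mono, auto)
    then have 1: "\<bar>shift_quotient h n s t\<bar> \<le> C" by simp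
    have 2: "\<bar>qd s t \<bullet> shift_quotient P n s t\<bar> \<le> L * L"
      by (rule order_trans[OF Cauchy_Schwarz_ineq2 mult_mono]) (use Q.velocity_bounded P.shift_quotient_bounded L0 in auto)
    have 3: "\<bar>pd s t \<bullet> shift_quotient Q n s t\<bar> \<le> L * L"
      by (rule order_trans[OF Cauchy_Schwarz_ineq2 mult_mono]) (use P.velocity_bounded Q.shift_quotient_bounded L0 in auto)
    show "\<bar>defect n s t\<bar> \<le> 2 * L\<^sup>2 + C" using 1 2 3 unfolding defect_def power2_eq_square by linarith
  qed
qed

lemma defect_measurable: "(\<lambda>z. defect n (fst z) (snd z)) \<in> borel_measurable (borel \<Otimes>\<^sub>M MT)"
  unfolding defect_def using shift_quotient_h_measurable[of "\<lambda>x. x" borel n, simplified, measurable] by measurable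

lemma drift_measurable: "(\<lambda>z. drift n (fst z) (snd z)) \<in> borel_measurable (borel \<Otimes>\<^sub>M MT)"
  unfolding drift_def by measurable

lemma defect_tendsto: "AE t in MT. (\<lambda>n. defect n s t) \<longlonglongrightarrow> 0"
  using flow_velocity[of s] AE_space
proof eventually_elim
  case (elim t)
  then have t: "t \<in> {t0..t1}" by (simp add: space_MT)
  have H: "qd s t = Hp s t" "pd s t = - Hq s t" using elim by auto
  show ?case
  proof (rule LIMSEQ_I)
    fix e :: real assume e: "e > 0"
    obtain d where d: "d > 0" "\<And>s'. \<bar>s' - s\<bar> < d \<Longrightarrow>
        \<bar>h s' t - h s t - (Hq s t \<bullet> (Q s' t - Q s t) + Hp s t \<bullet> (P s' t - P s t))\<bar> \<le> e / 2 * \<bar>s' - s\<bar>"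
      using h_diff[OF t, of "e / 2" s] e by auto
    obtain N where N: "inverse (real (Suc N)) < d" using reals_Archimedean d(1) by blast
    show "\<exists>N. \<forall>n\<ge>N. norm (defect n s t - 0) < e"
    proof (intro exI[of _ N] allI impI)
      fix n assume n: "N \<le> n"
      define s' where "s' = s + 1 / real (Suc n)"
      have "1 / real (Suc n) \<le> inverse (real (Suc N))" using n by (simp add: field_simps)
      then have "\<bar>s' - s\<bar> < d" using N by (simp add: s'_def)
      then have b: "\<bar>h s' t - h s t - (Hq s t \<bullet> (Q s' t - Q s t) + Hp s t \<bullet> (P s' t - P s t))\<bar> \<le> e / 2 * (1 / real (Suc n))"
        using d(2)[of s'] by (simp add: s'_def)
      have "defect n s t = - real (Suc n) * (h s' t - h s t - (Hq s t \<bullet> (Q s' t - Q s t) + Hp s t \<bullet> (P s' t - P s t)))"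
        unfolding defect_def shift_quotient_def H s'_def by (simp add: algebra_simps)
      then have "\<bar>defect n s t\<bar> = real (Suc n) * \<bar>h s' t - h s t - (Hq s t \<bullet> (Q s' t - Q s t) + Hp s t \<bullet> (P s' t - P s t))\<bar>"
        by (simp add: abs_mult)
      also have "\<dots> \<le> real (Suc n) * (e / 2 * (1 / real (Suc n)))" by (intro mult_left_mono b) simp
      also have "\<dots> = (real (Suc n) * (1 / real (Suc n))) * (e / 2)" by (simp only: mult_ac)
      also have "\<dots> < e" using e by simp
      finally show "norm (defect n s t - 0) < e" by simp
    qed
  qed
qed

text \<open>The difference quotient of \<open>gain\<close> is the integral of \<open>defect\<close> plus
  \<open>drift\<close>. The first tends to zero by dominated convergence, the second because the velocities
  are continuous in mean.\<close>

lemma gain_tendsto: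
  assumes ab: "a \<le> b"
  shows "(\<lambda>n. \<integral>s. \<bar>real (Suc n) * gain s (s + 1 / real (Suc n))\<bar> \<partial>lebesgue_on {a..b}) \<longlonglongrightarrow> 0"
    and "integrable (lebesgue_on {a..b}) (\<lambda>s. \<bar>real (Suc n) * gain s (s + 1 / real (Suc n))\<bar>)"
proof -
  interpret MT: finite_measure MT by (rule finite_measure_MT)
  interpret S: finite_measure "lebesgue_on {a..b}" by (rule finite_measure_lebesgue_on) simp
  define \<mu> where "\<mu> = measure MT (space MT)"
  define \<phi> where "\<phi> n s = (\<integral>t. \<bar>defect n s t\<bar> \<partial>MT)" for n s
  define \<psi> where "\<psi> n s = (\<integral>t. norm (qd (s + 1 / real (Suc n)) t - qd s t) \<partial>MT)" for n s
  define \<kappa> where "\<kappa> n s = real (Suc n) * gain s (s + 1 / real (Suc n))" for n s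
  have C0: "C \<ge> 0" by (simp add: C_def)
  have dm: "(\<lambda>t. defect n s t) \<in> borel_measurable MT" for n s
    using measurable_compose_Pair1[OF _ defect_measurable, of s n] by simp
  have rm: "(\<lambda>t. drift n s t) \<in> borel_measurable MT" for n s
    using measurable_compose_Pair1[OF _ drift_measurable, of s n] by simp
  have di: "integrable MT (\<lambda>t. defect n s t)" for n s
    by (rule MT.integrable_const_bound[OF _ dm, of _ _ "2 * L\<^sup>2 + C"]) (use defect_bounded in \<open>auto elim: eventually_mono\<close>)
  have qb: "norm (qd s' t - qd s t) \<le> 2 * L" for s s' t
    using norm_triangle_ineq4[of "qd s' t" "qd s t"] Q.velocity_bounded[of s' t] Q.velocity_bounded[of s t]
    by linarith
  have rb: "\<bar>drift n s t\<bar> \<le> L * norm (qd (s + 1 / real (Suc n)) t - qd s t)" for n s t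
    unfolding drift_def
    by (rule order_trans[OF Cauchy_Schwarz_ineq2 mult_right_mono]) (use P.shift_quotient_bounded in auto)
  have qi: "integrable MT (\<lambda>t. norm (qd s' t - qd s t))" for s s'
    by (rule MT.integrable_const_bound[of _ "2 * L"]) (use qb in auto)
  have ri: "integrable MT (\<lambda>t. drift n s t)" for n s
    by (rule Bochner_Integration.integrable_bound[OF integrable_mult_right[OF qi, of L] rm])
       (use rb in \<open>auto intro!: AE_I2 order_trans[OF rb abs_ge_self]\<close>)
  have \<kappa>eq: "\<kappa> n s = (\<integral>t. defect n s t + drift n s t \<partial>MT)" for n s
  proof -
    have "\<kappa> n s = (\<integral>t. real (Suc n) * (P (s + 1 / real (Suc n)) t \<bullet> qd (s + 1 / real (Suc n)) t
        - P s t \<bullet> qd (s + 1 / real (Suc n)) t - (h (s + 1 / real (Suc n)) t - h s t)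
        - pd s t \<bullet> (Q (s + 1 / real (Suc n)) t - Q s t)) \<partial>MT)"
      unfolding \<kappa>_def gain_eq(2)[symmetric] by simp
    also have "\<dots> = (\<integral>t. defect n s t + drift n s t \<partial>MT)"
      by (rule arg_cong[where f = "integral\<^sup>L MT"])
         (auto simp: defect_def drift_def shift_quotient_def algebra_simps inner_commute)
    finally show ?thesis .
  qed
  have \<kappa>le: "\<bar>\<kappa> n s\<bar> \<le> \<phi> n s + L * \<psi> n s" for n s
  proof -
    have "\<bar>\<kappa> n s\<bar> \<le> (\<integral>t. \<bar>defect n s t\<bar> + L * norm (qd (s + 1 / real (Suc n)) t - qd s t) \<partial>MT)"
      unfolding \<kappa>eq
    proof (rule order_trans[OF integral_abs_bound integral_mono])
      show "integrable MT (\<lambda>t. \<bar>defect n s t + drift n s t\<bar>)" using di ri by auto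
      show "integrable MT (\<lambda>t. \<bar>defect n s t\<bar> + L * norm (qd (s + 1 / real (Suc n)) t - qd s t))"
        using di qi by auto
      show "\<bar>defect n s t + drift n s t\<bar> \<le> \<bar>defect n s t\<bar> + L * norm (qd (s + 1 / real (Suc n)) t - qd s t)" for t
        using rb[of n s t] by linarith
    qed
    also have "\<dots> = \<phi> n s + L * \<psi> n s" using di qi by (simp add: \<phi>_def \<psi>_def)
    finally show ?thesis .
  qed
  have \<phi>b: "0 \<le> \<phi> n s \<and> \<phi> n s \<le> (2 * L\<^sup>2 + C) * \<mu>" for n s
  proof
    show "0 \<le> \<phi> n s" by (simp add: \<phi>_def)
    have "\<phi> n s \<le> (\<integral>t. 2 * L\<^sup>2 + C \<partial>MT)"
      unfolding \<phi>_def by (rule integral_mono_AE) (use di defect_bounded in \<open>auto elim: eventually_mono\<close>)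
    then show "\<phi> n s \<le> (2 * L\<^sup>2 + C) * \<mu>" by (simp add: \<mu>_def mult.commute)
  qed
  have \<psi>b: "0 \<le> \<psi> n s \<and> \<psi> n s \<le> 2 * L * \<mu>" for n s
  proof
    show "0 \<le> \<psi> n s" by (simp add: \<psi>_def)
    have "\<psi> n s \<le> (\<integral>t. 2 * L \<partial>MT)" unfolding \<psi>_def by (rule integral_mono) (use qi qb in auto)
    then show "\<psi> n s \<le> 2 * L * \<mu>" by (simp add: \<mu>_def mult.commute)
  qed
  have tom: "g \<in> borel_measurable (lebesgue_on {a..b})" if "g \<in> borel_measurable borel" for g :: "real \<Rightarrow> real"
    using that by (intro measurable_restrict_space1 measurable_completion) simp
  have \<phi>m: "\<phi> n \<in> borel_measurable borel" for n
    unfolding \<phi>_def by (rule MT.borel_measurable_lebesgue_integral) (use defect_measurable[measurable] in \<open>simp add: case_prod_beta'\<close>)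
  have \<psi>m: "\<psi> n \<in> borel_measurable borel" for n
    unfolding \<psi>_def by (rule MT.borel_measurable_lebesgue_integral) (simp add: case_prod_beta')
  have \<kappa>m: "\<kappa> n \<in> borel_measurable borel" for n
    unfolding \<kappa>eq[abs_def]
    by (rule MT.borel_measurable_lebesgue_integral)
       (use defect_measurable[measurable] drift_measurable[measurable] in \<open>simp add: case_prod_beta'\<close>)
  have \<phi>i: "integrable (lebesgue_on {a..b}) (\<phi> n)" for n
    by (rule S.integrable_const_bound[OF _ tom[OF \<phi>m], of _ "(2 * L\<^sup>2 + C) * \<mu>"]) (use \<phi>b in auto)
  have \<psi>i: "integrable (lebesgue_on {a..b}) (\<psi> n)" for n
    by (rule S.integrable_const_bound[OF _ tom[OF \<psi>m], of _ "2 * L * \<mu>"]) (use \<psi>b in auto)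
  have \<kappa>i: "integrable (lebesgue_on {a..b}) (\<lambda>s. \<bar>\<kappa> n s\<bar>)" for n
  proof (rule Bochner_Integration.integrable_bound)
    show "integrable (lebesgue_on {a..b}) (\<lambda>s. \<phi> n s + L * \<psi> n s)" using \<phi>i \<psi>i by auto
    show "(\<lambda>s. \<bar>\<kappa> n s\<bar>) \<in> borel_measurable (lebesgue_on {a..b})" by (rule tom[OF borel_measurable_abs[OF \<kappa>m]])
    show "AE s in lebesgue_on {a..b}. norm \<bar>\<kappa> n s\<bar> \<le> norm (\<phi> n s + L * \<psi> n s)"
      using \<kappa>le by (intro AE_I2) (auto intro: order_trans[OF _ abs_ge_self])
  qed
  show "integrable (lebesgue_on {a..b}) (\<lambda>s. \<bar>real (Suc n) * gain s (s + 1 / real (Suc n))\<bar>)"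
    using \<kappa>i by (simp add: \<kappa>_def)
  have \<phi>0: "(\<lambda>n. \<phi> n s) \<longlonglongrightarrow> 0" for s
  proof -
    have "(\<lambda>n. \<integral>t. \<bar>defect n s t\<bar> \<partial>MT) \<longlonglongrightarrow> (\<integral>t. 0 \<partial>MT)"
    proof (rule integral_dominated_convergence[where w = "\<lambda>_. 2 * L\<^sup>2 + C"])
      show "AE t in MT. (\<lambda>n. \<bar>defect n s t\<bar>) \<longlonglongrightarrow> 0"
        using defect_tendsto[of s] by eventually_elim (rule tendsto_rabs_zero)
      show "AE t in MT. norm \<bar>defect n s t\<bar> \<le> 2 * L\<^sup>2 + C" for n
        using defect_bounded by eventually_elim simp
    qed (use dm in simp_all)
    then show ?thesis by (simp add: \<phi>_def)
  qed
  have \<Phi>: "(\<lambda>n. \<integral>s. \<phi> n s \<partial>lebesgue_on {a..b}) \<longlonglongrightarrow> (\<integral>s. 0 \<partial>lebesgue_on {a..b})"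
    by (rule integral_dominated_convergence[where w = "\<lambda>_. (2 * L\<^sup>2 + C) * \<mu>"])
       (use \<phi>b \<phi>0 tom[OF \<phi>m] in auto)
  have \<Psi>: "(\<lambda>n. \<integral>s. \<psi> n s \<partial>lebesgue_on {a..b}) \<longlonglongrightarrow> 0"
    unfolding \<psi>_def MT_def
  proof (rule Q.velocity_translation[OF t01 ab])
    show "AE t in lebesgue_on {t0..t1}. \<exists>v. (Q s has_vector_derivative v) (at t within {t0..t1})" for s
      using flow[of s] by eventually_elim blast
  qed
  have lim: "(\<lambda>n. (\<integral>s. \<phi> n s \<partial>lebesgue_on {a..b}) + L * (\<integral>s. \<psi> n s \<partial>lebesgue_on {a..b})) \<longlonglongrightarrow> 0"
    using tendsto_add[OF \<Phi> tendsto_mult[OF tendsto_const[of L] \<Psi>]] by simp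
  show "(\<lambda>n. \<integral>s. \<bar>real (Suc n) * gain s (s + 1 / real (Suc n))\<bar> \<partial>lebesgue_on {a..b}) \<longlonglongrightarrow> 0"
    unfolding \<kappa>_def[symmetric]
  proof (rule tendsto_sandwich[OF _ _ tendsto_const lim])
    show "\<forall>\<^sub>F n in sequentially. 0 \<le> (\<integral>s. \<bar>\<kappa> n s\<bar> \<partial>lebesgue_on {a..b})" by simp
    show "\<forall>\<^sub>F n in sequentially. (\<integral>s. \<bar>\<kappa> n s\<bar> \<partial>lebesgue_on {a..b}) \<le>
        (\<integral>s. \<phi> n s \<partial>lebesgue_on {a..b}) + L * (\<integral>s. \<psi> n s \<partial>lebesgue_on {a..b})"
    proof (rule always_eventually, rule allI)
      fix n
      have "(\<integral>s. \<bar>\<kappa> n s\<bar> \<partial>lebesgue_on {a..b}) \<le> (\<integral>s. \<phi> n s + L * \<psi> n s \<partial>lebesgue_on {a..b})"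
        by (rule integral_mono) (use \<kappa>i \<phi>i \<psi>i \<kappa>le in auto)
      then show "(\<integral>s. \<bar>\<kappa> n s\<bar> \<partial>lebesgue_on {a..b}) \<le>
        (\<integral>s. \<phi> n s \<partial>lebesgue_on {a..b}) + L * (\<integral>s. \<psi> n s \<partial>lebesgue_on {a..b})"
        using \<phi>i \<psi>i by simp
    qed
  qed
qed

text \<open>The function \<open>f s = \<theta>1 s - P a t1 \<bullet> Q s t1\<close> is recovered from the mean
  of its difference quotients. These split into \<open>gain\<close>, which vanishes in the limit, the initial
  error, which is quadratic, and the error of replacing \<open>P s t1\<close> by \<open>P a t1\<close>, which
  is the bound that remains.\<close>

theorem action_expansion:
  fixes \<theta>0 \<theta>1 :: "real \<Rightarrow> real"
  assumes ab: "a \<le> b" and cont: "continuous_on UNIV \<theta>1"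
    and \<theta>: "\<And>s. \<theta>1 s - \<theta>0 s = (\<integral>t. P s t \<bullet> Hp s t - h s t \<partial>lebesgue_on {t0..t1})"
    and init: "\<And>s s'. s \<le> s' \<Longrightarrow> \<bar>\<theta>0 s' - \<theta>0 s - P s t0 \<bullet> (Q s' t0 - Q s t0)\<bar> \<le> K * (s' - s)\<^sup>2"
  shows "\<bar>\<theta>1 b - \<theta>1 a - P a t1 \<bullet> (Q b t1 - Q a t1)\<bar> \<le> L\<^sup>2 * (b - a)\<^sup>2"
proof -
  interpret S: finite_measure "lebesgue_on {a..b}" by (rule finite_measure_lebesgue_on) simp
  define f where "f s = \<theta>1 s - P a t1 \<bullet> Q s t1" for s
  have fc: "continuous_on UNIV f" unfolding f_def by (intro continuous_intros cont)
  define I where "I n = (\<integral>s. \<bar>real (Suc n) * gain s (s + 1 / real (Suc n))\<bar> \<partial>lebesgue_on {a..b})" for n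
  have K0: "K \<ge> 0" using order_trans[OF abs_ge_zero init[of 0 1]] by simp
  have le: "\<bar>integral {a..b} (\<lambda>s. real (Suc n) * (f (s + 1 / real (Suc n)) - f s))\<bar>
      \<le> I n + K * (b - a) * (1 / real (Suc n)) + L\<^sup>2 * (b - a)\<^sup>2" for n
  proof -
    define \<epsilon> where "\<epsilon> = 1 / real (Suc n)"
    have \<epsilon>: "\<epsilon> > 0" "real (Suc n) * \<epsilon> = 1" by (auto simp: \<epsilon>_def)
    have pt: "\<bar>real (Suc n) * (f (s + \<epsilon>) - f s)\<bar> \<le> \<bar>real (Suc n) * gain s (s + \<epsilon>)\<bar> + (K * \<epsilon> + L\<^sup>2 * (b - a))"
      if s: "s \<in> {a..b}" for s
    proof -
      define r where "r = \<theta>0 (s + \<epsilon>) - \<theta>0 s - P s t0 \<bullet> (Q (s + \<epsilon>) t0 - Q s t0)"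
      define e where "e = (P s t1 - P a t1) \<bullet> (Q (s + \<epsilon>) t1 - Q s t1)"
      have "f (s + \<epsilon>) - f s = gain s (s + \<epsilon>) + r + e"
        using \<theta>[of s] \<theta>[of "s + \<epsilon>"]
        by (simp add: f_def gain_def r_def e_def MT_def inner_diff_left inner_diff_right)
      then have "real (Suc n) * (f (s + \<epsilon>) - f s) = real (Suc n) * gain s (s + \<epsilon>) + real (Suc n) * r + real (Suc n) * e"
        by (simp add: distrib_left)
      moreover have "\<bar>real (Suc n) * r\<bar> \<le> K * \<epsilon>"
      proof -
        have "\<bar>real (Suc n) * r\<bar> \<le> real (Suc n) * (K * \<epsilon>\<^sup>2)"
          using init[of s "s + \<epsilon>"] \<epsilon> unfolding abs_mult abs_of_nat r_def[symmetric]
          by (intro mult_left_mono) auto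
        also have "\<dots> = (real (Suc n) * \<epsilon>) * (K * \<epsilon>)" by (simp only: power2_eq_square mult_ac)
        finally show ?thesis using \<epsilon> by simp
      qed
      moreover have "\<bar>real (Suc n) * e\<bar> \<le> L\<^sup>2 * (b - a)"
      proof -
        have "norm (P s t1 - P a t1) \<le> L * (b - a)"
          using P.lip[of s t1 a t1] s mult_left_mono[OF _ L0, of "s - a" "b - a"] by fastforce
        moreover have "norm (Q (s + \<epsilon>) t1 - Q s t1) \<le> L * \<epsilon>" using Q.lip[of "s + \<epsilon>" t1 s t1] \<epsilon> by simp
        ultimately have "\<bar>e\<bar> \<le> (L * (b - a)) * (L * \<epsilon>)"
          unfolding e_def using L0 ab by (intro order_trans[OF Cauchy_Schwarz_ineq2 mult_mono]) auto
        then have "\<bar>real (Suc n) * e\<bar> \<le> real (Suc n) * ((L * (b - a)) * (L * \<epsilon>))"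
          unfolding abs_mult abs_of_nat by (rule mult_left_mono) simp
        also have "\<dots> = (real (Suc n) * \<epsilon>) * (L\<^sup>2 * (b - a))" by (simp only: power2_eq_square mult_ac)
        finally show ?thesis using \<epsilon> by simp
      qed
      ultimately show ?thesis by linarith
    qed
    have fi: "continuous_on {a..b} (\<lambda>s. real (Suc n) * (f (s + \<epsilon>) - f s))"
      by (intro continuous_intros continuous_on_compose2[OF fc] continuous_on_subset[OF fc]) auto
    have gi: "integrable (lebesgue_on {a..b}) (\<lambda>s. \<bar>real (Suc n) * gain s (s + \<epsilon>)\<bar> + (K * \<epsilon> + L\<^sup>2 * (b - a)))"
      using gain_tendsto(2)[OF ab, of n] by (auto simp: \<epsilon>_def)
    note gh = has_integral_integral_lebesgue_on[OF gi, simplified]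
    have "\<bar>integral {a..b} (\<lambda>s. real (Suc n) * (f (s + \<epsilon>) - f s))\<bar> \<le>
        (\<integral>s. \<bar>real (Suc n) * gain s (s + \<epsilon>)\<bar> + (K * \<epsilon> + L\<^sup>2 * (b - a)) \<partial>lebesgue_on {a..b})"
      using integral_norm_bound_integral[OF integrable_continuous_real[OF fi] has_integral_integrable[OF gh]] pt
        integral_unique[OF gh] by simp
    also have "\<dots> = I n + (K * \<epsilon> + L\<^sup>2 * (b - a)) * (b - a)"
      using gain_tendsto(2)[OF ab, of n] ab
      by (simp add: I_def \<epsilon>_def measure_restrict_space)
    also have "\<dots> = I n + K * (b - a) * \<epsilon> + L\<^sup>2 * (b - a)\<^sup>2" by (simp add: power2_eq_square algebra_simps)
    finally show ?thesis unfolding \<epsilon>_def .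
  qed
  have l1: "(\<lambda>n. \<bar>integral {a..b} (\<lambda>s. real (Suc n) * (f (s + 1 / real (Suc n)) - f s))\<bar>) \<longlonglongrightarrow> \<bar>f b - f a\<bar>"
    by (intro tendsto_rabs tendsto_integral_difference_quotient fc ab)
  have l2: "(\<lambda>n. I n + K * (b - a) * (1 / real (Suc n)) + L\<^sup>2 * (b - a)\<^sup>2) \<longlonglongrightarrow> 0 + K * (b - a) * 0 + L\<^sup>2 * (b - a)\<^sup>2"
    unfolding I_def by (intro tendsto_add tendsto_mult tendsto_const gain_tendsto(1) ab LIMSEQ_Suc[OF lim_1_over_n])
  have "\<bar>f b - f a\<bar> \<le> L\<^sup>2 * (b - a)\<^sup>2" using LIMSEQ_le[OF l1 l2] le by auto
  then show ?thesis by (simp add: f_def inner_diff_right algebra_simps)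
qed

end

lemma clamp_real:
  fixes a b :: real
  assumes "a \<le> b"
  shows "max a (min b x) \<in> {a..b}" "\<bar>max a (min b x) - max a (min b y)\<bar> \<le> \<bar>x - y\<bar>"
  using assms by (auto simp: max_def min_def)

text \<open>The data are extended to all parameters and times by clamping.\<close>

lemma action_expansion_strip:
  fixes q p :: "real \<Rightarrow> real \<Rightarrow> 'e::euclidean_space" and h :: "real \<Rightarrow> real \<Rightarrow> real"
    and \<theta>0 \<theta>1 :: "real \<Rightarrow> real"
  assumes t01: "t0 \<le> t1" and ab: "a \<le> b" and L: "L \<ge> 0"
    and lipq: "\<And>s s' t t'. \<lbrakk>s \<in> {a..b}; s' \<in> {a..b}; t \<in> {t0..t1}; t' \<in> {t0..t1}\<rbrakk> \<Longrightarrow>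
        norm (q s t - q s' t') \<le> L * (\<bar>s - s'\<bar> + \<bar>t - t'\<bar>)"
    and lipp: "\<And>s s' t t'. \<lbrakk>s \<in> {a..b}; s' \<in> {a..b}; t \<in> {t0..t1}; t' \<in> {t0..t1}\<rbrakk> \<Longrightarrow>
        norm (p s t - p s' t') \<le> L * (\<bar>s - s'\<bar> + \<bar>t - t'\<bar>)"
    and h_diff: "\<And>s t \<eta>. \<lbrakk>s \<in> {a..b}; t \<in> {t0..t1}; \<eta> > 0\<rbrakk> \<Longrightarrow>
        \<exists>d>0. \<forall>s'\<in>{a..b}. \<bar>s' - s\<bar> < d \<longrightarrow>
        \<bar>h s' t - h s t - (Hq s t \<bullet> (q s' t - q s t) + Hp s t \<bullet> (p s' t - p s t))\<bar> \<le> \<eta> * \<bar>s' - s\<bar>"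
    and flow: "\<And>s. s \<in> {a..b} \<Longrightarrow> AE t in lebesgue_on {t0..t1}.
        ((\<lambda>t. q s t) has_vector_derivative Hp s t) (at t within {t0..t1}) \<and>
        ((\<lambda>t. p s t) has_vector_derivative - Hq s t) (at t within {t0..t1})"
    and G_int: "\<And>s. s \<in> {a..b} \<Longrightarrow> integrable (lebesgue_on {t0..t1}) (\<lambda>t. p s t \<bullet> Hp s t - h s t)"
    and cont: "continuous_on {a..b} \<theta>1"
    and \<theta>: "\<And>s. s \<in> {a..b} \<Longrightarrow>
        \<theta>1 s - \<theta>0 s = (\<integral>t. p s t \<bullet> Hp s t - h s t \<partial>lebesgue_on {t0..t1})"
    and init: "\<And>s s'. \<lbrakk>s \<in> {a..b}; s' \<in> {a..b}; s \<le> s'\<rbrakk> \<Longrightarrow>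
        \<bar>\<theta>0 s' - \<theta>0 s - p s t0 \<bullet> (q s' t0 - q s t0)\<bar> \<le> K * (s' - s)\<^sup>2"
    and ss: "s \<in> {a..b}" "s' \<in> {a..b}" "s \<le> s'"
  shows "\<bar>\<theta>1 s' - \<theta>1 s - p s t1 \<bullet> (q s' t1 - q s t1)\<bar> \<le> L\<^sup>2 * (s' - s)\<^sup>2"
proof -
  define \<sigma> where "\<sigma> s = max a (min b s)" for s
  define \<tau> where "\<tau> t = max t0 (min t1 t)" for t
  have \<sigma>: "\<sigma> s \<in> {a..b}" "\<bar>\<sigma> s - \<sigma> s'\<bar> \<le> \<bar>s - s'\<bar>" for s s'
    unfolding \<sigma>_def by (rule clamp_real[OF ab])+
  have \<sigma>id: "\<sigma> s = s" if "s \<in> {a..b}" for s using that by (auto simp: \<sigma>_def)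
  have \<sigma>mono: "s \<le> s' \<Longrightarrow> \<sigma> s \<le> \<sigma> s'" for s s' by (auto simp: \<sigma>_def)
  have \<tau>: "\<tau> t \<in> {t0..t1}" "\<bar>\<tau> t - \<tau> t'\<bar> \<le> \<bar>t - t'\<bar>" for t t'
    unfolding \<tau>_def by (rule clamp_real[OF t01])+
  have \<tau>id: "\<tau> t = t" if "t \<in> {t0..t1}" for t using that by (auto simp: \<tau>_def)
  have K0: "K * (\<sigma> s' - \<sigma> s)\<^sup>2 \<le> \<bar>K\<bar> * (s' - s)\<^sup>2" for s s'
  proof -
    have "K * (\<sigma> s' - \<sigma> s)\<^sup>2 \<le> \<bar>K\<bar> * (\<sigma> s' - \<sigma> s)\<^sup>2" by (intro mult_right_mono) auto
    also have "\<dots> \<le> \<bar>K\<bar> * (s' - s)\<^sup>2"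
      using \<sigma>(2)[of s' s] by (intro mult_left_mono) (auto simp: abs_le_square_iff)
    finally show ?thesis .
  qed
  have clampL: "L * (\<bar>\<sigma> s - \<sigma> s'\<bar> + \<bar>\<tau> t - \<tau> t'\<bar>) \<le> L * (\<bar>s - s'\<bar> + \<bar>t - t'\<bar>)" for s s' t t'
    using \<sigma>(2)[of s s'] \<tau>(2)[of t t'] L by (intro mult_left_mono) auto
  interpret ham_strip "\<lambda>s t. q (\<sigma> s) (\<tau> t)" "\<lambda>s t. p (\<sigma> s) (\<tau> t)" L "\<lambda>s t. h (\<sigma> s) t"
    "\<lambda>s t. Hq (\<sigma> s) t" "\<lambda>s t. Hp (\<sigma> s) t" t0 t1
  proof unfold_locales
    show "0 \<le> L" "t0 \<le> t1" by (fact L t01)+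
    show "norm (q (\<sigma> s) (\<tau> t) - q (\<sigma> s') (\<tau> t')) \<le> L * (\<bar>s - s'\<bar> + \<bar>t - t'\<bar>)" for s t s' t'
      by (rule order_trans[OF lipq clampL]) (fact \<sigma> \<tau>)+
    show "norm (p (\<sigma> s) (\<tau> t) - p (\<sigma> s') (\<tau> t')) \<le> L * (\<bar>s - s'\<bar> + \<bar>t - t'\<bar>)" for s t s' t'
      by (rule order_trans[OF lipp clampL]) (fact \<sigma> \<tau>)+
  next
    fix s t \<eta> :: real assume t: "t \<in> {t0..t1}" and \<eta>: "\<eta> > 0"
    obtain d where d: "d > 0" "\<And>s'. \<lbrakk>s' \<in> {a..b}; \<bar>s' - \<sigma> s\<bar> < d\<rbrakk> \<Longrightarrow>
        \<bar>h s' t - h (\<sigma> s) t - (Hq (\<sigma> s) t \<bullet> (q s' t - q (\<sigma> s) t) + Hp (\<sigma> s) t \<bullet> (p s' t - p (\<sigma> s) t))\<bar>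
          \<le> \<eta> * \<bar>s' - \<sigma> s\<bar>"
      using h_diff[OF \<sigma>(1)[of s] t \<eta>] by blast
    show "\<exists>d>0. \<forall>s'. \<bar>s' - s\<bar> < d \<longrightarrow> \<bar>h (\<sigma> s') t - h (\<sigma> s) t - (Hq (\<sigma> s) t \<bullet> (q (\<sigma> s') (\<tau> t) - q (\<sigma> s) (\<tau> t))
        + Hp (\<sigma> s) t \<bullet> (p (\<sigma> s') (\<tau> t) - p (\<sigma> s) (\<tau> t)))\<bar> \<le> \<eta> * \<bar>s' - s\<bar>"
    proof (intro exI[of _ d] conjI allI impI)
      fix s' assume "\<bar>s' - s\<bar> < d"
      then have "\<bar>\<sigma> s' - \<sigma> s\<bar> < d" using \<sigma>(2)[of s' s] by linarith
      from d(2)[OF \<sigma>(1) this] show "\<bar>h (\<sigma> s') t - h (\<sigma> s) t - (Hq (\<sigma> s) t \<bullet> (q (\<sigma> s') (\<tau> t) - q (\<sigma> s) (\<tau> t))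
        + Hp (\<sigma> s) t \<bullet> (p (\<sigma> s') (\<tau> t) - p (\<sigma> s) (\<tau> t)))\<bar> \<le> \<eta> * \<bar>s' - s\<bar>"
        unfolding \<tau>id[OF t] using \<sigma>(2)[of s' s] \<eta>
        by (elim order_trans) (intro mult_left_mono, auto)
    qed (rule d(1))
  next
    fix s
    have "AE t in lebesgue_on {t0..t1}. t \<in> {t0..t1}" using AE_space[of "lebesgue_on {t0..t1}"] by simp
    then show "AE t in lebesgue_on {t0..t1}.
        ((\<lambda>t. q (\<sigma> s) (\<tau> t)) has_vector_derivative Hp (\<sigma> s) t) (at t within {t0..t1}) \<and>
        ((\<lambda>t. p (\<sigma> s) (\<tau> t)) has_vector_derivative - Hq (\<sigma> s) t) (at t within {t0..t1})"
      using flow[OF \<sigma>(1)[of s]]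
    proof eventually_elim
      case (elim t)
      show ?case
        by (intro conjI has_vector_derivative_transform[OF elim(1) _ conjunct1[OF elim(2)]]
            has_vector_derivative_transform[OF elim(1) _ conjunct2[OF elim(2)]]) (simp_all add: \<tau>id)
    qed
  next
    fix s
    show "integrable (lebesgue_on {t0..t1}) (\<lambda>t. p (\<sigma> s) (\<tau> t) \<bullet> Hp (\<sigma> s) t - h (\<sigma> s) t)"
      using G_int[OF \<sigma>(1)[of s]] \<tau>id by (subst Bochner_Integration.integrable_cong[OF refl]) auto
  qed
  have "\<bar>\<theta>1 (\<sigma> s') - \<theta>1 (\<sigma> s) - p (\<sigma> s) (\<tau> t1) \<bullet> (q (\<sigma> s') (\<tau> t1) - q (\<sigma> s) (\<tau> t1))\<bar> \<le> L\<^sup>2 * (s' - s)\<^sup>2"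
  proof (rule action_expansion[where ?\<theta>0.0 = "\<lambda>s. \<theta>0 (\<sigma> s)" and ?\<theta>1.0 = "\<lambda>s. \<theta>1 (\<sigma> s)" and K = "\<bar>K\<bar>", OF ss(3)])
    show "continuous_on UNIV (\<lambda>s. \<theta>1 (\<sigma> s))"
      by (rule continuous_on_compose2[OF cont]) (use \<sigma>(1) in \<open>auto simp: \<sigma>_def intro!: continuous_intros\<close>)
    show "\<theta>1 (\<sigma> s) - \<theta>0 (\<sigma> s) = (\<integral>t. p (\<sigma> s) (\<tau> t) \<bullet> Hp (\<sigma> s) t - h (\<sigma> s) t \<partial>lebesgue_on {t0..t1})" for s
      unfolding \<theta>[OF \<sigma>(1)] by (rule Bochner_Integration.integral_cong) (auto simp: \<tau>id)
    show "\<bar>\<theta>0 (\<sigma> s') - \<theta>0 (\<sigma> s) - p (\<sigma> s) (\<tau> t0) \<bullet> (q (\<sigma> s') (\<tau> t0) - q (\<sigma> s) (\<tau> t0))\<bar> \<le> \<bar>K\<bar> * (s' - s)\<^sup>2"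
      if "s \<le> s'" for s s'
      using init[OF \<sigma>(1) \<sigma>(1) \<sigma>mono[OF that]] K0[of s' s] \<tau>id[of t0] t01 by simp
  qed
  then show ?thesis using ss \<tau>id[of t1] t01 by (simp add: \<sigma>id)
qed

text \<open>The function \<open>\<theta> s - P \<bullet> q s\<close> has difference quotients at most \<open>e
  * L\<close>, up to any positive error.\<close>

lemma expansion_of_pointwise:
  fixes \<theta> :: "real \<Rightarrow> real" and q p :: "real \<Rightarrow> 'e::euclidean_space"
  assumes ab: "a \<le> b" and L: "L \<ge> 0"
    and pt: "\<And>s \<eta>. \<lbrakk>s \<in> {a..b}; \<eta> > 0\<rbrakk> \<Longrightarrow> \<exists>d>0. \<forall>s'\<in>{a..b}. \<bar>s' - s\<bar> < d \<longrightarrow>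
        \<bar>\<theta> s' - \<theta> s - p s \<bullet> (q s' - q s)\<bar> \<le> \<eta> * \<bar>s' - s\<bar>"
    and q: "\<And>s s'. \<lbrakk>s \<in> {a..b}; s' \<in> {a..b}\<rbrakk> \<Longrightarrow> norm (q s' - q s) \<le> L * \<bar>s' - s\<bar>"
    and p: "\<And>s. s \<in> {a..b} \<Longrightarrow> norm (p s - P) \<le> e"
  shows "\<bar>\<theta> b - \<theta> a - P \<bullet> (q b - q a)\<bar> \<le> e * L * (b - a)"
proof (rule field_le_epsilon)
  fix \<eta> :: real assume \<eta>: "\<eta> > 0"
  define \<eta>' where "\<eta>' = \<eta> / (b - a + 1)"
  have \<eta>': "\<eta>' > 0" using \<eta> ab by (simp add: \<eta>'_def)
  have loc: "\<exists>d>0. \<forall>s'\<in>{a..b}. \<bar>s' - s\<bar> < d \<longrightarrow>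
      \<bar>(\<theta> s' - P \<bullet> q s') - (\<theta> s - P \<bullet> q s)\<bar> \<le> (e * L + \<eta>') * \<bar>s' - s\<bar>" if s: "s \<in> {a..b}" for s
  proof -
    obtain d where d: "d > 0" "\<And>s'. \<lbrakk>s' \<in> {a..b}; \<bar>s' - s\<bar> < d\<rbrakk> \<Longrightarrow>
        \<bar>\<theta> s' - \<theta> s - p s \<bullet> (q s' - q s)\<bar> \<le> \<eta>' * \<bar>s' - s\<bar>" using pt[OF s \<eta>'] by blast
    show ?thesis
    proof (intro exI[of _ d] conjI ballI impI)
      fix s' assume s': "s' \<in> {a..b}" "\<bar>s' - s\<bar> < d"
      have "e \<ge> 0" using p[OF s] norm_ge_zero order_trans by blast
      then have "\<bar>(p s - P) \<bullet> (q s' - q s)\<bar> \<le> e * (L * \<bar>s' - s\<bar>)"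
        by (intro order_trans[OF Cauchy_Schwarz_ineq2 mult_mono] p[OF s] q[OF s s'(1)]) auto
      moreover have "(\<theta> s' - P \<bullet> q s') - (\<theta> s - P \<bullet> q s) =
          (\<theta> s' - \<theta> s - p s \<bullet> (q s' - q s)) + (p s - P) \<bullet> (q s' - q s)"
        by (simp add: inner_diff_left inner_diff_right)
      ultimately have "\<bar>(\<theta> s' - P \<bullet> q s') - (\<theta> s - P \<bullet> q s)\<bar> \<le> \<eta>' * \<bar>s' - s\<bar> + e * (L * \<bar>s' - s\<bar>)"
        using d(2)[OF s'] by linarith
      then show "\<bar>(\<theta> s' - P \<bullet> q s') - (\<theta> s - P \<bullet> q s)\<bar> \<le> (e * L + \<eta>') * \<bar>s' - s\<bar>"
        by (simp add: algebra_simps)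
    qed (rule d(1))
  qed
  have "\<bar>(\<theta> b - P \<bullet> q b) - (\<theta> a - P \<bullet> q a)\<bar> \<le> (e * L + \<eta>') * (b - a)"
    by (rule lipschitz_of_AE_bound[OF ab negligible_empty]) (use loc in blast)+
  also have "\<dots> = e * L * (b - a) + \<eta>' * (b - a)" by (simp add: algebra_simps)
  also have "\<eta>' * (b - a) \<le> \<eta>" using \<eta> ab by (simp add: \<eta>'_def field_simps)
  finally show "\<bar>\<theta> b - \<theta> a - P \<bullet> (q b - q a)\<bar> \<le> e * L * (b - a) + \<eta>" by (simp add: inner_diff_right algebra_simps)
qed

text \<open>Both sides are the limit of the second difference of \<open>f\<close> on the parallelogram spanned
  by \<open>k *\<^sub>R u\<close> and \<open>k *\<^sub>R v\<close>, divided by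
  \<open>k\<^sup>2\<close>.\<close>

lemma second_derivative_symmetric:
  fixes f :: "'a::real_normed_vector \<Rightarrow> real"
  assumes S: "open S" "x \<in> S" and f: "\<And>y. y \<in> S \<Longrightarrow> (f has_derivative f' y) (at y)"
    and u: "((\<lambda>y. f' y u) has_derivative Du) (at x)" and v: "((\<lambda>y. f' y v) has_derivative Dv) (at x)"
  shows "Du v = Dv u"
proof -
  have half: "\<forall>e>0. \<exists>d>0. \<forall>k. 0 < k \<and> k < d \<longrightarrow>
      \<bar>f (x + k *\<^sub>R u + k *\<^sub>R v) - f (x + k *\<^sub>R u) - f (x + k *\<^sub>R v) + f x - k\<^sup>2 * Du v\<bar> \<le> e * k\<^sup>2"
    if D: "((\<lambda>y. f' y u) has_derivative Du) (at x)" for u v Du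
  proof (intro allI impI)
    fix e :: real assume e: "e > 0"
    define B where "B = norm u + norm v + 1"
    have B: "B > 0" by (simp add: B_def add_nonneg_pos)
    interpret Du: bounded_linear Du using D by (rule has_derivative_bounded_linear)
    obtain r where r: "r > 0" "ball x r \<subseteq> S" using S open_contains_ball by blast
    obtain d where d: "d > 0" "\<And>y. norm (y - x) < d \<Longrightarrow>
        \<bar>f' y u - f' x u - Du (y - x)\<bar> \<le> e / (2 * B) * norm (y - x)"
      using D[unfolded has_derivative_within_alt, THEN conjunct2, rule_format, of "e / (2 * B)"] e B
      by (auto simp: zero_less_divide_iff)
    show "\<exists>d>0. \<forall>k. 0 < k \<and> k < d \<longrightarrow>
      \<bar>f (x + k *\<^sub>R u + k *\<^sub>R v) - f (x + k *\<^sub>R u) - f (x + k *\<^sub>R v) + f x - k\<^sup>2 * Du v\<bar> \<le> e * k\<^sup>2"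
    proof (intro exI[of _ "min d r / B"] conjI allI impI)
      show "0 < min d r / B" using d r B by simp
      fix k :: real assume k: "0 < k \<and> k < min d r / B"
      then have kB: "k * B < d" "k * B < r" using B by (auto simp: field_simps)
      define \<phi> where "\<phi> t = f (x + (t * k) *\<^sub>R u + k *\<^sub>R v) - f (x + (t * k) *\<^sub>R u)" for t
      have nb: "norm ((t * k) *\<^sub>R u + (c * k) *\<^sub>R v) \<le> k * B" if "0 \<le> t" "t \<le> 1" "c \<in> {0, 1}" for t c
      proof -
        have "norm ((t * k) *\<^sub>R u + (c * k) *\<^sub>R v) \<le> (t * k) * norm u + (c * k) * norm v"
          using norm_triangle_ineq[of "(t * k) *\<^sub>R u" "(c * k) *\<^sub>R v"] k that by (auto simp: abs_mult)
        also have "\<dots> \<le> (1 * k) * norm u + (1 * k) * norm v"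
          using k that by (intro add_mono mult_right_mono) auto
        also have "\<dots> \<le> k * B" using k by (simp add: B_def algebra_simps)
        finally show ?thesis .
      qed
      have inS: "x + (t * k) *\<^sub>R u + k *\<^sub>R v \<in> S" "x + (t * k) *\<^sub>R u \<in> S" if "0 \<le> t" "t \<le> 1" for t
      proof -
        have "norm ((t * k) *\<^sub>R u + k *\<^sub>R v) < r" "norm ((t * k) *\<^sub>R u) < r"
          using nb[OF that, of 1] nb[OF that, of 0] kB by auto
        moreover have "dist x (x + w) = norm w" for w by (simp add: dist_norm)
        ultimately have "x + ((t * k) *\<^sub>R u + k *\<^sub>R v) \<in> ball x r" "x + (t * k) *\<^sub>R u \<in> ball x r"
          unfolding mem_ball by simp_all
        then show "x + (t * k) *\<^sub>R u + k *\<^sub>R v \<in> S" "x + (t * k) *\<^sub>R u \<in> S"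
          using r(2) by (auto simp: add.assoc)
      qed
      have lin: "f' y (c *\<^sub>R w) = c * f' y w" if "y \<in> S" for y c w
        using linear_scale[OF has_derivative_linear[OF f[OF that]]] by simp
      have der: "(\<phi> has_real_derivative k * (f' (x + (t * k) *\<^sub>R u + k *\<^sub>R v) u - f' (x + (t * k) *\<^sub>R u) u)) (at t)"
        if t: "0 \<le> t" "t \<le> 1" for t
      proof -
        have 1: "((\<lambda>t. x + (t * k) *\<^sub>R u + k *\<^sub>R v) has_derivative (\<lambda>h. (h * k) *\<^sub>R u)) (at t)"
          "((\<lambda>t. x + (t * k) *\<^sub>R u) has_derivative (\<lambda>h. (h * k) *\<^sub>R u)) (at t)"
          by (auto intro!: derivative_eq_intros)
        have "(\<phi> has_derivative (\<lambda>h. f' (x + (t * k) *\<^sub>R u + k *\<^sub>R v) ((h * k) *\<^sub>R u) - f' (x + (t * k) *\<^sub>R u) ((h * k) *\<^sub>R u))) (at t)"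
          unfolding \<phi>_def
          using has_derivative_compose[OF 1(1) f[OF inS(1)[OF t]]] has_derivative_compose[OF 1(2) f[OF inS(2)[OF t]]]
          by (rule has_derivative_diff)
        then show ?thesis
          unfolding has_field_derivative_def
          by (rule has_derivative_eq_rhs) (use inS[OF t] in \<open>auto simp: lin algebra_simps\<close>)
      qed
      obtain z where z: "0 < z" "z < 1" "\<phi> 1 - \<phi> 0 = (1 - 0) * (k * (f' (x + (z * k) *\<^sub>R u + k *\<^sub>R v) u - f' (x + (z * k) *\<^sub>R u) u))"
        using MVT2[of 0 1 \<phi> "\<lambda>t. k * (f' (x + (t * k) *\<^sub>R u + k *\<^sub>R v) u - f' (x + (t * k) *\<^sub>R u) u)"] der by auto
      define y1 where "y1 = x + (z * k) *\<^sub>R u + k *\<^sub>R v"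
      define y2 where "y2 = x + (z * k) *\<^sub>R u"
      have n: "norm (y1 - x) \<le> k * B" "norm (y2 - x) \<le> k * B"
        using nb[of z 1] nb[of z 0] z by (auto simp: y1_def y2_def algebra_simps)
      have est: "\<bar>f' y u - f' x u - Du (y - x)\<bar> \<le> e / (2 * B) * (k * B)" if n: "norm (y - x) \<le> k * B" for y
      proof -
        have "0 \<le> e / (2 * B)" using e B by simp
        from mult_left_mono[OF n this] show ?thesis using d(2)[of y] n kB by linarith
      qed
      note e1 = est[OF n(1)] and e2 = est[OF n(2)]
      have "Du (y1 - x) - Du (y2 - x) = k * Du v"
        by (simp add: Du.diff[symmetric] y1_def y2_def Du.scaleR Du.add)
      moreover have "e / (2 * B) * (k * B) = e * k / 2" using B by simp
      ultimately have "\<bar>f' y1 u - f' y2 u - k * Du v\<bar> \<le> e * k" using e1 e2 by linarith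
      then have "k * \<bar>f' y1 u - f' y2 u - k * Du v\<bar> \<le> k * (e * k)" using k by (intro mult_left_mono) auto
      then have "\<bar>k * (f' y1 u - f' y2 u - k * Du v)\<bar> \<le> e * k\<^sup>2"
        using k by (simp add: abs_mult power2_eq_square mult_ac)
      moreover have "f (x + k *\<^sub>R u + k *\<^sub>R v) - f (x + k *\<^sub>R u) - f (x + k *\<^sub>R v) + f x - k\<^sup>2 * Du v
          = k * (f' y1 u - f' y2 u - k * Du v)"
        using z(3) by (simp add: \<phi>_def y1_def y2_def power2_eq_square algebra_simps)
      ultimately show "\<bar>f (x + k *\<^sub>R u + k *\<^sub>R v) - f (x + k *\<^sub>R u) - f (x + k *\<^sub>R v) + f x - k\<^sup>2 * Du v\<bar> \<le> e * k\<^sup>2"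
        by simp
    qed
  qed
  have "\<bar>Du v - Dv u\<bar> \<le> e" if e: "e > 0" for e
  proof -
    obtain d1 where d1: "d1 > 0" "\<And>k. 0 < k \<Longrightarrow> k < d1 \<Longrightarrow>
      \<bar>f (x + k *\<^sub>R u + k *\<^sub>R v) - f (x + k *\<^sub>R u) - f (x + k *\<^sub>R v) + f x - k\<^sup>2 * Du v\<bar> \<le> e / 2 * k\<^sup>2"
      using half[OF u, rule_format, of "e / 2" v] e by auto
    obtain d2 where d2: "d2 > 0" "\<And>k. 0 < k \<Longrightarrow> k < d2 \<Longrightarrow>
      \<bar>f (x + k *\<^sub>R v + k *\<^sub>R u) - f (x + k *\<^sub>R v) - f (x + k *\<^sub>R u) + f x - k\<^sup>2 * Dv u\<bar> \<le> e / 2 * k\<^sup>2"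
      using half[OF v, rule_format, of "e / 2" u] e by auto
    define k where "k = min d1 d2 / 2"
    have k: "0 < k" "k < d1" "k < d2" using d1 d2 by (auto simp: k_def)
    have "f (x + k *\<^sub>R v + k *\<^sub>R u) = f (x + k *\<^sub>R u + k *\<^sub>R v)" by (simp add: algebra_simps)
    then have "\<bar>k\<^sup>2 * Du v - k\<^sup>2 * Dv u\<bar> \<le> e / 2 * k\<^sup>2 + e / 2 * k\<^sup>2"
      using d1(2)[OF k(1,2)] d2(2)[OF k(1,3)] by linarith
    moreover have "\<bar>k\<^sup>2 * Du v - k\<^sup>2 * Dv u\<bar> = k\<^sup>2 * \<bar>Du v - Dv u\<bar>"
      unfolding right_diff_distrib[symmetric] abs_mult by simp
    ultimately have "k\<^sup>2 * \<bar>Du v - Dv u\<bar> \<le> k\<^sup>2 * e" by (simp add: mult.commute)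
    then show ?thesis using k by simp
  qed
  then have "\<bar>Du v - Dv u\<bar> \<le> 0" by (rule field_le_epsilon) simp
  then show ?thesis by simp
qed

section \<open>Atlases with continuously differentiable transitions\<close>

lemma Ck_on_1I:
  assumes "\<And>x. x \<in> S \<Longrightarrow> (f has_derivative f' x) (at x)" "\<And>v. continuous_on S (\<lambda>x. f' x v)"
  shows "\<And>x. x \<in> S \<Longrightarrow> f differentiable (at x)" "\<And>v. continuous_on S (\<lambda>x. frechet_derivative f (at x) v)"
proof -
  show "f differentiable (at x)" if "x \<in> S" for x using assms(1)[OF that] by (rule differentiableI)
  have "frechet_derivative f (at x) = f' x" if "x \<in> S" for x
    using frechet_derivative_at[OF assms(1)[OF that]] by simp
  then show "continuous_on S (\<lambda>x. frechet_derivative f (at x) v)" for v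
    using assms(2)[of v] continuous_on_cong[of S S "\<lambda>x. frechet_derivative f (at x) v" "\<lambda>x. f' x v"] by simp
qed

text \<open>A manifold and its cotangent bundle are treated alike. Each derivative of a transition of the
  manifold costs one for the bundle, whose transitions are only shown to be continuously
  differentiable.\<close>

locale C1_atlas =
  fixes X :: "'a set" and A :: "('a, 'e::euclidean_space) chart set"
  assumes cover: "(\<Union>c\<in>A. fst c) = X"
    and inj: "c \<in> A \<Longrightarrow> inj_on (snd c) (fst c)"
    and open_image: "c \<in> A \<Longrightarrow> open (snd c ` fst c)"
    and open_overlap: "\<lbrakk>c \<in> A; d \<in> A\<rbrakk> \<Longrightarrow> open (snd c ` (fst c \<inter> fst d))"
    and transition_differentiable: "\<lbrakk>c \<in> A; d \<in> A; x \<in> fst c; x \<in> fst d\<rbrakk> \<Longrightarrow>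
        (snd d \<circ> chart_inv c) differentiable (at (snd c x))"
    and transition_continuous: "\<lbrakk>c \<in> A; d \<in> A\<rbrakk> \<Longrightarrow> continuous_on (snd c ` (fst c \<inter> fst d))
        (\<lambda>y. frechet_derivative (snd d \<circ> chart_inv c) (at y) v)"
begin

lemma chart_inv_eq [simp]: "\<lbrakk>c \<in> A; x \<in> fst c\<rbrakk> \<Longrightarrow> chart_inv c (snd c x) = x"
  unfolding chart_inv_def by (rule inv_into_f_f[OF inj])

lemma chart_inv_in: "\<lbrakk>c \<in> A; y \<in> snd c ` fst c\<rbrakk> \<Longrightarrow> chart_inv c y \<in> fst c"
  unfolding chart_inv_def by (rule inv_into_into)

lemma chart_chart_inv: "\<lbrakk>c \<in> A; y \<in> snd c ` fst c\<rbrakk> \<Longrightarrow> snd c (chart_inv c y) = y"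
  unfolding chart_inv_def by (rule f_inv_into_f)

lemma chart_eq_iff: "\<lbrakk>c \<in> A; x \<in> fst c; x' \<in> fst c\<rbrakk> \<Longrightarrow> snd c x = snd c x' \<longleftrightarrow> x = x'"
  using inj inj_on_eq_iff by metis

lemma chart_in_X: "\<lbrakk>c \<in> A; x \<in> fst c\<rbrakk> \<Longrightarrow> x \<in> X" using cover by auto

lemma exists_chart: "x \<in> X \<Longrightarrow> \<exists>c\<in>A. x \<in> fst c" using cover by auto

lemma chart_at_in: "x \<in> X \<Longrightarrow> chart_at A x \<in> A \<and> x \<in> fst (chart_at A x)"
  unfolding chart_at_def by (rule someI_ex) (use exists_chart in blast)

lemma openin_mtop_iff: "openin (mtop X A) W \<longleftrightarrow> W \<subseteq> X \<and> (\<forall>c\<in>A. open (snd c ` (W \<inter> fst c)))"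
proof -
  have "istopology (\<lambda>W. W \<subseteq> X \<and> (\<forall>c\<in>A. open (snd c ` (W \<inter> fst c))))"
    unfolding istopology_def
  proof (intro conjI allI impI ballI)
    fix S T c
    assume S: "S \<subseteq> X \<and> (\<forall>c\<in>A. open (snd c ` (S \<inter> fst c)))"
      and T: "T \<subseteq> X \<and> (\<forall>c\<in>A. open (snd c ` (T \<inter> fst c)))"
    show "S \<inter> T \<subseteq> X" using S by blast
    assume c: "c \<in> A"
    have "snd c ` (S \<inter> T \<inter> fst c) = snd c ` (S \<inter> fst c) \<inter> snd c ` (T \<inter> fst c)"
      using inj[OF c] unfolding inj_on_def by blast
    then show "open (snd c ` (S \<inter> T \<inter> fst c))" using S T c by auto
  next
    fix K
    assume K: "\<forall>S\<in>K. S \<subseteq> X \<and> (\<forall>c\<in>A. open (snd c ` (S \<inter> fst c)))"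
    show "\<Union>K \<subseteq> X" using K by blast
    fix c assume c: "c \<in> A"
    have "snd c ` (\<Union>K \<inter> fst c) = (\<Union>S\<in>K. snd c ` (S \<inter> fst c))" by blast
    then show "open (snd c ` (\<Union>K \<inter> fst c))" using K c by auto
  qed
  then show ?thesis by (simp add: mtop_def topology_inverse')
qed

lemma topspace_mtop [simp]: "topspace (mtop X A) = X"
proof
  show "topspace (mtop X A) \<subseteq> X" using openin_topspace[of "mtop X A"] unfolding openin_mtop_iff by blast
  have "X \<inter> fst c = fst c" if "c \<in> A" for c using chart_in_X that by blast
  then have "openin (mtop X A) X" unfolding openin_mtop_iff using open_image by auto
  then show "X \<subseteq> topspace (mtop X A)" by (rule openin_subset)
qed

lemma transition_has_derivative:
  assumes "c \<in> A" "d \<in> A" "x \<in> fst c" "x \<in> fst d"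
  shows "((snd d \<circ> chart_inv c) has_derivative frechet_derivative (snd d \<circ> chart_inv c) (at (snd c x))) (at (snd c x))"
  using transition_differentiable[OF assms] by (simp add: frechet_derivative_works)

lemma transition_continuous_on:
  assumes "c \<in> A" "d \<in> A"
  shows "continuous_on (snd c ` (fst c \<inter> fst d)) (snd d \<circ> chart_inv c)"
proof (rule continuous_at_imp_continuous_on, rule ballI)
  fix y assume "y \<in> snd c ` (fst c \<inter> fst d)"
  then obtain x where "x \<in> fst c" "x \<in> fst d" "y = snd c x" by blast
  then show "isCont (snd d \<circ> chart_inv c) y"
    using differentiable_imp_continuous_within transition_differentiable[OF assms] by blast
qed

lemma openin_chart_preimage:
  assumes c: "c \<in> A" and V: "open V"
  shows "openin (mtop X A) {x \<in> fst c. snd c x \<in> V}"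
  unfolding openin_mtop_iff
proof (intro conjI ballI)
  show "{x \<in> fst c. snd c x \<in> V} \<subseteq> X" using chart_in_X[OF c] by auto
  fix d assume d: "d \<in> A"
  have "snd d ` ({x \<in> fst c. snd c x \<in> V} \<inter> fst d) =
      snd d ` (fst d \<inter> fst c) \<inter> (snd c \<circ> chart_inv d) -` V"
    using c d by (auto simp: image_iff)
  also have "open \<dots>"
    by (rule continuous_open_preimage[OF transition_continuous_on[OF d c] open_overlap[OF d c] V])
  finally show "open (snd d ` ({x \<in> fst c. snd c x \<in> V} \<inter> fst d))" .
qed

lemma openin_chart: "c \<in> A \<Longrightarrow> openin (mtop X A) (fst c)"
  using openin_chart_preimage[of c UNIV] by simp

lemma continuous_map_chart_inv:
  assumes c: "c \<in> A"
  shows "continuous_map (top_of_set (snd c ` fst c)) (mtop X A) (chart_inv c)"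
  unfolding continuous_map_def
proof (intro conjI allI impI)
  show "chart_inv c \<in> topspace (top_of_set (snd c ` fst c)) \<rightarrow> topspace (mtop X A)"
    using chart_inv_in[OF c] chart_in_X[OF c] by auto
  fix W assume W: "openin (mtop X A) W"
  have "{y \<in> topspace (top_of_set (snd c ` fst c)). chart_inv c y \<in> W} = snd c ` (W \<inter> fst c)"
    using c by auto
  moreover have "open (snd c ` (W \<inter> fst c))" using W c by (simp add: openin_mtop_iff)
  ultimately show "openin (top_of_set (snd c ` fst c)) {y \<in> topspace (top_of_set (snd c ` fst c)). chart_inv c y \<in> W}"
    by (metis Int_lower2 image_mono open_openin_trans open_image[OF c])
qed

lemma continuous_map_chart_iff:
  assumes c: "c \<in> A" and g: "g ` S \<subseteq> fst c"
  shows "continuous_map (top_of_set S) (mtop X A) g \<longleftrightarrow> continuous_on S (snd c \<circ> g)"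
proof
  assume L: "continuous_map (top_of_set S) (mtop X A) g"
  show "continuous_on S (snd c \<circ> g)"
    unfolding continuous_on_open_gen[of _ _ UNIV, simplified]
  proof (intro allI impI)
    fix V :: "'e set" assume "open V"
    have "openin (top_of_set S) {x \<in> topspace (top_of_set S). g x \<in> {x \<in> fst c. snd c x \<in> V}}"
      by (rule openin_continuous_map_preimage[OF L openin_chart_preimage[OF c \<open>open V\<close>]])
    moreover have "{x \<in> topspace (top_of_set S). g x \<in> {x \<in> fst c. snd c x \<in> V}} = S \<inter> (snd c \<circ> g) -` V"
      using g by auto
    ultimately show "openin (top_of_set S) (S \<inter> (snd c \<circ> g) -` V)" by simp
  qed
next
  assume "continuous_on S (snd c \<circ> g)"
  then have "continuous_map (top_of_set S) (top_of_set (snd c ` fst c)) (snd c \<circ> g)"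
    using g by (auto simp: continuous_map_in_subtopology)
  from continuous_map_compose[OF this continuous_map_chart_inv[OF c]]
  show "continuous_map (top_of_set S) (mtop X A) g"
    by (rule continuous_map_eq) (use g c in auto)
qed

lemma continuous_map_domain_open:
  assumes g: "continuous_map (top_of_set S) (mtop X A) g" and W: "openin (mtop X A) W"
    and t: "t \<in> S" "g t \<in> W"
  shows "\<exists>d>0. \<forall>s\<in>S. dist s t < d \<longrightarrow> g s \<in> W"
proof -
  have "openin (top_of_set S) {s \<in> S. g s \<in> W}" using g W by (auto simp: continuous_map_def)
  then obtain O' where "open O'" "{s \<in> S. g s \<in> W} = S \<inter> O'" unfolding openin_open by blast
  then show ?thesis using t unfolding open_dist by blast
qed

subsection \<open>Tangent vectors\<close>

lemma transition_chain:
  assumes c: "c \<in> A" "p \<in> fst c" and d: "d \<in> A" "p \<in> fst d" and e: "e \<in> A" "p \<in> fst e"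
  shows "frechet_derivative (snd e \<circ> chart_inv c) (at (snd c p)) w =
     frechet_derivative (snd e \<circ> chart_inv d) (at (snd d p)) (frechet_derivative (snd d \<circ> chart_inv c) (at (snd c p)) w)"
proof -
  let ?F = "snd d \<circ> chart_inv c"
  have 1: "(?F has_derivative frechet_derivative ?F (at (snd c p))) (at (snd c p))"
    by (rule transition_has_derivative[OF c(1) d(1) c(2) d(2)])
  have 2: "((snd e \<circ> chart_inv d) has_derivative frechet_derivative (snd e \<circ> chart_inv d) (at (snd d p))) (at (?F (snd c p)))"
    using transition_has_derivative[OF d(1) e(1) d(2) e(2)] c by simp
  have "((snd e \<circ> chart_inv c) has_derivative
      (\<lambda>w. frechet_derivative (snd e \<circ> chart_inv d) (at (snd d p)) (frechet_derivative ?F (at (snd c p)) w))) (at (snd c p))"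
  proof (rule has_derivative_transform_within_open[OF has_derivative_compose[OF 1 2]])
    show "open (snd c ` (fst c \<inter> fst d))" using open_overlap c d by blast
    show "snd c p \<in> snd c ` (fst c \<inter> fst d)" using c d by blast
    show "(snd e \<circ> chart_inv d) (?F y) = (snd e \<circ> chart_inv c) y" if "y \<in> snd c ` (fst c \<inter> fst d)" for y
      using that c d by auto
  qed
  then show ?thesis using frechet_derivative_at by metis
qed

lemma transition_self:
  assumes c: "c \<in> A" "p \<in> fst c"
  shows "frechet_derivative (snd c \<circ> chart_inv c) (at (snd c p)) w = w"
proof -
  have "((snd c \<circ> chart_inv c) has_derivative (\<lambda>w. w)) (at (snd c p))"
    by (rule has_derivative_transform_within_open[OF has_derivative_ident open_image[OF c(1)]])
       (use c chart_chart_inv[OF c(1)] in auto)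
  then show ?thesis using frechet_derivative_at by metis
qed

lemma coord_vec_tangent: "c \<in> A \<Longrightarrow> p \<in> fst c \<Longrightarrow> coord_vec A c p w \<in> tangent_space A p"
  unfolding tangent_space_def mem_Collect_eq
proof (intro conjI ballI allI impI)
  fix d e assume "c \<in> A" "p \<in> fst c" "d \<in> A" "e \<in> A" "p \<in> fst d \<and> p \<in> fst e"
  then show "coord_vec A c p w e =
      frechet_derivative (snd e \<circ> chart_inv d) (at (snd d p)) (coord_vec A c p w d)"
    using transition_chain[of c p d e w] by (simp add: coord_vec_def)
qed (auto simp: coord_vec_def)

lemma coord_vec_self: "c \<in> A \<Longrightarrow> p \<in> fst c \<Longrightarrow> coord_vec A c p w c = w"
  unfolding coord_vec_def by (simp add: transition_self)

lemma coord_vec_other: "d \<in> A \<Longrightarrow> p \<in> fst d \<Longrightarrow>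
    coord_vec A c p w d = frechet_derivative (snd d \<circ> chart_inv c) (at (snd c p)) w"
  unfolding coord_vec_def by simp

lemma tangent_other:
  assumes "v \<in> tangent_space A p" "c \<in> A" "p \<in> fst c" "d \<in> A" "p \<in> fst d"
  shows "v d = frechet_derivative (snd d \<circ> chart_inv c) (at (snd c p)) (v c)"
  using assms(1)[unfolded tangent_space_def mem_Collect_eq, THEN conjunct1, rule_format, OF assms(2,4)]
    assms(3,5) by blast

lemma tangent_zero:
  assumes "v \<in> tangent_space A p" "\<not> (d \<in> A \<and> p \<in> fst d)"
  shows "v d = 0"
  using assms(1)[unfolded tangent_space_def mem_Collect_eq, THEN conjunct2] assms(2) by blast

lemma tangent_eq_coord_vec:
  assumes "v \<in> tangent_space A p" "c \<in> A" "p \<in> fst c"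
  shows "v = coord_vec A c p (v c)"
proof
  fix d
  show "v d = coord_vec A c p (v c) d"
  proof (cases "d \<in> A \<and> p \<in> fst d")
    case True
    then show ?thesis using tangent_other[OF assms, of d] by (simp only: coord_vec_def if_True simp_thms)
  next
    case False
    then show ?thesis using tangent_zero[OF assms(1) False] by (simp only: coord_vec_def if_False simp_thms)
  qed
qed

lemma tangent_eqI:
  assumes "v \<in> tangent_space A p" "w \<in> tangent_space A p" "c \<in> A" "p \<in> fst c" "v c = w c"
  shows "v = w"
  by (subst tangent_eq_coord_vec[OF assms(1,3,4)], subst tangent_eq_coord_vec[OF assms(2,3,4)]) (simp add: assms(5))

lemma linear_transition: "\<lbrakk>c \<in> A; d \<in> A; x \<in> fst c; x \<in> fst d\<rbrakk> \<Longrightarrow>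
    linear (frechet_derivative (snd d \<circ> chart_inv c) (at (snd c x)))"
  using has_derivative_linear[OF transition_has_derivative] .

lemma coord_vec_linear:
  assumes "c \<in> A" "p \<in> fst c"
  shows "coord_vec A c p (r *\<^sub>R v + s *\<^sub>R w) = (\<lambda>d. r *\<^sub>R coord_vec A c p v d + s *\<^sub>R coord_vec A c p w d)"
proof
  fix d
  show "coord_vec A c p (r *\<^sub>R v + s *\<^sub>R w) d = r *\<^sub>R coord_vec A c p v d + s *\<^sub>R coord_vec A c p w d"
  proof (cases "d \<in> A \<and> p \<in> fst d")
    case True
    then have "linear (frechet_derivative (snd d \<circ> chart_inv c) (at (snd c p)))"
      using linear_transition assms by blast
    then show ?thesis using True by (simp add: coord_vec_def linear_add linear_scale)
  qed (auto simp: coord_vec_def)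
qed

lemma tangent_combination:
  assumes "u \<in> tangent_space A p" "v \<in> tangent_space A p"
  shows "(\<lambda>c. r *\<^sub>R u c + s *\<^sub>R v c) \<in> tangent_space A p"
proof (cases "\<exists>c\<in>A. p \<in> fst c")
  case True
  then obtain c where c: "c \<in> A" "p \<in> fst c" by blast
  have "coord_vec A c p (r *\<^sub>R u c + s *\<^sub>R v c) = (\<lambda>d. r *\<^sub>R u d + s *\<^sub>R v d)"
    unfolding coord_vec_linear[OF c] tangent_eq_coord_vec[OF assms(1) c, symmetric]
      tangent_eq_coord_vec[OF assms(2) c, symmetric] by (rule refl)
  then show ?thesis using coord_vec_tangent[OF c] by metis
next
  case False
  then have "d \<notin> A \<or> p \<notin> fst d" for d by blast
  then show ?thesis using tangent_zero[OF assms(1)] tangent_zero[OF assms(2)]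
    unfolding tangent_space_def by auto
qed

text \<open>A velocity in one chart determines the velocities in the others by the chain rule, provided that
  the curve stays in the chart for a while.\<close>

lemma has_velocity_chartI:
  assumes c: "c \<in> A" "\<gamma> t \<in> fst c" and v: "v \<in> tangent_space A (\<gamma> t)"
    and d: "((snd c \<circ> \<gamma>) has_vector_derivative v c) (at t within S)"
    and near: "\<exists>e>0. \<forall>s\<in>S. dist s t < e \<longrightarrow> \<gamma> s \<in> fst c" and t: "t \<in> S"
  shows "has_velocity A \<gamma> S t v"
  unfolding has_velocity_def
proof (intro conjI ballI impI v)
  fix e assume e: "e \<in> A" "\<gamma> t \<in> fst e"
  obtain \<epsilon> where \<epsilon>: "\<epsilon> > 0" "\<And>s. s \<in> S \<Longrightarrow> dist s t < \<epsilon> \<Longrightarrow> \<gamma> s \<in> fst c" using near by blast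
  have "((snd e \<circ> chart_inv c) \<circ> (snd c \<circ> \<gamma>) has_vector_derivative
      frechet_derivative (snd e \<circ> chart_inv c) (at (snd c (\<gamma> t))) (v c)) (at t within S)"
    by (rule vector_derivative_diff_chain_within[OF d])
       (use transition_has_derivative[OF c(1) e(1) c(2) e(2)] in \<open>auto simp: o_def intro: has_derivative_at_withinI\<close>)
  then have "((snd e \<circ> \<gamma>) has_vector_derivative
      frechet_derivative (snd e \<circ> chart_inv c) (at (snd c (\<gamma> t))) (v c)) (at t within S)"
    by (rule has_vector_derivative_transform_within[OF _ \<epsilon>(1) t]) (use \<epsilon>(2) c in auto)
  then show "((snd e \<circ> \<gamma>) has_vector_derivative v e) (at t within S)"
    using tangent_other[OF v c e] by simp
qed

end

lemma C1_atlas_of_smooth_atlas: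
  assumes "smooth_atlas X A" shows "C1_atlas X A"
proof
  note a = assms[unfolded smooth_atlas_def]
  show "(\<Union>c\<in>A. fst c) = X" using a by (rule conjunct1)
  fix c assume c: "c \<in> A"
  show "inj_on (snd c) (fst c)" "open (snd c ` fst c)"
    using a[THEN conjunct2, THEN conjunct1, rule_format, OF c] by simp_all
  fix d assume d: "d \<in> A"
  have o: "open (snd c ` (fst c \<inter> fst d))" "smooth_on (snd c ` (fst c \<inter> fst d)) (snd d \<circ> chart_inv c)"
    using a[THEN conjunct2, THEN conjunct2, rule_format, OF c d] by simp_all
  show "open (snd c ` (fst c \<inter> fst d))" by (rule o(1))
  have C: "Ck_on (Suc 0) (snd c ` (fst c \<inter> fst d)) (snd d \<circ> chart_inv c)"
    using o(2) unfolding smooth_on_def by (rule spec)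
  then show "continuous_on (snd c ` (fst c \<inter> fst d)) (\<lambda>y. frechet_derivative (snd d \<circ> chart_inv c) (at y) v)" for v
    by simp
  show "(snd d \<circ> chart_inv c) differentiable (at (snd c x))" if x: "x \<in> fst c" "x \<in> fst d" for x
  proof -
    have "snd c x \<in> snd c ` (fst c \<inter> fst d)" using x by blast
    then show ?thesis using C unfolding Ck_on.simps(2) by blast
  qed
qed

section \<open>Riemannian distances in charts\<close>

locale riemannian_atlas = C1_atlas X A for X :: "'a set" and A :: "('a, 'e::euclidean_space) chart set" +
  fixes g :: "'a \<Rightarrow> ('a, 'e) tvec \<Rightarrow> ('a, 'e) tvec \<Rightarrow> real"
  assumes metric: "riemannian_metric X A g"
begin

definition chart_metric :: "('a, 'e) chart \<Rightarrow> 'e \<Rightarrow> 'e \<Rightarrow> real" where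
  "chart_metric c y w = g (chart_inv c y) (coord_vec A c (chart_inv c y) w) (coord_vec A c (chart_inv c y) w)"

lemma metric_sym: "\<lbrakk>p \<in> X; u \<in> tangent_space A p; v \<in> tangent_space A p\<rbrakk> \<Longrightarrow> g p u v = g p v u"
  and metric_pos: "\<lbrakk>p \<in> X; u \<in> tangent_space A p; u \<noteq> (\<lambda>c. 0)\<rbrakk> \<Longrightarrow> 0 < g p u u"
  and metric_linear: "\<lbrakk>p \<in> X; u \<in> tangent_space A p; v \<in> tangent_space A p; w \<in> tangent_space A p\<rbrakk> \<Longrightarrow>
     g p (\<lambda>c. r *\<^sub>R u c + s *\<^sub>R v c) w = r * g p u w + s * g p v w"
  using metric unfolding riemannian_metric_def by blast+

lemma metric_nonneg:
  assumes "p \<in> X" "u \<in> tangent_space A p"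
  shows "0 \<le> g p u u"
proof (cases "u = (\<lambda>c. 0)")
  case True
  have "g p (\<lambda>c. 0 *\<^sub>R u c + 0 *\<^sub>R u c) u = 0 * g p u u + 0 * g p u u"
    by (rule metric_linear[OF assms(1,2,2,2)])
  then show ?thesis using True by simp
qed (use metric_pos[OF assms] in simp)

lemma chart_metric_velocity:
  assumes "c \<in> A" "p \<in> fst c" "v \<in> tangent_space A p"
  shows "g p v v = chart_metric c (snd c p) (v c)"
  unfolding chart_metric_def chart_inv_eq[OF assms(1,2)] tangent_eq_coord_vec[OF assms(3,1,2), symmetric] ..

lemma chart_metric_pos: "\<lbrakk>c \<in> A; y \<in> snd c ` fst c; w \<noteq> 0\<rbrakk> \<Longrightarrow> 0 < chart_metric c y w"
  unfolding chart_metric_def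
proof (rule metric_pos)
  assume c: "c \<in> A" and y: "y \<in> snd c ` fst c" and w: "w \<noteq> 0"
  have p: "chart_inv c y \<in> fst c" by (rule chart_inv_in[OF c y])
  show "chart_inv c y \<in> X" by (rule chart_in_X[OF c p])
  show "coord_vec A c (chart_inv c y) w \<in> tangent_space A (chart_inv c y)" by (rule coord_vec_tangent[OF c p])
  show "coord_vec A c (chart_inv c y) w \<noteq> (\<lambda>c. 0)"
    using coord_vec_self[OF c p, of w] w by (metis (full_types))
qed

lemma chart_metric_expand:
  assumes c: "c \<in> A" and y: "y \<in> snd c ` fst c"
  shows "chart_metric c y w = (\<Sum>i\<in>Basis. \<Sum>j\<in>Basis. (w \<bullet> i) * (w \<bullet> j) *
     g (chart_inv c y) (coord_vec A c (chart_inv c y) i) (coord_vec A c (chart_inv c y) j))"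
proof -
  define p where "p = chart_inv c y"
  have p: "p \<in> fst c" "p \<in> X" using chart_inv_in[OF c y] chart_in_X[OF c] by (auto simp: p_def)
  define B where "B u v = g p (coord_vec A c p u) (coord_vec A c p v)" for u v
  note tan = coord_vec_tangent[OF c p(1)]
  have lin: "B (r *\<^sub>R u + s *\<^sub>R v) w = r * B u w + s * B v w" for r s u v w
    unfolding B_def coord_vec_linear[OF c p(1)] by (rule metric_linear[OF p(2) tan tan tan])
  have sym: "B u v = B v u" for u v unfolding B_def by (rule metric_sym[OF p(2) tan tan])
  have l: "linear (\<lambda>u. B u w)" for w
    using lin[of 1 _ 1] lin[of _ _ 0 0] by (intro linearI) auto
  have "B w v = (\<Sum>i\<in>Basis. (w \<bullet> i) * B i v)" for v w
  proof -
    have "B w v = B (\<Sum>i\<in>Basis. (w \<bullet> i) *\<^sub>R i) v" by (simp add: euclidean_representation)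
    then show ?thesis by (simp add: linear_sum[OF l] linear_scale[OF l])
  qed
  note ex = this
  have "B w w = (\<Sum>i\<in>Basis. (w \<bullet> i) * B w i)" using ex[of w w] sym by simp
  also have "\<dots> = (\<Sum>i\<in>Basis. \<Sum>j\<in>Basis. (w \<bullet> i) * (w \<bullet> j) * B i j)"
    unfolding ex[of w] sum_distrib_left by (intro sum.cong refl) (simp add: sym mult_ac)
  finally show ?thesis by (simp add: chart_metric_def B_def p_def)
qed

lemma chart_metric_continuous:
  assumes c: "c \<in> A"
  shows "continuous_on ((snd c ` fst c) \<times> UNIV) (\<lambda>z. chart_metric c (fst z) (snd z))"
proof -
  have k: "continuous_on (snd c ` fst c)
      (\<lambda>q. g (chart_inv c q) (coord_vec A c (chart_inv c q) i) (coord_vec A c (chart_inv c q) j))" for i j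
  proof -
    have "smooth_on (snd c ` fst c)
      (\<lambda>q. g (chart_inv c q) (coord_vec A c (chart_inv c q) i) (coord_vec A c (chart_inv c q) j))"
      using metric[unfolded riemannian_metric_def, THEN conjunct2] c by blast
    then have "Ck_on 0 (snd c ` fst c)
      (\<lambda>q. g (chart_inv c q) (coord_vec A c (chart_inv c q) i) (coord_vec A c (chart_inv c q) j))"
      unfolding smooth_on_def by (rule spec)
    then show ?thesis unfolding Ck_on.simps(1) .
  qed
  have "continuous_on ((snd c ` fst c) \<times> UNIV) (\<lambda>z. \<Sum>i\<in>Basis. \<Sum>j\<in>Basis. (snd z \<bullet> i) * (snd z \<bullet> j) *
     g (chart_inv c (fst z)) (coord_vec A c (chart_inv c (fst z)) i) (coord_vec A c (chart_inv c (fst z)) j))"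
    by (intro continuous_intros continuous_on_compose2[OF k]) auto
  then show ?thesis
    by (rule continuous_on_eq) (auto simp: chart_metric_expand[OF c])
qed

lemma chart_metric_scale:
  assumes c: "c \<in> A" and y: "y \<in> snd c ` fst c"
  shows "chart_metric c y (r *\<^sub>R w) = r\<^sup>2 * chart_metric c y w"
  unfolding chart_metric_expand[OF assms] sum_distrib_left
  by (intro sum.cong refl) (simp add: power2_eq_square mult_ac)

text \<open>Minimise and maximise the metric on the product of the compact set with the unit sphere.\<close>

lemma chart_metric_bounds:
  assumes c: "c \<in> A" and K: "compact K" "K \<subseteq> snd c ` fst c"
  obtains m M where "m > 0" "M > 0"
    "\<And>y w. y \<in> K \<Longrightarrow> m * norm w \<le> sqrt (chart_metric c y w)"
    "\<And>y w. y \<in> K \<Longrightarrow> sqrt (chart_metric c y w) \<le> M * norm w"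
proof (cases "K = {}")
  case True
  show ?thesis by (rule that[of 1 1]) (use True in auto)
next
  case False
  define S where "S = K \<times> sphere (0::'e) 1"
  have S: "compact S" "S \<noteq> {}" unfolding S_def using K False
    by (auto intro!: compact_Times simp: sphere_eq_empty)
  have cont: "continuous_on S (\<lambda>z. sqrt (chart_metric c (fst z) (snd z)))"
    by (intro continuous_intros continuous_on_subset[OF chart_metric_continuous[OF c]]) (use K in \<open>auto simp: S_def\<close>)
  obtain z1 where z1: "z1 \<in> S" "\<And>z. z \<in> S \<Longrightarrow> sqrt (chart_metric c (fst z1) (snd z1)) \<le> sqrt (chart_metric c (fst z) (snd z))"
    using continuous_attains_inf[OF S cont] by blast
  obtain z2 where z2: "z2 \<in> S" "\<And>z. z \<in> S \<Longrightarrow> sqrt (chart_metric c (fst z) (snd z)) \<le> sqrt (chart_metric c (fst z2) (snd z2))"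
    using continuous_attains_sup[OF S cont] by blast
  have pos: "0 < sqrt (chart_metric c (fst z) (snd z))" if "z \<in> S" for z
    using chart_metric_pos[OF c, of "fst z" "snd z"] that K by (force simp: S_def)
  have scale: "sqrt (chart_metric c y w) = norm w * sqrt (chart_metric c y (w /\<^sub>R norm w))" if "y \<in> K" "w \<noteq> 0" for y w
  proof -
    have "chart_metric c y (norm w *\<^sub>R (w /\<^sub>R norm w)) = (norm w)\<^sup>2 * chart_metric c y (w /\<^sub>R norm w)"
      by (rule chart_metric_scale[OF c]) (use that K in auto)
    then show ?thesis using that by (simp add: real_sqrt_mult)
  qed
  have zero: "chart_metric c y 0 = 0" if "y \<in> K" for y
    using chart_metric_scale[OF c, of y 0 0] that K by auto
  have inS: "(y, w /\<^sub>R norm w) \<in> S" if "y \<in> K" "w \<noteq> 0" for y and w :: 'e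
    using that by (simp add: S_def)
  show ?thesis
  proof (rule that[OF pos[OF z1(1)] pos[OF z2(1)]])
    fix y and w :: 'e assume y: "y \<in> K"
    show "sqrt (chart_metric c (fst z1) (snd z1)) * norm w \<le> sqrt (chart_metric c y w)"
    proof (cases "w = 0")
      case False
      show ?thesis unfolding scale[OF y False]
        using z1(2)[OF inS[OF y False]] by (simp add: mult.commute mult_left_mono)
    qed (simp add: zero[OF y])
    show "sqrt (chart_metric c y w) \<le> sqrt (chart_metric c (fst z2) (snd z2)) * norm w"
    proof (cases "w = 0")
      case False
      show ?thesis unfolding scale[OF y False]
        using z2(2)[OF inS[OF y False]] by (simp add: mult.commute mult_left_mono)
    qed (simp add: zero[OF y])
  qed
qed

lemma C1_curveD:
  assumes "C1_curve X A a b \<gamma> v"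
  shows "continuous_map (top_of_set {a..b}) (mtop X A) \<gamma>"
    "t \<in> {a..b} \<Longrightarrow> has_velocity A \<gamma> {a..b} t (v t)"
    "c \<in> A \<Longrightarrow> continuous_on {t \<in> {a..b}. \<gamma> t \<in> fst c} (\<lambda>t. v t c)"
  using assms unfolding C1_curve_def by blast+

lemma C1_curve_in_X:
  assumes "C1_curve X A a b \<gamma> v" "t \<in> {a..b}"
  shows "\<gamma> t \<in> X" "v t \<in> tangent_space A (\<gamma> t)"
proof -
  from continuous_map_image_subset_topspace[OF C1_curveD(1)[OF assms(1)]] show "\<gamma> t \<in> X" using assms(2) by auto
  show "v t \<in> tangent_space A (\<gamma> t)" using C1_curveD(2)[OF assms] unfolding has_velocity_def by blast
qed

lemma speed_continuous:
  assumes C: "C1_curve X A a b \<gamma> v"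
  shows "continuous_on {a..b} (\<lambda>t. sqrt (g (\<gamma> t) (v t) (v t)))"
  unfolding continuous_on_eq_continuous_within
proof
  fix t assume t: "t \<in> {a..b}"
  have cm: "continuous_map (top_of_set {a..b}) (mtop X A) \<gamma>" by (rule C1_curveD(1)[OF C])
  obtain c where c: "c \<in> A" "\<gamma> t \<in> fst c" using exists_chart C1_curve_in_X[OF C t] by blast
  obtain d where d: "d > 0" "\<And>s. s \<in> {a..b} \<Longrightarrow> dist s t < d \<Longrightarrow> \<gamma> s \<in> fst c"
    using continuous_map_domain_open[OF cm openin_chart[OF c(1)] t c(2)] by blast
  define S where "S = {a..b} \<inter> ball t d"
  have S: "\<gamma> ` S \<subseteq> fst c" using d(2) by (auto simp: S_def dist_commute)
  have "continuous_on S (snd c \<circ> \<gamma>)"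
    using continuous_map_chart_iff[OF c(1) S] continuous_map_from_subtopology_mono[OF cm, of S] by (auto simp: S_def)
  moreover have "continuous_on S (\<lambda>t. v t c)"
  proof (rule continuous_on_subset)
    show "continuous_on {t \<in> {a..b}. \<gamma> t \<in> fst c} (\<lambda>t. v t c)" by (rule C1_curveD(3)[OF C c(1)])
    show "S \<subseteq> {t \<in> {a..b}. \<gamma> t \<in> fst c}" using S by (auto simp: S_def)
  qed
  ultimately have "continuous_on S (\<lambda>t. ((snd c \<circ> \<gamma>) t, v t c))" by (rule continuous_on_Pair)
  then have "continuous_on S (\<lambda>t. chart_metric c (fst ((snd c \<circ> \<gamma>) t, v t c)) (snd ((snd c \<circ> \<gamma>) t, v t c)))"
    by (rule continuous_on_compose2[OF chart_metric_continuous[OF c(1)]]) (use S in auto)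
  then have "continuous_on S (\<lambda>t. sqrt (chart_metric c (snd c (\<gamma> t)) (v t c)))"
    by (intro continuous_intros) simp
  then have "continuous_on S (\<lambda>t. sqrt (g (\<gamma> t) (v t) (v t)))"
  proof (rule continuous_on_eq)
    fix s assume s: "s \<in> S"
    then have "\<gamma> s \<in> fst c" "s \<in> {a..b}" using S by (auto simp: S_def)
    then show "sqrt (chart_metric c (snd c (\<gamma> s)) (v s c)) = sqrt (g (\<gamma> s) (v s) (v s))"
      using chart_metric_velocity[OF c(1) _ C1_curve_in_X(2)[OF C]] by simp
  qed
  then have "continuous (at t within S) (\<lambda>t. sqrt (g (\<gamma> t) (v t) (v t)))"
    using t d(1) by (simp add: continuous_on_eq_continuous_within S_def)
  moreover have "at t within S = at t within {a..b}"
    by (rule at_within_nhd[of t "ball t d"]) (use d(1) in \<open>auto simp: S_def\<close>)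
  ultimately show "continuous (at t within {a..b}) (\<lambda>t. sqrt (g (\<gamma> t) (v t) (v t)))" by simp
qed

lemma pw_C1_path_nonneg: "pw_C1_path X A g p q l \<Longrightarrow> 0 \<le> l"
proof (induction rule: pw_C1_path.induct)
  case (piece a b \<gamma> v)
  show ?case
    by (rule Henstock_Kurzweil_Integration.integral_nonneg[OF integrable_continuous_real[OF speed_continuous[OF piece(2)]]])
       (use C1_curve_in_X[OF piece(2)] in \<open>simp add: metric_nonneg\<close>)
qed simp

lemma riem_dist_le: "pw_C1_path X A g p q l \<Longrightarrow> riem_dist X A g p q \<le> l"
  unfolding riem_dist_def by (rule cInf_lower) (auto intro: bdd_belowI[of _ 0] pw_C1_path_nonneg)

lemma riem_dist_less:
  assumes "pw_C1_path X A g p q l'" "riem_dist X A g p q < r"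
  obtains l where "pw_C1_path X A g p q l" "l < r"
  using assms cInf_lessD[of "{l. pw_C1_path X A g p q l}" r] unfolding riem_dist_def by blast

lemma riem_dist_nonneg: "pw_C1_path X A g p q l \<Longrightarrow> 0 \<le> riem_dist X A g p q"
  unfolding riem_dist_def by (rule cInf_greatest) (auto intro: pw_C1_path_nonneg)

lemma segment_path:
  assumes c: "c \<in> A" and p: "p \<in> fst c" "q \<in> fst c"
    and seg: "closed_segment (snd c p) (snd c q) \<subseteq> snd c ` fst c"
    and M: "\<And>y w. y \<in> closed_segment (snd c p) (snd c q) \<Longrightarrow> sqrt (chart_metric c y w) \<le> M * norm w"
  obtains l where "pw_C1_path X A g p q l" "l \<le> M * norm (snd c q - snd c p)"
proof -
  define w where "w = snd c q - snd c p"
  define y where "y t = snd c p + t *\<^sub>R w" for t :: real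
  define \<gamma> where "\<gamma> t = chart_inv c (y t)" for t
  define v where "v t = coord_vec A c (\<gamma> t) w" for t
  have y: "y t \<in> closed_segment (snd c p) (snd c q)" if "t \<in> {0..1}" for t
    using that unfolding closed_segment_def y_def w_def by (intro CollectI exI[of _ t]) (auto simp: algebra_simps)
  have yi: "y t \<in> snd c ` fst c" if "t \<in> {0..1}" for t using y[OF that] seg by blast
  have \<gamma>c: "\<gamma> t \<in> fst c" "snd c (\<gamma> t) = y t" if "t \<in> {0..1}" for t
    unfolding \<gamma>_def using chart_inv_in[OF c yi[OF that]] chart_chart_inv[OF c yi[OF that]] by auto
  have yc: "continuous_on {0..1} y" unfolding y_def by (intro continuous_intros)
  have C: "C1_curve X A 0 1 \<gamma> v"
    unfolding C1_curve_def
  proof (intro conjI ballI)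
    show "continuous_map (top_of_set {0..1}) (mtop X A) \<gamma>"
    proof (subst continuous_map_chart_iff[OF c])
      show "continuous_on {0..1} (snd c \<circ> \<gamma>)" by (rule continuous_on_eq[OF yc]) (simp add: \<gamma>c)
    qed (use \<gamma>c in auto)
    fix t :: real assume t: "t \<in> {0..1}"
    show "has_velocity A \<gamma> {0..1} t (v t)"
    proof (rule has_velocity_chartI[where \<gamma> = \<gamma> and t = t, OF c \<gamma>c(1)[OF t]])
      show "v t \<in> tangent_space A (\<gamma> t)" unfolding v_def by (rule coord_vec_tangent[OF c \<gamma>c(1)[OF t]])
      have "(y has_vector_derivative w) (at t within {0..1})"
        unfolding y_def by (auto intro!: derivative_eq_intros)
      then have "((snd c \<circ> \<gamma>) has_vector_derivative w) (at t within {0..1})"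
        by (rule has_vector_derivative_transform[OF t, rotated]) (use \<gamma>c in simp)
      then show "((snd c \<circ> \<gamma>) has_vector_derivative v t c) (at t within {0..1})"
        unfolding v_def coord_vec_self[OF c \<gamma>c(1)[OF t]] .
      show "\<exists>e>0. \<forall>s\<in>{0..1}. dist s t < e \<longrightarrow> \<gamma> s \<in> fst c" using \<gamma>c(1) by (intro exI[of _ 1]) auto
    qed (rule t)
  next
    fix d assume d: "d \<in> A"
    have "continuous_on {t \<in> {0..1}. \<gamma> t \<in> fst d} (\<lambda>t. frechet_derivative (snd d \<circ> chart_inv c) (at (y t)) w)"
    proof (rule continuous_on_compose2[OF transition_continuous[OF c d] continuous_on_subset[OF yc]])
      show "y ` {t \<in> {0..1}. \<gamma> t \<in> fst d} \<subseteq> snd c ` (fst c \<inter> fst d)"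
        using \<gamma>c by (force simp: image_iff)
    qed auto
    then show "continuous_on {t \<in> {0..1}. \<gamma> t \<in> fst d} (\<lambda>t. v t d)"
      by (rule continuous_on_eq) (use d \<gamma>c in \<open>auto simp: v_def coord_vec_def\<close>)
  qed
  have io: "(\<lambda>t. sqrt (g (\<gamma> t) (v t) (v t))) integrable_on {0..1}"
    by (rule integrable_continuous_real[OF speed_continuous[OF C]])
  have "integral {0..1} (\<lambda>t. sqrt (g (\<gamma> t) (v t) (v t))) \<le> integral {0..1} (\<lambda>t::real. M * norm w)"
  proof (rule integral_le[OF io])
    fix t :: real assume t: "t \<in> {0..1}"
    have "g (\<gamma> t) (v t) (v t) = chart_metric c (y t) (v t c)"
      using chart_metric_velocity[OF c \<gamma>c(1)[OF t] C1_curve_in_X(2)[OF C t]] \<gamma>c(2)[OF t] by simp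
    also have "v t c = w" unfolding v_def by (rule coord_vec_self[OF c \<gamma>c(1)[OF t]])
    finally show "sqrt (g (\<gamma> t) (v t) (v t)) \<le> M * norm w" using M[OF y[OF t]] by simp
  qed auto
  then have le: "integral {0..1} (\<lambda>t. sqrt (g (\<gamma> t) (v t) (v t))) \<le> M * norm (snd c q - snd c p)" by (simp add: w_def)
  have "pw_C1_path X A g (\<gamma> 0) (\<gamma> 1) (integral {0..1} (\<lambda>t. sqrt (g (\<gamma> t) (v t) (v t))))"
    by (rule pw_C1_path.piece[OF _ C]) simp
  moreover have "\<gamma> 0 = p" "\<gamma> 1 = q" using c p by (auto simp: \<gamma>_def y_def w_def)
  ultimately show ?thesis using that le by simp
qed

lemma riem_dist_upper:
  assumes c: "c \<in> A" and p: "p \<in> fst c"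
  obtains r M where "r > 0" "M > 0" "ball (snd c p) r \<subseteq> snd c ` fst c"
    "\<And>x x'. \<lbrakk>x \<in> fst c; x' \<in> fst c; norm (snd c x - snd c p) < r; norm (snd c x' - snd c p) < r\<rbrakk> \<Longrightarrow>
       riem_dist X A g x x' \<le> M * norm (snd c x' - snd c x) \<and> (\<exists>l. pw_C1_path X A g x x' l)"
proof -
  obtain r where r: "r > 0" "cball (snd c p) r \<subseteq> snd c ` fst c"
    using open_contains_cball[of "snd c ` fst c"] open_image[OF c] p by blast
  obtain m M where M: "M > 0" "\<And>y w. y \<in> cball (snd c p) r \<Longrightarrow> sqrt (chart_metric c y w) \<le> M * norm w"
    using chart_metric_bounds[OF c compact_cball r(2)] by metis
  show ?thesis
  proof (rule that[OF r(1) M(1)])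
    show "ball (snd c p) r \<subseteq> snd c ` fst c" using r(2) ball_subset_cball by blast
    fix x x' assume x: "x \<in> fst c" "x' \<in> fst c" "norm (snd c x - snd c p) < r" "norm (snd c x' - snd c p) < r"
    have s: "closed_segment (snd c x) (snd c x') \<subseteq> cball (snd c p) r"
      by (rule closed_segment_subset) (use x in \<open>auto simp: dist_norm norm_minus_commute\<close>)
    obtain l where "pw_C1_path X A g x x' l" "l \<le> M * norm (snd c x' - snd c x)"
      using segment_path[OF c x(1,2) order_trans[OF s r(2)] M(2)] s by blast
    then show "riem_dist X A g x x' \<le> M * norm (snd c x' - snd c x) \<and> (\<exists>l. pw_C1_path X A g x x' l)"
      using riem_dist_le order_trans by blast
  qed
qed

text \<open>The coordinate ball is compact and, the topology being Hausdorff, closed in the manifold. Hence at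
  the first time at which the curve could leave it the length estimate is still valid, and shows that the
  curve is in the interior.\<close>

lemma C1_curve_stays:
  assumes H: "Hausdorff_space (mtop X A)" and c: "c \<in> A"
    and R: "cball y0 R \<subseteq> snd c ` fst c" and m: "m > 0"
    and low: "\<And>y w. y \<in> cball y0 R \<Longrightarrow> m * norm w \<le> sqrt (chart_metric c y w)"
    and C: "C1_curve X A a b \<gamma> v" and ab: "a \<le> b"
    and start: "\<gamma> a \<in> fst c" "norm (snd c (\<gamma> a) - y0) + integral {a..b} (\<lambda>t. sqrt (g (\<gamma> t) (v t) (v t))) / m < R"
  shows "\<gamma> b \<in> fst c \<and> m * norm (snd c (\<gamma> b) - snd c (\<gamma> a)) \<le> integral {a..b} (\<lambda>t. sqrt (g (\<gamma> t) (v t) (v t)))"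
proof -
  define l where "l = integral {a..b} (\<lambda>t. sqrt (g (\<gamma> t) (v t) (v t)))"
  define K where "K = {x \<in> fst c. snd c x \<in> cball y0 R}"
  have cm: "continuous_map (top_of_set {a..b}) (mtop X A) \<gamma>" by (rule C1_curveD(1)[OF C])
  have Keq: "K = chart_inv c ` cball y0 R"
    unfolding K_def using R c chart_inv_in[OF c] chart_chart_inv[OF c]
    by (auto simp: image_iff subset_iff) (metis chart_inv_eq mem_cball)+
  have "compactin (mtop X A) K"
    unfolding Keq
  proof (rule image_compactin[OF _ continuous_map_chart_inv[OF c]])
    show "compactin (top_of_set (snd c ` fst c)) (cball y0 R)" using R by (simp add: compactin_subtopology)
  qed
  then have Kc: "closedin (mtop X A) K" by (rule compactin_imp_closedin[OF H])
  have io: "(\<lambda>t. sqrt (g (\<gamma> t) (v t) (v t))) integrable_on {u..w}" if "{u..w} \<subseteq> {a..b}" for u w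
    by (rule integrable_continuous_real[OF continuous_on_subset[OF speed_continuous[OF C] that]])
  have nn: "0 \<le> sqrt (g (\<gamma> t) (v t) (v t))" if "t \<in> {a..b}" for t
    using C1_curve_in_X[OF C that] by (simp add: metric_nonneg)
  have l0: "0 \<le> l" unfolding l_def by (rule Henstock_Kurzweil_Integration.integral_nonneg[OF io]) (use nn in auto)
  have est: "m * norm (snd c (\<gamma> \<tau>) - snd c (\<gamma> a)) \<le> l"
    if \<tau>: "a \<le> \<tau>" "\<tau> \<le> b" and inK: "\<And>t. t \<in> {a..\<tau>} \<Longrightarrow> \<gamma> t \<in> K" for \<tau>
  proof -
    have hv: "((snd c \<circ> \<gamma>) has_vector_derivative v t c) (at t within {a..\<tau>})" if t: "t \<in> {a..\<tau>}" for t
    proof -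
      have "has_velocity A \<gamma> {a..b} t (v t)" by (rule C1_curveD(2)[OF C]) (use t \<tau> in auto)
      moreover have "\<gamma> t \<in> fst c" using inK[OF t] by (simp add: K_def)
      ultimately have "((snd c \<circ> \<gamma>) has_vector_derivative v t c) (at t within {a..b})"
        using c unfolding has_velocity_def by blast
      then show ?thesis by (rule has_vector_derivative_within_subset) (use \<tau> in auto)
    qed
    have fc: "((\<lambda>t. v t c) has_integral ((snd c \<circ> \<gamma>) \<tau> - (snd c \<circ> \<gamma>) a)) {a..\<tau>}"
      by (rule fundamental_theorem_of_calculus[OF \<tau>(1) hv])
    have "norm (integral {a..\<tau>} (\<lambda>t. v t c)) \<le> integral {a..\<tau>} (\<lambda>t. sqrt (g (\<gamma> t) (v t) (v t)) / m)"
    proof (rule integral_norm_bound_integral[OF has_integral_integrable[OF fc]])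
      show "(\<lambda>t. sqrt (g (\<gamma> t) (v t) (v t)) / m) integrable_on {a..\<tau>}"
        using io[of a \<tau>] \<tau> integrable_on_cmult_right[of "\<lambda>t. sqrt (g (\<gamma> t) (v t) (v t))" "{a..\<tau>}" "1/m"] by simp
      fix t assume t: "t \<in> {a..\<tau>}"
      have k: "\<gamma> t \<in> fst c" "snd c (\<gamma> t) \<in> cball y0 R" using inK[OF t] by (auto simp: K_def)
      have "m * norm (v t c) \<le> sqrt (chart_metric c (snd c (\<gamma> t)) (v t c))" by (rule low[OF k(2)])
      also have "\<dots> = sqrt (g (\<gamma> t) (v t) (v t))"
        using chart_metric_velocity[OF c k(1) C1_curve_in_X(2)[OF C]] t \<tau> by simp
      finally show "norm (v t c) \<le> sqrt (g (\<gamma> t) (v t) (v t)) / m" using m by (simp add: field_simps)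
    qed
    also have "\<dots> = integral {a..\<tau>} (\<lambda>t. sqrt (g (\<gamma> t) (v t) (v t))) / m" by simp
    also have "\<dots> \<le> l / m"
      unfolding l_def using m by (intro divide_right_mono integral_subset_le io) (use nn \<tau> in auto)
    finally have "norm (snd c (\<gamma> \<tau>) - snd c (\<gamma> a)) \<le> l / m" using integral_unique[OF fc] by simp
    then show ?thesis using m by (simp add: field_simps)
  qed
  have all: "\<gamma> t \<in> K" if "t \<in> {a..b}" for t
  proof (rule ccontr)
    assume bad: "\<gamma> t \<notin> K"
    define B where "B = {t \<in> {a..b}. \<gamma> t \<notin> K}"
    define \<tau> where "\<tau> = Inf B"
    have B: "B \<noteq> {}" "bdd_below B" using that bad by (auto simp: B_def intro!: bdd_belowI[of _ a])
    have \<tau>: "a \<le> \<tau>" "\<tau> \<le> b"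
    proof -
      have tB: "t \<in> B" using that bad by (simp add: B_def)
      show "a \<le> \<tau>" unfolding \<tau>_def by (rule cInf_greatest[OF B(1)]) (simp add: B_def)
      show "\<tau> \<le> b" using cInf_lower[OF tB B(2)] that by (simp add: \<tau>_def)
    qed
    have before: "\<gamma> s \<in> K" if "s \<in> {a..b}" "s < \<tau>" for s
      using that cInf_lower[OF _ B(2), of s] unfolding \<tau>_def B_def by force
    have aK: "\<gamma> a \<in> K"
    proof -
      have "0 \<le> l / m" using l0 m by simp
      then have "norm (snd c (\<gamma> a) - y0) < R" using start(2) unfolding l_def[symmetric] by linarith
      then show ?thesis using start(1) by (simp add: K_def dist_norm norm_minus_commute)
    qed
    have tK: "\<gamma> \<tau> \<in> K"
    proof (rule ccontr)
      assume n: "\<gamma> \<tau> \<notin> K"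
      have o: "openin (mtop X A) (X - K)" using Kc by (simp add: closedin_def)
      have "\<gamma> \<tau> \<in> X - K" using n C1_curve_in_X(1)[OF C, of \<tau>] \<tau> by auto
      then obtain d where d: "d > 0" "\<And>s. s \<in> {a..b} \<Longrightarrow> dist s \<tau> < d \<Longrightarrow> \<gamma> s \<in> X - K"
        using continuous_map_domain_open[OF cm o, of \<tau>] \<tau> by auto
      have "\<tau> > a" using n aK \<tau> by (cases "\<tau> = a") auto
      define s where "s = max a (\<tau> - d / 2)"
      have "s \<in> {a..b}" "s < \<tau>" "dist s \<tau> < d" using \<open>\<tau> > a\<close> \<tau> d(1) by (auto simp: s_def dist_real_def)
      then show False using before d(2) by blast
    qed
    have upto: "\<gamma> s \<in> K" if "s \<in> {a..\<tau>}" for s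
      using that before[of s] tK \<tau> by (cases "s = \<tau>") auto
    have "m * norm (snd c (\<gamma> \<tau>) - snd c (\<gamma> a)) \<le> l" by (rule est[OF \<tau> upto])
    then have "norm (snd c (\<gamma> \<tau>) - snd c (\<gamma> a)) \<le> l / m" using m by (simp add: field_simps)
    then have "norm (snd c (\<gamma> \<tau>) - y0) < R"
      using start(2) norm_triangle_ineq[of "snd c (\<gamma> \<tau>) - snd c (\<gamma> a)" "snd c (\<gamma> a) - y0"]
      unfolding l_def[symmetric] by simp
    then have "\<gamma> \<tau> \<in> {x \<in> fst c. snd c x \<in> ball y0 R}" using tK by (simp add: K_def dist_norm norm_minus_commute)
    then have "\<exists>d>0. \<forall>s\<in>{a..b}. dist s \<tau> < d \<longrightarrow> \<gamma> s \<in> {x \<in> fst c. snd c x \<in> ball y0 R}"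
      by (rule continuous_map_domain_open[OF cm openin_chart_preimage[OF c open_ball], rotated]) (use \<tau> in auto)
    then obtain d where d: "d > 0" "\<And>s. s \<in> {a..b} \<Longrightarrow> dist s \<tau> < d \<Longrightarrow> \<gamma> s \<in> {x \<in> fst c. snd c x \<in> ball y0 R}"
      by blast
    have "\<tau> + d \<le> \<tau>"
    proof -
      have "\<tau> + d \<le> s" if s: "s \<in> B" for s
      proof (rule ccontr)
        assume "\<not> \<tau> + d \<le> s"
        moreover have "\<tau> \<le> s" unfolding \<tau>_def by (rule cInf_lower[OF s B(2)])
        ultimately have "dist s \<tau> < d" by (simp add: dist_real_def)
        then have "\<gamma> s \<in> K" using d(2)[of s] s by (auto simp: B_def K_def)
        then show False using s by (simp add: B_def)
      qed
      then show ?thesis using cInf_greatest[OF B(1), of "\<tau> + d"] unfolding \<tau>_def by blast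
    qed
    then show False using d(1) by simp
  qed
  have "m * norm (snd c (\<gamma> b) - snd c (\<gamma> a)) \<le> l" by (rule est[OF ab order_refl all])
  then show ?thesis using all[of b] ab by (simp add: K_def l_def)
qed

lemma pw_C1_path_stays:
  assumes H: "Hausdorff_space (mtop X A)" and c: "c \<in> A"
    and R: "cball y0 R \<subseteq> snd c ` fst c" and m: "m > 0"
    and low: "\<And>y w. y \<in> cball y0 R \<Longrightarrow> m * norm w \<le> sqrt (chart_metric c y w)"
    and path: "pw_C1_path X A g p q l"
    and start: "p \<in> fst c" "norm (snd c p - y0) + l / m < R"
  shows "q \<in> fst c \<and> m * norm (snd c q - snd c p) \<le> l"
  using path start
proof (induction rule: pw_C1_path.induct)
  case (piece a b \<gamma> v)
  show ?case by (rule C1_curve_stays[OF H c R m low piece(2,1,3,4)])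
next
  case (concat p q l r k)
  have nn: "0 \<le> l" "0 \<le> k" using concat(1,2) pw_C1_path_nonneg by auto
  have d: "(l + k) / m = l / m + k / m" by (simp add: add_divide_distrib)
  have "0 \<le> k / m" using nn m by simp
  then have 1: "q \<in> fst c" "m * norm (snd c q - snd c p) \<le> l"
    using concat(3)[OF concat(5)] concat(6) unfolding d by auto
  have "norm (snd c q - snd c p) \<le> l / m" using 1(2) m by (simp add: field_simps)
  then have "norm (snd c q - y0) + k / m < R"
    using concat(6) norm_triangle_ineq[of "snd c q - snd c p" "snd c p - y0"] unfolding d by simp
  then have 2: "r \<in> fst c" "m * norm (snd c r - snd c q) \<le> k" using concat(4)[OF 1(1)] by auto
  have "m * norm (snd c r - snd c p) \<le> m * (norm (snd c r - snd c q) + norm (snd c q - snd c p))"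
    using norm_triangle_ineq[of "snd c r - snd c q" "snd c q - snd c p"] m by (intro mult_left_mono) auto
  then show ?case using 1 2 by (simp add: distrib_left)
qed

text \<open>Any path shorter than the distance plus a bit stays in a coordinate ball, where its length
  dominates a multiple of its Euclidean length. Connectedness by paths excludes the infimum over an empty
  set.\<close>

lemma riem_dist_lower:
  assumes H: "Hausdorff_space (mtop X A)" and c: "c \<in> A" and p: "p \<in> fst c"
    and conn: "\<And>x x'. x \<in> X \<Longrightarrow> x' \<in> X \<Longrightarrow> \<exists>l. pw_C1_path X A g x x' l"
  obtains r m where "r > 0" "m > 0"
    "\<And>x x'. \<lbrakk>x \<in> fst c; x' \<in> X; norm (snd c x - snd c p) < r; riem_dist X A g x x' < m * r\<rbrakk> \<Longrightarrow>
       x' \<in> fst c \<and> m * norm (snd c x' - snd c x) \<le> riem_dist X A g x x'"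
proof -
  obtain R where R: "R > 0" "cball (snd c p) R \<subseteq> snd c ` fst c"
    using open_contains_cball[of "snd c ` fst c"] open_image[OF c] p by blast
  obtain m M where m: "m > 0" "\<And>y w. y \<in> cball (snd c p) R \<Longrightarrow> m * norm w \<le> sqrt (chart_metric c y w)"
    using chart_metric_bounds[OF c compact_cball R(2)] by metis
  show ?thesis
  proof (rule that[of "R / 2" m])
    fix x x' assume x: "x \<in> fst c" "x' \<in> X" "norm (snd c x - snd c p) < R / 2" "riem_dist X A g x x' < m * (R / 2)"
    obtain l0 where l0: "pw_C1_path X A g x x' l0" using conn chart_in_X[OF c x(1)] x(2) by blast
    have stay: "x' \<in> fst c \<and> m * norm (snd c x' - snd c x) \<le> l"
      if l: "pw_C1_path X A g x x' l" "l < m * (R / 2)" for l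
    proof (rule pw_C1_path_stays[OF H c R(2) m l(1) x(1)])
      have "l / m < R / 2" using l(2) m(1) by (simp add: field_simps)
      then show "norm (snd c x - snd c p) + l / m < R" using x(3) by linarith
    qed
    obtain l1 where l1: "pw_C1_path X A g x x' l1" "l1 < m * (R / 2)"
      by (rule riem_dist_less[OF l0 x(4)])
    have "m * norm (snd c x' - snd c x) \<le> riem_dist X A g x x'"
    proof (rule ccontr)
      assume "\<not> ?thesis"
      then have "riem_dist X A g x x' < min (m * norm (snd c x' - snd c x)) (m * (R / 2))" using x(4) by simp
      then obtain l where "pw_C1_path X A g x x' l" "l < min (m * norm (snd c x' - snd c x)) (m * (R / 2))"
        by (rule riem_dist_less[OF l0])
      then show False using stay[of l] by simp
    qed
    then show "x' \<in> fst c \<and> m * norm (snd c x' - snd c x) \<le> riem_dist X A g x x'" using stay[OF l1] by simp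
  qed (use R m in auto)
qed

end

section \<open>The cotangent bundle\<close>

text \<open>Two derivatives of the transitions are needed, because those of the cotangent charts contain the
  first derivative.\<close>

locale C2_atlas = C1_atlas X A for X :: "'a set" and A :: "('a, 'e::euclidean_space) chart set" +
  assumes transition2_differentiable: "\<lbrakk>c \<in> A; d \<in> A; x \<in> fst c; x \<in> fst d\<rbrakk> \<Longrightarrow>
        (\<lambda>y. frechet_derivative (snd d \<circ> chart_inv c) (at y) v) differentiable (at (snd c x))"
    and transition2_continuous: "\<lbrakk>c \<in> A; d \<in> A\<rbrakk> \<Longrightarrow> continuous_on (snd c ` (fst c \<inter> fst d))
        (\<lambda>y. frechet_derivative (\<lambda>y. frechet_derivative (snd d \<circ> chart_inv c) (at y) v) (at y) w)"

lemma C2_atlas_of_smooth_atlas: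
  assumes "smooth_atlas X A" shows "C2_atlas X A"
proof -
  interpret C1_atlas X A by (rule C1_atlas_of_smooth_atlas[OF assms])
  note a = assms[unfolded smooth_atlas_def]
  have C: "Ck_on (Suc (Suc 0)) (snd c ` (fst c \<inter> fst d)) (snd d \<circ> chart_inv c)" if "c \<in> A" "d \<in> A" for c d
    using a[THEN conjunct2, THEN conjunct2, rule_format, OF that] unfolding smooth_on_def by blast
  show ?thesis
  proof
    fix c d assume cd: "c \<in> A" "d \<in> A"
    note C2 = C[OF cd, unfolded Ck_on.simps(2)[of "Suc 0"], THEN conjunct2, rule_format]
    show "continuous_on (snd c ` (fst c \<inter> fst d))
        (\<lambda>y. frechet_derivative (\<lambda>y. frechet_derivative (snd d \<circ> chart_inv c) (at y) v) (at y) w)" for v w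
      using C2[of v, unfolded Ck_on.simps] by blast
    fix x assume x: "x \<in> fst c" "x \<in> fst d"
    then have "snd c x \<in> snd c ` (fst c \<inter> fst d)" by blast
    then show "(\<lambda>y. frechet_derivative (snd d \<circ> chart_inv c) (at y) v) differentiable (at (snd c x))" for v
      using C2[of v, unfolded Ck_on.simps] by blast
  qed
qed

context C2_atlas
begin

abbreviation "CX \<equiv> cot_bundle X A"
abbreviation "CA \<equiv> cot_atlas A"

definition pos :: "('a, 'e) chart \<Rightarrow> ('a, 'e) covec \<Rightarrow> 'e" where
  "pos c z = snd c (fst z)"

definition mom :: "('a, 'e) chart \<Rightarrow> ('a, 'e) covec \<Rightarrow> 'e" where
  "mom c z = (\<Sum>b\<in>Basis. snd z (coord_vec A c (fst z) b) *\<^sub>R b)"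

definition trans :: "('a, 'e) chart \<Rightarrow> ('a, 'e) chart \<Rightarrow> 'e \<Rightarrow> 'e \<Rightarrow> 'e" where
  "trans c d y w = frechet_derivative (snd d \<circ> chart_inv c) (at y) w"

definition trans2 :: "('a, 'e) chart \<Rightarrow> ('a, 'e) chart \<Rightarrow> 'e \<Rightarrow> 'e \<Rightarrow> 'e \<Rightarrow> 'e" where
  "trans2 c d y v w = frechet_derivative (\<lambda>y. trans c d y v) (at y) w"

definition cot_point :: "('a, 'e) chart \<Rightarrow> 'e \<Rightarrow> 'e \<Rightarrow> ('a, 'e) covec" where
  "cot_point c y \<eta> = (chart_inv c y, \<lambda>v. if v \<in> tangent_space A (chart_inv c y) then \<eta> \<bullet> v c else 0)"

lemma cot_chart_coords: "snd (cot_chart A c) z = (pos c z, mom c z)"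
  by (simp add: cot_chart_def pos_def mom_def)

lemma CX_D: "z \<in> CX \<Longrightarrow> fst z \<in> X" "z \<in> CX \<Longrightarrow> snd z \<in> cotangent_space A (fst z)"
  by (auto simp: cot_bundle_def)

lemma cot_chart_domain: "c \<in> A \<Longrightarrow> z \<in> fst (cot_chart A c) \<longleftrightarrow> z \<in> CX \<and> fst z \<in> fst c"
proof -
  assume "c \<in> A"
  then have "fst c \<subseteq> X" using chart_in_X by blast
  then show ?thesis by (auto simp: cot_chart_def cot_bundle_def)
qed

lemma covec_linear:
  assumes "z \<in> CX" "u \<in> tangent_space A (fst z)" "v \<in> tangent_space A (fst z)"
  shows "snd z (\<lambda>c. r *\<^sub>R u c + s *\<^sub>R v c) = r * snd z u + s * snd z v"
  using CX_D(2)[OF assms(1)] assms(2,3) unfolding cotangent_space_def by blast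

lemma covec_outside: "z \<in> CX \<Longrightarrow> v \<notin> tangent_space A (fst z) \<Longrightarrow> snd z v = 0"
  using CX_D(2) unfolding cotangent_space_def by blast

lemma covec_coord_vec:
  assumes z: "z \<in> CX" and c: "c \<in> A" "fst z \<in> fst c"
  shows "snd z (coord_vec A c (fst z) w) = mom c z \<bullet> w"
proof -
  define l where "l w = snd z (coord_vec A c (fst z) w)" for w
  have L: "l (r *\<^sub>R u + s *\<^sub>R v) = r * l u + s * l v" for r s u v
    unfolding l_def coord_vec_linear[OF c] by (rule covec_linear[OF z coord_vec_tangent[OF c] coord_vec_tangent[OF c]])
  have lin: "linear l"
  proof (rule linearI)
    show "l (u + v) = l u + l v" for u v using L[of 1 u 1 v] by simp
    show "l (r *\<^sub>R u) = r *\<^sub>R l u" for r u using L[of r u 0 u] by simp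
  qed
  have "l w = l (\<Sum>b\<in>Basis. (w \<bullet> b) *\<^sub>R b)" by (simp add: euclidean_representation)
  also have "\<dots> = (\<Sum>b\<in>Basis. (w \<bullet> b) * l b)" by (simp add: linear_sum[OF lin] linear_scale[OF lin])
  also have "\<dots> = mom c z \<bullet> w"
    unfolding mom_def inner_sum_left by (intro sum.cong) (simp_all add: l_def inner_commute)
  finally show ?thesis by (simp add: l_def)
qed

lemma covec_apply:
  assumes z: "z \<in> CX" and c: "c \<in> A" "fst z \<in> fst c" and v: "v \<in> tangent_space A (fst z)"
  shows "snd z v = mom c z \<bullet> v c"
  by (subst tangent_eq_coord_vec[OF v c]) (rule covec_coord_vec[OF z c])

lemma mom_transform:
  assumes z: "z \<in> CX" and c: "c \<in> A" "fst z \<in> fst c" and d: "d \<in> A" "fst z \<in> fst d"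
  shows "mom d z \<bullet> w = mom c z \<bullet> trans d c (pos d z) w"
proof -
  have "mom d z \<bullet> w = snd z (coord_vec A d (fst z) w)" by (rule covec_coord_vec[OF z d, symmetric])
  also have "\<dots> = mom c z \<bullet> coord_vec A d (fst z) w c"
    by (rule covec_apply[OF z c coord_vec_tangent[OF d]])
  also have "coord_vec A d (fst z) w c = trans d c (pos d z) w"
    unfolding coord_vec_other[OF c] trans_def pos_def ..
  finally show ?thesis .
qed

lemma cot_point_in:
  assumes c: "c \<in> A" and y: "y \<in> snd c ` fst c"
  shows "cot_point c y \<eta> \<in> CX" "fst (cot_point c y \<eta>) = chart_inv c y" "fst (cot_point c y \<eta>) \<in> fst c"
    "pos c (cot_point c y \<eta>) = y" "mom c (cot_point c y \<eta>) = \<eta>"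
proof -
  let ?x = "chart_inv c y"
  have x: "?x \<in> fst c" by (rule chart_inv_in[OF c y])
  show f: "fst (cot_point c y \<eta>) = ?x" by (simp add: cot_point_def)
  then show fc: "fst (cot_point c y \<eta>) \<in> fst c" using x by simp
  have "(\<lambda>v. if v \<in> tangent_space A ?x then \<eta> \<bullet> v c else 0) \<in> cotangent_space A ?x"
    unfolding cotangent_space_def
  proof (intro CollectI conjI ballI allI impI)
    fix u v r s assume uv: "u \<in> tangent_space A ?x" "v \<in> tangent_space A ?x"
    show "(if (\<lambda>c. r *\<^sub>R u c + s *\<^sub>R v c) \<in> tangent_space A ?x then \<eta> \<bullet> (r *\<^sub>R u c + s *\<^sub>R v c) else 0) =
        r * (if u \<in> tangent_space A ?x then \<eta> \<bullet> u c else 0) + s * (if v \<in> tangent_space A ?x then \<eta> \<bullet> v c else 0)"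
      using uv tangent_combination[OF uv, of r s] by (simp add: inner_add_right)
  qed simp
  then show i: "cot_point c y \<eta> \<in> CX"
    using chart_in_X[OF c x] by (simp add: cot_bundle_def cot_point_def)
  show "pos c (cot_point c y \<eta>) = y" by (simp add: pos_def f chart_chart_inv[OF c y])
  have "mom c (cot_point c y \<eta>) \<bullet> w = \<eta> \<bullet> w" for w
  proof -
    have "mom c (cot_point c y \<eta>) \<bullet> w = snd (cot_point c y \<eta>) (coord_vec A c ?x w)"
      using covec_coord_vec[OF i c fc, of w] f by simp
    also have "\<dots> = \<eta> \<bullet> w"
      using coord_vec_tangent[OF c x, of w] coord_vec_self[OF c x, of w] by (simp add: cot_point_def)
    finally show ?thesis .
  qed
  then show "mom c (cot_point c y \<eta>) = \<eta>" by (metis inner_diff_left inner_eq_zero_iff right_minus_eq)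
qed

lemma covec_eqI:
  assumes z: "z \<in> CX" "z' \<in> CX" and c: "c \<in> A" "fst z \<in> fst c" "fst z' \<in> fst c"
    and eq: "pos c z = pos c z'" "mom c z = mom c z'"
  shows "z = z'"
proof (rule prod_eqI)
  show f: "fst z = fst z'" using eq(1) chart_eq_iff[OF c] by (simp add: pos_def)
  show "snd z = snd z'"
  proof
    fix v
    show "snd z v = snd z' v"
    proof (cases "v \<in> tangent_space A (fst z)")
      case True
      then have "v \<in> tangent_space A (fst z')" using f by simp
      then show ?thesis using covec_apply[OF z(1) c(1,2) True] covec_apply[OF z(2) c(1,3)] eq(2) by simp
    next
      case False
      then show ?thesis using covec_outside[OF z(1) False] covec_outside[OF z(2), of v] f by simp
    qed
  qed
qed

lemma cot_point_coords: "\<lbrakk>z \<in> CX; c \<in> A; fst z \<in> fst c\<rbrakk> \<Longrightarrow> cot_point c (pos c z) (mom c z) = z"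
  by (rule covec_eqI[where c = c]) (auto simp: cot_point_in pos_def)

lemma inj_cot_chart: "c \<in> A \<Longrightarrow> inj_on (snd (cot_chart A c)) (fst (cot_chart A c))"
proof (rule inj_onI)
  fix z w assume c: "c \<in> A" and zw: "z \<in> fst (cot_chart A c)" "w \<in> fst (cot_chart A c)"
    and eq: "snd (cot_chart A c) z = snd (cot_chart A c) w"
  show "z = w"
    by (rule covec_eqI[where c = c]) (use c zw eq in \<open>simp_all add: cot_chart_coords cot_chart_domain\<close>)
qed

lemma cot_chart_image:
  assumes "c \<in> A" "d \<in> A"
  shows "snd (cot_chart A c) ` (fst (cot_chart A c) \<inter> fst (cot_chart A d)) = snd c ` (fst c \<inter> fst d) \<times> UNIV"
proof (intro set_eqI iffI)
  fix w assume "w \<in> snd (cot_chart A c) ` (fst (cot_chart A c) \<inter> fst (cot_chart A d))"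
  then show "w \<in> snd c ` (fst c \<inter> fst d) \<times> UNIV"
    using assms by (auto simp: cot_chart_coords cot_chart_domain pos_def)
next
  fix w assume "w \<in> snd c ` (fst c \<inter> fst d) \<times> (UNIV :: 'e set)"
  then obtain x \<eta> where w: "w = (snd c x, \<eta>)" "x \<in> fst c" "x \<in> fst d" by auto
  define z where "z = cot_point c (snd c x) \<eta>"
  have "snd c x \<in> snd c ` fst c" using w by blast
  note z = cot_point_in[OF assms(1) this, of \<eta>, folded z_def]
  have "fst z = x" using z(2) w assms by simp
  then have "z \<in> fst (cot_chart A c) \<inter> fst (cot_chart A d)" "snd (cot_chart A c) z = w"
    using z w assms by (auto simp: cot_chart_domain cot_chart_coords)
  then show "w \<in> snd (cot_chart A c) ` (fst (cot_chart A c) \<inter> fst (cot_chart A d))" by blast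
qed

lemma chart_inv_cot:
  assumes c: "c \<in> A" and y: "y \<in> snd c ` fst c"
  shows "chart_inv (cot_chart A c) (y, \<eta>) = cot_point c y \<eta>"
proof -
  note z = cot_point_in[OF assms, of \<eta>]
  have "chart_inv (cot_chart A c) (snd (cot_chart A c) (cot_point c y \<eta>)) = cot_point c y \<eta>"
    unfolding chart_inv_def by (rule inv_into_f_f[OF inj_cot_chart[OF c]]) (use z c in \<open>simp add: cot_chart_domain\<close>)
  then show ?thesis using z by (simp add: cot_chart_coords)
qed

lemma trans_has_derivative:
  "\<lbrakk>c \<in> A; d \<in> A; x \<in> fst c; x \<in> fst d\<rbrakk> \<Longrightarrow> ((snd d \<circ> chart_inv c) has_derivative trans c d (snd c x)) (at (snd c x))"
  using transition_has_derivative unfolding trans_def[abs_def] .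

lemma trans2_has_derivative:
  "\<lbrakk>c \<in> A; d \<in> A; x \<in> fst c; x \<in> fst d\<rbrakk> \<Longrightarrow> ((\<lambda>y. trans c d y v) has_derivative trans2 c d (snd c x) v) (at (snd c x))"
  using transition2_differentiable unfolding trans_def[abs_def] trans2_def[abs_def]
  by (simp add: frechet_derivative_works)

lemma trans_continuous: "\<lbrakk>c \<in> A; d \<in> A\<rbrakk> \<Longrightarrow> continuous_on (snd c ` (fst c \<inter> fst d)) (\<lambda>y. trans c d y v)"
  using transition_continuous unfolding trans_def .

lemma trans2_continuous: "\<lbrakk>c \<in> A; d \<in> A\<rbrakk> \<Longrightarrow> continuous_on (snd c ` (fst c \<inter> fst d)) (\<lambda>y. trans2 c d y v w)"
  using transition2_continuous unfolding trans2_def trans_def .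

text \<open>The derivative at \<open>z\<close> of the transition between the cotangent charts over
  \<open>c\<close> and \<open>d\<close>; the second summand of the fibre component differentiates the
  cotangent map with respect to the base point.\<close>

definition cot_trans :: "('a, 'e) chart \<Rightarrow> ('a, 'e) chart \<Rightarrow> 'e \<times> 'e \<Rightarrow> 'e \<times> 'e \<Rightarrow> 'e \<times> 'e" where
  "cot_trans c d z w = (trans c d (fst z) (fst w),
     \<Sum>b\<in>Basis. (snd w \<bullet> trans d c ((snd d \<circ> chart_inv c) (fst z)) b
       + snd z \<bullet> trans2 d c ((snd d \<circ> chart_inv c) (fst z)) b (trans c d (fst z) (fst w))) *\<^sub>R b)"

lemma cot_transition_eq:
  assumes c: "c \<in> A" and d: "d \<in> A" and y: "y \<in> snd c ` (fst c \<inter> fst d)"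
  shows "(snd (cot_chart A d) \<circ> chart_inv (cot_chart A c)) (y, \<eta>) =
     ((snd d \<circ> chart_inv c) y, \<Sum>b\<in>Basis. (\<eta> \<bullet> trans d c ((snd d \<circ> chart_inv c) y) b) *\<^sub>R b)"
proof -
  have y': "y \<in> snd c ` fst c" using y by blast
  note z = cot_point_in[OF c y', of \<eta>]
  have xd: "fst (cot_point c y \<eta>) \<in> fst d" using y c z(2) by auto
  have p: "pos d (cot_point c y \<eta>) = (snd d \<circ> chart_inv c) y" by (simp add: pos_def z(2))
  have "mom d (cot_point c y \<eta>) = (\<Sum>b\<in>Basis. (mom d (cot_point c y \<eta>) \<bullet> b) *\<^sub>R b)"
    by (simp add: euclidean_representation)
  also have "\<dots> = (\<Sum>b\<in>Basis. (\<eta> \<bullet> trans d c ((snd d \<circ> chart_inv c) y) b) *\<^sub>R b)"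
    unfolding mom_transform[OF z(1) c z(3) d xd] z(5) p ..
  finally show ?thesis using p by (simp add: chart_inv_cot[OF c y'] cot_chart_coords)
qed

lemma cot_transition_has_derivative:
  assumes c: "c \<in> A" and d: "d \<in> A" and y: "y \<in> snd c ` (fst c \<inter> fst d)"
  shows "((snd (cot_chart A d) \<circ> chart_inv (cot_chart A c)) has_derivative cot_trans c d (y, \<eta>)) (at (y, \<eta>))"
proof -
  let ?F = "snd d \<circ> chart_inv c"
  obtain x where x: "x \<in> fst c" "x \<in> fst d" "y = snd c x" using y by blast
  have Fy: "?F y = snd d x" using x c by simp
  have 1: "((\<lambda>z. ?F (fst z)) has_derivative (\<lambda>w. trans c d y (fst w))) (at (y, \<eta>))"
    using has_derivative_compose[OF has_derivative_fst[OF has_derivative_ident], of ?F] trans_has_derivative[OF c d x(1,2)] x(3)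
    by fastforce
  have 2: "((\<lambda>z. trans d c (?F (fst z)) b) has_derivative (\<lambda>w. trans2 d c (?F y) b (trans c d y (fst w)))) (at (y, \<eta>))" for b
    using has_derivative_compose[OF 1, of "\<lambda>y'. trans d c y' b"] trans2_has_derivative[OF d c x(2,1), of b] Fy
    by simp
  have 3: "((\<lambda>z. snd z \<bullet> trans d c (?F (fst z)) b) has_derivative
      (\<lambda>w. snd (y, \<eta>) \<bullet> trans2 d c (?F y) b (trans c d y (fst w)) + snd w \<bullet> trans d c (?F (fst (y, \<eta>))) b)) (at (y, \<eta>))" for b
    by (rule has_derivative_inner[OF has_derivative_snd[OF has_derivative_ident] 2])
  have "((\<lambda>z. (?F (fst z), \<Sum>b\<in>Basis. (snd z \<bullet> trans d c (?F (fst z)) b) *\<^sub>R b)) has_derivative cot_trans c d (y, \<eta>)) (at (y, \<eta>))"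
    unfolding cot_trans_def
    by (rule has_derivative_eq_rhs[OF has_derivative_Pair[OF 1 has_derivative_sum[OF has_derivative_scaleR_left[OF 3]]]])
       (auto simp: add.commute)
  then show ?thesis
  proof (rule has_derivative_transform_within_open)
    show "open (snd c ` (fst c \<inter> fst d) \<times> (UNIV :: 'e set))" using open_overlap[OF c d] by (simp add: open_Times)
    show "(y, \<eta>) \<in> snd c ` (fst c \<inter> fst d) \<times> UNIV" using y by simp
    show "(?F (fst z), \<Sum>b\<in>Basis. (snd z \<bullet> trans d c (?F (fst z)) b) *\<^sub>R b) = (snd (cot_chart A d) \<circ> chart_inv (cot_chart A c)) z"
      if "z \<in> snd c ` (fst c \<inter> fst d) \<times> UNIV" for z
      using cot_transition_eq[OF c d, of "fst z" "snd z"] that by (simp add: mem_Times_iff)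
  qed
qed

lemma cot_trans_continuous:
  assumes c: "c \<in> A" and d: "d \<in> A"
  shows "continuous_on (snd c ` (fst c \<inter> fst d) \<times> UNIV) (\<lambda>z. cot_trans c d z w)"
proof -
  let ?S = "snd c ` (fst c \<inter> fst d)"
  let ?F = "snd d \<circ> chart_inv c"
  have F: "continuous_on ?S ?F" by (rule transition_continuous_on[OF c d])
  have FS: "?F y \<in> snd d ` (fst d \<inter> fst c)" if "y \<in> ?S" for y using that c by auto
  have lin: "trans2 d c (?F y) b v = (\<Sum>j\<in>Basis. (v \<bullet> j) *\<^sub>R trans2 d c (?F y) b j)" if "y \<in> ?S" for y b v
  proof -
    obtain x where x: "x \<in> fst c" "x \<in> fst d" "y = snd c x" using \<open>y \<in> ?S\<close> by blast
    have l: "linear (trans2 d c (?F y) b)"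
      using has_derivative_linear[OF trans2_has_derivative[OF d c x(2,1), of b]] x c by simp
    have "trans2 d c (?F y) b v = trans2 d c (?F y) b (\<Sum>j\<in>Basis. (v \<bullet> j) *\<^sub>R j)" by (simp add: euclidean_representation)
    also have "\<dots> = (\<Sum>j\<in>Basis. (v \<bullet> j) *\<^sub>R trans2 d c (?F y) b j)"
      by (simp only: linear_sum[OF l] linear_scale[OF l])
    finally show ?thesis .
  qed
  have 1: "continuous_on (?S \<times> UNIV) (\<lambda>z::'e \<times> 'e. trans c d (fst z) v)" for v
    by (rule continuous_on_compose2[OF trans_continuous[OF c d]]) (auto intro!: continuous_intros)
  have 2: "continuous_on (?S \<times> UNIV) (\<lambda>z::'e \<times> 'e. trans d c (?F (fst z)) b)" for b
    by (rule continuous_on_compose2[OF trans_continuous[OF d c] continuous_on_compose2[OF F]])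
       (use FS in \<open>auto intro!: continuous_intros\<close>)
  have 3: "continuous_on (?S \<times> UNIV) (\<lambda>z::'e \<times> 'e. trans2 d c (?F (fst z)) b v)" for b v
    by (rule continuous_on_compose2[OF trans2_continuous[OF d c] continuous_on_compose2[OF F]])
       (use FS in \<open>auto intro!: continuous_intros\<close>)
  have 4: "continuous_on (?S \<times> UNIV) (\<lambda>z::'e \<times> 'e. trans2 d c (?F (fst z)) b (trans c d (fst z) (fst w)))" for b
  proof (rule continuous_on_eq)
    show "continuous_on (?S \<times> UNIV) (\<lambda>z::'e \<times> 'e. \<Sum>j\<in>Basis. (trans c d (fst z) (fst w) \<bullet> j) *\<^sub>R trans2 d c (?F (fst z)) b j)"
      by (intro continuous_intros 1 3)
    fix z :: "'e \<times> 'e" assume "z \<in> ?S \<times> UNIV"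
    then show "(\<Sum>j\<in>Basis. (trans c d (fst z) (fst w) \<bullet> j) *\<^sub>R trans2 d c (?F (fst z)) b j) =
        trans2 d c (?F (fst z)) b (trans c d (fst z) (fst w))"
      by (intro lin[symmetric]) auto
  qed
  show ?thesis unfolding cot_trans_def by (intro continuous_intros 1 2 4)
qed

lemma cot_atlas_C1: "C1_atlas CX CA"
proof
  show "(\<Union>C\<in>CA. fst C) = CX"
  proof (intro set_eqI iffI)
    fix z assume "z \<in> (\<Union>C\<in>CA. fst C)"
    then show "z \<in> CX" by (auto simp: cot_atlas_def cot_chart_domain)
  next
    fix z assume z: "z \<in> CX"
    obtain c where "c \<in> A" "fst z \<in> fst c" using exists_chart[OF CX_D(1)[OF z]] by blast
    then have "z \<in> fst (cot_chart A c)" "cot_chart A c \<in> CA" using z by (auto simp: cot_chart_domain cot_atlas_def)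
    then show "z \<in> (\<Union>C\<in>CA. fst C)" by blast
  qed
  fix C assume "C \<in> CA"
  then obtain c where c: "c \<in> A" "C = cot_chart A c" by (auto simp: cot_atlas_def)
  show "inj_on (snd C) (fst C)" using inj_cot_chart c by simp
  show "open (snd C ` fst C)"
    using cot_chart_image[OF c(1) c(1)] open_image[OF c(1)] c(2) by (simp add: open_Times)
  fix D assume "D \<in> CA"
  then obtain d where d: "d \<in> A" "D = cot_chart A d" by (auto simp: cot_atlas_def)
  note im = cot_chart_image[OF c(1) d(1), folded c(2) d(2)]
  show "open (snd C ` (fst C \<inter> fst D))" unfolding im using open_overlap[OF c(1) d(1)] by (simp add: open_Times)
  have der: "((snd D \<circ> chart_inv C) has_derivative cot_trans c d w) (at w)" if "w \<in> snd C ` (fst C \<inter> fst D)" for w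
  proof -
    have "fst w \<in> snd c ` (fst c \<inter> fst d)" using that unfolding im by (simp add: mem_Times_iff)
    from cot_transition_has_derivative[OF c(1) d(1) this, of "snd w"] show ?thesis by (simp add: c(2) d(2))
  qed
  show "continuous_on (snd C ` (fst C \<inter> fst D)) (\<lambda>y. frechet_derivative (snd D \<circ> chart_inv C) (at y) v)" for v
    by (rule Ck_on_1I(2)[OF der]) (auto simp: im intro: cot_trans_continuous[OF c(1) d(1)])
  show "(snd D \<circ> chart_inv C) differentiable (at (snd C x))" if "x \<in> fst C" "x \<in> fst D" for x
    by (rule differentiableI[OF der]) (use that in blast)
qed

end

sublocale C2_atlas \<subseteq> cot: C1_atlas "cot_bundle X A" "cot_atlas A"
  by (rule cot_atlas_C1)

context C2_atlas
begin

lemma cot_chart_in: "c \<in> A \<Longrightarrow> cot_chart A c \<in> CA" by (simp add: cot_atlas_def)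

lemma cot_chart_at:
  assumes "z \<in> CX"
  obtains c where "c \<in> A" "fst z \<in> fst c" "chart_at CA z = cot_chart A c"
proof -
  have C: "chart_at CA z \<in> CA" "z \<in> fst (chart_at CA z)" using cot.chart_at_in[OF assms] by auto
  then obtain c where c: "c \<in> A" "chart_at CA z = cot_chart A c" by (auto simp: cot_atlas_def)
  then show ?thesis using that C cot_chart_domain by auto
qed

lemma openin_base_preimage:
  assumes U: "openin (mtop X A) U"
  shows "openin (mtop CX CA) {z \<in> CX. fst z \<in> U}"
  unfolding cot.openin_mtop_iff
proof (intro conjI ballI)
  show "{z \<in> CX. fst z \<in> U} \<subseteq> CX" by blast
  fix C assume "C \<in> CA"
  then obtain c where c: "c \<in> A" "C = cot_chart A c" by (auto simp: cot_atlas_def)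
  have "snd C ` ({z \<in> CX. fst z \<in> U} \<inter> fst C) = snd c ` (U \<inter> fst c) \<times> UNIV"
  proof (intro set_eqI iffI)
    fix w assume "w \<in> snd C ` ({z \<in> CX. fst z \<in> U} \<inter> fst C)"
    then show "w \<in> snd c ` (U \<inter> fst c) \<times> UNIV"
      using c by (auto simp: cot_chart_coords cot_chart_domain pos_def)
  next
    fix w assume "w \<in> snd c ` (U \<inter> fst c) \<times> (UNIV :: 'e set)"
    then obtain x \<eta> where w: "w = (snd c x, \<eta>)" "x \<in> fst c" "x \<in> U" by auto
    have "snd c x \<in> snd c ` fst c" using w by blast
    note z = cot_point_in[OF c(1) this, of \<eta>]
    have "cot_point c (snd c x) \<eta> \<in> {z \<in> CX. fst z \<in> U} \<inter> fst C" "snd C (cot_point c (snd c x) \<eta>) = w"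
      using z w c by (auto simp: cot_chart_domain cot_chart_coords)
    then show "w \<in> snd C ` ({z \<in> CX. fst z \<in> U} \<inter> fst C)" by blast
  qed
  moreover have "open (snd c ` (U \<inter> fst c))" using U c(1) by (simp add: openin_mtop_iff)
  ultimately show "open (snd C ` ({z \<in> CX. fst z \<in> U} \<inter> fst C))" by (simp add: open_Times)
qed

text \<open>Points over different base points are separated by their base points, points of the same fibre in
  a chart.\<close>

lemma Hausdorff_cot:
  assumes H: "Hausdorff_space (mtop X A)"
  shows "Hausdorff_space (mtop CX CA)"
  unfolding Hausdorff_space_def
proof (intro allI impI)
  fix z w assume "z \<in> topspace (mtop CX CA) \<and> w \<in> topspace (mtop CX CA) \<and> z \<noteq> w"
  then have zw: "z \<in> CX" "w \<in> CX" "z \<noteq> w" by auto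
  show "\<exists>U V. openin (mtop CX CA) U \<and> openin (mtop CX CA) V \<and> z \<in> U \<and> w \<in> V \<and> disjnt U V"
  proof (cases "fst z = fst w")
    case False
    then obtain U V where "openin (mtop X A) U" "openin (mtop X A) V" "fst z \<in> U" "fst w \<in> V" "disjnt U V"
      using H CX_D(1)[OF zw(1)] CX_D(1)[OF zw(2)] unfolding Hausdorff_space_def by (metis topspace_mtop)
    then show ?thesis using zw
      by (intro exI[of _ "{z \<in> CX. fst z \<in> U}"] exI[of _ "{z \<in> CX. fst z \<in> V}"])
         (auto intro: openin_base_preimage simp: disjnt_iff)
  next
    case True
    obtain c where c: "c \<in> A" "fst z \<in> fst c" using exists_chart[OF CX_D(1)[OF zw(1)]] by blast
    let ?C = "cot_chart A c"
    have d: "z \<in> fst ?C" "w \<in> fst ?C" using c zw True by (auto simp: cot_chart_domain)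
    have "snd ?C z \<noteq> snd ?C w" using inj_onD[OF inj_cot_chart[OF c(1)] _ d] zw(3) by blast
    then obtain U V where "open U" "open V" "snd ?C z \<in> U" "snd ?C w \<in> V" "U \<inter> V = {}"
      using hausdorff[of "snd ?C z" "snd ?C w"] by auto
    then show ?thesis using d
      by (intro exI[of _ "{z \<in> fst ?C. snd ?C z \<in> U}"] exI[of _ "{z \<in> fst ?C. snd ?C z \<in> V}"])
         (auto intro!: cot.openin_chart_preimage cot_chart_in c(1) simp: disjnt_iff)
  qed
qed

text \<open>Differentiate the invariance of the pairing \<open>p \<bullet> w\<close> under the transition, and
  use the symmetry of the second derivative of the transition of the base charts.\<close>

lemma cot_trans_symplectic:
  assumes c: "c \<in> A" and d: "d \<in> A" and z: "z \<in> CX" "fst z \<in> fst c" "fst z \<in> fst d"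
  defines "T \<equiv> cot_trans c d (pos c z, mom c z)"
  shows "snd (T u) \<bullet> fst (T v) - snd (T v) \<bullet> fst (T u) = snd u \<bullet> fst v - snd v \<bullet> fst u"
proof -
  let ?x = "fst z"
  let ?F = "snd d \<circ> chart_inv c"
  let ?y = "pos c z" and ?\<eta> = "mom c z" and ?\<eta>' = "mom d z"
  let ?S = "snd c ` (fst c \<inter> fst d)"
  have y: "?y \<in> ?S" using z by (auto simp: pos_def)
  have oS: "open (?S \<times> (UNIV :: 'e set))" using open_overlap[OF c d] by (simp add: open_Times)
  have tr: "((snd (cot_chart A d) \<circ> chart_inv (cot_chart A c)) has_derivative T) (at (?y, ?\<eta>))"
    unfolding T_def by (rule cot_transition_has_derivative[OF c d y])
  have val: "snd ((snd (cot_chart A d) \<circ> chart_inv (cot_chart A c)) (?y, ?\<eta>)) = ?\<eta>'"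
  proof -
    have "?y \<in> snd c ` fst c" using y by blast
    then show ?thesis
      by (simp add: chart_inv_cot[OF c] cot_point_coords[OF z(1) c z(2)] cot_chart_coords)
  qed
  \<comment> \<open>The derivative of the invariance of the pairing, in the direction \<open>u\<close>.\<close>
  have key: "snd u \<bullet> w = snd (T u) \<bullet> trans c d ?y w + ?\<eta>' \<bullet> trans2 c d ?y w (fst u)" for u w
  proof -
    have d1: "((\<lambda>q. trans c d (fst q) w) has_derivative (\<lambda>u. trans2 c d ?y w (fst u))) (at (?y, ?\<eta>))"
      using has_derivative_compose[OF has_derivative_fst[OF has_derivative_ident], of "\<lambda>y. trans c d y w"]
        trans2_has_derivative[OF c d z(2,3), of w] by (fastforce simp: pos_def)
    have "((\<lambda>q. snd ((snd (cot_chart A d) \<circ> chart_inv (cot_chart A c)) q) \<bullet> trans c d (fst q) w) has_derivative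
        (\<lambda>u. ?\<eta>' \<bullet> trans2 c d ?y w (fst u) + snd (T u) \<bullet> trans c d ?y w)) (at (?y, ?\<eta>))"
      using has_derivative_inner[OF has_derivative_snd[OF tr] d1] unfolding val by simp
    then have "((\<lambda>q. snd q \<bullet> w) has_derivative
        (\<lambda>u. ?\<eta>' \<bullet> trans2 c d ?y w (fst u) + snd (T u) \<bullet> trans c d ?y w)) (at (?y, ?\<eta>))"
    proof (rule has_derivative_transform_within_open[OF _ oS])
      show "(?y, ?\<eta>) \<in> ?S \<times> UNIV" using y by simp
      fix q assume q: "q \<in> ?S \<times> (UNIV :: 'e set)"
      then have q': "fst q \<in> snd c ` fst c" by auto
      let ?z = "cot_point c (fst q) (snd q)"
      note zz = cot_point_in[OF c q', of "snd q"]
      have zd: "fst ?z \<in> fst d" using zz(2) q c by auto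
      have "snd q \<bullet> w = mom d ?z \<bullet> trans c d (fst q) w"
        using mom_transform[OF zz(1) d zd c zz(3), of w] zz(4,5) by simp
      moreover have "chart_inv (cot_chart A c) q = ?z" using chart_inv_cot[OF c q', of "snd q"] by simp
      ultimately show "snd ((snd (cot_chart A d) \<circ> chart_inv (cot_chart A c)) q) \<bullet> trans c d (fst q) w = snd q \<bullet> w"
        by (simp add: cot_chart_coords)
    qed
    moreover have "((\<lambda>q. snd q \<bullet> w) has_derivative (\<lambda>u. snd u \<bullet> w)) (at (?y, ?\<eta>))"
      by (auto intro!: derivative_eq_intros)
    ultimately have "(\<lambda>u. ?\<eta>' \<bullet> trans2 c d ?y w (fst u) + snd (T u) \<bullet> trans c d ?y w) = (\<lambda>u. snd u \<bullet> w)"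
      by (rule has_derivative_unique)
    from fun_cong[OF this, of u] show ?thesis by simp
  qed
  have sym: "?\<eta>' \<bullet> trans2 c d ?y a b = ?\<eta>' \<bullet> trans2 c d ?y b a" for a b
  proof (rule second_derivative_symmetric[where f = "\<lambda>y. ?\<eta>' \<bullet> ?F y" and f' = "\<lambda>y a. ?\<eta>' \<bullet> trans c d y a"
        and Du = "\<lambda>w. ?\<eta>' \<bullet> trans2 c d ?y a w" and Dv = "\<lambda>w. ?\<eta>' \<bullet> trans2 c d ?y b w" and u = a and v = b])
    show "open ?S" by (rule open_overlap[OF c d])
    show "?y \<in> ?S" by (rule y)
    show "((\<lambda>y. ?\<eta>' \<bullet> ?F y) has_derivative (\<lambda>a. ?\<eta>' \<bullet> trans c d y a)) (at y)" if "y \<in> ?S" for y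
      using has_derivative_inner_right[OF trans_has_derivative[OF c d]] that by auto
    show "((\<lambda>y. ?\<eta>' \<bullet> trans c d y a) has_derivative (\<lambda>w. ?\<eta>' \<bullet> trans2 c d ?y a w)) (at ?y)"
      "((\<lambda>y. ?\<eta>' \<bullet> trans c d y b) has_derivative (\<lambda>w. ?\<eta>' \<bullet> trans2 c d ?y b w)) (at ?y)"
      using has_derivative_inner_right[OF trans2_has_derivative[OF c d z(2,3)]] by (auto simp: pos_def)
  qed
  have f: "fst (T w) = trans c d ?y (fst w)" for w by (simp add: T_def cot_trans_def)
  show ?thesis using key[of u "fst v"] key[of v "fst u"] sym[of "fst u" "fst v"] by (simp add: f)
qed

lemma cot_trans_frechet:
  assumes "c \<in> A" "d \<in> A" "z \<in> CX" "fst z \<in> fst c" "fst z \<in> fst d"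
  shows "frechet_derivative (snd (cot_chart A d) \<circ> chart_inv (cot_chart A c)) (at (snd (cot_chart A c) z))
     = cot_trans c d (pos c z, mom c z)"
proof -
  have "pos c z \<in> snd c ` (fst c \<inter> fst d)" using assms by (auto simp: pos_def)
  from cot_transition_has_derivative[OF assms(1,2) this, of "mom c z"] show ?thesis
    using frechet_derivative_at by (metis cot_chart_coords)
qed

lemma cot_tangent_transform:
  assumes c: "c \<in> A" and d: "d \<in> A" and z: "z \<in> CX" "fst z \<in> fst c" "fst z \<in> fst d"
    and V: "V \<in> tangent_space CA z"
  shows "V (cot_chart A d) = cot_trans c d (pos c z, mom c z) (V (cot_chart A c))"
proof -
  have "z \<in> fst (cot_chart A c)" "z \<in> fst (cot_chart A d)" using c d z by (simp_all add: cot_chart_domain)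
  from cot.tangent_other[OF V cot_chart_in[OF c] this(1) cot_chart_in[OF d] this(2)]
  show ?thesis unfolding cot_trans_frechet[OF c d z] .
qed

lemma cot_velocity:
  assumes c: "c \<in> A" and z: "\<mu> t \<in> CX" "fst (\<mu> t) \<in> fst c" and v: "has_velocity CA \<mu> S t V"
  shows "((\<lambda>t. pos c (\<mu> t)) has_vector_derivative fst (V (cot_chart A c))) (at t within S)"
    "((\<lambda>t. mom c (\<mu> t)) has_vector_derivative snd (V (cot_chart A c))) (at t within S)"
    "V \<in> tangent_space CA (\<mu> t)"
proof -
  have "\<mu> t \<in> fst (cot_chart A c)" using c z by (simp add: cot_chart_domain)
  then have d: "((snd (cot_chart A c) \<circ> \<mu>) has_vector_derivative V (cot_chart A c)) (at t within S)"
    using v cot_chart_in[OF c] unfolding has_velocity_def by blast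
  have e: "snd (cot_chart A c) \<circ> \<mu> = (\<lambda>t. (pos c (\<mu> t), mom c (\<mu> t)))"
    by (auto simp: cot_chart_coords)
  show "((\<lambda>t. pos c (\<mu> t)) has_vector_derivative fst (V (cot_chart A c))) (at t within S)"
    using bounded_linear.has_vector_derivative[OF bounded_linear_fst d] unfolding e by simp
  show "((\<lambda>t. mom c (\<mu> t)) has_vector_derivative snd (V (cot_chart A c))) (at t within S)"
    using bounded_linear.has_vector_derivative[OF bounded_linear_snd d] unfolding e by simp
  show "V \<in> tangent_space CA (\<mu> t)" using v unfolding has_velocity_def by blast
qed

subsection \<open>Hamiltonian vector fields in coordinates\<close>

lemma bundle_push_eq:
  assumes z: "z \<in> CX" and c: "c \<in> A" "fst z \<in> fst c" and V: "V \<in> tangent_space CA z"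
  shows "bundle_push A z V \<in> tangent_space A (fst z)" "bundle_push A z V c = fst (V (cot_chart A c))"
proof -
  obtain c0 where c0: "c0 \<in> A" "fst z \<in> fst c0" "chart_at CA z = cot_chart A c0"
    using cot_chart_at[OF z] .
  have y: "pos c0 z \<in> snd c0 ` fst c0" using c0 by (auto simp: pos_def)
  have "frechet_derivative (snd d \<circ> fst \<circ> chart_inv (cot_chart A c0)) (at (pos c0 z, mom c0 z)) W = trans c0 d (pos c0 z) (fst W)"
    if d: "d \<in> A" "fst z \<in> fst d" for d W
  proof -
    have "((\<lambda>q. (snd d \<circ> chart_inv c0) (fst q)) has_derivative (\<lambda>W. trans c0 d (pos c0 z) (fst W))) (at (pos c0 z, mom c0 z))"
      using has_derivative_compose[OF has_derivative_fst[OF has_derivative_ident], of "snd d \<circ> chart_inv c0"]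
        trans_has_derivative[OF c0(1) d(1) c0(2) d(2)] by (fastforce simp: pos_def)
    then have "((snd d \<circ> fst \<circ> chart_inv (cot_chart A c0)) has_derivative (\<lambda>W. trans c0 d (pos c0 z) (fst W))) (at (pos c0 z, mom c0 z))"
    proof (rule has_derivative_transform_within_open)
      show "open (snd c0 ` fst c0 \<times> (UNIV :: 'e set))" using open_image[OF c0(1)] by (simp add: open_Times)
      show "(pos c0 z, mom c0 z) \<in> snd c0 ` fst c0 \<times> UNIV" using y by simp
      show "(snd d \<circ> chart_inv c0) (fst q) = (snd d \<circ> fst \<circ> chart_inv (cot_chart A c0)) q"
        if "q \<in> snd c0 ` fst c0 \<times> UNIV" for q
        using that chart_inv_cot[OF c0(1), of "fst q" "snd q"] cot_point_in(2)[OF c0(1), of "fst q" "snd q"]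
        by (simp add: mem_Times_iff)
    qed
    then show ?thesis using frechet_derivative_at by metis
  qed
  then have e: "bundle_push A z V = coord_vec A c0 (fst z) (fst (V (cot_chart A c0)))"
    unfolding push_forward_def coord_vec_def c0(3) cot_chart_coords
    by (intro ext) (auto simp: trans_def pos_def)
  show "bundle_push A z V \<in> tangent_space A (fst z)" unfolding e by (rule coord_vec_tangent[OF c0(1,2)])
  have "bundle_push A z V c = trans c0 c (pos c0 z) (fst (V (cot_chart A c0)))"
    unfolding e coord_vec_other[OF c] trans_def pos_def ..
  also have "\<dots> = fst (V (cot_chart A c))"
    unfolding cot_tangent_transform[OF c0(1) c(1) z c0(2) c(2) V] by (simp add: cot_trans_def)
  finally show "bundle_push A z V c = fst (V (cot_chart A c))" .
qed

lemma liouville_eq: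
  assumes z: "z \<in> CX" and c: "c \<in> A" "fst z \<in> fst c" and V: "V \<in> tangent_space CA z"
  shows "snd z (bundle_push A z V) = mom c z \<bullet> fst (V (cot_chart A c))"
  unfolding covec_apply[OF z c bundle_push_eq(1)[OF z c V]] bundle_push_eq(2)[OF z c V] ..

text \<open>\<open>symplectic\<close> is computed in an arbitrary chart around the point; by
  \<open>cot_trans_symplectic\<close> the coordinate expression does not depend on it.\<close>

lemma symplectic_eq:
  assumes z: "z \<in> CX" and c: "c \<in> A" "fst z \<in> fst c"
    and U: "U \<in> tangent_space CA z" and V: "V \<in> tangent_space CA z"
  shows "symplectic A z U V = snd (U (cot_chart A c)) \<bullet> fst (V (cot_chart A c))
     - snd (V (cot_chart A c)) \<bullet> fst (U (cot_chart A c))"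
proof -
  obtain c0 where c0: "c0 \<in> A" "fst z \<in> fst c0" "chart_at CA z = cot_chart A c0"
    using cot_chart_at[OF z] .
  let ?C = "cot_chart A c0"
  have y: "pos c0 z \<in> snd c0 ` fst c0" using c0 by (auto simp: pos_def)
  have "frechet_derivative (\<lambda>y. liouville A (chart_inv ?C y) (coord_vec CA ?C (chart_inv ?C y) w)) (at (pos c0 z, mom c0 z)) u
      = snd u \<bullet> fst w" for u w
  proof -
    have "((\<lambda>q. snd q \<bullet> fst w) has_derivative (\<lambda>u. snd u \<bullet> fst w)) (at (pos c0 z, mom c0 z))"
      by (auto intro!: derivative_eq_intros)
    then have "((\<lambda>y. liouville A (chart_inv ?C y) (coord_vec CA ?C (chart_inv ?C y) w)) has_derivative (\<lambda>u. snd u \<bullet> fst w)) (at (pos c0 z, mom c0 z))"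
    proof (rule has_derivative_transform_within_open)
      show "open (snd c0 ` fst c0 \<times> (UNIV :: 'e set))" using open_image[OF c0(1)] by (simp add: open_Times)
      show "(pos c0 z, mom c0 z) \<in> snd c0 ` fst c0 \<times> UNIV" using y by simp
      fix q assume "q \<in> snd c0 ` fst c0 \<times> (UNIV :: 'e set)"
      then have q: "fst q \<in> snd c0 ` fst c0" by auto
      let ?z = "cot_point c0 (fst q) (snd q)"
      note zz = cot_point_in[OF c0(1) q, of "snd q"]
      have dom: "?z \<in> fst ?C" using zz c0 by (simp add: cot_chart_domain)
      have e: "chart_inv ?C q = ?z" using chart_inv_cot[OF c0(1) q, of "snd q"] by simp
      show "snd q \<bullet> fst w = liouville A (chart_inv ?C q) (coord_vec CA ?C (chart_inv ?C q) w)"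
        unfolding liouville_def e liouville_eq[OF zz(1) c0(1) zz(3) cot.coord_vec_tangent[OF cot_chart_in[OF c0(1)] dom]]
          cot.coord_vec_self[OF cot_chart_in[OF c0(1)] dom] zz(5) ..
    qed
    from fun_cong[OF frechet_derivative_at[OF this], of u] show ?thesis by (rule sym)
  qed
  then have "symplectic A z U V = snd (U ?C) \<bullet> fst (V ?C) - snd (V ?C) \<bullet> fst (U ?C)"
    unfolding symplectic_def ext_deriv_def Let_def c0(3) cot_chart_coords by simp
  also have "\<dots> = snd (U (cot_chart A c)) \<bullet> fst (V (cot_chart A c)) - snd (V (cot_chart A c)) \<bullet> fst (U (cot_chart A c))"
    unfolding cot_tangent_transform[OF c0(1) c(1) z c0(2) c(2) U] cot_tangent_transform[OF c0(1) c(1) z c0(2) c(2) V]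
    by (rule cot_trans_symplectic[OF c0(1) c(1) z c0(2) c(2), symmetric])
  finally show ?thesis .
qed

text \<open>The symplectic form is nondegenerate, so that the vector \<open>(H\<^sub>p, - H\<^sub>q)\<close>
  of one chart is the only one with the defining property; the form of the derivative in any other chart
  follows from the invariance of the symplectic form.\<close>

lemma ham_vec_eq:
  assumes z: "z \<in> CX" and c: "c \<in> A" "fst z \<in> fst c" and h: "differentiable_at CA h z"
  shows "ham_vec A h z \<in> tangent_space CA z"
    "((\<lambda>q. h (cot_point c (fst q) (snd q))) has_derivative
       (\<lambda>w. snd w \<bullet> fst (ham_vec A h z (cot_chart A c)) - snd (ham_vec A h z (cot_chart A c)) \<bullet> fst w))
       (at (pos c z, mom c z))"
proof -
  obtain c0 where c0: "c0 \<in> A" "fst z \<in> fst c0" "chart_at CA z = cot_chart A c0"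
    using cot_chart_at[OF z] .
  let ?C = "cot_chart A c0"
  let ?z0 = "(pos c0 z, mom c0 z)"
  define D where "D = frechet_derivative (h \<circ> chart_inv ?C) (at ?z0)"
  have D: "((h \<circ> chart_inv ?C) has_derivative D) (at ?z0)"
    using h unfolding differentiable_at_def c0(3) cot_chart_coords D_def by (simp add: frechet_derivative_works)
  have lin: "linear D" by (rule has_derivative_linear[OF D])
  define a where "a = (\<Sum>b\<in>Basis. D (b, 0) *\<^sub>R b)"
  define p where "p = (\<Sum>b\<in>Basis. D (0, b) *\<^sub>R b)"
  have Dexp: "D w = a \<bullet> fst w + p \<bullet> snd w" for w
  proof -
    have s: "D (r *\<^sub>R u, r *\<^sub>R v) = r *\<^sub>R D (u, v)" for r u v
      using linear_scale[OF lin, of r "(u, v)"] by simp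
    have l1: "linear (\<lambda>v. D (v, 0))" and l2: "linear (\<lambda>v. D (0, v))"
      using s[of _ _ 0] s[of _ 0] by (auto intro!: linearI simp: linear_add[OF lin, symmetric])
    have "D w = D (fst w, 0) + D (0, snd w)" by (simp add: linear_add[OF lin, symmetric])
    moreover have "D (fst w, 0) = D (\<Sum>b\<in>Basis. (fst w \<bullet> b) *\<^sub>R b, 0)" by (simp add: euclidean_representation)
    moreover have "\<dots> = a \<bullet> fst w"
      unfolding linear_sum[OF l1] linear_scale[OF l1] a_def inner_sum_left by (simp add: inner_commute mult.commute)
    moreover have "D (0, snd w) = D (0, \<Sum>b\<in>Basis. (snd w \<bullet> b) *\<^sub>R b)" by (simp add: euclidean_representation)
    moreover have "\<dots> = p \<bullet> snd w"
      unfolding linear_sum[OF l2] linear_scale[OF l2] p_def inner_sum_left by (simp add: inner_commute mult.commute)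
    ultimately show ?thesis by linarith
  qed
  have dom: "z \<in> fst ?C" using z c0 by (simp add: cot_chart_domain)
  note tan = cot.coord_vec_tangent[OF cot_chart_in[OF c0(1)] dom]
  note self = cot.coord_vec_self[OF cot_chart_in[OF c0(1)] dom]
  define V where "V = coord_vec CA ?C z (p, - a)"
  have V: "V \<in> tangent_space CA z" "V ?C = (p, - a)" unfolding V_def by (rule tan, rule self)
  have df: "diff_fun CA h z W = D (W ?C)" for W
    unfolding diff_fun_def c0(3) cot_chart_coords D_def ..
  have "ham_vec A h z = V"
    unfolding ham_vec_def
  proof (rule the_equality)
    show "V \<in> tangent_space CA z \<and> (\<forall>W\<in>tangent_space CA z. diff_fun CA h z W = symplectic A z W V)"
      using V symplectic_eq[OF z c0(1,2) _ V(1)] by (simp add: df Dexp inner_commute)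
    fix V' assume V': "V' \<in> tangent_space CA z \<and> (\<forall>W\<in>tangent_space CA z. diff_fun CA h z W = symplectic A z W V')"
    have eq: "a \<bullet> fst w + p \<bullet> snd w = snd w \<bullet> fst (V' ?C) - snd (V' ?C) \<bullet> fst w" for w
    proof -
      have "D w = symplectic A z (coord_vec CA ?C z w) V'"
        using V' tan[of w] df[of "coord_vec CA ?C z w"] self[of w] by simp
      also have "\<dots> = snd w \<bullet> fst (V' ?C) - snd (V' ?C) \<bullet> fst w"
        using symplectic_eq[OF z c0(1,2) tan conjunct1[OF V']] unfolding self .
      finally show ?thesis by (simp add: Dexp)
    qed
    have "w \<bullet> (fst (V' ?C) - p) = 0" "w \<bullet> (snd (V' ?C) + a) = 0" for w
      using eq[of "(0, w)"] eq[of "(w, 0)"] by (simp_all add: inner_diff_right inner_add_right inner_commute)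
    from this(1)[of "fst (V' ?C) - p"] this(2)[of "snd (V' ?C) + a"]
    have "fst (V' ?C) = p" "snd (V' ?C) = - a" by (simp_all add: eq_neg_iff_add_eq_0)
    then have "V' ?C = V ?C" using V(2) by (simp add: prod_eq_iff)
    then show "V' = V" by (rule cot.tangent_eqI[OF conjunct1[OF V'] V(1) cot_chart_in[OF c0(1)] dom])
  qed
  then have hv: "ham_vec A h z \<in> tangent_space CA z" "ham_vec A h z ?C = (p, - a)" using V by simp_all
  show "ham_vec A h z \<in> tangent_space CA z" by (rule hv(1))
  let ?W = "ham_vec A h z (cot_chart A c)"
  let ?S = "cot_trans c c0 (pos c z, mom c z)"
  have y: "pos c z \<in> snd c ` (fst c \<inter> fst c0)" using c c0 by (auto simp: pos_def)
  have S: "((snd ?C \<circ> chart_inv (cot_chart A c)) has_derivative ?S) (at (pos c z, mom c z))"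
    by (rule cot_transition_has_derivative[OF c(1) c0(1) y])
  have pt: "(snd ?C \<circ> chart_inv (cot_chart A c)) (pos c z, mom c z) = ?z0"
  proof -
    have "pos c z \<in> snd c ` fst c" using y by blast
    then show ?thesis by (simp add: chart_inv_cot[OF c(1)] cot_point_coords[OF z c] cot_chart_coords)
  qed
  have "((h \<circ> chart_inv ?C) \<circ> (snd ?C \<circ> chart_inv (cot_chart A c)) has_derivative D \<circ> ?S) (at (pos c z, mom c z))"
    by (rule diff_chain_at[OF S]) (use D pt in simp)
  then have "((\<lambda>q. h (cot_point c (fst q) (snd q))) has_derivative D \<circ> ?S) (at (pos c z, mom c z))"
  proof (rule has_derivative_transform_within_open)
    show "open (snd c ` (fst c \<inter> fst c0) \<times> (UNIV :: 'e set))" using open_overlap[OF c(1) c0(1)] by (simp add: open_Times)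
    show "(pos c z, mom c z) \<in> snd c ` (fst c \<inter> fst c0) \<times> UNIV" using y by simp
    fix q assume "q \<in> snd c ` (fst c \<inter> fst c0) \<times> (UNIV :: 'e set)"
    then have q: "fst q \<in> snd c ` fst c" "fst q \<in> snd c ` (fst c \<inter> fst c0)" by auto
    note zz = cot_point_in[OF c(1) q(1), of "snd q"]
    have "fst (cot_point c (fst q) (snd q)) \<in> fst c0" using zz(2) q(2) c by auto
    then have "cot_point c (fst q) (snd q) \<in> fst ?C" using zz c0 by (simp add: cot_chart_domain)
    then show "((h \<circ> chart_inv ?C) \<circ> (snd ?C \<circ> chart_inv (cot_chart A c))) q = h (cot_point c (fst q) (snd q))"
      using chart_inv_cot[OF c(1) q(1), of "snd q"] cot.chart_inv_eq[OF cot_chart_in[OF c0(1)]] by simp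
  qed
  moreover have "(D \<circ> ?S) w = snd w \<bullet> fst ?W - snd ?W \<bullet> fst w" for w
  proof -
    have T: "?S ?W = (p, - a)"
      using cot_tangent_transform[OF c(1) c0(1) z c(2) c0(2) hv(1)] hv(2) by simp
    have "(D \<circ> ?S) w = snd (?S w) \<bullet> fst (?S ?W) - snd (?S ?W) \<bullet> fst (?S w)"
      unfolding T by (simp add: Dexp inner_commute)
    also have "\<dots> = snd w \<bullet> fst ?W - snd ?W \<bullet> fst w"
      by (rule cot_trans_symplectic[OF c(1) c0(1) z c(2) c0(2)])
    finally show ?thesis .
  qed
  then have "D \<circ> ?S = (\<lambda>w. snd w \<bullet> fst ?W - snd ?W \<bullet> fst w)" by (rule ext)
  ultimately show "((\<lambda>q. h (cot_point c (fst q) (snd q))) has_derivative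
       (\<lambda>w. snd w \<bullet> fst ?W - snd ?W \<bullet> fst w)) (at (pos c z, mom c z))"
    by simp
qed

end

subsection \<open>Distances on the cotangent bundle\<close>

locale cotangent_metric = C2_atlas X A + cm: riemannian_atlas "cot_bundle X A" "cot_atlas A" gT
  for X :: "'a set" and A :: "('a, 'e::euclidean_space) chart set" and gT +
  assumes Hausdorff: "Hausdorff_space (mtop X A)" and connected: "connected_space (mtop X A)"
begin

abbreviation "dT \<equiv> riem_dist CX CA gT"

text \<open>\<open>riem_dist\<close> is an infimum over lengths of paths, and says nothing if there are
  none.\<close>

definition reach :: "('a, 'e) covec \<Rightarrow> ('a, 'e) covec \<Rightarrow> bool" where
  "reach z w \<longleftrightarrow> (\<exists>l. pw_C1_path CX CA gT z w l)"

lemma reach_trans: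
  assumes "reach z w" "reach w u"
  shows "reach z u"
proof -
  obtain l where l: "pw_C1_path CX CA gT z w l" using assms(1) unfolding reach_def ..
  obtain m where m: "pw_C1_path CX CA gT w u m" using assms(2) unfolding reach_def ..
  show ?thesis unfolding reach_def by (rule exI, rule pw_C1_path.concat[OF l m])
qed

lemma reach_local:
  assumes c: "c \<in> A" and x: "x \<in> fst c"
  obtains U where "openin (mtop X A) U" "x \<in> U"
    "\<And>z w. \<lbrakk>z \<in> CX; w \<in> CX; fst z \<in> U; fst w \<in> U\<rbrakk> \<Longrightarrow> reach z w"
proof -
  obtain r where r: "r > 0" "ball (snd c x) r \<subseteq> snd c ` fst c"
    using open_contains_ball[of "snd c ` fst c"] open_image[OF c] x by blast
  define U where "U = {x' \<in> fst c. snd c x' \<in> ball (snd c x) r}"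
  let ?C = "cot_chart A c"
  have im: "snd ?C ` fst ?C = snd c ` fst c \<times> UNIV" using cot_chart_image[OF c c] by simp
  show ?thesis
  proof (rule that[of U])
    show "openin (mtop X A) U" unfolding U_def by (rule openin_chart_preimage[OF c open_ball])
    show "x \<in> U" using x r by (simp add: U_def)
    fix z w assume zw: "z \<in> CX" "w \<in> CX" "fst z \<in> U" "fst w \<in> U"
    have dom: "z \<in> fst ?C" "w \<in> fst ?C" using zw c by (auto simp: cot_chart_domain U_def)
    have seg: "closed_segment (snd ?C z) (snd ?C w) \<subseteq> snd ?C ` fst ?C"
    proof -
      have "convex (ball (snd c x) r \<times> (UNIV :: 'e set))" by (simp add: convex_Times)
      moreover have "snd ?C z \<in> ball (snd c x) r \<times> UNIV" "snd ?C w \<in> ball (snd c x) r \<times> UNIV"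
        using zw by (auto simp: cot_chart_coords pos_def U_def)
      ultimately have "closed_segment (snd ?C z) (snd ?C w) \<subseteq> ball (snd c x) r \<times> UNIV"
        by (simp add: closed_segment_subset)
      then show ?thesis unfolding im using r(2) by blast
    qed
    obtain m M where M: "\<And>y v. y \<in> closed_segment (snd ?C z) (snd ?C w) \<Longrightarrow> sqrt (cm.chart_metric ?C y v) \<le> M * norm v"
      using cm.chart_metric_bounds[OF cot_chart_in[OF c] compact_segment seg] by metis
    obtain l where "pw_C1_path CX CA gT z w l"
      by (rule cm.segment_path[OF cot_chart_in[OF c] dom seg M])
    then show "reach z w" unfolding reach_def by (rule exI)
  qed
qed

lemma exists_covec: "x \<in> X \<Longrightarrow> \<exists>z\<in>CX. fst z = x"
proof -
  assume "x \<in> X"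
  then obtain c where c: "c \<in> A" "x \<in> fst c" using exists_chart by blast
  then have "snd c x \<in> snd c ` fst c" by blast
  note cp = cot_point_in[OF c(1) this, of 0]
  have "fst (cot_point c (snd c x) 0) = x" using cp(2) c by simp
  then show ?thesis using cp(1) by (rule bexI)
qed

text \<open>The base points whose whole fibre can be reached form an open and closed set.\<close>

lemma reach_all:
  assumes "z \<in> CX" "w \<in> CX"
  shows "reach z w"
proof -
  \<comment> \<open>Fibres are convex in a chart, so that reaching one point of a fibre near a given one means reaching all of them.\<close>
  define S where "S = {x \<in> X. \<forall>w\<in>CX. fst w = x \<longrightarrow> reach z w}"
  have nbh: "\<exists>U. openin (mtop X A) U \<and> x \<in> U \<and> ((U \<inter> S \<noteq> {}) \<longrightarrow> U \<subseteq> S)" if x: "x \<in> X" for x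
  proof -
    obtain c where c: "c \<in> A" "x \<in> fst c" using exists_chart[OF x] by blast
    obtain U where U: "openin (mtop X A) U" "x \<in> U"
      "\<And>z w. \<lbrakk>z \<in> CX; w \<in> CX; fst z \<in> U; fst w \<in> U\<rbrakk> \<Longrightarrow> reach z w"
      using reach_local[OF c] by blast
    have UX: "U \<subseteq> X" using openin_subset[OF U(1)] by simp
    have "U \<subseteq> S" if ne: "U \<inter> S \<noteq> {}"
    proof
      obtain y where y: "y \<in> U" "y \<in> S" using ne by blast
      obtain v where v: "v \<in> CX" "fst v = y" using exists_covec y UX by blast
      fix x' assume x': "x' \<in> U"
      have "reach z w" if "w \<in> CX" "fst w = x'" for w
        using reach_trans[of z v w] U(3)[OF v(1) that(1)] v y x' that by (auto simp: S_def)
      then show "x' \<in> S" using x' UX by (auto simp: S_def)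
    qed
    then show ?thesis using U by blast
  qed
  have "openin (mtop X A) S"
    unfolding openin_subopen[of _ S]
  proof
    fix x assume x: "x \<in> S"
    then have "x \<in> X" by (simp add: S_def)
    with nbh x show "\<exists>T. openin (mtop X A) T \<and> x \<in> T \<and> T \<subseteq> S" by blast
  qed
  moreover have "openin (mtop X A) (X - S)"
    unfolding openin_subopen[of _ "X - S"]
  proof
    fix x assume x: "x \<in> X - S"
    obtain U where U: "openin (mtop X A) U" "x \<in> U" "(U \<inter> S \<noteq> {}) \<longrightarrow> U \<subseteq> S" using nbh x by blast
    then show "\<exists>T. openin (mtop X A) T \<and> x \<in> T \<and> T \<subseteq> X - S"
      using x openin_subset[OF U(1)] by (intro exI[of _ U]) auto
  qed
  moreover have "fst z \<in> S"
  proof -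
    have x: "fst z \<in> X" by (rule CX_D(1)[OF assms(1)])
    obtain c where c: "c \<in> A" "fst z \<in> fst c" using exists_chart[OF x] by blast
    obtain U where U: "openin (mtop X A) U" "fst z \<in> U"
      "\<And>z w. \<lbrakk>z \<in> CX; w \<in> CX; fst z \<in> U; fst w \<in> U\<rbrakk> \<Longrightarrow> reach z w"
      using reach_local[OF c] by blast
    have "reach z w" if w: "w \<in> CX" "fst w = fst z" for w
      by (rule U(3)[OF assms(1) w(1) U(2)]) (use U(2) w(2) in simp)
    then show ?thesis using x by (simp add: S_def)
  qed
  moreover have "S \<subseteq> X" by (auto simp: S_def)
  ultimately have "openin (mtop X A) S" "closedin (mtop X A) S" "S \<noteq> {}" by (auto simp: closedin_def)
  then have "S = X" using connected unfolding connected_space_clopen_in by fastforce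
  then have "fst w \<in> S" using CX_D(1)[OF assms(2)] by simp
  then show ?thesis using assms(2) unfolding S_def by blast
qed

lemma dT_nonneg:
  assumes "z \<in> CX" "w \<in> CX"
  shows "0 \<le> dT z w"
proof -
  obtain l where "pw_C1_path CX CA gT z w l" using reach_all[OF assms] unfolding reach_def by (elim exE)
  then show ?thesis by (rule cm.riem_dist_nonneg)
qed

lemma dT_lower:
  assumes c: "c \<in> A" and p: "p \<in> CX" "fst p \<in> fst c"
  obtains r m where "r > 0" "m > 0"
    "\<And>z w. \<lbrakk>z \<in> CX; w \<in> CX; fst z \<in> fst c; norm (snd (cot_chart A c) z - snd (cot_chart A c) p) < r; dT z w < m * r\<rbrakk> \<Longrightarrow>
       fst w \<in> fst c \<and> m * norm (snd (cot_chart A c) w - snd (cot_chart A c) z) \<le> dT z w"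
proof -
  have pd: "p \<in> fst (cot_chart A c)" using c p by (simp add: cot_chart_domain)
  have conn: "\<exists>l. pw_C1_path CX CA gT x x' l" if "x \<in> CX" "x' \<in> CX" for x x'
    using reach_all[OF that] by (simp add: reach_def)
  obtain r m where rm: "r > 0" "m > 0"
    "\<And>x x'. \<lbrakk>x \<in> fst (cot_chart A c); x' \<in> CX; norm (snd (cot_chart A c) x - snd (cot_chart A c) p) < r; dT x x' < m * r\<rbrakk> \<Longrightarrow>
       x' \<in> fst (cot_chart A c) \<and> m * norm (snd (cot_chart A c) x' - snd (cot_chart A c) x) \<le> dT x x'"
    using cm.riem_dist_lower[OF Hausdorff_cot[OF Hausdorff] cot_chart_in[OF c] pd conn] by metis
  show ?thesis
  proof (rule that[OF rm(1,2)])
    fix z w assume zw: "z \<in> CX" "w \<in> CX" "fst z \<in> fst c"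
      "norm (snd (cot_chart A c) z - snd (cot_chart A c) p) < r" "dT z w < m * r"
    have "z \<in> fst (cot_chart A c)" using zw c by (simp add: cot_chart_domain)
    from rm(3)[OF this zw(2,4,5)]
    show "fst w \<in> fst c \<and> m * norm (snd (cot_chart A c) w - snd (cot_chart A c) z) \<le> dT z w"
      using c by (simp add: cot_chart_domain)
  qed
qed

lemma dT_upper:
  assumes c: "c \<in> A" and p: "p \<in> CX" "fst p \<in> fst c"
  obtains r M where "r > 0" "M > 0"
    "\<And>z w. \<lbrakk>z \<in> CX; w \<in> CX; fst z \<in> fst c; fst w \<in> fst c; norm (snd (cot_chart A c) z - snd (cot_chart A c) p) < r;
        norm (snd (cot_chart A c) w - snd (cot_chart A c) p) < r\<rbrakk> \<Longrightarrow>
       dT z w \<le> M * norm (snd (cot_chart A c) w - snd (cot_chart A c) z)"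
proof -
  have pd: "p \<in> fst (cot_chart A c)" using c p by (simp add: cot_chart_domain)
  obtain r M where rM: "r > 0" "M > 0"
    "\<And>x x'. \<lbrakk>x \<in> fst (cot_chart A c); x' \<in> fst (cot_chart A c); norm (snd (cot_chart A c) x - snd (cot_chart A c) p) < r;
        norm (snd (cot_chart A c) x' - snd (cot_chart A c) p) < r\<rbrakk> \<Longrightarrow>
       dT x x' \<le> M * norm (snd (cot_chart A c) x' - snd (cot_chart A c) x) \<and> (\<exists>l. pw_C1_path CX CA gT x x' l)"
    using cm.riem_dist_upper[OF cot_chart_in[OF c] pd] by metis
  show ?thesis
  proof (rule that[OF rM(1,2)])
    fix z w assume zw: "z \<in> CX" "w \<in> CX" "fst z \<in> fst c" "fst w \<in> fst c"
      "norm (snd (cot_chart A c) z - snd (cot_chart A c) p) < r"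
      "norm (snd (cot_chart A c) w - snd (cot_chart A c) p) < r"
    have "z \<in> fst (cot_chart A c)" "w \<in> fst (cot_chart A c)" using zw c by (simp_all add: cot_chart_domain)
    from rM(3)[OF this zw(5,6)]
    show "dT z w \<le> M * norm (snd (cot_chart A c) w - snd (cot_chart A c) z)" by (rule conjunct1)
  qed
qed

end

section \<open>The action along the flow\<close>

lemma C1_lipschitz_on_cball:
  fixes f :: "'a::euclidean_space \<Rightarrow> 'b::real_normed_vector"
  assumes S: "cball x0 r \<subseteq> S" and d: "\<And>x. x \<in> S \<Longrightarrow> (f has_derivative f' x) (at x)"
    and c: "\<And>v. continuous_on S (\<lambda>x. f' x v)"
  obtains L where "L \<ge> 0" "\<And>x y. x \<in> cball x0 r \<Longrightarrow> y \<in> cball x0 r \<Longrightarrow> norm (f x - f y) \<le> L * norm (x - y)"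
proof -
  have "\<exists>B. \<forall>x\<in>cball x0 r. norm (f' x v) \<le> B" for v
  proof -
    have "compact ((\<lambda>x. f' x v) ` cball x0 r)"
      by (rule compact_continuous_image[OF continuous_on_subset[OF c S] compact_cball])
    then show ?thesis using compact_imp_bounded bounded_iff by (metis imageI)
  qed
  then obtain B where B: "\<And>v x. x \<in> cball x0 r \<Longrightarrow> norm (f' x v) \<le> B v" by metis
  define L where "L = (\<Sum>i\<in>Basis. \<bar>B i\<bar>)"
  have on: "onorm (f' x) \<le> L" if x: "x \<in> cball x0 r" for x
  proof (rule onorm_le)
    fix v
    have lin: "linear (f' x)" using has_derivative_linear[OF d] S x by blast
    have "f' x v = f' x (\<Sum>i\<in>Basis. (v \<bullet> i) *\<^sub>R i)" by (simp add: euclidean_representation)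
    also have "\<dots> = (\<Sum>i\<in>Basis. (v \<bullet> i) *\<^sub>R f' x i)" by (simp only: linear_sum[OF lin] linear_scale[OF lin])
    also have "norm \<dots> \<le> (\<Sum>i\<in>Basis. norm v * \<bar>B i\<bar>)"
    proof (rule sum_norm_le)
      fix i :: 'a assume i: "i \<in> Basis"
      have "norm (f' x i) \<le> \<bar>B i\<bar>" using B[OF x, of i] by linarith
      then show "norm ((v \<bullet> i) *\<^sub>R f' x i) \<le> norm v * \<bar>B i\<bar>"
        unfolding norm_scaleR by (intro mult_mono) (use Basis_le_norm[OF i] in auto)
    qed
    finally show "norm (f' x v) \<le> L * norm v" by (simp add: L_def sum_distrib_left mult.commute)
  qed
  show ?thesis
  proof (rule that[of L])
    show "0 \<le> L" by (auto simp: L_def intro: sum_nonneg)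
    show "norm (f x - f y) \<le> L * norm (x - y)" if "x \<in> cball x0 r" "y \<in> cball x0 r" for x y
      by (rule differentiable_bound[OF convex_cball _ on that]) (use d S in \<open>blast intro: has_derivative_at_withinI\<close>)
  qed
qed

lemma prod_dist_le: "0 \<le> d2 y y' \<Longrightarrow> prod_dist dist d2 (x, y) (x', y') \<le> \<bar>x - x'\<bar> + d2 y y'"
  for x x' :: real
proof -
  assume n: "0 \<le> d2 y y'"
  have "(\<bar>x - x'\<bar>)\<^sup>2 + (d2 y y')\<^sup>2 \<le> (\<bar>x - x'\<bar> + d2 y y')\<^sup>2"
    using n by (simp add: power2_sum)
  from real_sqrt_le_mono[OF this] show ?thesis using n by (simp add: prod_dist_def dist_real_def)
qed

lemma prod_dist_ge: "d2 y y' \<le> prod_dist dist d2 (x, y) (x', y')"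
  unfolding prod_dist_def prod.case by (rule real_le_rsqrt) simp

text \<open>The Hamiltonian flow started on the graph of \<open>d\<alpha>\<close>, separated from the control
  problem.\<close>

locale exact_flow = cotangent_metric X A gT
  for X :: "'a set" and A :: "('a, 'e::euclidean_space) chart set" and gT +
  fixes \<alpha> :: "'a \<Rightarrow> real" and D B\<^sub>0 :: "'a set" and J :: "real set" and Q \<Lambda>\<^sub>0 :: "('a, 'e) covec set"
    and H :: "real \<Rightarrow> ('a, 'e) covec \<Rightarrow> real" and fl :: "real \<Rightarrow> ('a, 'e) covec \<Rightarrow> ('a, 'e) covec"
  assumes D_open: "openin (mtop X A) D" and alpha_smooth: "smooth_fun A D \<alpha>"
    and B0: "openin (mtop X A) B\<^sub>0" "B\<^sub>0 \<subseteq> D" and Lambda0: "\<Lambda>\<^sub>0 = diff_covec A \<alpha> ` B\<^sub>0"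
    and J: "open J" "is_interval J" "0 \<in> J"
    and A1: "assumption_A1 X A dT J Q \<Lambda>\<^sub>0 H fl"
begin

subsection \<open>The initial Lagrangian submanifold\<close>

definition lam :: "('a, 'e) chart \<Rightarrow> 'e \<Rightarrow> ('a, 'e) covec" where
  "lam c y = diff_covec A \<alpha> (chart_inv c y)"

definition base :: "('a, 'e) chart \<Rightarrow> 'e set" where "base c = snd c ` (fst c \<inter> B\<^sub>0)"

lemma open_base: "c \<in> A \<Longrightarrow> open (base c)"
  using B0(1) unfolding base_def openin_mtop_iff by (simp add: Int_commute)

lemma alpha_Ck: "c \<in> A \<Longrightarrow> Ck_on (Suc (Suc 0)) (snd c ` (fst c \<inter> D)) (\<alpha> \<circ> chart_inv c)"
  using alpha_smooth unfolding smooth_fun_def smooth_on_def by blast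

lemma alpha_has_derivative:
  assumes "c \<in> A" "x \<in> fst c" "x \<in> D"
  shows "((\<alpha> \<circ> chart_inv c) has_derivative frechet_derivative (\<alpha> \<circ> chart_inv c) (at (snd c x))) (at (snd c x))"
proof -
  have "snd c x \<in> snd c ` (fst c \<inter> D)" using assms by blast
  then have "(\<alpha> \<circ> chart_inv c) differentiable (at (snd c x))"
    using alpha_Ck[OF assms(1), unfolded Ck_on.simps(2)[of "Suc 0"]] by blast
  then show ?thesis by (simp add: frechet_derivative_works)
qed

lemma alpha_chain:
  assumes c: "c \<in> A" "x \<in> fst c" and d: "d \<in> A" "x \<in> fst d" and x: "x \<in> D"
  shows "frechet_derivative (\<alpha> \<circ> chart_inv c) (at (snd c x)) w =
     frechet_derivative (\<alpha> \<circ> chart_inv d) (at (snd d x)) (trans c d (snd c x) w)"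
proof -
  let ?F = "snd d \<circ> chart_inv c"
  have 1: "(?F has_derivative trans c d (snd c x)) (at (snd c x))"
    by (rule trans_has_derivative[OF c(1) d(1) c(2) d(2)])
  have 2: "((\<alpha> \<circ> chart_inv d) has_derivative frechet_derivative (\<alpha> \<circ> chart_inv d) (at (snd d x))) (at (?F (snd c x)))"
    using alpha_has_derivative[OF d x] c by simp
  have "((\<alpha> \<circ> chart_inv c) has_derivative
      (\<lambda>w. frechet_derivative (\<alpha> \<circ> chart_inv d) (at (snd d x)) (trans c d (snd c x) w))) (at (snd c x))"
  proof (rule has_derivative_transform_within_open[OF has_derivative_compose[OF 1 2]])
    show "open (snd c ` (fst c \<inter> fst d))" using open_overlap c d by blast
    show "snd c x \<in> snd c ` (fst c \<inter> fst d)" using c d by blast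
    show "(\<alpha> \<circ> chart_inv d) (?F y) = (\<alpha> \<circ> chart_inv c) y" if "y \<in> snd c ` (fst c \<inter> fst d)" for y
      using that c d by auto
  qed
  from fun_cong[OF frechet_derivative_at[OF this], of w] show ?thesis by simp
qed

lemma diff_covec_coords:
  assumes c: "c \<in> A" "x \<in> fst c" and x: "x \<in> D"
  shows "diff_covec A \<alpha> x \<in> CX" "fst (diff_covec A \<alpha> x) = x" "pos c (diff_covec A \<alpha> x) = snd c x"
    "mom c (diff_covec A \<alpha> x) \<bullet> w = frechet_derivative (\<alpha> \<circ> chart_inv c) (at (snd c x)) w"
proof -
  have xX: "x \<in> X" by (rule chart_in_X[OF c])
  define d where "d = chart_at A x"
  have d: "d \<in> A" "x \<in> fst d" using chart_at_in[OF xX] by (simp_all add: d_def)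
  let ?D = "frechet_derivative (\<alpha> \<circ> chart_inv d) (at (snd d x))"
  have lin: "linear ?D" by (rule has_derivative_linear[OF alpha_has_derivative[OF d x]])
  have df: "diff_fun A \<alpha> x v = ?D (v d)" for v unfolding diff_fun_def d_def ..
  show f: "fst (diff_covec A \<alpha> x) = x" by (simp add: diff_covec_def)
  have s: "snd (diff_covec A \<alpha> x) v = (if v \<in> tangent_space A x then ?D (v d) else 0)" for v
    by (simp add: diff_covec_def df)
  have "snd (diff_covec A \<alpha> x) \<in> cotangent_space A x"
    unfolding cotangent_space_def
  proof (intro CollectI conjI ballI allI impI)
    fix u v r s' assume uv: "u \<in> tangent_space A x" "v \<in> tangent_space A x"
    show "snd (diff_covec A \<alpha> x) (\<lambda>c. r *\<^sub>R u c + s' *\<^sub>R v c) =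
        r * snd (diff_covec A \<alpha> x) u + s' * snd (diff_covec A \<alpha> x) v"
      using uv tangent_combination[OF uv, of r s'] unfolding s
      by (simp add: linear_add[OF lin] linear_scale[OF lin])
  qed (simp add: s)
  then show i: "diff_covec A \<alpha> x \<in> CX"
    using xX f by (simp add: cot_bundle_def case_prod_beta)
  show "pos c (diff_covec A \<alpha> x) = snd c x" by (simp add: pos_def f)
  have "mom c (diff_covec A \<alpha> x) \<bullet> w = snd (diff_covec A \<alpha> x) (coord_vec A c x w)"
    using covec_coord_vec[OF i c(1), of w] c f by simp
  also have "\<dots> = ?D (coord_vec A c x w d)" using coord_vec_tangent[OF c, of w] by (simp add: s)
  also have "coord_vec A c x w d = trans c d (snd c x) w" unfolding coord_vec_other[OF d] trans_def ..
  also have "?D \<dots> = frechet_derivative (\<alpha> \<circ> chart_inv c) (at (snd c x)) w"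
    by (rule alpha_chain[OF c d x, symmetric])
  finally show "mom c (diff_covec A \<alpha> x) \<bullet> w = frechet_derivative (\<alpha> \<circ> chart_inv c) (at (snd c x)) w" .
qed

lemma base_D:
  assumes c: "c \<in> A" and y: "y \<in> base c"
  shows "chart_inv c y \<in> fst c" "chart_inv c y \<in> B\<^sub>0" "chart_inv c y \<in> D" "snd c (chart_inv c y) = y" "y \<in> snd c ` fst c"
  using assms B0(2) by (auto simp: base_def)

lemma lam_coords:
  assumes c: "c \<in> A" and y: "y \<in> base c"
  shows "lam c y \<in> CX" "lam c y \<in> \<Lambda>\<^sub>0" "fst (lam c y) = chart_inv c y" "fst (lam c y) \<in> fst c" "pos c (lam c y) = y"
    "mom c (lam c y) = (\<Sum>b\<in>Basis. frechet_derivative (\<alpha> \<circ> chart_inv c) (at y) b *\<^sub>R b)"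
proof -
  note b = base_D[OF assms]
  note dc = diff_covec_coords[OF c b(1,3), folded lam_def, unfolded b(4)]
  show "lam c y \<in> CX" "fst (lam c y) = chart_inv c y" "fst (lam c y) \<in> fst c" "pos c (lam c y) = y"
    using dc(1-3) b by simp_all
  show "lam c y \<in> \<Lambda>\<^sub>0" unfolding Lambda0 lam_def using b(2) by blast
  have "mom c (lam c y) = (\<Sum>b\<in>Basis. (mom c (lam c y) \<bullet> b) *\<^sub>R b)" by (simp add: euclidean_representation)
  then show "mom c (lam c y) = (\<Sum>b\<in>Basis. frechet_derivative (\<alpha> \<circ> chart_inv c) (at y) b *\<^sub>R b)"
    unfolding dc(4) .
qed

lemma Lambda0_lam:
  assumes l: "l \<in> \<Lambda>\<^sub>0" and c: "c \<in> A" "fst l \<in> fst c"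
  shows "snd c (fst l) \<in> base c" "lam c (snd c (fst l)) = l" "l \<in> CX"
proof -
  obtain x where x: "x \<in> B\<^sub>0" "l = diff_covec A \<alpha> x" using l Lambda0 by blast
  then have f: "fst l = x" by (simp add: diff_covec_def)
  show b: "snd c (fst l) \<in> base c" using x f c by (auto simp: base_def)
  show "lam c (snd c (fst l)) = l" using c f x by (simp add: lam_def)
  then show "l \<in> CX" using lam_coords(1)[OF c(1) b] by simp
qed

lemma Lambda0_CX: "l \<in> \<Lambda>\<^sub>0 \<Longrightarrow> l \<in> CX"
proof -
  assume l: "l \<in> \<Lambda>\<^sub>0"
  then obtain x where x: "x \<in> B\<^sub>0" "l = diff_covec A \<alpha> x" using Lambda0 by blast
  then have "x \<in> X" using openin_subset[OF B0(1)] by auto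
  then obtain c where c: "c \<in> A" "x \<in> fst c" using exists_chart by blast
  have "fst l = x" using x by (simp add: diff_covec_def)
  then show ?thesis using Lambda0_lam(3)[OF l c(1)] c(2) by simp
qed

lemma lam_lipschitz:
  assumes c: "c \<in> A" and y0: "y0 \<in> base c"
  obtains r L where "r > 0" "L \<ge> 0" "ball y0 r \<subseteq> base c"
    "\<And>y y'. y \<in> ball y0 r \<Longrightarrow> y' \<in> ball y0 r \<Longrightarrow>
       norm (snd (cot_chart A c) (lam c y) - snd (cot_chart A c) (lam c y')) \<le> L * norm (y - y')"
proof -
  let ?a = "\<alpha> \<circ> chart_inv c"
  let ?S = "snd c ` (fst c \<inter> D)"
  have bS: "base c \<subseteq> ?S" using B0(2) by (auto simp: base_def)
  obtain r where r: "r > 0" "cball y0 r \<subseteq> base c" using open_base[OF c] y0 open_contains_cball by blast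
  note C2 = alpha_Ck[OF c, unfolded Ck_on.simps(2)[of "Suc 0"], THEN conjunct2, rule_format]
  define g where "g b y = frechet_derivative ?a (at y) b" for b y
  have g1: "(g b has_derivative frechet_derivative (g b) (at y)) (at y)" if "y \<in> ?S" for b y
  proof -
    have "g b differentiable (at y)" using C2[of b, unfolded Ck_on.simps] that unfolding g_def[abs_def] by blast
    then show ?thesis by (rule iffD1[OF frechet_derivative_works])
  qed
  have g2: "continuous_on ?S (\<lambda>y. frechet_derivative (g b) (at y) v)" for b v
    using C2[of b, unfolded Ck_on.simps] unfolding g_def[abs_def] by blast
  define f where "f y = (y, \<Sum>b\<in>Basis. g b y *\<^sub>R b)" for y
  define f' where "f' y v = (v, \<Sum>b\<in>Basis. frechet_derivative (g b) (at y) v *\<^sub>R b)" for y v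
  obtain L where L: "L \<ge> 0" "\<And>x y. x \<in> cball y0 r \<Longrightarrow> y \<in> cball y0 r \<Longrightarrow> norm (f x - f y) \<le> L * norm (x - y)"
  proof (rule C1_lipschitz_on_cball[of y0 r ?S f f'])
    show "cball y0 r \<subseteq> ?S" using r(2) bS by blast
    show "(f has_derivative f' x) (at x)" if "x \<in> ?S" for x
      unfolding f_def f'_def by (intro derivative_intros g1[OF that])
    show "continuous_on ?S (\<lambda>x. f' x v)" for v
      unfolding f'_def by (intro continuous_intros g2)
  qed blast
  have e: "snd (cot_chart A c) (lam c y) = f y" if "y \<in> base c" for y
    using lam_coords(5,6)[OF c that] by (simp add: cot_chart_coords f_def g_def)
  show ?thesis
  proof (rule that[OF r(1) L(1)])
    show "ball y0 r \<subseteq> base c" using r(2) ball_subset_cball by blast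
    fix y y' assume y: "y \<in> ball y0 r" "y' \<in> ball y0 r"
    then have "y \<in> base c" "y' \<in> base c" "y \<in> cball y0 r" "y' \<in> cball y0 r" using r(2) by auto
    then show "norm (snd (cot_chart A c) (lam c y) - snd (cot_chart A c) (lam c y')) \<le> L * norm (y - y')"
      using e L(2) by simp
  qed
qed

lemma lam_dT:
  assumes c: "c \<in> A" and y0: "y0 \<in> base c"
  obtains r M where "r > 0" "M \<ge> 0" "ball y0 r \<subseteq> base c"
    "\<And>y y'. y \<in> ball y0 r \<Longrightarrow> y' \<in> ball y0 r \<Longrightarrow> dT (lam c y) (lam c y') \<le> M * norm (y - y')"
proof -
  let ?C = "cot_chart A c"
  obtain r1 L where L: "r1 > 0" "L \<ge> 0" "ball y0 r1 \<subseteq> base c"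
    "\<And>y y'. y \<in> ball y0 r1 \<Longrightarrow> y' \<in> ball y0 r1 \<Longrightarrow> norm (snd ?C (lam c y) - snd ?C (lam c y')) \<le> L * norm (y - y')"
    using lam_lipschitz[OF assms] by metis
  note l0 = lam_coords[OF c y0]
  obtain r2 M where M: "r2 > 0" "M > 0"
    "\<And>z w. \<lbrakk>z \<in> CX; w \<in> CX; fst z \<in> fst c; fst w \<in> fst c; norm (snd ?C z - snd ?C (lam c y0)) < r2;
        norm (snd ?C w - snd ?C (lam c y0)) < r2\<rbrakk> \<Longrightarrow> dT z w \<le> M * norm (snd ?C w - snd ?C z)"
    using dT_upper[OF c l0(1,4)] by metis
  define r where "r = min r1 (r2 / (L + 1))"
  show ?thesis
  proof (rule that[of r "M * L"])
    show "0 < r" using L M by (simp add: r_def)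
    show "0 \<le> M * L" using L M by simp
    show "ball y0 r \<subseteq> base c" using L(3) by (auto simp: r_def)
    fix y y' assume y: "y \<in> ball y0 r" "y' \<in> ball y0 r"
    then have y1: "y \<in> ball y0 r1" "y' \<in> ball y0 r1" by (auto simp: r_def)
    have near: "norm (snd ?C (lam c z) - snd ?C (lam c y0)) < r2" if z: "z \<in> ball y0 r" for z
    proof -
      have z1: "z \<in> ball y0 r1" using z by (auto simp: r_def)
      have "norm (z - y0) < r2 / (L + 1)" using z by (simp add: r_def dist_norm norm_minus_commute)
      then have "(L + 1) * norm (z - y0) < r2" using L(2) by (simp add: field_simps)
      moreover have "L * norm (z - y0) \<le> (L + 1) * norm (z - y0)" by (intro mult_right_mono) auto
      ultimately show ?thesis using L(4)[OF z1, of y0] L(1) by fastforce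
    qed
    have b: "y \<in> base c" "y' \<in> base c" using y1 L(3) by auto
    have "dT (lam c y) (lam c y') \<le> M * norm (snd ?C (lam c y') - snd ?C (lam c y))"
      by (rule M(3)) (use lam_coords[OF c b(1)] lam_coords[OF c b(2)] near y in simp_all)
    also have "\<dots> \<le> M * (L * norm (y - y'))"
      using L(4)[OF y1] M(2) by (intro mult_left_mono) (auto simp: norm_minus_commute)
    finally show "dT (lam c y) (lam c y') \<le> M * L * norm (y - y')" by simp
  qed
qed

subsection \<open>The flow in coordinates\<close>

lemma flow_D:
  assumes l: "l \<in> \<Lambda>\<^sub>0"
  shows "fl 0 l = l" "ac_curve CX CA J (\<lambda>t. fl t l)"
    "AE t in lebesgue. t \<in> J \<longrightarrow> has_velocity CA (\<lambda>t. fl t l) J t (ham_vec A (H t) (fl t l))"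
    "\<And>t. t \<in> J \<Longrightarrow> differentiable_at CA (H t) (fl t l)"
    "\<And>t. t \<in> J \<Longrightarrow> fl t l \<in> CX"
proof -
  have F: "fl 0 l = l \<and> ham_solution X A Q H J (\<lambda>t. fl t l) \<and> (\<forall>t\<in>J. differentiable_at CA (H t) (fl t l))"
    using A1 l unfolding assumption_A1_def is_ham_flow_def by blast
  show "fl 0 l = l" using F by blast
  show ac: "ac_curve CX CA J (\<lambda>t. fl t l)" using F unfolding ham_solution_def by blast
  have "AE t in lebesgue. t \<in> J \<longrightarrow> differentiable_at CA (H t) (fl t l) \<and> has_velocity CA (\<lambda>t. fl t l) J t (ham_vec A (H t) (fl t l))"
    using F unfolding ham_solution_def by blast
  then show "AE t in lebesgue. t \<in> J \<longrightarrow> has_velocity CA (\<lambda>t. fl t l) J t (ham_vec A (H t) (fl t l))"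
    by eventually_elim blast
  show "differentiable_at CA (H t) (fl t l)" if "t \<in> J" for t using F that by blast
  have "continuous_map (top_of_set J) (mtop CX CA) (\<lambda>t. fl t l)" using ac unfolding ac_curve_def by blast
  from continuous_map_image_subset_topspace[OF this] show "fl t l \<in> CX" if "t \<in> J" for t using that by auto
qed

lemma flow_lipschitz:
  obtains L where "L \<ge> 0" "\<And>t t' l l'. \<lbrakk>t \<in> J; t' \<in> J; l \<in> \<Lambda>\<^sub>0; l' \<in> \<Lambda>\<^sub>0\<rbrakk> \<Longrightarrow>
     dT (fl t l) (fl t' l') \<le> L * (\<bar>t - t'\<bar> + dT l l')"
proof -
  obtain L where L: "L \<ge> 0" "\<And>x y. x \<in> J \<times> \<Lambda>\<^sub>0 \<Longrightarrow> y \<in> J \<times> \<Lambda>\<^sub>0 \<Longrightarrow>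
      dT ((\<lambda>(t, l). fl t l) x) ((\<lambda>(t, l). fl t l) y) \<le> L * prod_dist dist dT x y"
    using A1 unfolding assumption_A1_def lipschitz_wrt_def by blast
  show ?thesis
  proof (rule that[OF L(1)])
    fix t t' l l' assume a: "t \<in> J" "t' \<in> J" "l \<in> \<Lambda>\<^sub>0" "l' \<in> \<Lambda>\<^sub>0"
    have "dT (fl t l) (fl t' l') \<le> L * prod_dist dist dT (t, l) (t', l')" using L(2)[of "(t, l)" "(t', l')"] a by simp
    also have "\<dots> \<le> L * (\<bar>t - t'\<bar> + dT l l')"
    proof (rule mult_left_mono[OF _ L(1)])
      have "0 \<le> dT l l'" by (rule dT_nonneg) (use Lambda0_CX a in auto)
      then show "prod_dist dist dT (t, l) (t', l') \<le> \<bar>t - t'\<bar> + dT l l'" by (rule prod_dist_le)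
    qed
    finally show "dT (fl t l) (fl t' l') \<le> L * (\<bar>t - t'\<bar> + dT l l')" .
  qed
qed

text \<open>The flow is Lipschitz for the distances; near a given time and initial point it stays in one
  chart, where distances are comparable with Euclidean ones.\<close>

lemma flow_local:
  assumes t0: "t0 \<in> J" and c0: "c0 \<in> A" and y0: "y0 \<in> base c0" and c: "c \<in> A" "fst (fl t0 (lam c0 y0)) \<in> fst c"
  obtains r L where "r > 0" "L \<ge> 0" "ball y0 r \<subseteq> base c0"
    "\<And>t y. \<lbrakk>t \<in> J; \<bar>t - t0\<bar> < r; y \<in> ball y0 r\<rbrakk> \<Longrightarrow> fst (fl t (lam c0 y)) \<in> fst c"
    "\<And>t t' y y'. \<lbrakk>t \<in> J; t' \<in> J; \<bar>t - t0\<bar> < r; \<bar>t' - t0\<bar> < r; y \<in> ball y0 r; y' \<in> ball y0 r\<rbrakk> \<Longrightarrow>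
       norm (snd (cot_chart A c) (fl t (lam c0 y)) - snd (cot_chart A c) (fl t' (lam c0 y'))) \<le> L * (\<bar>t - t'\<bar> + norm (y - y'))"
proof -
  let ?C = "cot_chart A c"
  obtain K where K: "K \<ge> 0" "\<And>t t' l l'. \<lbrakk>t \<in> J; t' \<in> J; l \<in> \<Lambda>\<^sub>0; l' \<in> \<Lambda>\<^sub>0\<rbrakk> \<Longrightarrow>
     dT (fl t l) (fl t' l') \<le> K * (\<bar>t - t'\<bar> + dT l l')" using flow_lipschitz by metis
  obtain r1 M where M: "r1 > 0" "M \<ge> 0" "ball y0 r1 \<subseteq> base c0"
    "\<And>y y'. y \<in> ball y0 r1 \<Longrightarrow> y' \<in> ball y0 r1 \<Longrightarrow> dT (lam c0 y) (lam c0 y') \<le> M * norm (y - y')"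
    using lam_dT[OF c0 y0] by metis
  have z0: "fl t0 (lam c0 y0) \<in> CX" by (rule flow_D(5)[OF lam_coords(2)[OF c0 y0] t0])
  obtain r2 m where m: "r2 > 0" "m > 0"
    "\<And>z w. \<lbrakk>z \<in> CX; w \<in> CX; fst z \<in> fst c; norm (snd ?C z - snd ?C (fl t0 (lam c0 y0))) < r2; dT z w < m * r2\<rbrakk> \<Longrightarrow>
       fst w \<in> fst c \<and> m * norm (snd ?C w - snd ?C z) \<le> dT z w"
    using dT_lower[OF c(1) z0 c(2)] by metis
  define N where "N = K * (1 + M)"
  have N0: "N \<ge> 0" using K M by (simp add: N_def)
  have est: "dT (fl t (lam c0 y)) (fl t' (lam c0 y')) \<le> N * (\<bar>t - t'\<bar> + norm (y - y'))"
    if "t \<in> J" "t' \<in> J" "y \<in> ball y0 r1" "y' \<in> ball y0 r1" for t t' y y'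
  proof -
    have "y \<in> base c0" "y' \<in> base c0" using that M(3) by auto
    then have "dT (fl t (lam c0 y)) (fl t' (lam c0 y')) \<le> K * (\<bar>t - t'\<bar> + dT (lam c0 y) (lam c0 y'))"
      by (intro K(2) that lam_coords(2)[OF c0])
    also have "\<dots> \<le> K * (\<bar>t - t'\<bar> + M * norm (y - y'))"
      using M(4)[OF that(3,4)] K(1) by (intro mult_left_mono) auto
    also have "\<dots> \<le> K * ((1 + M) * (\<bar>t - t'\<bar> + norm (y - y')))"
      using K(1) M(2) by (intro mult_left_mono) (auto simp: algebra_simps)
    finally show ?thesis by (simp add: N_def mult.assoc)
  qed
  define r where "r = min r1 (m * r2 / (8 * (N + 1)))"
  have r: "r > 0" "r \<le> r1" using M m N0 by (auto simp: r_def)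
  have small: "N * (\<bar>t - t'\<bar> + norm (y - y')) < m * r2"
    if "\<bar>t - t0\<bar> < r" "\<bar>t' - t0\<bar> < r" "y \<in> ball y0 r" "y' \<in> ball y0 r" for t t' y y'
  proof -
    have "norm (y - y') \<le> norm (y - y0) + norm (y' - y0)"
      using norm_triangle_ineq4[of "y - y0" "y' - y0"] by simp
    then have "\<bar>t - t'\<bar> + norm (y - y') \<le> 4 * r" using that by (auto simp: dist_norm norm_minus_commute)
    then have "N * (\<bar>t - t'\<bar> + norm (y - y')) \<le> N * (4 * r)" using N0 by (rule mult_left_mono)
    also have "\<dots> \<le> N * (4 * (m * r2 / (8 * (N + 1))))"
      using N0 by (intro mult_left_mono) (auto simp: r_def)
    also have "\<dots> < m * r2"
    proof -
      have "N * (4 * (m * r2 / (8 * (N + 1)))) = (m * r2) * (N / (2 * (N + 1)))" using N0 by (simp add: field_simps)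
      also have "\<dots> < (m * r2) * 1" using N0 m by (intro mult_strict_left_mono) auto
      finally show ?thesis by simp
    qed
    finally show ?thesis .
  qed
  have flX: "fl t (lam c0 y) \<in> CX" if "t \<in> J" "y \<in> ball y0 r" for t y
  proof -
    have "y \<in> base c0" using that(2) M(3) r(2) by auto
    then show ?thesis by (intro flow_D(5)[OF lam_coords(2)[OF c0]] that(1))
  qed
  have y0r: "y0 \<in> ball y0 r" using r by simp
  have stay: "fst (fl t (lam c0 y)) \<in> fst c \<and> norm (snd ?C (fl t (lam c0 y)) - snd ?C (fl t0 (lam c0 y0))) < r2"
    if ty: "t \<in> J" "\<bar>t - t0\<bar> < r" "y \<in> ball y0 r" for t y
  proof -
    have e: "dT (fl t0 (lam c0 y0)) (fl t (lam c0 y)) \<le> N * (\<bar>t0 - t\<bar> + norm (y0 - y))"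
      by (rule est[OF t0 ty(1)]) (use ty(3) r M(1) in auto)
    have s: "N * (\<bar>t0 - t\<bar> + norm (y0 - y)) < m * r2"
      by (rule small) (use ty r in auto)
    have lt: "dT (fl t0 (lam c0 y0)) (fl t (lam c0 y)) < m * r2" using e s by linarith
    have "fst (fl t (lam c0 y)) \<in> fst c \<and>
        m * norm (snd ?C (fl t (lam c0 y)) - snd ?C (fl t0 (lam c0 y0))) \<le> dT (fl t0 (lam c0 y0)) (fl t (lam c0 y))"
      by (rule m(3)[OF z0 flX[OF ty(1,3)] c(2) _ lt]) (use m(1) in simp)
    moreover from this have "m * norm (snd ?C (fl t (lam c0 y)) - snd ?C (fl t0 (lam c0 y0))) < m * r2" using lt by linarith
    ultimately show ?thesis using m(2) by simp
  qed
  show ?thesis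
  proof (rule that[OF r(1), of "N / m"])
    show "0 \<le> N / m" using N0 m by simp
    show "ball y0 r \<subseteq> base c0" using M(3) r(2) by auto
    show "fst (fl t (lam c0 y)) \<in> fst c" if "t \<in> J" "\<bar>t - t0\<bar> < r" "y \<in> ball y0 r" for t y
      using stay[OF that] by blast
    fix t t' y y' assume a: "t \<in> J" "t' \<in> J" "\<bar>t - t0\<bar> < r" "\<bar>t' - t0\<bar> < r" "y \<in> ball y0 r" "y' \<in> ball y0 r"
    note s = stay[OF a(2,4,6)]
    have e: "dT (fl t' (lam c0 y')) (fl t (lam c0 y)) \<le> N * (\<bar>t' - t\<bar> + norm (y' - y))"
      by (rule est[OF a(2,1)]) (use a r in auto)
    have lt: "dT (fl t' (lam c0 y')) (fl t (lam c0 y)) < m * r2"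
      using e small[OF a(4,3,6,5)] by linarith
    have "m * norm (snd ?C (fl t (lam c0 y)) - snd ?C (fl t' (lam c0 y'))) \<le> N * (\<bar>t' - t\<bar> + norm (y' - y))"
      using m(3)[OF flX[OF a(2,6)] flX[OF a(1,5)] conjunct1[OF s] conjunct2[OF s] lt] e by linarith
    then show "norm (snd ?C (fl t (lam c0 y)) - snd ?C (fl t' (lam c0 y'))) \<le> N / m * (\<bar>t - t'\<bar> + norm (y - y'))"
      using m(2) by (simp add: field_simps abs_minus_commute norm_minus_commute)
  qed
qed

abbreviation "dens \<equiv> action_density A H fl"
abbreviation "tht \<equiv> theta A \<alpha> H fl"

lemma interval_J: "\<lbrakk>u \<in> J; v \<in> J\<rbrakk> \<Longrightarrow> {u..v} \<subseteq> J"
proof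
  fix x assume uv: "u \<in> J" "v \<in> J" and x: "x \<in> {u..v}"
  show "x \<in> J" by (rule mem_is_interval_1_I[OF J(2) uv]) (use x in auto)
qed

lemma density_J:
  assumes l: "l \<in> \<Lambda>\<^sub>0"
  shows "(\<lambda>t. dens t l) \<in> borel_measurable (lebesgue_on J)" "bounded ((\<lambda>t. dens t l) ` J)"
proof -
  have lc: "lipschitz_caratheodory J (subtopology (mtop CX CA) \<Lambda>\<^sub>0) dT dens"
    using A1 unfolding assumption_A1_def by blast
  have l': "l \<in> topspace (subtopology (mtop CX CA) \<Lambda>\<^sub>0)" using l Lambda0_CX[OF l] by simp
  show "(\<lambda>t. dens t l) \<in> borel_measurable (lebesgue_on J)" "bounded ((\<lambda>t. dens t l) ` J)"
    using lc l' unfolding lipschitz_caratheodory_def by blast+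
qed

lemma density_integrable:
  assumes l: "l \<in> \<Lambda>\<^sub>0" and uv: "{u..v} \<subseteq> J"
  shows "integrable (lebesgue_on {u..v}) (\<lambda>t. dens t l)"
proof -
  interpret S: finite_measure "lebesgue_on {u..v}" by (rule finite_measure_lebesgue_on) simp
  obtain B where B: "\<And>t. t \<in> J \<Longrightarrow> \<bar>dens t l\<bar> \<le> B"
    using density_J(2)[OF l] unfolding bounded_iff by auto
  have m: "(\<lambda>t. dens t l) \<in> borel_measurable (lebesgue_on {u..v})"
    by (rule measurable_restrict_mono[OF density_J(1)[OF l] uv])
  show ?thesis 
  proof (rule S.integrable_const_bound[where B = B, OF _ m])
    show "AE t in lebesgue_on {u..v}. norm (dens t l) \<le> B" by (rule AE_I2) (use B uv in auto)
  qed
qed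

lemma theta_eq: "tht t l = \<alpha> (fst l) + (\<integral>s. dens s l \<partial>lebesgue_on {0..t})"
  unfolding theta_def by (simp add: integral_restrict_space set_lebesgue_integral_def)

lemma theta_diff:
  assumes l: "l \<in> \<Lambda>\<^sub>0" and uv: "0 \<le> u" "u \<le> v" "v \<in> J"
  shows "tht v l - tht u l = (\<integral>s. dens s l \<partial>lebesgue_on {u..v})"
  using Equivalence_Measurable_On_Borel.integral_combine[OF density_integrable[OF l interval_J[OF J(3) uv(3)]] uv(1,2)]
  unfolding theta_eq by linarith

text \<open>The coordinate ball in \<open>\<Lambda>\<^sub>0\<close> has compact closure, on which the
  Caratheodory condition gives a Lipschitz constant that holds for almost all times.\<close>

lemma density_local:
  assumes c: "c \<in> A" and y0: "y0 \<in> base c"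
  obtains r B where "r > 0" "B \<ge> 0" "ball y0 r \<subseteq> base c"
    "\<And>y. y \<in> ball y0 r \<Longrightarrow> AE t in lebesgue. t \<in> J \<longrightarrow> \<bar>dens t (lam c y)\<bar> \<le> B"
    "\<And>y y'. y \<in> ball y0 r \<Longrightarrow> y' \<in> ball y0 r \<Longrightarrow>
       AE t in lebesgue. t \<in> J \<longrightarrow> \<bar>dens t (lam c y) - dens t (lam c y')\<bar> \<le> B * norm (y - y')"
proof -
  obtain r1 M where M: "r1 > 0" "M \<ge> 0" "ball y0 r1 \<subseteq> base c"
    "\<And>y y'. y \<in> ball y0 r1 \<Longrightarrow> y' \<in> ball y0 r1 \<Longrightarrow> dT (lam c y) (lam c y') \<le> M * norm (y - y')"
    using lam_dT[OF assms] by metis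
  obtain r2 L where L: "r2 > 0" "L \<ge> 0" "ball y0 r2 \<subseteq> base c"
    "\<And>y y'. y \<in> ball y0 r2 \<Longrightarrow> y' \<in> ball y0 r2 \<Longrightarrow>
       norm (snd (cot_chart A c) (lam c y) - snd (cot_chart A c) (lam c y')) \<le> L * norm (y - y')"
    using lam_lipschitz[OF assms] by metis
  define r where "r = min r1 r2 / 2"
  have r: "r > 0" using M L by (simp add: r_def)
  have cb: "cball y0 r \<subseteq> ball y0 r1" "cball y0 r \<subseteq> ball y0 r2" using M(1) L(1) by (auto simp: r_def)
  have bb: "cball y0 r \<subseteq> base c" using cb M(3) by blast
  define K where "K = lam c ` cball y0 r"
  have KL: "K \<subseteq> \<Lambda>\<^sub>0" using lam_coords(2)[OF c] bb by (auto simp: K_def)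
  have dom: "lam c ` cball y0 r \<subseteq> fst (cot_chart A c)"
    using lam_coords(1,4)[OF c] bb c by (auto simp: cot_chart_domain)
  have "continuous_on (cball y0 r) (snd (cot_chart A c) \<circ> lam c)"
  proof (rule continuous_onI)
    fix y e :: 'e and \<epsilon> :: real assume y: "y \<in> cball y0 r" and \<epsilon>: "\<epsilon> > 0"
    show "\<exists>d>0. \<forall>y'\<in>cball y0 r. dist y' y < d \<longrightarrow> dist ((snd (cot_chart A c) \<circ> lam c) y') ((snd (cot_chart A c) \<circ> lam c) y) \<le> \<epsilon>"
    proof (intro exI[of _ "\<epsilon> / (L + 1)"] conjI ballI impI)
      fix y' assume y': "y' \<in> cball y0 r" "dist y' y < \<epsilon> / (L + 1)"
      have "L * norm (y' - y) \<le> (L + 1) * norm (y' - y)" by (intro mult_right_mono) auto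
      also have "\<dots> \<le> \<epsilon>" using y'(2) L(2) by (simp add: dist_norm field_simps)
      finally show "dist ((snd (cot_chart A c) \<circ> lam c) y') ((snd (cot_chart A c) \<circ> lam c) y) \<le> \<epsilon>"
        using L(4)[of y' y] y y' cb(2) by (force simp: dist_norm)
    qed (use \<epsilon> L in auto)
  qed
  then have "continuous_map (top_of_set (cball y0 r)) (mtop CX CA) (lam c)"
    using cot.continuous_map_chart_iff[OF cot_chart_in[OF c] dom] by blast
  moreover have "compactin (top_of_set (cball y0 r)) (cball y0 r)" by (simp add: compactin_subtopology)
  ultimately have "compactin (mtop CX CA) K" unfolding K_def by (rule image_compactin[rotated])
  then have Kc: "compactin (subtopology (mtop CX CA) \<Lambda>\<^sub>0) K" using KL by (simp add: compactin_subtopology)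
  have "lipschitz_caratheodory J (subtopology (mtop CX CA) \<Lambda>\<^sub>0) dT dens"
    using A1 unfolding assumption_A1_def by blast
  then obtain m Bm where m: "AE t in lebesgue. t \<in> J \<longrightarrow> \<bar>m t\<bar> \<le> Bm"
    "AE t in lebesgue. t \<in> J \<longrightarrow> (\<forall>x\<in>K. \<forall>y\<in>K. dist (dens t x) (dens t y) \<le> m t * dT x y)"
    using Kc unfolding lipschitz_caratheodory_def by blast
  have ae: "AE t in lebesgue. t \<in> J \<longrightarrow> (\<forall>y\<in>ball y0 r. \<forall>y'\<in>ball y0 r.
      \<bar>dens t (lam c y) - dens t (lam c y')\<bar> \<le> (\<bar>Bm\<bar> * M) * norm (y - y'))"
    using m
  proof eventually_elim
    case (elim t)
    show ?case
    proof (intro impI ballI)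
      fix y y' assume t: "t \<in> J" and y: "y \<in> ball y0 r" "y' \<in> ball y0 r"
      then have k: "lam c y \<in> K" "lam c y' \<in> K" by (auto simp: K_def)
      have "y \<in> cball y0 r" "y' \<in> cball y0 r" using y by auto
      then have y1: "y \<in> ball y0 r1" "y' \<in> ball y0 r1" using cb by blast+
      have "lam c y \<in> CX" "lam c y' \<in> CX" using KL k Lambda0_CX by blast+
      then have d0: "0 \<le> dT (lam c y) (lam c y')" by (rule dT_nonneg)
      have "\<bar>dens t (lam c y) - dens t (lam c y')\<bar> \<le> m t * dT (lam c y) (lam c y')"
        using elim t k by (auto simp: dist_real_def)
      also have "\<dots> \<le> \<bar>Bm\<bar> * dT (lam c y) (lam c y')" using elim(1) t d0 by (intro mult_right_mono) auto
      also have "\<dots> \<le> \<bar>Bm\<bar> * (M * norm (y - y'))" using M(4)[OF y1] by (intro mult_left_mono) auto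
      finally show "\<bar>dens t (lam c y) - dens t (lam c y')\<bar> \<le> (\<bar>Bm\<bar> * M) * norm (y - y')" by simp
    qed
  qed
  obtain B0 where B0: "\<And>t. t \<in> J \<Longrightarrow> \<bar>dens t (lam c y0)\<bar> \<le> B0"
    using density_J(2)[OF lam_coords(2)[OF assms]] unfolding bounded_iff by auto
  define B where "B = \<bar>B0\<bar> + \<bar>Bm\<bar> * M * (r + 1)"
  have BM: "\<bar>Bm\<bar> * M \<le> B" "B \<ge> 0"
  proof -
    have "\<bar>Bm\<bar> * M * 1 \<le> \<bar>Bm\<bar> * M * (r + 1)" using r M(2) by (intro mult_left_mono) auto
    then show "\<bar>Bm\<bar> * M \<le> B" by (simp add: B_def)
    show "B \<ge> 0" using M(2) r by (simp add: B_def)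
  qed
  show ?thesis
  proof (rule that[OF r BM(2)])
    show "ball y0 r \<subseteq> base c" using bb ball_subset_cball by blast
    show "AE t in lebesgue. t \<in> J \<longrightarrow> \<bar>dens t (lam c y)\<bar> \<le> B" if y: "y \<in> ball y0 r" for y
      using ae
    proof eventually_elim
      case (elim t)
      show ?case
      proof
        assume t: "t \<in> J"
        have "\<bar>dens t (lam c y) - dens t (lam c y0)\<bar> \<le> (\<bar>Bm\<bar> * M) * norm (y - y0)" using elim t y r by simp
        also have "\<dots> \<le> (\<bar>Bm\<bar> * M) * (r + 1)"
          using y M(2) by (intro mult_left_mono) (auto simp: dist_norm norm_minus_commute)
        finally show "\<bar>dens t (lam c y)\<bar> \<le> B" using B0[OF t] by (simp add: B_def)
      qed
    qed
    show "AE t in lebesgue. t \<in> J \<longrightarrow> \<bar>dens t (lam c y) - dens t (lam c y')\<bar> \<le> B * norm (y - y')"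
      if y: "y \<in> ball y0 r" "y' \<in> ball y0 r" for y y'
      using ae
    proof eventually_elim
      case (elim t)
      have "(\<bar>Bm\<bar> * M) * norm (y - y') \<le> B * norm (y - y')" using BM by (intro mult_right_mono) auto
      then show ?case using elim y by fastforce
    qed
  qed
qed

lemma integral_abs_le_AE:
  fixes f :: "real \<Rightarrow> real"
  assumes f: "integrable (lebesgue_on {u..v}) f" and uv: "u \<le> v" "{u..v} \<subseteq> J" and B: "B \<ge> 0"
    and ae: "AE t in lebesgue. t \<in> J \<longrightarrow> \<bar>f t\<bar> \<le> B"
  shows "\<bar>\<integral>t. f t \<partial>lebesgue_on {u..v}\<bar> \<le> B * (v - u)"
proof -
  interpret S: finite_measure "lebesgue_on {u..v}" by (rule finite_measure_lebesgue_on) simp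
  have "AE t in lebesgue_on {u..v}. \<bar>f t\<bar> \<le> B"
  proof (subst AE_restrict_space_iff)
    show "AE t in lebesgue. t \<in> {u..v} \<longrightarrow> \<bar>f t\<bar> \<le> B"
      using ae by eventually_elim (use uv(2) in auto)
  qed simp
  then have "(\<integral>t. \<bar>f t\<bar> \<partial>lebesgue_on {u..v}) \<le> (\<integral>t. B \<partial>lebesgue_on {u..v})"
    by (intro integral_mono_AE) (use f in auto)
  also have "\<dots> = B * (v - u)" using uv by (simp add: measure_restrict_space)
  finally show ?thesis using integral_abs_bound[of "lebesgue_on {u..v}" f] by linarith
qed

text \<open>The densities at all points of the ball are bounded by the same constant, for almost all
  times.\<close>

lemma theta_lipschitz_time:
  assumes c: "c \<in> A" and y0: "y0 \<in> base c"
  obtains r B where "r > 0" "B \<ge> 0" "ball y0 r \<subseteq> base c"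
    "\<And>y u v. \<lbrakk>y \<in> ball y0 r; 0 \<le> u; u \<le> v; v \<in> J\<rbrakk> \<Longrightarrow> \<bar>tht v (lam c y) - tht u (lam c y)\<bar> \<le> B * (v - u)"
    "\<And>\<tau>. \<tau> \<in> J \<Longrightarrow> 0 \<le> \<tau> \<Longrightarrow> continuous_on (ball y0 r) (\<lambda>y. tht \<tau> (lam c y))"
proof -
  obtain r B where r: "r > 0" "B \<ge> 0" "ball y0 r \<subseteq> base c"
    "\<And>y. y \<in> ball y0 r \<Longrightarrow> AE t in lebesgue. t \<in> J \<longrightarrow> \<bar>dens t (lam c y)\<bar> \<le> B"
    "\<And>y y'. y \<in> ball y0 r \<Longrightarrow> y' \<in> ball y0 r \<Longrightarrow>
       AE t in lebesgue. t \<in> J \<longrightarrow> \<bar>dens t (lam c y) - dens t (lam c y')\<bar> \<le> B * norm (y - y')"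
    by (rule density_local[OF assms]) blast
  have L: "lam c y \<in> \<Lambda>\<^sub>0" if "y \<in> ball y0 r" for y using lam_coords(2)[OF c] that r(3) by blast
  show ?thesis
  proof (rule that[OF r(1-3)])
    fix y u v assume a: "y \<in> ball y0 r" "0 \<le> u" "u \<le> v" "v \<in> J"
    have s: "{u..v} \<subseteq> J" using interval_J[OF J(3) a(4)] a(2) by auto
    show "\<bar>tht v (lam c y) - tht u (lam c y)\<bar> \<le> B * (v - u)"
      unfolding theta_diff[OF L[OF a(1)] a(2-4)]
      by (rule integral_abs_le_AE[OF density_integrable[OF L[OF a(1)] s] a(3) s r(2) r(4)[OF a(1)]])
  next
    fix \<tau> assume \<tau>: "\<tau> \<in> J" "0 \<le> \<tau>"
    have s: "{0..\<tau>} \<subseteq> J" by (rule interval_J[OF J(3) \<tau>(1)])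
    have 1: "continuous_on (ball y0 r) (\<alpha> \<circ> chart_inv c)"
    proof (rule continuous_at_imp_continuous_on, rule ballI)
      fix y assume "y \<in> ball y0 r"
      then have "y \<in> base c" using r(3) by blast
      note b = base_D[OF c this]
      show "isCont (\<alpha> \<circ> chart_inv c) y"
        using has_derivative_continuous[OF alpha_has_derivative[OF c b(1,3)]] b(4) by simp
    qed
    have 2: "continuous_on (ball y0 r) (\<lambda>y. \<integral>t. dens t (lam c y) \<partial>lebesgue_on {0..\<tau>})"
    proof (rule continuous_onI)
      fix y and \<epsilon> :: real assume y: "y \<in> ball y0 r" and \<epsilon>: "\<epsilon> > 0"
      show "\<exists>d>0. \<forall>y'\<in>ball y0 r. dist y' y < d \<longrightarrow>
          dist (\<integral>t. dens t (lam c y') \<partial>lebesgue_on {0..\<tau>}) (\<integral>t. dens t (lam c y) \<partial>lebesgue_on {0..\<tau>}) \<le> \<epsilon>"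
      proof (intro exI[of _ "\<epsilon> / (B * \<tau> + 1)"] conjI ballI impI)
        have B\<tau>: "0 \<le> B * \<tau>" using r(2) \<tau>(2) by simp
        then show "0 < \<epsilon> / (B * \<tau> + 1)" using \<epsilon> by (intro divide_pos_pos) auto
        fix y' assume y': "y' \<in> ball y0 r" "dist y' y < \<epsilon> / (B * \<tau> + 1)"
        note i = density_integrable[OF L[OF y] s] density_integrable[OF L[OF y'(1)] s]
        have "\<bar>\<integral>t. dens t (lam c y') - dens t (lam c y) \<partial>lebesgue_on {0..\<tau>}\<bar> \<le> (B * norm (y' - y)) * (\<tau> - 0)"
          by (rule integral_abs_le_AE[OF _ \<tau>(2) s _ r(5)[OF y'(1) y]]) (use i r(2) in auto)
        also have "\<dots> \<le> (B * \<tau> + 1) * norm (y' - y)" by (simp add: algebra_simps)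
        also have "\<dots> \<le> \<epsilon>" using y'(2) B\<tau> by (simp add: dist_norm field_simps)
        finally show "dist (\<integral>t. dens t (lam c y') \<partial>lebesgue_on {0..\<tau>}) (\<integral>t. dens t (lam c y) \<partial>lebesgue_on {0..\<tau>}) \<le> \<epsilon>"
          using i by (simp add: dist_real_def)
      qed
    qed
    show "continuous_on (ball y0 r) (\<lambda>y. tht \<tau> (lam c y))"
    proof (rule continuous_on_eq[OF continuous_on_add[OF 1 2]])
      fix y assume "y \<in> ball y0 r"
      then have "y \<in> base c" using r(3) by blast
      then show "(\<alpha> \<circ> chart_inv c) y + (\<integral>t. dens t (lam c y) \<partial>lebesgue_on {0..\<tau>}) = tht \<tau> (lam c y)"
        using lam_coords(3)[OF c] by (simp add: theta_eq)
    qed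
  qed
qed

lemma pos_mom_norm:
  "norm (pos c z - pos c z') \<le> norm (snd (cot_chart A c) z - snd (cot_chart A c) z')"
  "norm (mom c z - mom c z') \<le> norm (snd (cot_chart A c) z - snd (cot_chart A c) z')"
proof -
  have e: "snd (cot_chart A c) z - snd (cot_chart A c) z' = (pos c z - pos c z', mom c z - mom c z')"
    by (simp add: cot_chart_coords)
  show "norm (pos c z - pos c z') \<le> norm (snd (cot_chart A c) z - snd (cot_chart A c) z')"
    unfolding e by (rule norm_fst_le)
  show "norm (mom c z - mom c z') \<le> norm (snd (cot_chart A c) z - snd (cot_chart A c) z')"
    unfolding e by (rule norm_snd_le)
qed

end

subsection \<open>The differential of the action\<close>

text \<open>A segment of initial points in a chart, the parameter strip to which the action expansion is
  applied.\<close>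

locale exact_ray = exact_flow X A gT \<alpha> D B\<^sub>0 J Q \<Lambda>\<^sub>0 H fl
  for X :: "'a set" and A :: "('a, 'e::euclidean_space) chart set" and gT \<alpha> D B\<^sub>0 J Q \<Lambda>\<^sub>0 H fl +
  fixes c0 :: "('a, 'e) chart" and y0 w :: 'e
  assumes c0: "c0 \<in> A" and ray: "\<And>s. s \<in> {0..1} \<Longrightarrow> y0 + s *\<^sub>R w \<in> base c0"
begin

definition l :: "real \<Rightarrow> ('a, 'e) covec" where "l s = lam c0 (y0 + s *\<^sub>R w)"

lemma l_in: "s \<in> {0..1} \<Longrightarrow> l s \<in> \<Lambda>\<^sub>0" "s \<in> {0..1} \<Longrightarrow> l s \<in> CX"
  unfolding l_def by (rule lam_coords(2)[OF c0 ray], assumption, rule lam_coords(1)[OF c0 ray])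

lemma ray_local:
  assumes \<tau>0: "\<tau>0 \<in> J" and s0: "s0 \<in> {0..1}" and c: "c \<in> A" "fst (fl \<tau>0 (l s0)) \<in> fst c"
  obtains r L where "r > 0" "L \<ge> 0"
    "\<And>t s. \<lbrakk>t \<in> J; \<bar>t - \<tau>0\<bar> < r; s \<in> {0..1}; \<bar>s - s0\<bar> < r\<rbrakk> \<Longrightarrow> fst (fl t (l s)) \<in> fst c"
    "\<And>t t' s s'. \<lbrakk>t \<in> J; t' \<in> J; \<bar>t - \<tau>0\<bar> < r; \<bar>t' - \<tau>0\<bar> < r; s \<in> {0..1}; s' \<in> {0..1}; \<bar>s - s0\<bar> < r; \<bar>s' - s0\<bar> < r\<rbrakk> \<Longrightarrow>
       norm (snd (cot_chart A c) (fl t (l s)) - snd (cot_chart A c) (fl t' (l s'))) \<le> L * (\<bar>s - s'\<bar> + \<bar>t - t'\<bar>)"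
proof -
  let ?y = "\<lambda>s. y0 + s *\<^sub>R w"
  obtain r L where r: "r > 0" "L \<ge> 0" "ball (?y s0) r \<subseteq> base c0"
    "\<And>t y. \<lbrakk>t \<in> J; \<bar>t - \<tau>0\<bar> < r; y \<in> ball (?y s0) r\<rbrakk> \<Longrightarrow> fst (fl t (lam c0 y)) \<in> fst c"
    "\<And>t t' y y'. \<lbrakk>t \<in> J; t' \<in> J; \<bar>t - \<tau>0\<bar> < r; \<bar>t' - \<tau>0\<bar> < r; y \<in> ball (?y s0) r; y' \<in> ball (?y s0) r\<rbrakk> \<Longrightarrow>
       norm (snd (cot_chart A c) (fl t (lam c0 y)) - snd (cot_chart A c) (fl t' (lam c0 y'))) \<le> L * (\<bar>t - t'\<bar> + norm (y - y'))"
    using flow_local[OF \<tau>0 c0 ray[OF s0] c(1)] c(2) unfolding l_def by metis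
  define W where "W = norm w + 1"
  have W: "W \<ge> 1" "norm w \<le> W" by (auto simp: W_def)
  have dy: "norm (?y s - ?y s') = \<bar>s - s'\<bar> * norm w" for s s'
  proof -
    have "?y s - ?y s' = (s - s') *\<^sub>R w" by (simp add: scaleR_diff_left)
    then show ?thesis by simp
  qed
  have near: "?y s \<in> ball (?y s0) r" if "\<bar>s - s0\<bar> < r / W" for s
  proof -
    have "\<bar>s0 - s\<bar> * norm w \<le> \<bar>s0 - s\<bar> * W" using W by (intro mult_left_mono) auto
    also have "\<dots> < r" using that W by (simp add: field_simps abs_minus_commute)
    finally show ?thesis unfolding mem_ball dist_norm dy .
  qed
  have rW: "r / W \<le> r" using r(1) W by (simp add: field_simps)
  show ?thesis
  proof (rule that[of "r / W" "L * W"])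
    show "0 < r / W" "0 \<le> L * W" using r W by auto
    show "fst (fl t (l s)) \<in> fst c" if "t \<in> J" "\<bar>t - \<tau>0\<bar> < r / W" "s \<in> {0..1}" "\<bar>s - s0\<bar> < r / W" for t s
      unfolding l_def by (rule r(4)) (use that rW near in auto)
    fix t t' s s' assume a: "t \<in> J" "t' \<in> J" "\<bar>t - \<tau>0\<bar> < r / W" "\<bar>t' - \<tau>0\<bar> < r / W" "s \<in> {0..1}" "s' \<in> {0..1}"
      "\<bar>s - s0\<bar> < r / W" "\<bar>s' - s0\<bar> < r / W"
    have "norm (snd (cot_chart A c) (fl t (l s)) - snd (cot_chart A c) (fl t' (l s'))) \<le> L * (\<bar>t - t'\<bar> + norm (?y s - ?y s'))"
      unfolding l_def by (rule r(5)) (use a rW near in auto)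
    also have "\<dots> \<le> L * (W * (\<bar>s - s'\<bar> + \<bar>t - t'\<bar>))"
    proof (rule mult_left_mono[OF _ r(2)])
      have "\<bar>t - t'\<bar> \<le> W * \<bar>t - t'\<bar>" using W mult_right_mono[of 1 W "\<bar>t - t'\<bar>"] by simp
      moreover have "\<bar>s - s'\<bar> * norm w \<le> W * \<bar>s - s'\<bar>" using W mult_left_mono[of "norm w" W "\<bar>s - s'\<bar>"] by (simp add: mult.commute)
      ultimately show "\<bar>t - t'\<bar> + norm (?y s - ?y s') \<le> W * (\<bar>s - s'\<bar> + \<bar>t - t'\<bar>)"
        unfolding dy by (simp add: distrib_left)
    qed
    finally show "norm (snd (cot_chart A c) (fl t (l s)) - snd (cot_chart A c) (fl t' (l s'))) \<le> L * W * (\<bar>s - s'\<bar> + \<bar>t - t'\<bar>)"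
      by (simp add: mult.assoc)
  qed
qed

definition rest :: "('a, 'e) chart \<Rightarrow> real \<Rightarrow> real \<Rightarrow> real \<Rightarrow> real" where
  "rest c \<tau> s s' = tht \<tau> (l s') - tht \<tau> (l s) - mom c (fl \<tau> (l s)) \<bullet> (pos c (fl \<tau> (l s')) - pos c (fl \<tau> (l s)))"

definition exact_at :: "('a, 'e) chart \<Rightarrow> real \<Rightarrow> real \<Rightarrow> bool" where
  "exact_at c \<tau> s \<longleftrightarrow> (\<forall>\<eta>>0. \<exists>d>0. \<forall>s'\<in>{0..1}. \<bar>s' - s\<bar> < d \<longrightarrow> \<bar>rest c \<tau> s s'\<bar> \<le> \<eta> * \<bar>s' - s\<bar>)"

text \<open>The covector pairs with displacements in the same way in all charts, to first order.\<close>

lemma exact_at_chart: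
  assumes \<tau>: "\<tau> \<in> J" and s: "s \<in> {0..1}" and c: "c \<in> A" "fst (fl \<tau> (l s)) \<in> fst c"
    and d: "d \<in> A" "fst (fl \<tau> (l s)) \<in> fst d" and E: "exact_at c \<tau> s"
  shows "exact_at d \<tau> s"
  unfolding exact_at_def
proof (intro allI impI)
  fix \<eta> :: real assume \<eta>: "\<eta> > 0"
  define z where "z s' = fl \<tau> (l s')" for s'
  have zX: "z s' \<in> CX" if "s' \<in> {0..1}" for s' unfolding z_def by (rule flow_D(5)[OF l_in(1)[OF that] \<tau>])
  obtain r L where r: "r > 0" "L \<ge> 0"
    "\<And>t s'. \<lbrakk>t \<in> J; \<bar>t - \<tau>\<bar> < r; s' \<in> {0..1}; \<bar>s' - s\<bar> < r\<rbrakk> \<Longrightarrow> fst (fl t (l s')) \<in> fst c"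
    "\<And>t t' s1 s'. \<lbrakk>t \<in> J; t' \<in> J; \<bar>t - \<tau>\<bar> < r; \<bar>t' - \<tau>\<bar> < r; s1 \<in> {0..1}; s' \<in> {0..1}; \<bar>s1 - s\<bar> < r; \<bar>s' - s\<bar> < r\<rbrakk> \<Longrightarrow>
       norm (snd (cot_chart A c) (fl t (l s1)) - snd (cot_chart A c) (fl t' (l s'))) \<le> L * (\<bar>s1 - s'\<bar> + \<bar>t - t'\<bar>)"
    using ray_local[OF \<tau> s c] by metis
  let ?F = "snd d \<circ> chart_inv c"
  define p where "p = norm (mom d (z s))"
  define e where "e = \<eta> / (2 * (p * L + 1))"
  have pL: "0 \<le> p * L" using r(2) by (simp add: p_def)
  have e: "e > 0" using \<eta> pL by (simp add: e_def)
  obtain \<delta> where \<delta>: "\<delta> > 0" "\<And>q. norm (q - pos c (z s)) < \<delta> \<Longrightarrow>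
      norm (?F q - ?F (pos c (z s)) - trans c d (pos c (z s)) (q - pos c (z s))) \<le> e * norm (q - pos c (z s))"
    using trans_has_derivative[OF c(1) d(1) c(2) d(2)] e unfolding has_derivative_within_alt pos_def z_def
    by (auto simp: has_derivative_at_alt)
  obtain d1 where d1: "d1 > 0" "\<And>s'. s' \<in> {0..1} \<Longrightarrow> \<bar>s' - s\<bar> < d1 \<Longrightarrow> \<bar>rest c \<tau> s s'\<bar> \<le> \<eta> / 2 * \<bar>s' - s\<bar>"
    using E[unfolded exact_at_def, rule_format, of "\<eta> / 2"] \<eta> by auto
  define d0 where "d0 = Min {r, d1, \<delta> / (L + 1)}"
  show "\<exists>d0>0. \<forall>s'\<in>{0..1}. \<bar>s' - s\<bar> < d0 \<longrightarrow> \<bar>rest d \<tau> s s'\<bar> \<le> \<eta> * \<bar>s' - s\<bar>"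
  proof (intro exI[of _ d0] conjI ballI impI)
    show "0 < d0" using r d1 \<delta> by (simp add: d0_def)
    fix s' :: real assume s': "s' \<in> {0..1}" "\<bar>s' - s\<bar> < d0"
    then have b: "\<bar>s' - s\<bar> < r" "\<bar>s' - s\<bar> < d1" "\<bar>s' - s\<bar> < \<delta> / (L + 1)" by (auto simp: d0_def)
    have zc: "fst (z s') \<in> fst c" unfolding z_def using r(3)[OF \<tau> _ s'(1) b(1)] r(1) by simp
    have q: "norm (pos c (z s') - pos c (z s)) \<le> L * \<bar>s' - s\<bar>"
      using order_trans[OF pos_mom_norm(1) r(4)[OF \<tau> \<tau> _ _ s'(1) s b(1)]] r(1) unfolding z_def by simp
    also have "\<dots> < \<delta>"
    proof -
      have "L * \<bar>s' - s\<bar> \<le> (L + 1) * \<bar>s' - s\<bar>" by (intro mult_right_mono) auto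
      also have "\<dots> < \<delta>" using b(3) r(2) by (simp add: field_simps)
      finally show ?thesis .
    qed
    finally have F: "norm (?F (pos c (z s')) - ?F (pos c (z s)) - trans c d (pos c (z s)) (pos c (z s') - pos c (z s)))
        \<le> e * norm (pos c (z s') - pos c (z s))" by (rule \<delta>(2))
    have pF: "?F (pos c (z s')) = pos d (z s')" "?F (pos c (z s)) = pos d (z s)"
      using zc c by (simp_all add: pos_def z_def)
    define R where "R = pos d (z s') - pos d (z s) - trans c d (pos c (z s)) (pos c (z s') - pos c (z s))"
    have "norm R \<le> e * (L * \<bar>s' - s\<bar>)"
      using F[unfolded pF, folded R_def] mult_left_mono[OF q, of e] e by linarith
    then have "\<bar>mom d (z s) \<bullet> R\<bar> \<le> p * (e * (L * \<bar>s' - s\<bar>))"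
      unfolding p_def by (intro order_trans[OF Cauchy_Schwarz_ineq2 mult_left_mono]) auto
    also have "\<dots> = (e * (p * L)) * \<bar>s' - s\<bar>" by simp
    also have "\<dots> \<le> \<eta> / 2 * \<bar>s' - s\<bar>"
    proof (rule mult_right_mono)
      have "e * (p * L) = (\<eta> / 2) * (p * L / (p * L + 1))" by (simp add: e_def)
      also have "\<dots> \<le> (\<eta> / 2) * 1" using \<eta> pL by (intro mult_left_mono) auto
      finally show "e * (p * L) \<le> \<eta> / 2" by simp
    qed simp
    finally have "\<bar>mom d (z s) \<bullet> R\<bar> \<le> \<eta> / 2 * \<bar>s' - s\<bar>" .
    moreover have "mom d (z s) \<bullet> trans c d (pos c (z s)) v = mom c (z s) \<bullet> v" for v
      by (rule mom_transform[OF zX[OF s] d(1) _ c(1), symmetric]) (use c d in \<open>simp_all add: z_def\<close>)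
    then have "rest d \<tau> s s' = rest c \<tau> s s' - mom d (z s) \<bullet> R"
      unfolding rest_def R_def z_def[symmetric] by (simp add: inner_diff_right)
    ultimately show "\<bar>rest d \<tau> s s'\<bar> \<le> \<eta> * \<bar>s' - s\<bar>" using d1(2)[OF s'(1) b(2)] by linarith
  qed
qed

text \<open>At time zero the action is \<open>\<alpha>\<close>, and the points of
  \<open>\<Lambda>\<^sub>0\<close> are the differentials of \<open>\<alpha>\<close>.\<close>

lemma exact_at_0:
  assumes s: "s \<in> {0..1}"
  shows "exact_at c0 0 s"
  unfolding exact_at_def
proof (intro allI impI)
  fix \<eta> :: real assume \<eta>: "\<eta> > 0"
  let ?y = "\<lambda>s. y0 + s *\<^sub>R w"
  let ?a = "\<alpha> \<circ> chart_inv c0"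
  note b = base_D[OF c0 ray[OF s]]
  have "(?a has_derivative frechet_derivative ?a (at (?y s))) (at (?y s))"
    using alpha_has_derivative[OF c0 b(1,3)] unfolding b(4) .
  moreover define e where "e = \<eta> / (norm w + 1)"
  have e: "e > 0" using \<eta> by (simp add: e_def add_nonneg_pos)
  ultimately obtain \<delta> where \<delta>: "\<delta> > 0" "\<And>y. norm (y - ?y s) < \<delta> \<Longrightarrow>
      \<bar>?a y - ?a (?y s) - frechet_derivative ?a (at (?y s)) (y - ?y s)\<bar> \<le> e * norm (y - ?y s)"
    unfolding has_derivative_at_alt by auto
  show "\<exists>d>0. \<forall>s'\<in>{0..1}. \<bar>s' - s\<bar> < d \<longrightarrow> \<bar>rest c0 0 s s'\<bar> \<le> \<eta> * \<bar>s' - s\<bar>"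
  proof (intro exI[of _ "\<delta> / (norm w + 1)"] conjI ballI impI)
    have W: "norm w + 1 > 0" by (simp add: add_nonneg_pos)
    show "0 < \<delta> / (norm w + 1)" using \<delta>(1) W by simp
    fix s' :: real assume s': "s' \<in> {0..1}" "\<bar>s' - s\<bar> < \<delta> / (norm w + 1)"
    have dy: "?y s' - ?y s = (s' - s) *\<^sub>R w" by (simp add: scaleR_diff_left)
    have "norm (?y s' - ?y s) \<le> \<bar>s' - s\<bar> * (norm w + 1)" unfolding dy norm_scaleR by (intro mult_left_mono) auto
    moreover have "\<bar>s' - s\<bar> * (norm w + 1) < \<delta>" using s'(2) W by (simp add: field_simps)
    ultimately have "\<bar>?a (?y s') - ?a (?y s) - frechet_derivative ?a (at (?y s)) (?y s' - ?y s)\<bar> \<le> e * norm (?y s' - ?y s)"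
      by (intro \<delta>(2)) linarith
    also have "\<dots> \<le> e * (\<bar>s' - s\<bar> * (norm w + 1))"
      using \<open>norm (?y s' - ?y s) \<le> \<bar>s' - s\<bar> * (norm w + 1)\<close> e by (intro mult_left_mono) auto
    also have "\<dots> = \<eta> * \<bar>s' - s\<bar>" using W by (simp add: e_def)
    finally have main: "\<bar>?a (?y s') - ?a (?y s) - frechet_derivative ?a (at (?y s)) (?y s' - ?y s)\<bar> \<le> \<eta> * \<bar>s' - s\<bar>" .
    have th: "tht 0 (l s) = ?a (?y s)" if "s \<in> {0..1}" for s
    proof -
      have "integral\<^sup>L (lebesgue_on {0..0::real}) (\<lambda>t. dens t (l s)) = 0"
        using theta_diff[OF l_in(1)[OF that], of 0 0] J(3) by simp
      then show ?thesis using lam_coords(3)[OF c0 ray[OF that]] by (simp add: theta_eq l_def)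
    qed
    have f0: "fl 0 (l s) = l s" if "s \<in> {0..1}" for s by (rule flow_D(1)[OF l_in(1)[OF that]])
    have p: "pos c0 (l s) = ?y s" if "s \<in> {0..1}" for s unfolding l_def by (rule lam_coords(5)[OF c0 ray[OF that]])
    have m: "mom c0 (l s) \<bullet> v = frechet_derivative ?a (at (?y s)) v" for v
      unfolding l_def lam_def using diff_covec_coords(4)[OF c0 b(1,3)] unfolding b(4) .
    show "\<bar>rest c0 0 s s'\<bar> \<le> \<eta> * \<bar>s' - s\<bar>"
      unfolding rest_def f0[OF s] f0[OF s'(1)] th[OF s] th[OF s'(1)] p[OF s] p[OF s'(1)] m by (rule main)
  qed
qed

definition exact_near :: "real \<Rightarrow> real \<Rightarrow> bool" where
  "exact_near s0 \<tau> \<longleftrightarrow> (\<exists>\<delta>>0. \<forall>s\<in>{0..1}. \<bar>s - s0\<bar> < \<delta> \<longrightarrow>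
     (\<forall>c\<in>A. fst (fl \<tau> (l s)) \<in> fst c \<longrightarrow> exact_at c \<tau> s))"

lemma rest_swap:
  "rest c \<tau> s s' = - rest c \<tau> s' s
     + (mom c (fl \<tau> (l s')) - mom c (fl \<tau> (l s))) \<bullet> (pos c (fl \<tau> (l s')) - pos c (fl \<tau> (l s)))"
  by (simp add: rest_def inner_diff_left inner_diff_right)

text \<open>Exactness is transported forward over a time interval on which the strip stays in one cotangent
  chart. There it even holds with a quadratic error, by \<open>action_expansion_strip\<close>.\<close>

lemma exact_step:
  assumes \<tau>0: "\<tau>0 \<in> J" and s0: "s0 \<in> {0..1}"
  shows "\<exists>r>0. \<forall>\<tau>1 \<tau>2. 0 \<le> \<tau>1 \<and> \<tau>1 \<le> \<tau>2 \<and> \<tau>2 \<in> J \<and> \<bar>\<tau>1 - \<tau>0\<bar> < r \<and> \<bar>\<tau>2 - \<tau>0\<bar> < r \<and> exact_near s0 \<tau>1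
     \<longrightarrow> exact_near s0 \<tau>2"
proof -
  obtain c where c: "c \<in> A" "fst (fl \<tau>0 (l s0)) \<in> fst c"
    using exists_chart[OF CX_D(1)[OF flow_D(5)[OF l_in(1)[OF s0] \<tau>0]]] by blast
  obtain r1 L where r1: "r1 > 0" "L \<ge> 0"
    "\<And>t s. \<lbrakk>t \<in> J; \<bar>t - \<tau>0\<bar> < r1; s \<in> {0..1}; \<bar>s - s0\<bar> < r1\<rbrakk> \<Longrightarrow> fst (fl t (l s)) \<in> fst c"
    "\<And>t t' s s'. \<lbrakk>t \<in> J; t' \<in> J; \<bar>t - \<tau>0\<bar> < r1; \<bar>t' - \<tau>0\<bar> < r1; s \<in> {0..1}; s' \<in> {0..1}; \<bar>s - s0\<bar> < r1; \<bar>s' - s0\<bar> < r1\<rbrakk> \<Longrightarrow>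
       norm (snd (cot_chart A c) (fl t (l s)) - snd (cot_chart A c) (fl t' (l s'))) \<le> L * (\<bar>s - s'\<bar> + \<bar>t - t'\<bar>)"
    by (rule ray_local[OF \<tau>0 s0 c]) blast
  obtain r2 B where r2: "r2 > 0"
    "\<And>\<tau>. \<tau> \<in> J \<Longrightarrow> 0 \<le> \<tau> \<Longrightarrow> continuous_on (ball (y0 + s0 *\<^sub>R w) r2) (\<lambda>y. tht \<tau> (lam c0 y))"
    by (rule theta_lipschitz_time[OF c0 ray[OF s0]]) blast
  define W where "W = norm w + 1"
  have W: "W > 0" by (simp add: W_def add_nonneg_pos)
  show ?thesis
  proof (intro exI[of _ r1] conjI allI impI r1(1), elim conjE)
    fix \<tau>1 \<tau>2 assume t: "0 \<le> \<tau>1" "\<tau>1 \<le> \<tau>2" "\<tau>2 \<in> J" "\<bar>\<tau>1 - \<tau>0\<bar> < r1" "\<bar>\<tau>2 - \<tau>0\<bar> < r1" and E1: "exact_near s0 \<tau>1"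
    obtain \<delta> where \<delta>: "\<delta> > 0" "\<And>s c. \<lbrakk>s \<in> {0..1}; \<bar>s - s0\<bar> < \<delta>; c \<in> A; fst (fl \<tau>1 (l s)) \<in> fst c\<rbrakk> \<Longrightarrow> exact_at c \<tau>1 s"
      using E1 unfolding exact_near_def by blast
    define m where "m = min r1 (min (r2 / W) \<delta>)"
    have "r2 / W > 0" using r2(1) W by simp
    then have m: "m > 0" "m \<le> r1" "m \<le> r2 / W" "m \<le> \<delta>" using r1(1) \<delta>(1) unfolding m_def by linarith+
    define \<rho> where "\<rho> = m / 2"
    have \<rho>: "\<rho> > 0" and \<rho>lt: "\<rho> < r1" "\<rho> < r2 / W" "\<rho> < \<delta>"
      using m unfolding \<rho>_def by linarith+
    define a where "a = max 0 (s0 - \<rho>)"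
    define b where "b = min 1 (s0 + \<rho>)"
    have ab: "a \<le> b" using s0 \<rho> by (auto simp: a_def b_def)
    have inI: "s \<in> {0..1}" "\<bar>s - s0\<bar> \<le> \<rho>" if "s \<in> {a..b}" for s using that by (auto simp: a_def b_def)
    have Iab: "s \<in> {a..b}" if "s \<in> {0..1}" "\<bar>s - s0\<bar> \<le> \<rho>" for s using that by (auto simp: a_def b_def)
    have lt1: "\<bar>s - s0\<bar> < r1" "\<bar>s - s0\<bar> < \<delta>" if "s \<in> {a..b}" for s using inI(2)[OF that] \<rho>lt by auto
    have tJ: "t \<in> J" "\<bar>t - \<tau>0\<bar> < r1" "0 \<le> t" if "t \<in> {\<tau>1..\<tau>2}" for t
    proof -
      have "{0..\<tau>2} \<subseteq> J" by (rule interval_J[OF J(3) t(3)])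
      then show "t \<in> J" using that t(1) by auto
      show "\<bar>t - \<tau>0\<bar> < r1" using that t by auto
      show "0 \<le> t" using that t(1) by auto
    qed
    have sJ: "{\<tau>1..\<tau>2} \<subseteq> J" using tJ by blast
    have zc: "fst (fl t (l s)) \<in> fst c" if "t \<in> {\<tau>1..\<tau>2}" "s \<in> {a..b}" for t s
      by (rule r1(3)[OF tJ(1,2)[OF that(1)] inI(1)[OF that(2)] lt1(1)[OF that(2)]])
    have zX: "fl t (l s) \<in> CX" if "t \<in> {\<tau>1..\<tau>2}" "s \<in> {a..b}" for t s
      by (rule flow_D(5)[OF l_in(1)[OF inI(1)[OF that(2)]] tJ(1)[OF that(1)]])
    have lip: "norm (snd (cot_chart A c) (fl t (l s)) - snd (cot_chart A c) (fl t' (l s'))) \<le> L * (\<bar>s - s'\<bar> + \<bar>t - t'\<bar>)"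
      if "s \<in> {a..b}" "s' \<in> {a..b}" "t \<in> {\<tau>1..\<tau>2}" "t' \<in> {\<tau>1..\<tau>2}" for s s' t t'
      by (rule r1(4)[OF tJ(1)[OF that(3)] tJ(1)[OF that(4)] tJ(2)[OF that(3)] tJ(2)[OF that(4)]
            inI(1)[OF that(1)] inI(1)[OF that(2)] lt1(1)[OF that(1)] lt1(1)[OF that(2)]])
    define q where "q s t = pos c (fl t (l s))" for s t
    define p where "p s t = mom c (fl t (l s))" for s t
    have lipq: "norm (q s t - q s' t') \<le> L * (\<bar>s - s'\<bar> + \<bar>t - t'\<bar>)"
      and lipp: "norm (p s t - p s' t') \<le> L * (\<bar>s - s'\<bar> + \<bar>t - t'\<bar>)"
      if "s \<in> {a..b}" "s' \<in> {a..b}" "t \<in> {\<tau>1..\<tau>2}" "t' \<in> {\<tau>1..\<tau>2}" for s s' t t'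
      unfolding q_def p_def by (rule order_trans[OF pos_mom_norm(1) lip[OF that]], rule order_trans[OF pos_mom_norm(2) lip[OF that]])
    define V where "V s t = ham_vec A (H t) (fl t (l s)) (cot_chart A c)" for s t
    have dens_eq: "dens t (l s) = p s t \<bullet> fst (V s t) - H t (fl t (l s))" if "t \<in> {\<tau>1..\<tau>2}" "s \<in> {a..b}" for t s
    proof -
      have "ham_vec A (H t) (fl t (l s)) \<in> tangent_space CA (fl t (l s))"
        by (rule ham_vec_eq(1)[OF zX[OF that] c(1) zc[OF that] flow_D(4)[OF l_in(1)[OF inI(1)[OF that(2)]] tJ(1)[OF that(1)]]])
      from liouville_eq[OF zX[OF that] c(1) zc[OF that] this] show ?thesis
        unfolding action_density_def p_def V_def by simp
    qed
    \<comment> \<open>The expansion theorem compares increasing parameters; \<open>rest_swap\<close> gives the others in \<open>quad2\<close>.\<close>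
    have quad: "\<bar>rest c \<tau>2 s s'\<bar> \<le> L\<^sup>2 * (s' - s)\<^sup>2" if ss: "s \<in> {a..b}" "s' \<in> {a..b}" "s \<le> s'" for s s'
    proof -
      have "\<bar>tht \<tau>2 (l s') - tht \<tau>2 (l s) - p s \<tau>2 \<bullet> (q s' \<tau>2 - q s \<tau>2)\<bar> \<le> L\<^sup>2 * (s' - s)\<^sup>2"
      proof (rule action_expansion_strip[where q = q and p = p and h = "\<lambda>s t. H t (fl t (l s))"
            and Hq = "\<lambda>s t. - snd (V s t)" and Hp = "\<lambda>s t. fst (V s t)" and ?\<theta>0.0 = "\<lambda>s. tht \<tau>1 (l s)"
            and ?\<theta>1.0 = "\<lambda>s. tht \<tau>2 (l s)" and K = "L\<^sup>2", OF t(2) ab r1(2) lipq lipp])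
        fix s t and \<eta> :: real assume s: "s \<in> {a..b}" and t': "t \<in> {\<tau>1..\<tau>2}" and \<eta>: "\<eta> > 0"
        let ?f = "\<lambda>q. H t (cot_point c (fst q) (snd q))"
        let ?z = "\<lambda>s. snd (cot_chart A c) (fl t (l s))"
        have zz: "?z s = (q s t, p s t)" for s by (simp add: cot_chart_coords q_def p_def)
        have f: "H t (cot_point c (q s t) (p s t)) = H t (fl t (l s))" if "s \<in> {a..b}" for s
          using cot_point_coords[OF zX[OF t' that] c(1) zc[OF t' that]] by (simp add: q_def p_def)
        have "(?f has_derivative (\<lambda>v. snd v \<bullet> fst (V s t) - snd (V s t) \<bullet> fst v)) (at (?z s))"
          unfolding zz V_def q_def p_def
          by (rule ham_vec_eq(2)[OF zX[OF t' s] c(1) zc[OF t' s] flow_D(4)[OF l_in(1)[OF inI(1)[OF s]] tJ(1)[OF t']]])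
        moreover define e where "e = \<eta> / (L + 1)"
        have e: "e > 0" using \<eta> r1(2) by (simp add: e_def)
        ultimately obtain d where d: "d > 0" "\<And>v. norm (v - ?z s) < d \<Longrightarrow>
            \<bar>?f v - ?f (?z s) - (snd (v - ?z s) \<bullet> fst (V s t) - snd (V s t) \<bullet> fst (v - ?z s))\<bar> \<le> e * norm (v - ?z s)"
          unfolding has_derivative_at_alt by auto
        show "\<exists>d>0. \<forall>s'\<in>{a..b}. \<bar>s' - s\<bar> < d \<longrightarrow>
          \<bar>H t (fl t (l s')) - H t (fl t (l s)) - (- snd (V s t) \<bullet> (q s' t - q s t) + fst (V s t) \<bullet> (p s' t - p s t))\<bar> \<le> \<eta> * \<bar>s' - s\<bar>"
        proof (intro exI[of _ "d / (L + 1)"] conjI ballI impI)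
          show "0 < d / (L + 1)" using d(1) r1(2) by simp
          fix s' assume s': "s' \<in> {a..b}" "\<bar>s' - s\<bar> < d / (L + 1)"
          have n: "norm (?z s' - ?z s) \<le> L * \<bar>s' - s\<bar>" using lip[OF s'(1) s t' t'] by simp
          have "L * \<bar>s' - s\<bar> \<le> (L + 1) * \<bar>s' - s\<bar>" by (intro mult_right_mono) auto
          also have "\<dots> < d" using s'(2) r1(2) by (simp add: field_simps)
          finally have "norm (?z s' - ?z s) < d" using n by linarith
          from d(2)[OF this] have "\<bar>H t (fl t (l s')) - H t (fl t (l s)) - ((p s' t - p s t) \<bullet> fst (V s t) - snd (V s t) \<bullet> (q s' t - q s t))\<bar>
              \<le> e * norm (?z s' - ?z s)"
            by (simp add: zz f[OF s'(1)] f[OF s])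
          also have "\<dots> \<le> e * ((L + 1) * \<bar>s' - s\<bar>)"
            using n \<open>L * \<bar>s' - s\<bar> \<le> (L + 1) * \<bar>s' - s\<bar>\<close> e by (intro mult_left_mono) auto
          also have "\<dots> = \<eta> * \<bar>s' - s\<bar>" using r1(2) by (simp add: e_def)
          finally show "\<bar>H t (fl t (l s')) - H t (fl t (l s)) - (- snd (V s t) \<bullet> (q s' t - q s t) + fst (V s t) \<bullet> (p s' t - p s t))\<bar> \<le> \<eta> * \<bar>s' - s\<bar>"
            by (simp add: inner_commute)
        qed
      next
        fix s assume s: "s \<in> {a..b}"
        have "AE t in lebesgue. t \<in> {\<tau>1..\<tau>2} \<longrightarrow> ((\<lambda>t. q s t) has_vector_derivative fst (V s t)) (at t within {\<tau>1..\<tau>2}) \<and>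
            ((\<lambda>t. p s t) has_vector_derivative - (- snd (V s t))) (at t within {\<tau>1..\<tau>2})"
          using flow_D(3)[OF l_in(1)[OF inI(1)[OF s]]]
        proof eventually_elim
          case (elim t)
          show ?case
          proof
            assume t': "t \<in> {\<tau>1..\<tau>2}"
            have hv: "has_velocity CA (\<lambda>t. fl t (l s)) J t (ham_vec A (H t) (fl t (l s)))" using elim tJ(1)[OF t'] by blast
            note cv = cot_velocity[OF c(1) zX[OF t' s] zc[OF t' s] hv]
            show "((\<lambda>t. q s t) has_vector_derivative fst (V s t)) (at t within {\<tau>1..\<tau>2}) \<and>
              ((\<lambda>t. p s t) has_vector_derivative - (- snd (V s t))) (at t within {\<tau>1..\<tau>2})"
              using has_vector_derivative_within_subset[OF cv(1) sJ] has_vector_derivative_within_subset[OF cv(2) sJ]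
              by (simp add: q_def p_def V_def)
          qed
        qed
        then show "AE t in lebesgue_on {\<tau>1..\<tau>2}. ((\<lambda>t. q s t) has_vector_derivative fst (V s t)) (at t within {\<tau>1..\<tau>2}) \<and>
            ((\<lambda>t. p s t) has_vector_derivative - (- snd (V s t))) (at t within {\<tau>1..\<tau>2})"
          by (subst AE_restrict_space_iff) simp_all
        show "integrable (lebesgue_on {\<tau>1..\<tau>2}) (\<lambda>t. p s t \<bullet> fst (V s t) - H t (fl t (l s)))"
          using density_integrable[OF l_in(1)[OF inI(1)[OF s]] sJ] dens_eq[OF _ s]
          by (subst Bochner_Integration.integrable_cong[OF refl, of _ _ "\<lambda>t. dens t (l s)"]) auto
        show "tht \<tau>2 (l s) - tht \<tau>1 (l s) = (\<integral>t. p s t \<bullet> fst (V s t) - H t (fl t (l s)) \<partial>lebesgue_on {\<tau>1..\<tau>2})"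
          unfolding theta_diff[OF l_in(1)[OF inI(1)[OF s]] t(1-3)]
          by (rule Bochner_Integration.integral_cong) (use dens_eq[OF _ s] in auto)
      next
        show "continuous_on {a..b} (\<lambda>s. tht \<tau>2 (l s))"
          unfolding l_def
        proof (rule continuous_on_compose2[OF r2(2)])
          show "\<tau>2 \<in> J" "0 \<le> \<tau>2" using t by auto
          show "continuous_on {a..b} (\<lambda>s. y0 + s *\<^sub>R w)" by (intro continuous_intros)
          show "(\<lambda>s. y0 + s *\<^sub>R w) ` {a..b} \<subseteq> ball (y0 + s0 *\<^sub>R w) r2"
          proof
            fix y assume "y \<in> (\<lambda>s. y0 + s *\<^sub>R w) ` {a..b}"
            then obtain s where s: "s \<in> {a..b}" "y = y0 + s *\<^sub>R w" by blast
            have "norm ((y0 + s0 *\<^sub>R w) - y) = \<bar>s - s0\<bar> * norm w"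
            proof -
              have "(y0 + s0 *\<^sub>R w) - y = (s0 - s) *\<^sub>R w" by (simp add: s(2) scaleR_diff_left)
              then show ?thesis by (simp add: abs_minus_commute)
            qed
            also have "\<dots> \<le> \<bar>s - s0\<bar> * W" by (intro mult_left_mono) (auto simp: W_def)
            also have "\<dots> < r2"
              using order_le_less_trans[OF inI(2)[OF s(1)] \<rho>lt(2)] W by (simp add: pos_less_divide_eq)
            finally show "y \<in> ball (y0 + s0 *\<^sub>R w) r2" by (simp add: dist_norm)
          qed
        qed
      next
        fix s s' assume s: "s \<in> {a..b}" "s' \<in> {a..b}" "s \<le> s'"
        have t1: "\<tau>1 \<in> {\<tau>1..\<tau>2}" using t(2) by simp
        have sub: "\<sigma> \<in> {a..b}" if "\<sigma> \<in> {s..s'}" for \<sigma> using s that by auto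
        have "\<bar>tht \<tau>1 (l s') - tht \<tau>1 (l s) - p s \<tau>1 \<bullet> (q s' \<tau>1 - q s \<tau>1)\<bar> \<le> (L * (s' - s)) * L * (s' - s)"
        proof (rule expansion_of_pointwise[where p = "\<lambda>s. p s \<tau>1" and q = "\<lambda>s. q s \<tau>1" and \<theta> = "\<lambda>s. tht \<tau>1 (l s)", OF s(3) r1(2)])
          fix \<sigma> and \<eta> :: real assume \<sigma>: "\<sigma> \<in> {s..s'}" and \<eta>: "\<eta> > 0"
          note \<sigma>' = sub[OF \<sigma>]
          have "exact_at c \<tau>1 \<sigma>" by (rule \<delta>(2)[OF inI(1)[OF \<sigma>'] lt1(2)[OF \<sigma>'] c(1) zc[OF t1 \<sigma>']])
          then obtain d where d: "d > 0" "\<And>s'. s' \<in> {0..1} \<Longrightarrow> \<bar>s' - \<sigma>\<bar> < d \<Longrightarrow> \<bar>rest c \<tau>1 \<sigma> s'\<bar> \<le> \<eta> * \<bar>s' - \<sigma>\<bar>"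
            using \<eta> unfolding exact_at_def by blast
          show "\<exists>d>0. \<forall>s'\<in>{s..s'}. \<bar>s' - \<sigma>\<bar> < d \<longrightarrow>
              \<bar>tht \<tau>1 (l s') - tht \<tau>1 (l \<sigma>) - p \<sigma> \<tau>1 \<bullet> (q s' \<tau>1 - q \<sigma> \<tau>1)\<bar> \<le> \<eta> * \<bar>s' - \<sigma>\<bar>"
          proof (intro exI[of _ d] conjI ballI impI d(1))
            fix \<sigma>2 assume "\<sigma>2 \<in> {s..s'}" "\<bar>\<sigma>2 - \<sigma>\<bar> < d"
            then show "\<bar>tht \<tau>1 (l \<sigma>2) - tht \<tau>1 (l \<sigma>) - p \<sigma> \<tau>1 \<bullet> (q \<sigma>2 \<tau>1 - q \<sigma> \<tau>1)\<bar> \<le> \<eta> * \<bar>\<sigma>2 - \<sigma>\<bar>"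
              using d(2)[OF inI(1)[OF sub]] unfolding rest_def p_def q_def by blast
          qed
        next
          show "norm (q \<sigma>' \<tau>1 - q \<sigma> \<tau>1) \<le> L * \<bar>\<sigma>' - \<sigma>\<bar>" if "\<sigma> \<in> {s..s'}" "\<sigma>' \<in> {s..s'}" for \<sigma> \<sigma>'
            using lipq[OF sub[OF that(2)] sub[OF that(1)] t1 t1] by simp
          show "norm (p \<sigma> \<tau>1 - p s \<tau>1) \<le> L * (s' - s)" if \<sigma>: "\<sigma> \<in> {s..s'}" for \<sigma>
          proof -
            have "norm (p \<sigma> \<tau>1 - p s \<tau>1) \<le> L * \<bar>\<sigma> - s\<bar>" using lipp[OF sub[OF \<sigma>] s(1) t1 t1] by simp
            also have "\<dots> \<le> L * (s' - s)" using \<sigma> r1(2) by (intro mult_left_mono) auto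
            finally show ?thesis .
          qed
        qed
        then show "\<bar>tht \<tau>1 (l s') - tht \<tau>1 (l s) - p s \<tau>1 \<bullet> (q s' \<tau>1 - q s \<tau>1)\<bar> \<le> L\<^sup>2 * (s' - s)\<^sup>2"
          by (simp add: power2_eq_square mult_ac)
      qed (use ss in auto)
      then show ?thesis by (simp add: rest_def p_def q_def)
    qed
    have t2: "\<tau>2 \<in> {\<tau>1..\<tau>2}" using t(2) by simp
    have quad2: "\<bar>rest c \<tau>2 s s'\<bar> \<le> 2 * L\<^sup>2 * (s' - s)\<^sup>2" if ss: "s \<in> {a..b}" "s' \<in> {a..b}" for s s'
    proof (cases "s \<le> s'")
      case True
      have "L\<^sup>2 * (s' - s)\<^sup>2 \<le> 2 * L\<^sup>2 * (s' - s)\<^sup>2" by simp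
      then show ?thesis using quad[OF ss True] by linarith
    next
      case False
      have "\<bar>(p s' \<tau>2 - p s \<tau>2) \<bullet> (q s' \<tau>2 - q s \<tau>2)\<bar> \<le> (L * \<bar>s' - s\<bar>) * (L * \<bar>s' - s\<bar>)"
        by (rule order_trans[OF Cauchy_Schwarz_ineq2 mult_mono])
           (use lipp[OF ss(2,1) t2 t2] lipq[OF ss(2,1) t2 t2] r1(2) in auto)
      also have "\<dots> = L\<^sup>2 * (s' - s)\<^sup>2" by (simp add: power2_eq_square)
      finally have "\<bar>(p s' \<tau>2 - p s \<tau>2) \<bullet> (q s' \<tau>2 - q s \<tau>2)\<bar> \<le> L\<^sup>2 * (s' - s)\<^sup>2" .
      moreover have "\<bar>rest c \<tau>2 s' s\<bar> \<le> L\<^sup>2 * (s' - s)\<^sup>2"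
        using quad[OF ss(2,1)] False by (simp add: power2_commute[of s s'])
      ultimately show ?thesis using rest_swap[of c \<tau>2 s s'] unfolding p_def q_def by linarith
    qed
    show "exact_near s0 \<tau>2"
      unfolding exact_near_def
    proof (intro exI[of _ \<rho>] conjI ballI impI \<rho>)
      fix s d assume s: "s \<in> {0..1}" "\<bar>s - s0\<bar> < \<rho>" and d: "d \<in> A" "fst (fl \<tau>2 (l s)) \<in> fst d"
      have sab: "s \<in> {a..b}" by (rule Iab) (use s in auto)
      have "exact_at c \<tau>2 s"
        unfolding exact_at_def
      proof (intro allI impI)
        fix \<eta> :: real assume \<eta>: "\<eta> > 0"
        define k where "k = min (\<rho> - \<bar>s - s0\<bar>) (\<eta> / (2 * L\<^sup>2 + 1))"
        have L1: "2 * L\<^sup>2 + 1 > 0" by (simp add: add_nonneg_pos)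
        show "\<exists>d>0. \<forall>s'\<in>{0..1}. \<bar>s' - s\<bar> < d \<longrightarrow> \<bar>rest c \<tau>2 s s'\<bar> \<le> \<eta> * \<bar>s' - s\<bar>"
        proof (intro exI[of _ k] conjI ballI impI)
          show "0 < k" using s(2) \<eta> L1 by (simp add: k_def)
          fix s' assume s': "s' \<in> {0..1}" "\<bar>s' - s\<bar> < k"
          then have "\<bar>s' - s0\<bar> \<le> \<rho>" by (auto simp: k_def)
          then have "s' \<in> {a..b}" by (rule Iab[OF s'(1)])
          from quad2[OF sab this] have "\<bar>rest c \<tau>2 s s'\<bar> \<le> (2 * L\<^sup>2 * \<bar>s' - s\<bar>) * \<bar>s' - s\<bar>"
            by (simp add: power2_eq_square mult.assoc abs_mult_self_eq)
          also have "\<dots> \<le> \<eta> * \<bar>s' - s\<bar>"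
          proof (rule mult_right_mono)
            have "2 * L\<^sup>2 * \<bar>s' - s\<bar> \<le> (2 * L\<^sup>2 + 1) * \<bar>s' - s\<bar>" by (intro mult_right_mono) auto
            also have "\<dots> \<le> \<eta>" using s'(2) L1 by (simp add: k_def field_simps)
            finally show "2 * L\<^sup>2 * \<bar>s' - s\<bar> \<le> \<eta>" .
          qed simp
          finally show "\<bar>rest c \<tau>2 s s'\<bar> \<le> \<eta> * \<bar>s' - s\<bar>" .
        qed
      qed
      then show "exact_at d \<tau>2 s" by (rule exact_at_chart[OF t(3) s(1) c(1) zc[OF t2 sab] d])
    qed
  qed
qed

text \<open>The time steps are small, and exactness at time zero is propagated by compactness of the time
  interval.\<close>

lemma exact_everywhere:
  assumes \<tau>: "\<tau> \<in> J" "0 \<le> \<tau>" and s: "s \<in> {0..1}" and c: "c \<in> A" "fst (fl \<tau> (l s)) \<in> fst c"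
  shows "exact_at c \<tau> s"
proof -
  have sJ: "{0..\<tau>} \<subseteq> J" by (rule interval_J[OF J(3) \<tau>(1)])
  have "exact_near s 0"
    unfolding exact_near_def
  proof (intro exI[of _ 1] conjI ballI impI)
    fix s' d assume s': "s' \<in> {0..1}" and d: "d \<in> A" "fst (fl 0 (l s')) \<in> fst d"
    have f0: "fl 0 (l s') = l s'" by (rule flow_D(1)[OF l_in(1)[OF s']])
    have "fst (fl 0 (l s')) \<in> fst c0" unfolding f0 unfolding l_def by (rule lam_coords(4)[OF c0 ray[OF s']])
    then show "exact_at d 0 s'" by (rule exact_at_chart[OF J(3) s' c0 _ d exact_at_0[OF s']])
  qed simp
  define P where "P u v \<longleftrightarrow> (0 \<le> u \<and> v \<le> \<tau> \<longrightarrow> exact_near s u \<longrightarrow> exact_near s v)" for u v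
  have "P 0 \<tau>"
  proof (rule Bolzano[OF \<tau>(2)])
    fix a b d assume "P a b" "P b d" "a \<le> b" "b \<le> d"
    moreover from this have "0 \<le> a \<and> d \<le> \<tau> \<Longrightarrow> (0 \<le> a \<and> b \<le> \<tau>) \<and> (0 \<le> b \<and> d \<le> \<tau>)" by linarith
    ultimately show "P a d" unfolding P_def by blast
  next
    fix x assume x: "0 \<le> x" "x \<le> \<tau>"
    then have "x \<in> J" using sJ by auto
    from exact_step[OF this s] obtain r where r: "r > 0"
      "\<And>\<tau>1 \<tau>2. 0 \<le> \<tau>1 \<and> \<tau>1 \<le> \<tau>2 \<and> \<tau>2 \<in> J \<and> \<bar>\<tau>1 - x\<bar> < r \<and> \<bar>\<tau>2 - x\<bar> < r \<and> exact_near s \<tau>1 \<Longrightarrow> exact_near s \<tau>2"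
      by blast
    show "\<exists>d>0. \<forall>a b. a \<le> x \<and> x \<le> b \<and> b - a < d \<longrightarrow> P a b"
      unfolding P_def
    proof (intro exI[of _ r] conjI allI impI r(1))
      fix a b assume ab: "a \<le> x \<and> x \<le> b \<and> b - a < r" "0 \<le> a \<and> b \<le> \<tau>" and E: "exact_near s a"
      have "b \<in> J" using ab sJ x by auto
      then show "exact_near s b" using ab E by (intro r(2)[of a b]) auto
    qed
  qed
  then have "exact_near s \<tau>" using \<open>exact_near s 0\<close> \<tau>(2) by (simp add: P_def)
  then show ?thesis using s c unfolding exact_near_def by fastforce
qed

end

context exact_flow
begin

text \<open>The differential of the action at time \<open>\<tau>\<close> is the Liouville form pulled back by
  the flow. In the expansion the momentum may be frozen at the centre, because the momenta are continuous and
  the positions are Lipschitz.\<close>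

theorem theta_expansion:
  assumes t0: "t0 \<in> J" and c0: "c0 \<in> A" and y0: "y0 \<in> base c0"
    and c: "c \<in> A" "fst (fl t0 (lam c0 y0)) \<in> fst c" and \<epsilon>: "\<epsilon> > 0"
  obtains r where "r > 0" "ball y0 r \<subseteq> base c0"
    "\<And>\<tau> y y'. \<lbrakk>\<tau> \<in> J; 0 \<le> \<tau>; \<bar>\<tau> - t0\<bar> < r; y \<in> ball y0 r; y' \<in> ball y0 r\<rbrakk> \<Longrightarrow>
       \<bar>tht \<tau> (lam c0 y') - tht \<tau> (lam c0 y) - mom c (fl t0 (lam c0 y0)) \<bullet>
          (pos c (fl \<tau> (lam c0 y')) - pos c (fl \<tau> (lam c0 y)))\<bar> \<le> \<epsilon> * norm (y' - y)"
proof -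
  obtain r1 L where r1: "r1 > 0" "L \<ge> 0" "ball y0 r1 \<subseteq> base c0"
    "\<And>t y. \<lbrakk>t \<in> J; \<bar>t - t0\<bar> < r1; y \<in> ball y0 r1\<rbrakk> \<Longrightarrow> fst (fl t (lam c0 y)) \<in> fst c"
    "\<And>t t' y y'. \<lbrakk>t \<in> J; t' \<in> J; \<bar>t - t0\<bar> < r1; \<bar>t' - t0\<bar> < r1; y \<in> ball y0 r1; y' \<in> ball y0 r1\<rbrakk> \<Longrightarrow>
       norm (snd (cot_chart A c) (fl t (lam c0 y)) - snd (cot_chart A c) (fl t' (lam c0 y'))) \<le> L * (\<bar>t - t'\<bar> + norm (y - y'))"
    by (rule flow_local[OF t0 c0 y0 c]) blast
  define r where "r = min r1 (\<epsilon> / (2 * L\<^sup>2 + 1))"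
  have L1: "2 * L\<^sup>2 + 1 > 0" by (simp add: add_nonneg_pos)
  have r: "r > 0" "r \<le> r1" using r1(1) \<epsilon> L1 by (auto simp: r_def)
  show ?thesis
  proof (rule that[OF r(1)])
    show "ball y0 r \<subseteq> base c0" using r1(3) r(2) by auto
    fix \<tau> y y' assume \<tau>: "\<tau> \<in> J" "0 \<le> \<tau>" "\<bar>\<tau> - t0\<bar> < r" and y: "y \<in> ball y0 r" "y' \<in> ball y0 r"
    have inb: "y + s *\<^sub>R (y' - y) \<in> ball y0 r" if "s \<in> {0..1}" for s
    proof -
      have "y + s *\<^sub>R (y' - y) = (1 - s) *\<^sub>R y + s *\<^sub>R y'" by (simp add: algebra_simps)
      then show ?thesis using convexD[OF convex_ball y, of "1 - s" s] that by simp
    qed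
    have inb1: "y + s *\<^sub>R (y' - y) \<in> ball y0 r1" if "s \<in> {0..1}" for s using inb[OF that] r(2) by auto
    interpret exact_ray X A gT \<alpha> D B\<^sub>0 J Q \<Lambda>\<^sub>0 H fl c0 y "y' - y"
      by unfold_locales (use c0 inb1 r1(3) in auto)
    have \<tau>1: "\<bar>\<tau> - t0\<bar> < r1" using \<tau>(3) r(2) by linarith
    have ch: "fst (fl \<tau> (l s)) \<in> fst c" if "s \<in> {0..1}" for s
      unfolding l_def by (rule r1(4)[OF \<tau>(1) \<tau>1 inb1[OF that]])
    have l01: "l 0 = lam c0 y" "l 1 = lam c0 y'" by (simp_all add: l_def)
    have "\<bar>tht \<tau> (l 1) - tht \<tau> (l 0) - mom c (fl t0 (lam c0 y0)) \<bullet> (pos c (fl \<tau> (l 1)) - pos c (fl \<tau> (l 0)))\<bar>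
        \<le> (2 * L * r) * (L * norm (y' - y)) * (1 - 0)"
    proof (rule expansion_of_pointwise[where p = "\<lambda>s. mom c (fl \<tau> (l s))" and q = "\<lambda>s. pos c (fl \<tau> (l s))"
          and \<theta> = "\<lambda>s. tht \<tau> (l s)"])
      show "0 \<le> L * norm (y' - y)" using r1(2) by simp
      show "\<exists>d>0. \<forall>s'\<in>{0..1}. \<bar>s' - s\<bar> < d \<longrightarrow> \<bar>tht \<tau> (l s') - tht \<tau> (l s) - mom c (fl \<tau> (l s)) \<bullet>
          (pos c (fl \<tau> (l s')) - pos c (fl \<tau> (l s)))\<bar> \<le> \<eta> * \<bar>s' - s\<bar>" if s: "s \<in> {0..1}" and \<eta>: "\<eta> > 0" for s \<eta>
        using exact_everywhere[OF \<tau>(1,2) s c(1) ch[OF s]] \<eta> unfolding exact_at_def rest_def by blast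
      show "norm (pos c (fl \<tau> (l s')) - pos c (fl \<tau> (l s))) \<le> L * norm (y' - y) * \<bar>s' - s\<bar>"
        if "s \<in> {0..1}" "s' \<in> {0..1}" for s s'
      proof -
        have "norm (pos c (fl \<tau> (l s')) - pos c (fl \<tau> (l s))) \<le>
            L * (\<bar>\<tau> - \<tau>\<bar> + norm ((y + s' *\<^sub>R (y' - y)) - (y + s *\<^sub>R (y' - y))))"
          unfolding l_def by (rule order_trans[OF pos_mom_norm(1) r1(5)[OF \<tau>(1) \<tau>(1) \<tau>1 \<tau>1 inb1[OF that(2)] inb1[OF that(1)]]])
        moreover have "(y + s' *\<^sub>R (y' - y)) - (y + s *\<^sub>R (y' - y)) = (s' - s) *\<^sub>R (y' - y)"
          by (simp add: scaleR_diff_left)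
        ultimately show ?thesis by (simp add: mult_ac)
      qed
      show "norm (mom c (fl \<tau> (l s)) - mom c (fl t0 (lam c0 y0))) \<le> 2 * L * r" if s: "s \<in> {0..1}" for s
      proof -
        have "norm (mom c (fl \<tau> (l s)) - mom c (fl t0 (lam c0 y0))) \<le>
            L * (\<bar>\<tau> - t0\<bar> + norm ((y + s *\<^sub>R (y' - y)) - y0))"
          unfolding l_def by (rule order_trans[OF pos_mom_norm(2) r1(5)[OF \<tau>(1) t0 \<tau>1 _ inb1[OF s]]]) (use r1(1) in auto)
        also have "\<dots> \<le> L * (r + r)"
          using \<tau>(3) inb[OF s] r1(2) by (intro mult_left_mono add_mono) (auto simp: dist_norm norm_minus_commute)
        finally show ?thesis by (simp add: mult_ac)
      qed
    qed simp
    also have "(2 * L * r) * (L * norm (y' - y)) * (1 - 0) = (2 * L\<^sup>2 * r) * norm (y' - y)"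
      by (simp add: power2_eq_square)
    also have "\<dots> \<le> \<epsilon> * norm (y' - y)"
    proof (rule mult_right_mono)
      have "2 * L\<^sup>2 * r \<le> (2 * L\<^sup>2 + 1) * r" using r(1) by (intro mult_right_mono) auto
      also have "\<dots> \<le> (2 * L\<^sup>2 + 1) * (\<epsilon> / (2 * L\<^sup>2 + 1))" using L1 by (intro mult_left_mono) (auto simp: r_def)
      also have "\<dots> = \<epsilon>" using L1 by simp
      finally show "2 * L\<^sup>2 * r \<le> \<epsilon>" .
    qed simp
    finally show "\<bar>tht \<tau> (lam c0 y') - tht \<tau> (lam c0 y) - mom c (fl t0 (lam c0 y0)) \<bullet>
          (pos c (fl \<tau> (lam c0 y')) - pos c (fl \<tau> (lam c0 y)))\<bar> \<le> \<epsilon> * norm (y' - y)"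
      unfolding l01 .
  qed
qed

end

section \<open>The action along admissible trajectories\<close>

lemma norm_derivative_le_lipschitz:
  fixes f :: "real \<Rightarrow> 'b::real_inner"
  assumes d: "(f has_vector_derivative D) (at t within {a..b})" and t: "t \<in> {a..b}" and ab: "a < b"
    and lip: "\<And>u v. \<lbrakk>u \<in> {a..b}; v \<in> {a..b}; u \<le> v\<rbrakk> \<Longrightarrow> norm (f v - f u) \<le> L * (v - u)"
  shows "norm D \<le> L"
proof (rule ccontr)
  assume "\<not> norm D \<le> L"
  moreover have "0 \<le> L"
  proof -
    have "0 \<le> L * (b - a)" using order_trans[OF norm_ge_zero lip[of a b]] ab by simp
    then show ?thesis using ab by (simp add: zero_le_mult_iff)
  qed
  ultimately have D: "norm D > L" "norm D > 0" by auto
  define e where "e = norm D * (norm D - L) / 2"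
  have e: "e > 0" using D by (simp add: e_def)
  have "((\<lambda>t. - (D \<bullet> f t)) has_vector_derivative - (D \<bullet> D)) (at t within {a..b})"
    by (intro has_vector_derivative_minus bounded_linear.has_vector_derivative[OF bounded_linear_inner_right d])
  from straddle_derivative[OF this t e] obtain d where d: "d > 0"
    "\<And>u v. a \<le> u \<and> u \<le> t \<and> t \<le> v \<and> v \<le> b \<and> v - u < d \<Longrightarrow> - (D \<bullet> f v) - - (D \<bullet> f u) \<le> (- (D \<bullet> D) + e) * (v - u)"
    by blast
  define u where "u = max a (t - d / 3)"
  define v where "v = min b (t + d / 3)"
  have uv: "a \<le> u" "u \<le> t" "t \<le> v" "v \<le> b" "v - u < d" "u < v"
    using t ab d(1) by (auto simp: u_def v_def)
  have "D \<bullet> (f v - f u) \<le> norm D * norm (f v - f u)" by (rule norm_cauchy_schwarz)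
  also have "\<dots> \<le> norm D * (L * (v - u))" using uv by (intro mult_left_mono lip) auto
  finally have "(D \<bullet> D - e) * (v - u) \<le> norm D * L * (v - u)"
    using d(2)[of u v] uv by (simp add: inner_diff_right algebra_simps)
  then have "D \<bullet> D - e \<le> norm D * L" using uv(6) by (simp add: mult_le_cancel_right)
  moreover have "D \<bullet> D - e = norm D * L + e"
    by (simp add: e_def dot_square_norm power2_eq_square field_simps)
  ultimately show False using e by simp
qed

text \<open>The derivative controls increments over intervals containing \<open>t\<close>, not only those
  starting at \<open>t\<close>.\<close>

lemma has_vector_derivative_straddle:
  fixes f :: "real \<Rightarrow> 'b::real_normed_vector"
  assumes d: "(f has_vector_derivative D) (at t within S)" and t: "t \<in> S" and \<eta>: "\<eta> > 0"
  obtains d where "d > 0"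
    "\<And>u v. \<lbrakk>u \<in> S; v \<in> S; u \<le> t; t \<le> v; v - u < d\<rbrakk> \<Longrightarrow> norm (f v - f u - (v - u) *\<^sub>R D) \<le> \<eta> * (v - u)"
    "\<And>s. \<lbrakk>s \<in> S; \<bar>s - t\<bar> < d\<rbrakk> \<Longrightarrow> norm (f s - f t) \<le> (norm D + \<eta>) * \<bar>s - t\<bar>"
proof -
  obtain d where d0: "d > 0"
    "\<And>s. s \<in> S \<Longrightarrow> norm (s - t) < d \<Longrightarrow> norm (f s - f t - (s - t) *\<^sub>R D) \<le> \<eta> * norm (s - t)"
    using d \<eta> unfolding has_vector_derivative_def has_derivative_within_alt by meson
  show ?thesis
  proof (rule that[OF d0(1)])
    fix u v assume uv: "u \<in> S" "v \<in> S" "u \<le> t" "t \<le> v" "v - u < d"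
    have "f v - f u - (v - u) *\<^sub>R D = (f v - f t - (v - t) *\<^sub>R D) - (f u - f t - (u - t) *\<^sub>R D)"
      by (simp add: algebra_simps)
    also have "norm \<dots> \<le> \<eta> * norm (v - t) + \<eta> * norm (u - t)"
      by (rule order_trans[OF norm_triangle_ineq4 add_mono[OF d0(2) d0(2)]]) (use uv in auto)
    also have "\<dots> = \<eta> * (v - u)" using uv by (simp add: algebra_simps)
    finally show "norm (f v - f u - (v - u) *\<^sub>R D) \<le> \<eta> * (v - u)" .
  next
    fix s assume s: "s \<in> S" "\<bar>s - t\<bar> < d"
    have "norm (f s - f t) \<le> norm (f s - f t - (s - t) *\<^sub>R D) + norm ((s - t) *\<^sub>R D)"
      using norm_triangle_ineq[of "f s - f t - (s - t) *\<^sub>R D" "(s - t) *\<^sub>R D"] by simp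
    also have "\<dots> \<le> \<eta> * \<bar>s - t\<bar> + \<bar>s - t\<bar> * norm D" using d0(2)[OF s(1)] s(2) by simp
    finally show "norm (f s - f t) \<le> (norm D + \<eta>) * \<bar>s - t\<bar>" by (simp add: algebra_simps)
  qed
qed

context exact_flow
begin

text \<open>Nothing is known about the sign of \<open>dM\<close>, hence the absolute value.\<close>

lemma inverse_lipschitz:
  assumes A3: "assumption_A3 X A dM dT T \<xi> I \<Lambda> fl"
  obtains L where "L \<ge> 0" "\<And>t t' l l'. \<lbrakk>t \<in> I; t' \<in> I; l \<in> \<Lambda>; l' \<in> \<Lambda>\<rbrakk> \<Longrightarrow>
     dT l l' \<le> L * (\<bar>t - t'\<bar> + \<bar>dM (fst (fl t l)) (fst (fl t' l'))\<bar>)"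
proof -
  let ?\<Psi> = "\<lambda>(t, l). (t, fst (fl t l))"
  have inj: "inj_on ?\<Psi> (I \<times> \<Lambda>)" using A3 unfolding assumption_A3_def Let_def by (rule conjunct1)
  have "lipschitz_wrt (prod_dist dist dM) (prod_dist dist dT) (flow_image I \<Lambda> fl) (inv_into (I \<times> \<Lambda>) ?\<Psi>)"
    by (rule A3[unfolded assumption_A3_def Let_def, THEN conjunct2, THEN conjunct2, THEN conjunct1])
  then obtain L where L0: "L \<ge> 0 \<and> (\<forall>x\<in>flow_image I \<Lambda> fl. \<forall>y\<in>flow_image I \<Lambda> fl.
      prod_dist dist dT (inv_into (I \<times> \<Lambda>) ?\<Psi> x) (inv_into (I \<times> \<Lambda>) ?\<Psi> y) \<le> L * prod_dist dist dM x y)"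
    unfolding lipschitz_wrt_def by (elim exE)
  note L = conjunct1[OF L0] bspec[OF bspec[OF conjunct2[OF L0]]]
  show ?thesis
  proof (rule that[OF L(1)])
    fix t t' l l' assume a: "t \<in> I" "t' \<in> I" "l \<in> \<Lambda>" "l' \<in> \<Lambda>"
    have i: "inv_into (I \<times> \<Lambda>) ?\<Psi> (t, fst (fl t l)) = (t, l)" "inv_into (I \<times> \<Lambda>) ?\<Psi> (t', fst (fl t' l')) = (t', l')"
      using inv_into_f_f[OF inj, of "(t, l)"] inv_into_f_f[OF inj, of "(t', l')"] a by auto
    have m: "(t, fst (fl t l)) \<in> flow_image I \<Lambda> fl" "(t', fst (fl t' l')) \<in> flow_image I \<Lambda> fl"
      using a unfolding flow_image_def by force+
    have "dT l l' \<le> prod_dist dist dT (t, l) (t', l')" by (rule prod_dist_ge)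
    also have "\<dots> \<le> L * prod_dist dist dM (t, fst (fl t l)) (t', fst (fl t' l'))" using L(2)[OF m] unfolding i .
    also have "\<dots> \<le> L * (\<bar>t - t'\<bar> + \<bar>dM (fst (fl t l)) (fst (fl t' l'))\<bar>)"
    proof (rule mult_left_mono[OF _ L(1)])
      show "prod_dist dist dM (t, fst (fl t l)) (t', fst (fl t' l')) \<le> \<bar>t - t'\<bar> + \<bar>dM (fst (fl t l)) (fst (fl t' l'))\<bar>"
        using sqrt_sum_squares_le_sum_abs[of "t - t'" "dM (fst (fl t l)) (fst (fl t' l'))"]
        by (simp add: prod_dist_def dist_real_def)
    qed
    finally show "dT l l' \<le> L * (\<bar>t - t'\<bar> + \<bar>dM (fst (fl t l)) (fst (fl t' l'))\<bar>)" .
  qed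
qed

end

text \<open>A curve \<open>\<xi>\<close> together with the initial points \<open>lift t\<close> of the
  integral curves that project to \<open>\<xi> t\<close> at time \<open>t\<close>.\<close>

locale lifted_curve = exact_flow X A gT \<alpha> D B\<^sub>0 J Q \<Lambda>\<^sub>0 H fl + rm: riemannian_atlas X A gM
  for X :: "'a set" and A :: "('a, 'e::euclidean_space) chart set" and gT \<alpha> D B\<^sub>0 J Q \<Lambda>\<^sub>0 H fl gM +
  fixes T :: real and \<xi> :: "real \<Rightarrow> 'a" and lift :: "real \<Rightarrow> ('a, 'e) covec"
  assumes T: "T > 0" "T \<in> J"
    and xi_continuous: "continuous_map (top_of_set {0..T}) (mtop X A) \<xi>"
    and lift: "t \<in> {0..T} \<Longrightarrow> lift t \<in> \<Lambda>\<^sub>0" "t \<in> {0..T} \<Longrightarrow> fst (fl t (lift t)) = \<xi> t"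
    and lift_lipschitz: "\<exists>L\<ge>0. \<forall>t\<in>{0..T}. \<forall>t'\<in>{0..T}.
       dT (lift t) (lift t') \<le> L * (\<bar>t - t'\<bar> + \<bar>riem_dist X A gM (\<xi> t) (\<xi> t')\<bar>)"
begin

lemma time_J: "{0..T} \<subseteq> J" by (rule interval_J[OF J(3) T(2)])

text \<open>The hypothesis on distances is read in charts: \<open>dT_lower\<close> bounds coordinate
  differences of the lift, and \<open>riem_dist_upper\<close> the distances between points of
  \<open>\<xi>\<close>.\<close>

lemma lift_local:
  assumes x: "x \<in> {0..T}" and c: "c \<in> A" "\<xi> x \<in> fst c" and c0: "c0 \<in> A" "fst (lift x) \<in> fst c0" and \<epsilon>: "\<epsilon> > 0"
  obtains r K where "r > 0" "K \<ge> 0"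
    "\<And>t. \<lbrakk>t \<in> {0..T}; \<bar>t - x\<bar> < r\<rbrakk> \<Longrightarrow> \<xi> t \<in> fst c"
    "\<And>t. \<lbrakk>t \<in> {0..T}; \<bar>t - x\<bar> < r\<rbrakk> \<Longrightarrow> fst (lift t) \<in> fst c0"
    "\<And>t. \<lbrakk>t \<in> {0..T}; \<bar>t - x\<bar> < r\<rbrakk> \<Longrightarrow> pos c0 (lift t) \<in> ball (pos c0 (lift x)) \<epsilon>"
    "\<And>t t'. \<lbrakk>t \<in> {0..T}; t' \<in> {0..T}; \<bar>t - x\<bar> < r; \<bar>t' - x\<bar> < r\<rbrakk> \<Longrightarrow>
       norm (pos c0 (lift t) - pos c0 (lift t')) \<le> K * (\<bar>t - t'\<bar> + norm (snd c (\<xi> t) - snd c (\<xi> t')))"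
proof -
  let ?C = "cot_chart A c0"
  obtain L where L: "L \<ge> 0" "\<And>t t'. \<lbrakk>t \<in> {0..T}; t' \<in> {0..T}\<rbrakk> \<Longrightarrow>
      dT (lift t) (lift t') \<le> L * (\<bar>t - t'\<bar> + \<bar>riem_dist X A gM (\<xi> t) (\<xi> t')\<bar>)"
    using lift_lipschitz by blast
  have CX: "lift t \<in> CX" if "t \<in> {0..T}" for t by (rule Lambda0_CX[OF lift(1)[OF that]])
  obtain r1 M where r1: "r1 > 0" "M > 0"
    "\<And>y y'. \<lbrakk>y \<in> fst c; y' \<in> fst c; norm (snd c y - snd c (\<xi> x)) < r1; norm (snd c y' - snd c (\<xi> x)) < r1\<rbrakk> \<Longrightarrow>
       riem_dist X A gM y y' \<le> M * norm (snd c y' - snd c y) \<and> (\<exists>l. pw_C1_path X A gM y y' l)"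
    by (rule rm.riem_dist_upper[OF c]) blast
  obtain r2 m where m: "r2 > 0" "m > 0"
    "\<And>z w. \<lbrakk>z \<in> CX; w \<in> CX; fst z \<in> fst c0; norm (snd ?C z - snd ?C (lift x)) < r2; dT z w < m * r2\<rbrakk> \<Longrightarrow>
       fst w \<in> fst c0 \<and> m * norm (snd ?C w - snd ?C z) \<le> dT z w"
    by (rule dT_lower[OF c0(1) CX[OF x] c0(2)]) blast
  define N where "N = L * (1 + M)"
  have N: "N \<ge> 0" using L(1) r1(2) by (simp add: N_def)
  define m2 where "m2 = m * min r2 \<epsilon>"
  have m2: "m2 > 0" "m2 \<le> m * r2" "m2 \<le> m * \<epsilon>" using m \<epsilon> by (auto simp: m2_def intro: mult_left_mono)
  define \<rho> where "\<rho> = min r1 (m2 / (8 * (N + 1)))"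
  have \<rho>: "\<rho> > 0" "\<rho> \<le> r1" using r1 m2(1) N by (auto simp: \<rho>_def)
  have N\<rho>: "N * (4 * \<rho>) < m2"
  proof -
    have "N * (4 * \<rho>) \<le> N * (4 * (m2 / (8 * (N + 1))))"
      using N by (intro mult_left_mono) (auto simp: \<rho>_def)
    also have "\<dots> = m2 * (N / (2 * (N + 1)))" using N by (simp add: field_simps)
    also have "\<dots> < m2 * 1" using N m2(1) by (intro mult_strict_left_mono) auto
    finally show ?thesis by simp
  qed
  have op: "openin (mtop X A) {y \<in> fst c. snd c y \<in> ball (snd c (\<xi> x)) \<rho>}"
    by (rule openin_chart_preimage[OF c(1)]) simp
  obtain d where d: "d > 0" "\<And>s. s \<in> {0..T} \<Longrightarrow> dist s x < d \<Longrightarrow> \<xi> s \<in> {y \<in> fst c. snd c y \<in> ball (snd c (\<xi> x)) \<rho>}"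
    using continuous_map_domain_open[OF xi_continuous op x] c(2) \<rho>(1) by auto
  define r where "r = min d \<rho>"
  have r: "r > 0" "r \<le> d" "r \<le> \<rho>" using d(1) \<rho>(1) by (auto simp: r_def)
  have xc: "\<xi> t \<in> fst c" "norm (snd c (\<xi> t) - snd c (\<xi> x)) < \<rho>" if "t \<in> {0..T}" "\<bar>t - x\<bar> < r" for t
    using d(2)[OF that(1)] that(2) r by (auto simp: dist_real_def dist_norm norm_minus_commute)
  have est: "dT (lift t) (lift t') \<le> N * (\<bar>t - t'\<bar> + norm (snd c (\<xi> t) - snd c (\<xi> t')))"
    if t: "t \<in> {0..T}" "t' \<in> {0..T}" "\<bar>t - x\<bar> < r" "\<bar>t' - x\<bar> < r" for t t'
  proof -
    have "riem_dist X A gM (\<xi> t) (\<xi> t') \<le> M * norm (snd c (\<xi> t') - snd c (\<xi> t)) \<and> (\<exists>l. pw_C1_path X A gM (\<xi> t) (\<xi> t') l)"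
      by (rule r1(3)) (use xc[OF t(1,3)] xc[OF t(2,4)] \<rho>(2) in auto)
    then have "\<bar>riem_dist X A gM (\<xi> t) (\<xi> t')\<bar> \<le> M * norm (snd c (\<xi> t) - snd c (\<xi> t'))"
      using rm.riem_dist_nonneg by (auto simp: norm_minus_commute)
    then have "dT (lift t) (lift t') \<le> L * (\<bar>t - t'\<bar> + M * norm (snd c (\<xi> t) - snd c (\<xi> t')))"
      using L(2)[OF t(1,2)] L(1) by (smt (verit) mult_left_mono)
    also have "\<dots> \<le> L * ((1 + M) * (\<bar>t - t'\<bar> + norm (snd c (\<xi> t) - snd c (\<xi> t'))))"
      using L(1) r1(2) by (intro mult_left_mono) (auto simp: algebra_simps)
    finally show ?thesis by (simp add: N_def mult.assoc)
  qed
  have small: "dT (lift t) (lift t') < m2"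
    if t: "t \<in> {0..T}" "t' \<in> {0..T}" "\<bar>t - x\<bar> < r" "\<bar>t' - x\<bar> < r" for t t'
  proof -
    have "norm (snd c (\<xi> t) - snd c (\<xi> t')) \<le> norm (snd c (\<xi> t) - snd c (\<xi> x)) + norm (snd c (\<xi> t') - snd c (\<xi> x))"
      using norm_triangle_ineq4[of "snd c (\<xi> t) - snd c (\<xi> x)" "snd c (\<xi> t') - snd c (\<xi> x)"] by simp
    then have "\<bar>t - t'\<bar> + norm (snd c (\<xi> t) - snd c (\<xi> t')) \<le> 4 * \<rho>"
      using xc(2)[OF t(1,3)] xc(2)[OF t(2,4)] t(3,4) r(3) by linarith
    then have "N * (\<bar>t - t'\<bar> + norm (snd c (\<xi> t) - snd c (\<xi> t'))) \<le> N * (4 * \<rho>)" using N by (rule mult_left_mono)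
    then show ?thesis using est[OF t] N\<rho> by linarith
  qed
  have near: "fst (lift t) \<in> fst c0 \<and> norm (snd ?C (lift t) - snd ?C (lift x)) < min r2 \<epsilon>"
    if t: "t \<in> {0..T}" "\<bar>t - x\<bar> < r" for t
  proof -
    have s: "dT (lift x) (lift t) < m2" by (rule small[OF x t(1) _ t(2)]) (use r in simp)
    have "fst (lift t) \<in> fst c0 \<and> m * norm (snd ?C (lift t) - snd ?C (lift x)) \<le> dT (lift x) (lift t)"
      by (rule m(3)[OF CX[OF x] CX[OF t(1)] c0(2)]) (use m s m2 in auto)
    moreover from this have "m * norm (snd ?C (lift t) - snd ?C (lift x)) < m * min r2 \<epsilon>" using s m2_def by linarith
    ultimately show ?thesis using m(2) by simp
  qed
  show ?thesis
  proof (rule that[OF r(1), of "N / m"])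
    show "0 \<le> N / m" using N m by simp
    show "\<xi> t \<in> fst c" "fst (lift t) \<in> fst c0" if "t \<in> {0..T}" "\<bar>t - x\<bar> < r" for t
      using xc[OF that] near[OF that] by auto
    show "pos c0 (lift t) \<in> ball (pos c0 (lift x)) \<epsilon>" if t: "t \<in> {0..T}" "\<bar>t - x\<bar> < r" for t
      using order_le_less_trans[OF pos_mom_norm(1)[of c0 "lift t" "lift x"]] near[OF t]
      by (simp add: dist_norm norm_minus_commute)
    fix t t' assume t: "t \<in> {0..T}" "t' \<in> {0..T}" "\<bar>t - x\<bar> < r" "\<bar>t' - x\<bar> < r"
    have "m * norm (snd ?C (lift t') - snd ?C (lift t)) \<le> dT (lift t) (lift t')"
      using m(3)[OF CX[OF t(1)] CX[OF t(2)]] near[OF t(1,3)] small[OF t] m2(2) by auto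
    then have "m * norm (pos c0 (lift t) - pos c0 (lift t')) \<le> N * (\<bar>t - t'\<bar> + norm (snd c (\<xi> t) - snd c (\<xi> t')))"
      using order_trans[OF mult_left_mono[OF pos_mom_norm(1)[of c0 "lift t'" "lift t"], of m]] est[OF t] m(2)
      unfolding norm_minus_commute[of "pos c0 (lift t)"] by fastforce
    then show "norm (pos c0 (lift t) - pos c0 (lift t')) \<le> N / m * (\<bar>t - t'\<bar> + norm (snd c (\<xi> t) - snd c (\<xi> t')))"
      using m(2) by (simp add: field_simps)
  qed
qed

definition lifted_action :: "real \<Rightarrow> real" where "lifted_action t = tht t (lift t)"

lemma lift_lam:
  assumes "t \<in> {0..T}" "c0 \<in> A" "fst (lift t) \<in> fst c0"
  shows "lam c0 (pos c0 (lift t)) = lift t"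
  unfolding pos_def by (rule Lambda0_lam(2)[OF lift(1)[OF assms(1)] assms(2,3)])

text \<open>The action expansion bounds the change due to the initial point, the bound on the density the
  change due to time.\<close>

lemma lift_bad:
  assumes x: "x \<in> {0..T}" and c: "c \<in> A" "\<xi> x \<in> fst c"
  shows "\<exists>C. \<exists>d>0. \<forall>u v. 0 \<le> u \<and> u \<le> x \<and> x \<le> v \<and> v \<le> T \<and> v - u < d \<longrightarrow>
    lifted_action v - lifted_action u \<le> C * ((v - u) + norm (snd c (\<xi> v) - snd c (\<xi> u)))"
proof -
  obtain c0 where c0: "c0 \<in> A" "fst (lift x) \<in> fst c0"
    using exists_chart[OF CX_D(1)[OF Lambda0_CX[OF lift(1)[OF x]]]] by blast
  define y0 where "y0 = pos c0 (lift x)"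
  have ly: "lam c0 y0 = lift x" unfolding y0_def by (rule lift_lam[OF x c0])
  have y0: "y0 \<in> base c0" unfolding y0_def pos_def by (rule Lambda0_lam(1)[OF lift(1)[OF x] c0])
  have xJ: "x \<in> J" using x time_J by blast
  have fc: "fst (fl x (lam c0 y0)) \<in> fst c" unfolding ly lift(2)[OF x] by (rule c(2))
  define P where "P = mom c (fl x (lam c0 y0))"
  obtain r1 where r1: "r1 > 0"
    "\<And>\<tau> y y'. \<lbrakk>\<tau> \<in> J; 0 \<le> \<tau>; \<bar>\<tau> - x\<bar> < r1; y \<in> ball y0 r1; y' \<in> ball y0 r1\<rbrakk> \<Longrightarrow>
       \<bar>tht \<tau> (lam c0 y') - tht \<tau> (lam c0 y) - P \<bullet>
          (pos c (fl \<tau> (lam c0 y')) - pos c (fl \<tau> (lam c0 y)))\<bar> \<le> 1 * norm (y' - y)"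
    unfolding P_def by (rule theta_expansion[OF xJ c0(1) y0 c(1) fc zero_less_one]) blast
  obtain r2 B where r2: "r2 > 0" "B \<ge> 0" 
    "\<And>y u v. \<lbrakk>y \<in> ball y0 r2; 0 \<le> u; u \<le> v; v \<in> J\<rbrakk> \<Longrightarrow> \<bar>tht v (lam c0 y) - tht u (lam c0 y)\<bar> \<le> B * (v - u)"
    by (rule theta_lipschitz_time[OF c0(1) y0]) blast
  obtain r3 L where r3: "r3 > 0" "L \<ge> 0"
    "\<And>t t' y y'. \<lbrakk>t \<in> J; t' \<in> J; \<bar>t - x\<bar> < r3; \<bar>t' - x\<bar> < r3; y \<in> ball y0 r3; y' \<in> ball y0 r3\<rbrakk> \<Longrightarrow>
       norm (snd (cot_chart A c) (fl t (lam c0 y)) - snd (cot_chart A c) (fl t' (lam c0 y'))) \<le> L * (\<bar>t - t'\<bar> + norm (y - y'))"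
    by (rule flow_local[OF xJ c0(1) y0 c(1) fc]) blast
  define \<epsilon> where "\<epsilon> = min r1 (min r2 r3)"
  have \<epsilon>: "\<epsilon> > 0" "\<epsilon> \<le> r1" "\<epsilon> \<le> r2" "\<epsilon> \<le> r3" using r1(1) r2(1) r3(1) by (auto simp: \<epsilon>_def)
  obtain r4 K where r4: "r4 > 0" "K \<ge> 0"
    "\<And>t. \<lbrakk>t \<in> {0..T}; \<bar>t - x\<bar> < r4\<rbrakk> \<Longrightarrow> fst (lift t) \<in> fst c0"
    "\<And>t. \<lbrakk>t \<in> {0..T}; \<bar>t - x\<bar> < r4\<rbrakk> \<Longrightarrow> pos c0 (lift t) \<in> ball (pos c0 (lift x)) \<epsilon>"
    "\<And>t t'. \<lbrakk>t \<in> {0..T}; t' \<in> {0..T}; \<bar>t - x\<bar> < r4; \<bar>t' - x\<bar> < r4\<rbrakk> \<Longrightarrow>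
       norm (pos c0 (lift t) - pos c0 (lift t')) \<le> K * (\<bar>t - t'\<bar> + norm (snd c (\<xi> t) - snd c (\<xi> t')))"
    by (rule lift_local[OF x c c0 \<epsilon>(1)]) blast
  define d where "d = min \<epsilon> r4"
  define C where "C = norm P * (1 + L) + K + B"
  show ?thesis
  proof (rule exI[of _ C], rule exI[of _ d], intro conjI allI impI, goal_cases)
    case 1 show ?case using \<epsilon>(1) r4(1) by (simp add: d_def)
    case (2 u v)
    then have uT: "u \<in> {0..T}" "v \<in> {0..T}" and uv: "u \<le> v" by auto
    have ab: "\<bar>u - x\<bar> < d" "\<bar>v - x\<bar> < d" using 2 by auto
    have ab1: "\<bar>u - x\<bar> < r1" "\<bar>v - x\<bar> < r1" "\<bar>u - x\<bar> < r3" "\<bar>v - x\<bar> < r3" "\<bar>u - x\<bar> < r4" "\<bar>v - x\<bar> < r4"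
      using ab \<epsilon> unfolding d_def by linarith+
    have uJ: "u \<in> J" "v \<in> J" using uT time_J by auto
    define yu where "yu = pos c0 (lift u)"
    define yv where "yv = pos c0 (lift v)"
    have lu: "lam c0 yu = lift u" "lam c0 yv = lift v"
      unfolding yu_def yv_def by (rule lift_lam[OF uT(1) c0(1) r4(3)[OF uT(1) ab1(5)]], rule lift_lam[OF uT(2) c0(1) r4(3)[OF uT(2) ab1(6)]])
    have b: "yu \<in> ball y0 \<epsilon>" "yv \<in> ball y0 \<epsilon>"
      unfolding yu_def yv_def y0_def by (rule r4(4)[OF uT(1) ab1(5)], rule r4(4)[OF uT(2) ab1(6)])
    then have b1: "yu \<in> ball y0 r1" "yv \<in> ball y0 r1" "yu \<in> ball y0 r2" "yu \<in> ball y0 r3" using \<epsilon> by auto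
    define w where "w = norm (snd c (\<xi> v) - snd c (\<xi> u))"
    have w: "w \<ge> 0" by (simp add: w_def)
    have e1: "tht v (lam c0 yv) - tht v (lam c0 yu) \<le> P \<bullet> (pos c (fl v (lam c0 yv)) - pos c (fl v (lam c0 yu))) + norm (yv - yu)"
      using r1(2)[OF uJ(2) _ ab1(2) b1(1,2)] uT by auto
    have p: "pos c (fl v (lam c0 yv)) = snd c (\<xi> v)" "pos c (fl u (lam c0 yu)) = snd c (\<xi> u)"
      unfolding lu pos_def lift(2)[OF uT(1)] lift(2)[OF uT(2)] by simp_all
    have "norm (pos c (fl v (lam c0 yu)) - pos c (fl u (lam c0 yu))) \<le> L * (v - u)"
      using order_trans[OF pos_mom_norm(1) r3(3)[OF uJ(2,1) ab1(4,3) b1(4) b1(4)]] uv by simp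
    then have "norm (pos c (fl v (lam c0 yv)) - pos c (fl v (lam c0 yu))) \<le> w + L * (v - u)"
      unfolding p w_def using norm_triangle_ineq4[of "snd c (\<xi> v) - snd c (\<xi> u)" "pos c (fl v (lam c0 yu)) - snd c (\<xi> u)"]
      by (simp add: p)
    then have e2: "P \<bullet> (pos c (fl v (lam c0 yv)) - pos c (fl v (lam c0 yu))) \<le> norm P * (w + L * (v - u))"
      by (intro order_trans[OF norm_cauchy_schwarz] mult_left_mono) auto
    have e3: "norm (yv - yu) \<le> K * ((v - u) + w)"
      using r4(5)[OF uT(2,1) ab1(6,5)] uv unfolding yu_def yv_def w_def by simp
    have e4: "tht v (lam c0 yu) - tht u (lam c0 yu) \<le> B * (v - u)"
      using r2(3)[OF b1(3) _ uv uJ(2)] uT by auto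
    have "lifted_action v - lifted_action u \<le> norm P * (w + L * (v - u)) + K * ((v - u) + w) + B * (v - u)"
      using e1 e2 e3 e4 unfolding lifted_action_def lu by linarith
    also have "\<dots> \<le> norm P * ((1 + L) * ((v - u) + w)) + K * ((v - u) + w) + B * ((v - u) + w)"
    proof (intro add_mono mult_left_mono)
      show "w + L * (v - u) \<le> (1 + L) * ((v - u) + w)" 
      proof -
        have "(1 + L) * ((v - u) + w) = w + L * (v - u) + (v - u) + L * w" by (simp add: algebra_simps)
        moreover have "0 \<le> L * w" by (rule mult_nonneg_nonneg[OF r3(2) w])
        ultimately show ?thesis using uv by linarith
      qed
    qed (use r2(2) r4(2) uv w in auto)
    also have "\<dots> = C * ((v - u) + w)" by (simp add: C_def algebra_simps)
    finally show ?case unfolding w_def .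
  qed
qed

end

context exact_flow
begin

text \<open>For a fixed control value the vector field and the running cost have these properties: the last
  one is the inequality between \<open>H\<close> and the maximised Hamiltonian.\<close>

definition dominated :: "('a \<Rightarrow> ('a, 'e) tvec) \<Rightarrow> ('a \<Rightarrow> real) \<Rightarrow> bool" where
  "dominated \<phi> \<psi> \<longleftrightarrow> (\<forall>y\<in>X. \<phi> y \<in> tangent_space A y) \<and>
     (\<forall>c\<in>A. continuous_on (snd c ` fst c) (\<lambda>y. \<phi> (chart_inv c y) c)) \<and>
     (\<forall>c\<in>A. continuous_on (snd c ` fst c) (\<lambda>y. \<psi> (chart_inv c y))) \<and>
     (\<forall>t\<in>J. \<forall>l\<in>\<Lambda>\<^sub>0. snd (fl t l) (\<phi> (fst (fl t l))) - \<psi> (fst (fl t l)) \<le> H t (fl t l))"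

lemma dominatedD:
  assumes "dominated \<phi> \<psi>"
  shows "y \<in> X \<Longrightarrow> \<phi> y \<in> tangent_space A y"
    "c \<in> A \<Longrightarrow> continuous_on (snd c ` fst c) (\<lambda>y. \<phi> (chart_inv c y) c)"
    "c \<in> A \<Longrightarrow> continuous_on (snd c ` fst c) (\<lambda>y. \<psi> (chart_inv c y))"
    "\<lbrakk>t \<in> J; l \<in> \<Lambda>\<^sub>0\<rbrakk> \<Longrightarrow> snd (fl t l) (\<phi> (fst (fl t l))) - \<psi> (fst (fl t l)) \<le> H t (fl t l)"
  using assms unfolding dominated_def by blast+

text \<open>Along one integral curve the action grows at the rate \<open>p \<bullet> q' - H\<close>, and
  \<open>H\<close> is at least \<open>p \<bullet> \<phi> - \<psi>\<close>, which is continuous in time.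
  Comparing increments, not derivatives at the time \<open>x\<close> itself, allows \<open>x\<close> to be a
  time at which the curve has no velocity.\<close>

lemma action_increment_le:
  assumes l: "l \<in> \<Lambda>\<^sub>0" and x: "x \<in> J" "0 \<le> x" and c: "c \<in> A" "fst (fl x l) \<in> fst c"
    and dom: "dominated \<phi> \<psi>" and e: "e > 0"
  defines "P \<equiv> mom c (fl x l)" and "k \<equiv> mom c (fl x l) \<bullet> \<phi> (fst (fl x l)) c - \<psi> (fst (fl x l)) - e"
  shows "\<exists>d>0. \<forall>u v. 0 \<le> u \<and> u \<le> x \<and> x \<le> v \<and> v \<in> J \<and> v - u < d \<longrightarrow>
    tht v l - tht u l - P \<bullet> (pos c (fl v l) - pos c (fl u l)) \<le> - k * (v - u)"
proof -
  obtain c0 where c0: "c0 \<in> A" "fst l \<in> fst c0" using exists_chart[OF CX_D(1)[OF Lambda0_CX[OF l]]] by blast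
  note y0 = Lambda0_lam(1,2)[OF l c0]
  define y where "y = snd c0 (fst l)"
  have fc: "fst (fl x (lam c0 y)) \<in> fst c" unfolding y_def y0(2) by (rule c(2))
  obtain r L where r: "r > 0" "L \<ge> 0"
    "\<And>t y'. \<lbrakk>t \<in> J; \<bar>t - x\<bar> < r; y' \<in> ball y r\<rbrakk> \<Longrightarrow> fst (fl t (lam c0 y')) \<in> fst c"
    "\<And>t t' y1 y2. \<lbrakk>t \<in> J; t' \<in> J; \<bar>t - x\<bar> < r; \<bar>t' - x\<bar> < r; y1 \<in> ball y r; y2 \<in> ball y r\<rbrakk> \<Longrightarrow>
       norm (snd (cot_chart A c) (fl t (lam c0 y1)) - snd (cot_chart A c) (fl t' (lam c0 y2))) \<le> L * (\<bar>t - t'\<bar> + norm (y1 - y2))"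
    by (rule flow_local[OF x(1) c0(1) y0(1)[folded y_def] c(1) fc]) blast
  define S where "S = {t \<in> J. \<bar>t - x\<bar> < r}"
  have yb: "y \<in> ball y r" using r(1) by simp
  have ly: "lam c0 y = l" unfolding y_def by (rule y0(2))
  have xS: "x \<in> S" using x r(1) by (simp add: S_def)
  have SJ: "t \<in> J" if "t \<in> S" for t using that by (simp add: S_def)
  have inc: "fst (fl t l) \<in> fst c" if "t \<in> S" for t using r(3)[OF _ _ yb] that by (simp add: S_def ly)
  have inX: "fl t l \<in> CX" if "t \<in> S" for t by (rule flow_D(5)[OF l SJ[OF that]])
  have lipC: "norm (snd (cot_chart A c) (fl t l) - snd (cot_chart A c) (fl t' l)) \<le> L * \<bar>t - t'\<bar>" if "t \<in> S" "t' \<in> S" for t t'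
    using r(4)[OF _ _ _ _ yb yb, of t t'] that by (simp add: S_def ly)
  define q where "q t = pos c (fl t l)" for t
  define p where "p t = mom c (fl t l)" for t
  have lipq: "norm (q t - q t') \<le> L * \<bar>t - t'\<bar>" and lipp: "norm (p t - p t') \<le> L * \<bar>t - t'\<bar>" if "t \<in> S" "t' \<in> S" for t t'
    unfolding q_def p_def by (rule order_trans[OF pos_mom_norm(1) lipC[OF that]], rule order_trans[OF pos_mom_norm(2) lipC[OF that]])
  have lip_cont: "continuous_on S f" if f: "\<And>t t'. t \<in> S \<Longrightarrow> t' \<in> S \<Longrightarrow> norm (f t - f t') \<le> L * \<bar>t - t'\<bar>" for f :: "real \<Rightarrow> 'e"
  proof -
    have "L-lipschitz_on S f" using f r(2) by (intro lipschitz_onI) (auto simp: dist_norm)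
    then show ?thesis by (rule lipschitz_on_continuous_on)
  qed
  define m where "m t = p t \<bullet> \<phi> (fst (fl t l)) c - \<psi> (fst (fl t l))" for t
  have qi: "q t \<in> snd c ` fst c" "chart_inv c (q t) = fst (fl t l)" if "t \<in> S" for t
    using inc[OF that] c(1) by (auto simp: q_def pos_def)
  have "continuous_on S m"
  proof (rule continuous_on_eq)
    show "continuous_on S (\<lambda>t. p t \<bullet> \<phi> (chart_inv c (q t)) c - \<psi> (chart_inv c (q t)))"
      using qi(1) by (intro continuous_intros lip_cont[OF lipp] continuous_on_compose2[OF dominatedD(2)[OF dom c(1)]]
          continuous_on_compose2[OF dominatedD(3)[OF dom c(1)]] lip_cont[OF lipq]) auto
    show "p t \<bullet> \<phi> (chart_inv c (q t)) c - \<psi> (chart_inv c (q t)) = m t" if "t \<in> S" for t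
      unfolding m_def qi(2)[OF that] ..
  qed
  then obtain d1 where d1: "d1 > 0" "\<And>t. t \<in> S \<Longrightarrow> dist t x < d1 \<Longrightarrow> dist (m t) (m x) < e / 2"
    using xS e unfolding continuous_on_iff by (meson half_gt_zero)
  have L1: "2 * L\<^sup>2 + 1 > 0" by (simp add: add_nonneg_pos)
  define d where "d = min r (min d1 (e / (2 * L\<^sup>2 + 1)))"
  have d: "d > 0" "d \<le> r" "d \<le> d1" "d \<le> e / (2 * L\<^sup>2 + 1)" using r(1) d1(1) e L1 by (auto simp: d_def)
  have kx: "k = m x - e" by (simp add: k_def m_def p_def)
  show ?thesis
  proof (rule exI[of _ d], intro conjI allI impI d(1))
    fix u v assume uv: "0 \<le> u \<and> u \<le> x \<and> x \<le> v \<and> v \<in> J \<and> v - u < d"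
    show "tht v l - tht u l - P \<bullet> (pos c (fl v l) - pos c (fl u l)) \<le> - k * (v - u)"
    proof (cases "u < v")
      case False
      then have "u = v" using uv by linarith
      then show ?thesis by simp
    next
      case True
      have sub: "{u..v} \<subseteq> J" using interval_J[OF J(3)] uv by force
      have tS: "t \<in> S" "\<bar>t - x\<bar> < d" if "t \<in> {u..v}" for t
        using that sub uv d(2) by (auto simp: S_def)
      have "AE t in lebesgue. t \<in> J \<longrightarrow> has_velocity CA (\<lambda>t. fl t l) J t (ham_vec A (H t) (fl t l))"
        by (rule flow_D(3)[OF l])
      then obtain N where N: "\<And>t. t \<notin> N \<Longrightarrow> t \<in> J \<Longrightarrow> has_velocity CA (\<lambda>t. fl t l) J t (ham_vec A (H t) (fl t l))"
        "N \<in> null_sets lebesgue" by (rule AE_E3) auto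
      define I where "I = - (\<integral>t. dens t l \<partial>lebesgue_on {u..v}) - k * (v - u)"
      have gI: "((\<lambda>t. - dens t l - k) has_integral I) {u..v}"
      proof -
        have "((\<lambda>t. k) has_integral (v - u) *\<^sub>R k) {u..v}"
          using has_integral_const_real[of k u v] True by simp
        from has_integral_diff[OF has_integral_neg[OF has_integral_integral_lebesgue_on[OF density_integrable[OF l sub]]] this]
        show ?thesis by (simp add: I_def mult.commute)
      qed
      have "- (P \<bullet> q v) - - (P \<bullet> q u) \<le> I"
      proof (rule increment_le_integral[where F = "\<lambda>t. - (P \<bullet> q t)" and w = "\<lambda>t. 0::real" and N = N, OF _ gI])
        show "u \<le> v" using True by simp
        show "negligible N" using N(2) by (simp add: negligible_iff_null_sets)
        show "abs_continuous u v (\<lambda>t. 0::real)" by (rule abs_continuous_const)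
      next
        fix t e' :: real assume t: "t \<in> {u..v} - N" and e': "e' > 0"
        then have tuv: "t \<in> {u..v}" by simp
        note tS' = tS[OF tuv]
        define V where "V = ham_vec A (H t) (fl t l)"
        have hv: "has_velocity CA (\<lambda>t. fl t l) J t V" unfolding V_def using N(1) t SJ[OF tS'(1)] by blast
        note cv = cot_velocity[OF c(1) inX[OF tS'(1)] inc[OF tS'(1)] hv]
        have dq: "(q has_vector_derivative fst (V (cot_chart A c))) (at t within {u..v})"
          unfolding q_def[abs_def] by (rule has_vector_derivative_within_subset[OF cv(1) sub])
        have nV: "norm (fst (V (cot_chart A c))) \<le> L"
        proof (rule norm_derivative_le_lipschitz[OF dq tuv True])
          show "norm (q v' - q u') \<le> L * (v' - u')" if "u' \<in> {u..v}" "v' \<in> {u..v}" "u' \<le> v'" for u' v'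
            using lipq[OF tS(1)[OF that(2)] tS(1)[OF that(1)]] that(3) by simp
        qed
        have de: "dens t l = p t \<bullet> fst (V (cot_chart A c)) - H t (fl t l)"
          unfolding action_density_def V_def[symmetric] liouville_def[symmetric]
          unfolding liouville_def p_def using liouville_eq[OF inX[OF tS'(1)] c(1) inc[OF tS'(1)] cv(3)] by simp
        have "snd (fl t l) (\<phi> (fst (fl t l))) = p t \<bullet> \<phi> (fst (fl t l)) c"
          unfolding p_def by (rule covec_apply[OF inX[OF tS'(1)] c(1) inc[OF tS'(1)] dominatedD(1)[OF dom CX_D(1)[OF inX[OF tS'(1)]]]])
        then have Hm: "m t \<le> H t (fl t l)" using dominatedD(4)[OF dom SJ[OF tS'(1)] l] by (simp add: m_def)
        have "(p t - P) \<bullet> fst (V (cot_chart A c)) \<le> norm (p t - P) * norm (fst (V (cot_chart A c)))" by (rule norm_cauchy_schwarz)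
        also have "\<dots> \<le> (L * \<bar>t - x\<bar>) * L"
          using lipp[OF tS'(1) xS] nV r(2) unfolding P_def p_def by (intro mult_mono) auto
        also have "\<dots> = L\<^sup>2 * \<bar>t - x\<bar>" by (simp add: power2_eq_square)
        also have "\<dots> \<le> L\<^sup>2 * (e / (2 * L\<^sup>2 + 1))" using tS'(2) d(4) by (intro mult_left_mono) auto
        also have "\<dots> = (e / 2) * (2 * L\<^sup>2 / (2 * L\<^sup>2 + 1))" by simp
        also have "\<dots> \<le> (e / 2) * 1" using e L1 by (intro mult_left_mono) auto
        finally have pP: "(p t - P) \<bullet> fst (V (cot_chart A c)) \<le> e / 2" by simp
        have "\<bar>m t - m x\<bar> < e / 2" using d1(2)[OF tS'(1)] tS'(2) d(3) by (simp add: dist_real_def)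
        then have key: "- (P \<bullet> fst (V (cot_chart A c))) \<le> - dens t l - k"
          using pP Hm unfolding de kx inner_diff_left by linarith
        have "((\<lambda>t. - (P \<bullet> q t)) has_vector_derivative - (P \<bullet> fst (V (cot_chart A c)))) (at t within {u..v})"
          by (intro has_vector_derivative_minus bounded_linear.has_vector_derivative[OF bounded_linear_inner_right dq])
        from straddle_derivative[OF this tuv e'] obtain d' where d': "d' > 0"
          "\<And>u' v'. u \<le> u' \<and> u' \<le> t \<and> t \<le> v' \<and> v' \<le> v \<and> v' - u' < d' \<Longrightarrow>
             - (P \<bullet> q v') - - (P \<bullet> q u') \<le> (- (P \<bullet> fst (V (cot_chart A c))) + e') * (v' - u')" by blast
        show "\<exists>d'>0. \<forall>u' v'. u \<le> u' \<and> u' \<le> t \<and> t \<le> v' \<and> v' \<le> v \<and> v' - u' < d' \<longrightarrow>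
             - (P \<bullet> q v') - - (P \<bullet> q u') \<le> ((- dens t l - k) + e') * (v' - u')"
        proof (rule exI[of _ d'], intro conjI allI impI d'(1))
          fix u' v' assume uv': "u \<le> u' \<and> u' \<le> t \<and> t \<le> v' \<and> v' \<le> v \<and> v' - u' < d'"
          have "(- (P \<bullet> fst (V (cot_chart A c))) + e') * (v' - u') \<le> ((- dens t l - k) + e') * (v' - u')"
            using key uv' by (intro mult_right_mono) auto
          then show "- (P \<bullet> q v') - - (P \<bullet> q u') \<le> ((- dens t l - k) + e') * (v' - u')" using d'(2)[OF uv'] by linarith
        qed
      next
        fix t assume "t \<in> {u..v} \<inter> N"
        show "\<exists>C. \<exists>d>0. \<forall>u' v'. u \<le> u' \<and> u' \<le> t \<and> t \<le> v' \<and> v' \<le> v \<and> v' - u' < d \<longrightarrow>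
           - (P \<bullet> q v') - - (P \<bullet> q u') \<le> C * ((v' - u') + norm ((0::real) - 0))"
        proof (rule exI[of _ "norm P * L"], rule exI[of _ 1], intro conjI allI impI zero_less_one)
          fix u' v' assume uv': "u \<le> u' \<and> u' \<le> t \<and> t \<le> v' \<and> v' \<le> v \<and> v' - u' < 1"
          then have i: "u' \<in> {u..v}" "v' \<in> {u..v}" by auto
          have "P \<bullet> (q u' - q v') \<le> norm P * norm (q u' - q v')" by (rule norm_cauchy_schwarz)
          also have "\<dots> \<le> norm P * (L * \<bar>u' - v'\<bar>)" by (intro mult_left_mono lipq[OF tS(1)[OF i(1)] tS(1)[OF i(2)]]) simp
          finally show "- (P \<bullet> q v') - - (P \<bullet> q u') \<le> norm P * L * ((v' - u') + norm ((0::real) - 0))"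
            using abs_minus_commute[of u' v'] uv' by (simp add: inner_diff_right mult.assoc)
        qed
      qed
      moreover have "tht v l - tht u l = (\<integral>t. dens t l \<partial>lebesgue_on {u..v})"
        by (rule theta_diff[OF l]) (use uv True in auto)
      ultimately show ?thesis unfolding I_def q_def by (simp add: inner_diff_right)
    qed
  qed
qed

end

context lifted_curve
begin

text \<open>Write the increment of the action from \<open>u\<close> to \<open>v\<close> by passing through the
  initial point \<open>lift x\<close>: from \<open>(u, lift u)\<close> to \<open>(u, lift x)\<close>, then to
  \<open>(v, lift x)\<close>, then to \<open>(v, lift v)\<close>. The two changes of initial point contribute
  \<open>P\<close> applied to displacements in the base by \<open>theta_expansion\<close>; with the middle
  part, bounded by \<open>action_increment_le\<close>, the positions along the curve through \<open>lift
  x\<close> cancel.\<close>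

lemma lift_good:
  assumes x: "x \<in> {0..T}" and vel: "has_velocity A \<xi> {0..T} x (\<phi> (\<xi> x))" and dom: "dominated \<phi> \<psi>" and e: "e > 0"
  shows "\<exists>d>0. \<forall>u v. 0 \<le> u \<and> u \<le> x \<and> x \<le> v \<and> v \<le> T \<and> v - u < d \<longrightarrow>
    lifted_action v - lifted_action u \<le> (\<psi> (\<xi> x) + e) * (v - u)"
proof -
  have xJ: "x \<in> J" "0 \<le> x" using x time_J by auto
  have "fl x (lift x) \<in> CX" by (rule flow_D(5)[OF lift(1)[OF x] xJ(1)])
  then obtain c where c: "c \<in> A" "\<xi> x \<in> fst c" using exists_chart CX_D(1) lift(2)[OF x] by metis
  obtain c0 where c0: "c0 \<in> A" "fst (lift x) \<in> fst c0"
    using exists_chart[OF CX_D(1)[OF Lambda0_CX[OF lift(1)[OF x]]]] by blast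
  define y0 where "y0 = pos c0 (lift x)"
  have ly: "lam c0 y0 = lift x" unfolding y0_def by (rule lift_lam[OF x c0])
  have y0: "y0 \<in> base c0" unfolding y0_def pos_def by (rule Lambda0_lam(1)[OF lift(1)[OF x] c0])
  have fc: "fst (fl x (lam c0 y0)) \<in> fst c" unfolding ly lift(2)[OF x] by (rule c(2))
  define P where "P = mom c (fl x (lift x))"
  define V where "V = \<phi> (\<xi> x) c"
  obtain r4 K where r4: "r4 > 0" "K \<ge> 0"
    "\<And>t t'. \<lbrakk>t \<in> {0..T}; t' \<in> {0..T}; \<bar>t - x\<bar> < r4; \<bar>t' - x\<bar> < r4\<rbrakk> \<Longrightarrow>
       norm (pos c0 (lift t) - pos c0 (lift t')) \<le> K * (\<bar>t - t'\<bar> + norm (snd c (\<xi> t) - snd c (\<xi> t')))"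
    by (rule lift_local[OF x c c0 zero_less_one]) blast
  define \<eta> where "\<eta> = min 1 (e / 3 / (norm P + 1))"
  have P1: "norm P + 1 > 0" by (simp add: add_nonneg_pos)
  have \<eta>: "\<eta> > 0" "\<eta> \<le> 1" "norm P * \<eta> \<le> e / 3"
  proof -
    show "\<eta> > 0" "\<eta> \<le> 1" using e P1 by (auto simp: \<eta>_def)
    have "norm P * \<eta> \<le> (norm P + 1) * \<eta>" using \<open>\<eta> > 0\<close> by (intro mult_right_mono) auto
    also have "\<dots> \<le> (norm P + 1) * (e / 3 / (norm P + 1))" using P1 by (intro mult_left_mono) (auto simp: \<eta>_def)
    also have "\<dots> = e / 3" by (metis P1 less_irrefl nonzero_mult_div_cancel_left times_divide_eq_right)
    finally show "norm P * \<eta> \<le> e / 3" .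
  qed
  define M where "M = K * (2 + norm V)"
  have M: "M \<ge> 0" using r4(2) by (simp add: M_def)
  define \<epsilon> where "\<epsilon> = e / 3 / (M + 1)"
  have \<epsilon>: "\<epsilon> > 0" "\<epsilon> * M \<le> e / 3"
  proof -
    show "\<epsilon> > 0" using e M by (simp add: \<epsilon>_def)
    have "\<epsilon> * M \<le> \<epsilon> * (M + 1)" using \<open>\<epsilon> > 0\<close> by (intro mult_left_mono) auto
    also have "\<dots> = e / 3" using M unfolding \<epsilon>_def by (metis add_nonneg_pos less_irrefl nonzero_eq_divide_eq zero_less_one)
    finally show "\<epsilon> * M \<le> e / 3" .
  qed
  obtain r1 where r1: "r1 > 0"
    "\<And>\<tau> y y'. \<lbrakk>\<tau> \<in> J; 0 \<le> \<tau>; \<bar>\<tau> - x\<bar> < r1; y \<in> ball y0 r1; y' \<in> ball y0 r1\<rbrakk> \<Longrightarrow>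
       \<bar>tht \<tau> (lam c0 y') - tht \<tau> (lam c0 y) - P \<bullet>
          (pos c (fl \<tau> (lam c0 y')) - pos c (fl \<tau> (lam c0 y)))\<bar> \<le> \<epsilon> * norm (y' - y)"
    unfolding P_def ly[symmetric] by (rule theta_expansion[OF xJ(1) c0(1) y0 c(1) fc \<epsilon>(1)]) blast
  obtain r5 where r5: "r5 > 0"
    "\<And>t. \<lbrakk>t \<in> {0..T}; \<bar>t - x\<bar> < r5\<rbrakk> \<Longrightarrow> fst (lift t) \<in> fst c0"
    "\<And>t. \<lbrakk>t \<in> {0..T}; \<bar>t - x\<bar> < r5\<rbrakk> \<Longrightarrow> pos c0 (lift t) \<in> ball (pos c0 (lift x)) r1"
    by (rule lift_local[OF x c c0 r1(1)]) blast
  have "(snd c \<circ> \<xi> has_vector_derivative V) (at x within {0..T})"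
    using vel c unfolding has_velocity_def V_def by blast
  then obtain d1 where d1: "d1 > 0"
    "\<And>u v. \<lbrakk>u \<in> {0..T}; v \<in> {0..T}; u \<le> x; x \<le> v; v - u < d1\<rbrakk> \<Longrightarrow>
       norm ((snd c \<circ> \<xi>) v - (snd c \<circ> \<xi>) u - (v - u) *\<^sub>R V) \<le> \<eta> * (v - u)"
    "\<And>s. \<lbrakk>s \<in> {0..T}; \<bar>s - x\<bar> < d1\<rbrakk> \<Longrightarrow> norm ((snd c \<circ> \<xi>) s - (snd c \<circ> \<xi>) x) \<le> (norm V + \<eta>) * \<bar>s - x\<bar>"
    by (rule has_vector_derivative_straddle[OF _ x \<eta>(1)]) blast
  have fx: "fst (fl x (lift x)) \<in> fst c" unfolding lift(2)[OF x] by (rule c(2))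
  \<comment> \<open>The error \<open>e\<close> is shared between the velocity of \<open>\<xi>\<close>, the action along the curve through \<open>lift x\<close>, and the two expansions.\<close>
  define k where "k = P \<bullet> V - \<psi> (\<xi> x) - e / 3"
  obtain d2 where d2: "d2 > 0"
    "\<And>u v. 0 \<le> u \<and> u \<le> x \<and> x \<le> v \<and> v \<in> J \<and> v - u < d2 \<Longrightarrow>
      tht v (lift x) - tht u (lift x) - P \<bullet> (pos c (fl v (lift x)) - pos c (fl u (lift x))) \<le> - k * (v - u)"
    using action_increment_le[OF lift(1)[OF x] xJ c(1) fx dom, of "e / 3"] e
    unfolding P_def k_def V_def lift(2)[OF x] by auto
  define d where "d = Min {r1, r4, r5, d1, d2}"
  have d: "d > 0" "d \<le> r1" "d \<le> r4" "d \<le> r5" "d \<le> d1" "d \<le> d2"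
    using r1(1) r4(1) r5(1) d1(1) d2(1) by (auto simp: d_def)
  show ?thesis
  proof (rule exI[of _ d], intro conjI allI impI d(1))
    fix u v assume uv: "0 \<le> u \<and> u \<le> x \<and> x \<le> v \<and> v \<le> T \<and> v - u < d"
    then have uT: "u \<in> {0..T}" "v \<in> {0..T}" by auto
    have uJ: "u \<in> J" "v \<in> J" using uT time_J by auto
    define Y where "Y t = pos c0 (lift t)" for t
    have Yx: "Y x = y0" by (simp add: Y_def y0_def)
    have st: "tht s (lift s) - tht s (lift x) - P \<bullet> (snd c (\<xi> s) - pos c (fl s (lift x))) \<le> \<epsilon> * (M * \<bar>s - x\<bar>) \<and>
        tht s (lift x) - tht s (lift s) - P \<bullet> (pos c (fl s (lift x)) - snd c (\<xi> s)) \<le> \<epsilon> * (M * \<bar>s - x\<bar>)"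
      if s: "s \<in> {0..T}" "\<bar>s - x\<bar> < d" for s
    proof -
      have ls: "lam c0 (Y s) = lift s" unfolding Y_def by (rule lift_lam[OF s(1) c0(1) r5(2)[OF s(1)]]) (use s d in auto)
      have b: "Y s \<in> ball y0 r1" "y0 \<in> ball y0 r1"
        using r5(3)[OF s(1)] s(2) d r1(1) by (auto simp: Y_def y0_def)
      have sJ: "s \<in> J" "0 \<le> s" "\<bar>s - x\<bar> < r1" using s d time_J by auto
      have p: "pos c (fl s (lam c0 (Y s))) = snd c (\<xi> s)" unfolding ls pos_def lift(2)[OF s(1)] ..
      have "norm (Y s - y0) \<le> K * (\<bar>s - x\<bar> + norm (snd c (\<xi> s) - snd c (\<xi> x)))"
        unfolding Y_def y0_def by (rule r4(3)[OF s(1) x]) (use s d r4(1) in auto)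
      also have "\<dots> \<le> K * (\<bar>s - x\<bar> + (norm V + 1) * \<bar>s - x\<bar>)"
      proof (intro mult_left_mono add_left_mono r4(2))
        have "norm (snd c (\<xi> s) - snd c (\<xi> x)) \<le> (norm V + \<eta>) * \<bar>s - x\<bar>" using d1(3)[OF s(1)] s(2) d by simp
        also have "\<dots> \<le> (norm V + 1) * \<bar>s - x\<bar>" using \<eta>(2) by (intro mult_right_mono) auto
        finally show "norm (snd c (\<xi> s) - snd c (\<xi> x)) \<le> (norm V + 1) * \<bar>s - x\<bar>" .
      qed
      also have "\<dots> = M * \<bar>s - x\<bar>" by (simp add: M_def algebra_simps)
      finally have "\<epsilon> * norm (Y s - y0) \<le> \<epsilon> * (M * \<bar>s - x\<bar>)" using \<epsilon>(1) by (intro mult_left_mono) auto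
      then show ?thesis
        using r1(2)[OF sJ b(2,1)] r1(2)[OF sJ b(1,2)] unfolding p unfolding ls ly norm_minus_commute[of y0] by linarith
    qed
    have ax: "\<bar>v - x\<bar> = v - x" "\<bar>u - x\<bar> = x - u" using uv by auto
    have A1: "tht v (lift v) - tht v (lift x) - P \<bullet> (snd c (\<xi> v) - pos c (fl v (lift x))) \<le> \<epsilon> * (M * (v - x))"
      using st[OF uT(2)] uv unfolding ax by auto
    have A2: "tht u (lift x) - tht u (lift u) - P \<bullet> (pos c (fl u (lift x)) - snd c (\<xi> u)) \<le> \<epsilon> * (M * (x - u))"
      using st[OF uT(1)] uv unfolding ax by auto
    have A3: "tht v (lift x) - tht u (lift x) - P \<bullet> (pos c (fl v (lift x)) - pos c (fl u (lift x))) \<le> - k * (v - u)"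
      by (rule d2(2)) (use uv uJ d in auto)
    have "P \<bullet> (snd c (\<xi> v) - snd c (\<xi> u) - (v - u) *\<^sub>R V) \<le> norm P * (\<eta> * (v - u))"
      using d1(2)[OF uT] uv d by (intro order_trans[OF norm_cauchy_schwarz mult_left_mono]) auto
    also have "\<dots> \<le> (e / 3) * (v - u)" using mult_right_mono[OF \<eta>(3), of "v - u"] uv by (simp add: mult.assoc)
    finally have A4: "P \<bullet> (snd c (\<xi> v) - snd c (\<xi> u)) \<le> (P \<bullet> V) * (v - u) + (e / 3) * (v - u)"
      by (simp add: inner_diff_right mult.commute)
    have "\<epsilon> * (M * (v - x)) + \<epsilon> * (M * (x - u)) = (\<epsilon> * M) * (v - u)" by (simp add: algebra_simps)
    also have "\<dots> \<le> (e / 3) * (v - u)" using \<epsilon>(2) uv by (intro mult_right_mono) auto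
    finally have A5: "\<epsilon> * (M * (v - x)) + \<epsilon> * (M * (x - u)) \<le> (e / 3) * (v - u)" .
    have "lifted_action v - lifted_action u \<le> (P \<bullet> V) * (v - u) + (e / 3) * (v - u) - k * (v - u) + (e / 3) * (v - u)"
      using A1 A2 A3 A4 A5 unfolding lifted_action_def by (simp add: inner_diff_right)
    also have "\<dots> = (\<psi> (\<xi> x) + e) * (v - u)" by (simp add: k_def field_simps)
    finally show "lifted_action v - lifted_action u \<le> (\<psi> (\<xi> x) + e) * (v - u)" .
  qed
qed

text \<open>The time interval is divided into pieces over which \<open>\<xi>\<close> stays in one
  chart.\<close>

lemma lifted_action_le:
  assumes ac: "ac_curve X A {0..T} \<xi>" and g: "set_integrable lebesgue {0..T} g"
    and ae: "AE t in lebesgue. t \<in> {0..T} \<longrightarrow> (\<exists>\<phi> \<psi>. dominated \<phi> \<psi> \<and> has_velocity A \<xi> {0..T} t (\<phi> (\<xi> t)) \<and> \<psi> (\<xi> t) = g t)"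
  shows "lifted_action T - lifted_action 0 \<le> (LINT t:{0..T}|lebesgue. g t)"
proof -
  obtain N where N: "\<And>t. t \<notin> N \<Longrightarrow> t \<in> {0..T} \<Longrightarrow> \<exists>\<phi> \<psi>. dominated \<phi> \<psi> \<and> has_velocity A \<xi> {0..T} t (\<phi> (\<xi> t)) \<and> \<psi> (\<xi> t) = g t"
    "N \<in> null_sets lebesgue" using ae by (rule AE_E3) auto
  have gi: "(g has_integral (LINT t:{0..T}|lebesgue. g t)) {0..T}" by (rule has_integral_set_lebesgue[OF g])
  have gsub: "g integrable_on {a..b}" if "0 \<le> a" "b \<le> T" for a b
    by (rule integrable_on_subinterval[OF has_integral_integrable[OF gi]]) (use that in auto)
  define R where "R a b \<longleftrightarrow> (0 \<le> a \<and> b \<le> T \<longrightarrow> lifted_action b - lifted_action a \<le> integral {a..b} g)" for a b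
  have "R 0 T"
  proof (rule Bolzano[of 0 T R])
    show "0 \<le> T" using T by simp
    show "R a d" if ab: "R a b" "R b d" "a \<le> b" "b \<le> d" for a b d
      unfolding R_def
    proof
      assume h: "0 \<le> a \<and> d \<le> T"
      have "integral {a..b} g + integral {b..d} g = integral {a..d} g"
        by (rule Henstock_Kurzweil_Integration.integral_combine) (use ab h gsub in auto)
      moreover have "0 \<le> a \<and> b \<le> T" "0 \<le> b \<and> d \<le> T" using h ab(3,4) by auto
      ultimately show "lifted_action d - lifted_action a \<le> integral {a..d} g" using ab(1,2) unfolding R_def by linarith
    qed
    fix x assume x: "0 \<le> x" "x \<le> T"
    then have xT: "x \<in> {0..T}" by simp
    have "\<xi> x \<in> X" using continuous_map_image_subset_topspace[OF xi_continuous] xT by auto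
    then obtain c where c: "c \<in> A" "\<xi> x \<in> fst c" using exists_chart by blast
    obtain d where d: "d > 0" "\<And>s. s \<in> {0..T} \<Longrightarrow> dist s x < d \<Longrightarrow> \<xi> s \<in> fst c"
      using continuous_map_domain_open[OF xi_continuous openin_chart[OF c(1)] xT c(2)] by blast
    show "\<exists>d>0. \<forall>a b. a \<le> x \<and> x \<le> b \<and> b - a < d \<longrightarrow> R a b"
    proof (rule exI[of _ d], intro conjI allI impI d(1))
      fix a b assume ab: "a \<le> x \<and> x \<le> b \<and> b - a < d"
      show "R a b"
        unfolding R_def
      proof
        assume h: "0 \<le> a \<and> b \<le> T"
        have sub: "t \<in> {0..T}" if "t \<in> {a..b}" for t using that h by auto
        have inc: "\<xi> t \<in> fst c" if "t \<in> {a..b}" for t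
          by (rule d(2)[OF sub[OF that]]) (use that ab in \<open>auto simp: dist_real_def\<close>)
        show "lifted_action b - lifted_action a \<le> integral {a..b} g"
        proof (rule increment_le_integral[where F = lifted_action and a = a and b = b and g = g and N = N and w = "snd c \<circ> \<xi>"])
          show "a \<le> b" using ab by simp
          show "(g has_integral integral {a..b} g) {a..b}" by (rule integrable_integral[OF gsub]) (use h in auto)
          show "negligible N" using N(2) by (simp add: negligible_iff_null_sets)
          show "abs_continuous a b (snd c \<circ> \<xi>)"
            by (rule conjunct2[OF ac[unfolded ac_curve_def], rule_format, OF c(1)]) (use sub inc in auto)
        next
          fix t e :: real assume t: "t \<in> {a..b} - N" and e: "e > 0"
          then obtain \<phi> \<psi> where f: "dominated \<phi> \<psi>" "has_velocity A \<xi> {0..T} t (\<phi> (\<xi> t))" "\<psi> (\<xi> t) = g t"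
            using N(1)[of t] sub[of t] by auto
          have "t \<in> {0..T}" using sub t by blast
          from lift_good[OF this f(2,1) e] show "\<exists>d>0. \<forall>u v. a \<le> u \<and> u \<le> t \<and> t \<le> v \<and> v \<le> b \<and> v - u < d \<longrightarrow>
              lifted_action v - lifted_action u \<le> (g t + e) * (v - u)"
            unfolding f(3) using h by (meson order_trans)
        next
          fix t assume t: "t \<in> {a..b} \<inter> N"
          then have "t \<in> {0..T}" "\<xi> t \<in> fst c" using sub inc by auto
          from lift_bad[OF this(1) c(1) this(2)] show "\<exists>C. \<exists>d>0. \<forall>u v. a \<le> u \<and> u \<le> t \<and> t \<le> v \<and> v \<le> b \<and> v - u < d \<longrightarrow>
              lifted_action v - lifted_action u \<le> C * ((v - u) + norm ((snd c \<circ> \<xi>) v - (snd c \<circ> \<xi>) u))"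
            unfolding comp_def using h by (meson order_trans)
        qed
      qed
    qed
  qed
  then show ?thesis using gi T unfolding R_def by (simp add: integral_unique)
qed

end

section \<open>The reference extremal and the comparison of costs\<close>

context exact_flow
begin

text \<open>Uniqueness of the flow applies only as long as \<open>\<mu>\<close> stays in \<open>Q\<close>,
  which is not assumed at every time. The two curves agree on an open set of times, because \<open>Q\<close>
  is open and contains the flow, and on a closed one, because the cotangent bundle is Hausdorff.\<close>

lemma reference_flow:
  assumes T: "T > 0" "T \<in> J" and Q: "openin (mtop CX CA) Q" and l: "l \<in> \<Lambda>\<^sub>0" "\<mu> 0 = l"
    and ac: "ac_curve CX CA {0..T} \<mu>"
    and ae: "AE t in lebesgue. t \<in> {0..T} \<longrightarrow>
      differentiable_at CA (H t) (\<mu> t) \<and> has_velocity CA \<mu> {0..T} t (ham_vec A (H t) (\<mu> t))"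
    and t: "t \<in> {0..T}"
  shows "\<mu> t = fl t l"
proof -
  have F: "ham_solution X A Q H J (\<lambda>t. fl t l) \<and> (\<forall>S \<mu>. is_interval S \<and> 0 \<in> S \<and> S \<subseteq> J \<and> ham_solution X A Q H S \<mu> \<and> \<mu> 0 = l \<longrightarrow>
           (\<forall>t\<in>S. \<mu> t = fl t l))"
    using A1 l unfolding assumption_A1_def is_ham_flow_def by blast
  have flQ: "fl t l \<in> Q" if "t \<in> J" for t using F that unfolding ham_solution_def by blast
  have TJ: "{0..T} \<subseteq> J" by (rule interval_J[OF J(3) T(2)])
  have mc: "continuous_map (top_of_set {0..T}) (mtop CX CA) \<mu>" using ac unfolding ac_curve_def by (rule conjunct1)
  have fc: "continuous_map (top_of_set J) (mtop CX CA) (\<lambda>t. fl t l)"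
    using flow_D(2)[OF l(1)] unfolding ac_curve_def by (rule conjunct1)
  have mX: "\<mu> t \<in> CX" if "t \<in> {0..T}" for t using continuous_map_image_subset_topspace[OF mc] that by auto
  have ext: "\<mu> t = fl t l" if b: "b \<in> {0..T}" "\<And>t. t \<in> {0..b} \<Longrightarrow> \<mu> t \<in> Q" and t: "t \<in> {0..b}" for b t
  proof -
    have sub: "{0..b} \<subseteq> {0..T}" using b(1) by auto
    have "ac_curve CX CA {0..b} \<mu>"
      unfolding ac_curve_def
    proof
      show "continuous_map (top_of_set {0..b}) (mtop CX CA) \<mu>" by (rule continuous_map_from_subtopology_mono[OF mc sub])
      show "\<forall>c\<in>CA. \<forall>u v. {u..v} \<subseteq> {0..b} \<and> \<mu> ` {u..v} \<subseteq> fst c \<longrightarrow> abs_continuous u v (snd c \<circ> \<mu>)"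
        using conjunct2[OF ac[unfolded ac_curve_def]] sub by blast
    qed
    moreover have "AE t in lebesgue. t \<in> {0..b} \<longrightarrow> differentiable_at CA (H t) (\<mu> t) \<and> has_velocity CA \<mu> {0..b} t (ham_vec A (H t) (\<mu> t))"
      using ae
    proof eventually_elim
      case (elim t)
      then show ?case using sub has_vector_derivative_within_subset[OF _ sub] unfolding has_velocity_def by blast
    qed
    ultimately have "ham_solution X A Q H {0..b} \<mu>" using b(2) unfolding ham_solution_def by blast
    moreover have "is_interval {0..b}" "0 \<in> {0..b}" "{0..b} \<subseteq> J" using b(1) sub TJ is_interval_cc by auto
    ultimately show ?thesis using F l(2) t by blast
  qed
  define R where "R a b \<longleftrightarrow> (0 \<le> a \<and> b \<le> T \<longrightarrow> (\<forall>t\<in>{0..a}. \<mu> t = fl t l) \<longrightarrow> (\<forall>t\<in>{0..b}. \<mu> t = fl t l))" for a b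
  have "R 0 T"
  proof (rule Bolzano[of 0 T R])
    show "0 \<le> T" using T(1) by simp
    show "R a d" if ab: "R a b" "R b d" "a \<le> b" "b \<le> d" for a b d
    proof -
      have "0 \<le> a \<and> d \<le> T \<Longrightarrow> (0 \<le> a \<and> b \<le> T) \<and> (0 \<le> b \<and> d \<le> T)" using ab(3,4) by linarith
      then show ?thesis using ab(1,2) unfolding R_def by blast
    qed
    fix x assume x: "0 \<le> x" "x \<le> T"
    then have xT: "x \<in> {0..T}" and xJ: "x \<in> J" using TJ by auto
    show "\<exists>d>0. \<forall>a b. a \<le> x \<and> x \<le> b \<and> b - a < d \<longrightarrow> R a b"
    proof (cases "\<mu> x \<in> Q")
      case True
      obtain d where d: "d > 0" "\<And>s. s \<in> {0..T} \<Longrightarrow> dist s x < d \<Longrightarrow> \<mu> s \<in> Q"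
        using cot.continuous_map_domain_open[OF mc Q xT True] by blast
      show ?thesis
      proof (rule exI[of _ d], intro conjI allI impI d(1))
        fix a b assume ab: "a \<le> x \<and> x \<le> b \<and> b - a < d"
        show "R a b"
          unfolding R_def
        proof (intro impI ballI)
          fix t assume h: "0 \<le> a \<and> b \<le> T" "\<forall>t\<in>{0..a}. \<mu> t = fl t l" "t \<in> {0..b}"
          show "\<mu> t = fl t l"
          proof (rule ext[OF _ _ h(3)])
            show "b \<in> {0..T}" using h ab by auto
            fix s assume s: "s \<in> {0..b}"
            show "\<mu> s \<in> Q"
            proof (cases "s \<le> a")
              case True
              then have "s \<in> {0..a}" using s by simp
              moreover have "s \<in> J" using s h TJ by auto
              ultimately show ?thesis using h(2) flQ by simp
            next
              case False
              then show ?thesis by (intro d(2)) (use s h ab in \<open>auto simp: dist_real_def\<close>)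
            qed
          qed
        qed
      qed
    next
      case False
      \<comment> \<open>The curves differ near \<open>x\<close>, so that the premise of \<open>R\<close> fails at any earlier near time.\<close>
      then have ne: "\<mu> x \<noteq> fl x l" using flQ[OF xJ] by auto
      obtain U V where UV: "openin (mtop CX CA) U" "openin (mtop CX CA) V" "\<mu> x \<in> U" "fl x l \<in> V" "disjnt U V"
        using Hausdorff_cot[OF Hausdorff, unfolded Hausdorff_space_def, rule_format, of "\<mu> x" "fl x l"]
          ne mX[OF xT] flow_D(5)[OF l(1) xJ] unfolding cot.topspace_mtop by blast
      obtain d1 where d1: "d1 > 0" "\<And>s. s \<in> {0..T} \<Longrightarrow> dist s x < d1 \<Longrightarrow> \<mu> s \<in> U"
        using cot.continuous_map_domain_open[OF mc UV(1) xT UV(3)] by blast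
      obtain d2 where d2: "d2 > 0" "\<And>s. s \<in> J \<Longrightarrow> dist s x < d2 \<Longrightarrow> fl s l \<in> V"
        using cot.continuous_map_domain_open[OF fc UV(2) xJ UV(4)] by blast
      show ?thesis
      proof (rule exI[of _ "min d1 d2"], intro conjI allI impI)
        show "0 < min d1 d2" using d1(1) d2(1) by simp
        fix a b assume ab: "a \<le> x \<and> x \<le> b \<and> b - a < min d1 d2"
        show "R a b"
          unfolding R_def
        proof (intro impI)
          assume h: "0 \<le> a \<and> b \<le> T" "\<forall>t\<in>{0..a}. \<mu> t = fl t l"
          have aT: "a \<in> {0..T}" using h ab by auto
          then have "\<mu> a \<in> U" "fl a l \<in> V"
            using d1(2)[of a] d2(2)[of a] ab TJ by (auto simp: dist_real_def)
          moreover have "\<mu> a = fl a l" using h by auto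
          ultimately show "\<forall>t\<in>{0..b}. \<mu> t = fl t l" using UV(5) by (metis disjnt_iff)
        qed
      qed
    qed
  qed
  moreover have "\<forall>t\<in>{0..0}. \<mu> t = fl t l" using l flow_D(1)[OF l(1)] by simp
  ultimately show ?thesis using t unfolding R_def by simp
qed

text \<open>The base component of the Hamiltonian vector field at \<open>\<mu> t\<close> is the velocity of
  \<open>\<xi>\<close>.\<close>

lemma density_of_projection:
  assumes T: "T > 0" and t: "t \<in> {0..T}" and z: "\<mu> t \<in> CX" "\<mu> t = fl t l"
    and proj: "\<And>s. s \<in> {0..T} \<Longrightarrow> fst (\<mu> s) = \<xi> s"
    and hv: "has_velocity CA \<mu> {0..T} t (ham_vec A (H t) (\<mu> t))"
    and fv: "has_velocity A \<xi> {0..T} t f"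
  shows "dens t l = snd (\<mu> t) f - H t (\<mu> t)"
proof -
  obtain c where c: "c \<in> A" "fst (\<mu> t) \<in> fst c" using exists_chart[OF CX_D(1)[OF z(1)]] by blast
  let ?V = "ham_vec A (H t) (\<mu> t)"
  note cv = cot_velocity[OF c(1) z(1) c(2) hv]
  have "((snd c \<circ> \<xi>) has_vector_derivative f c) (at t within {0..T})"
    using fv c proj[OF t] unfolding has_velocity_def by auto
  then have "((\<lambda>s. pos c (\<mu> s)) has_vector_derivative f c) (at t within {0..T})"
    by (rule has_vector_derivative_transform[OF t, rotated]) (simp add: pos_def proj)
  then have f: "fst (?V (cot_chart A c)) = f c"
    using vector_derivative_unique_within_closed_interval[of 0 T t, unfolded cbox_interval, OF T t cv(1)] by simp
  have "f \<in> tangent_space A (fst (\<mu> t))" using fv proj[OF t] unfolding has_velocity_def by simp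
  then have "snd (\<mu> t) f = mom c (\<mu> t) \<bullet> f c" by (rule covec_apply[OF z(1) c])
  then show ?thesis
    using liouville_eq[OF z(1) c cv(3)] f unfolding action_density_def z(2)[symmetric] by simp
qed

end

theorem theorem3p10:
  fixes P :: "('m, 'e::euclidean_space, 'u::euclidean_space) control_problem"
    and gM :: "'m \<Rightarrow> ('m, 'e) tvec \<Rightarrow> ('m, 'e) tvec \<Rightarrow> real"
    and gT :: "('m, 'e) covec \<Rightarrow> (('m, 'e) covec, 'e \<times> 'e) tvec \<Rightarrow>
                 (('m, 'e) covec, 'e \<times> 'e) tvec \<Rightarrow> real"
    and T\<^sub>h T\<^sub>1 p\<^sub>0 :: real
    and \<xi>\<^sub>h :: "real \<Rightarrow> 'm" and \<upsilon>\<^sub>h :: "real \<Rightarrow> 'u" and \<mu>\<^sub>h :: "real \<Rightarrow> ('m, 'e) covec"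
    and \<alpha> \<beta> :: "'m \<Rightarrow> real" and dom\<alpha> dom\<beta> B\<^sub>0 :: "'m set"
    and J :: "real set" and Q Q' \<Lambda>\<^sub>0 \<Lambda> :: "('m, 'e) covec set"
    and H :: "real \<Rightarrow> ('m, 'e) covec \<Rightarrow> real"
    and \<H> :: "real \<Rightarrow> ('m, 'e) covec \<Rightarrow> ('m, 'e) covec"
  defines "M \<equiv> mfd P" and "A \<equiv> atl P"
  defines "dM \<equiv> riem_dist M A gM"
    and "dT \<equiv> riem_dist (cot_bundle M A) (cot_atlas A) gT"
    and "I \<equiv> {0..T\<^sub>1}"
  assumes data: "problem_data P"
    and metric_M: "riemannian_metric M A gM"
    and metric_T: "riemannian_metric (cot_bundle M A) (cot_atlas A) gT"
    and reference: "admissible P T\<^sub>h \<xi>\<^sub>h \<upsilon>\<^sub>h"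
    and pmp: "pmp_extremal P T\<^sub>h \<xi>\<^sub>h \<upsilon>\<^sub>h p\<^sub>0 \<mu>\<^sub>h"
    and normal: "p\<^sub>0 = 1"
    and alpha: "openin (mtop M A) dom\<alpha>" "\<xi>\<^sub>h 0 \<in> dom\<alpha>" "smooth_fun A dom\<alpha> \<alpha>"
      "\<forall>x\<in>init_mfd P \<inter> dom\<alpha>. \<alpha> x = p\<^sub>0 * init_cost P x"
      "diff_covec A \<alpha> (\<xi>\<^sub>h 0) = \<mu>\<^sub>h 0"
    and beta: "openin (mtop M A) dom\<beta>" "\<xi>\<^sub>h T\<^sub>h \<in> dom\<beta>" "smooth_fun A dom\<beta> \<beta>"
      "\<forall>x\<in>final_mfd P \<inter> dom\<beta>. \<beta> x = p\<^sub>0 * final_cost P x"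
      "\<forall>v\<in>tangent_space A (\<xi>\<^sub>h T\<^sub>h). diff_fun A \<beta> (\<xi>\<^sub>h T\<^sub>h) v = - snd (\<mu>\<^sub>h T\<^sub>h) v"
    and base: "openin (mtop M A) B\<^sub>0" "\<xi>\<^sub>h 0 \<in> B\<^sub>0" "B\<^sub>0 \<subseteq> dom\<alpha>"
      "contractible_space (subtopology (mtop M A) B\<^sub>0)"
    and Lambda0: "\<Lambda>\<^sub>0 = diff_covec A \<alpha> ` B\<^sub>0"
    and J: "open J" "is_interval J" "{0..T\<^sub>h} \<subseteq> J"
    and Q: "openin (cot_top M A) Q" "\<Lambda>\<^sub>0 \<subseteq> Q"
    and A1: "assumption_A1 M A dT J Q \<Lambda>\<^sub>0 H \<H>"
    and A2: "assumption_A2 P T\<^sub>h \<upsilon>\<^sub>h p\<^sub>0 \<mu>\<^sub>h J Q \<Lambda>\<^sub>0 H \<H>"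
    and T1: "T\<^sub>h < T\<^sub>1" "I \<subseteq> J"
    and Lambda: "openin (cot_top M A) Q'" "\<mu>\<^sub>h 0 \<in> Q'" "\<Lambda> = \<Lambda>\<^sub>0 \<inter> Q'"
      "\<forall>\<l>\<in>\<Lambda>. \<exists>\<mu>. ham_solution M A (cot_bundle M A) (ref_ham P p\<^sub>0 \<upsilon>\<^sub>h) {0..T\<^sub>h} \<mu> \<and> \<mu> 0 = \<l>"
    and A3: "assumption_A3 M A dM dT T\<^sub>h \<xi>\<^sub>h I \<Lambda> \<H>"
    and minimiser: "\<exists>\<O>. openin
          (subtopology (prod_topology euclideanreal (mtop M A))
            ((if final_time P = None then UNIV else {T\<^sub>h}) \<times> final_mfd P)) \<O> \<and>
        (T\<^sub>h, \<xi>\<^sub>h T\<^sub>h) \<in> \<O> \<and> \<O> \<subseteq> flow_image I \<Lambda> \<H> \<and> \<O> \<subseteq> UNIV \<times> dom\<beta> \<and>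
        (\<forall>z\<in>\<O>. Phi A \<alpha> \<beta> H \<H> \<Lambda> (T\<^sub>h, \<xi>\<^sub>h T\<^sub>h) \<le> Phi A \<alpha> \<beta> H \<H> \<Lambda> z)"
  shows "strong_local_minimiser P T\<^sub>h \<xi>\<^sub>h \<upsilon>\<^sub>h"
proof -
  have man: "smooth_atlas M A" "Hausdorff_space (mtop M A)" "connected_space (mtop M A)"
    using data unfolding problem_data_def smooth_manifold_def M_def A_def by blast+
  have ctrl: "(x, u) \<in> dom_dyn P" if "x \<in> M" "u \<in> ctrl P" for x u
    using data that unfolding problem_data_def M_def by blast
  have field: "vfield P x u \<in> tangent_space A x" if "(x, u) \<in> dom_dyn P" for x u
    using data that unfolding problem_data_def A_def by blast
  define D where "D (c :: ('m, 'e) chart) = {(y, u). y \<in> snd c ` fst c \<and> (chart_inv c y, u) \<in> dom_dyn P}" for c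
  have Dsmooth: "smooth_on (D c) (\<lambda>(y, u). run_cost P (chart_inv c y) u)" "smooth_on (D c) (\<lambda>(y, u). vfield P (chart_inv c y) u c)"
    if "c \<in> A" for c
  proof -
    have "\<forall>c\<in>A. let D = {(y, u). y \<in> snd c ` fst c \<and> (chart_inv c y, u) \<in> dom_dyn P} in
        smooth_on D (\<lambda>(y, u). run_cost P (chart_inv c y) u) \<and> smooth_on D (\<lambda>(y, u). vfield P (chart_inv c y) u c)"
      using data unfolding problem_data_def A_def by (elim conjE)
    from bspec[OF this that] show "smooth_on (D c) (\<lambda>(y, u). run_cost P (chart_inv c y) u)" "smooth_on (D c) (\<lambda>(y, u). vfield P (chart_inv c y) u c)"
      unfolding Let_def D_def by (rule conjunct1, rule conjunct2)
  qed
  interpret C2_atlas M A by (rule C2_atlas_of_smooth_atlas[OF man(1)])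
  interpret rm: riemannian_atlas M A gM by unfold_locales (rule metric_M)
  interpret cotangent_metric M A gT
    by unfold_locales (rule metric_T, rule man(2), rule man(3))
  have Th: "T\<^sub>h > 0" using reference unfolding admissible_def by blast
  have T0J: "0 \<in> J" "T\<^sub>h \<in> J" "{0..T\<^sub>h} \<subseteq> J" using J(3) Th by auto
  interpret exact_flow M A gT \<alpha> dom\<alpha> B\<^sub>0 J Q \<Lambda>\<^sub>0 H \<H>
    by unfold_locales (use alpha base Lambda0 J T0J A1 in \<open>simp_all add: dT_def\<close>)
  have dom: "dominated (\<lambda>x. vfield P x u) (\<lambda>x. run_cost P x u)" if u: "u \<in> ctrl P" for u
    unfolding dominated_def
  proof (intro conjI ballI)
    show "vfield P y u \<in> tangent_space A y" if "y \<in> M" for y by (rule field[OF ctrl[OF that u]])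
    fix c assume c: "c \<in> A"
    have sub: "(\<lambda>y. (y, u)) ` (snd c ` fst c) \<subseteq> D c"
      using ctrl[OF _ u] chart_in_X[OF c] c unfolding D_def by auto
    have "continuous_on (D c) (\<lambda>(y, u). run_cost P (chart_inv c y) u)" "continuous_on (D c) (\<lambda>(y, u). vfield P (chart_inv c y) u c)"
      using Dsmooth[OF c] unfolding smooth_on_def by (metis Ck_on.simps(1))+
    moreover have "continuous_on (snd c ` fst c) (\<lambda>y. (y, u))" by (intro continuous_intros)
    ultimately show "continuous_on (snd c ` fst c) (\<lambda>y. vfield P (chart_inv c y) u c)" "continuous_on (snd c ` fst c) (\<lambda>y. run_cost P (chart_inv c y) u)"
      using continuous_on_compose2[OF _ _ sub] by fastforce+
  next
    fix t l assume tl: "t \<in> J" "l \<in> \<Lambda>\<^sub>0"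
    have "ereal (pre_ham P p\<^sub>0 (\<H> t l) u) \<le> max_ham P p\<^sub>0 (\<H> t l)" unfolding max_ham_def by (rule SUP_upper[OF u])
    also have "\<dots> \<le> ereal (H t (\<H> t l))" using A2 tl unfolding assumption_A2_def by blast
    finally show "snd (\<H> t l) (vfield P (fst (\<H> t l)) u) - run_cost P (fst (\<H> t l)) u \<le> H t (\<H> t l)"
      by (simp add: pre_ham_def normal)
  qed
  have IJ: "t \<in> J" if "t \<in> I" for t using that T1(2) by blast
  have LL: "\<Lambda> \<subseteq> \<Lambda>\<^sub>0" using Lambda(3) by blast
  have inj: "inj_on (\<lambda>(t, l). (t, fst (\<H> t l))) (I \<times> \<Lambda>)"
    using A3 unfolding assumption_A3_def Let_def by (rule conjunct1)
  have injt: "inj_on (\<lambda>l. fst (\<H> t l)) \<Lambda>" if "t \<in> I" for t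
  proof (rule inj_onI)
    fix l l' assume "l \<in> \<Lambda>" "l' \<in> \<Lambda>" "fst (\<H> t l) = fst (\<H> t l')"
    then show "l = l'" using inj_onD[OF inj, of "(t, l)" "(t, l')"] that by simp
  qed
  have Uopen: "openin (subtopology (prod_topology euclideanreal (mtop M A)) (I \<times> M)) (flow_image I \<Lambda> \<H>)"
    by (rule A3[unfolded assumption_A3_def Let_def, THEN conjunct2, THEN conjunct2, THEN conjunct2, THEN conjunct1])
  have Ugraph: "(\<lambda>t. (t, \<xi>\<^sub>h t)) ` {0..T\<^sub>h} \<subseteq> flow_image I \<Lambda> \<H>"
    by (rule A3[unfolded assumption_A3_def Let_def, THEN conjunct2, THEN conjunct2, THEN conjunct2, THEN conjunct2])
  obtain V\<^sub>0 where V0: "openin (prod_topology euclideanreal (mtop M A)) V\<^sub>0" "flow_image I \<Lambda> \<H> = V\<^sub>0 \<inter> (I \<times> M)"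
    using Uopen unfolding openin_subtopology by blast
  obtain O' where O': "openin (subtopology (prod_topology euclideanreal (mtop M A))
            ((if final_time P = None then UNIV else {T\<^sub>h}) \<times> final_mfd P)) O'"
    "(T\<^sub>h, \<xi>\<^sub>h T\<^sub>h) \<in> O'" "O' \<subseteq> flow_image I \<Lambda> \<H>" "O' \<subseteq> UNIV \<times> dom\<beta>"
    "\<And>z. z \<in> O' \<Longrightarrow> Phi A \<alpha> \<beta> H \<H> \<Lambda> (T\<^sub>h, \<xi>\<^sub>h T\<^sub>h) \<le> Phi A \<alpha> \<beta> H \<H> \<Lambda> z"
    using minimiser by blast
  obtain W where W: "openin (prod_topology euclideanreal (mtop M A)) W"
    "O' = W \<inter> ((if final_time P = None then UNIV else {T\<^sub>h}) \<times> final_mfd P)"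
    using O'(1) unfolding openin_subtopology by blast
  \<comment> \<open>The set \<open>\<U>\<close> is open only relative to \<open>I \<times> M\<close>. Trajectories start at time zero, so only times from \<open>T\<^sub>1\<close> on have to be removed.\<close>
  define V where "V = V\<^sub>0 \<inter> ({..<T\<^sub>1} \<times> M)"
  have Vopen: "openin (prod_topology euclideanreal (mtop M A)) V"
    unfolding V_def
  proof (rule openin_Int[OF V0(1)])
    have "openin (mtop M A) M" using openin_topspace[of "mtop M A"] by simp
    then show "openin (prod_topology euclideanreal (mtop M A)) ({..<T\<^sub>1} \<times> M)"
      by (simp add: openin_prod_Times_iff open_openin[symmetric])
  qed

  have ref_parts: "ac_curve CX CA {0..T\<^sub>h} \<mu>\<^sub>h" "\<And>t. t \<in> {0..T\<^sub>h} \<Longrightarrow> fst (\<mu>\<^sub>h t) = \<xi>\<^sub>h t"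
    "AE t in lebesgue. t \<in> {0..T\<^sub>h} \<longrightarrow> has_velocity CA \<mu>\<^sub>h {0..T\<^sub>h} t (ham_vec A (ref_ham P p\<^sub>0 \<upsilon>\<^sub>h t) (\<mu>\<^sub>h t))"
  proof -
    have h: "ham_solution M A CX (ref_ham P p\<^sub>0 \<upsilon>\<^sub>h) {0..T\<^sub>h} \<mu>\<^sub>h"
      using pmp unfolding pmp_extremal_def M_def A_def by (elim conjE)
    then show "ac_curve CX CA {0..T\<^sub>h} \<mu>\<^sub>h" unfolding ham_solution_def by (elim conjE)
    have "AE t in lebesgue. t \<in> {0..T\<^sub>h} \<longrightarrow> differentiable_at CA (ref_ham P p\<^sub>0 \<upsilon>\<^sub>h t) (\<mu>\<^sub>h t) \<and>
        has_velocity CA \<mu>\<^sub>h {0..T\<^sub>h} t (ham_vec A (ref_ham P p\<^sub>0 \<upsilon>\<^sub>h t) (\<mu>\<^sub>h t))"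
      using h unfolding ham_solution_def by (elim conjE)
    then show "AE t in lebesgue. t \<in> {0..T\<^sub>h} \<longrightarrow> has_velocity CA \<mu>\<^sub>h {0..T\<^sub>h} t (ham_vec A (ref_ham P p\<^sub>0 \<upsilon>\<^sub>h t) (\<mu>\<^sub>h t))"
      by eventually_elim blast
    show "fst (\<mu>\<^sub>h t) = \<xi>\<^sub>h t" if "t \<in> {0..T\<^sub>h}" for t
      using pmp that unfolding pmp_extremal_def by blast
  qed
  have ref_vel: "AE t in lebesgue. t \<in> {0..T\<^sub>h} \<longrightarrow> has_velocity A \<xi>\<^sub>h {0..T\<^sub>h} t (vfield P (\<xi>\<^sub>h t) (\<upsilon>\<^sub>h t))"
    using reference unfolding admissible_def A_def by (elim conjE)
  have A2': "AE t in lebesgue. t \<in> {0..T\<^sub>h} \<longrightarrow> H t (\<mu>\<^sub>h t) = ref_ham P p\<^sub>0 \<upsilon>\<^sub>h t (\<mu>\<^sub>h t) \<and>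
        differentiable_at CA (H t) (\<mu>\<^sub>h t) \<and> ham_vec A (H t) (\<mu>\<^sub>h t) = ham_vec A (ref_ham P p\<^sub>0 \<upsilon>\<^sub>h t) (\<mu>\<^sub>h t)"
    using conjunct2[OF A2[unfolded assumption_A2_def]] unfolding A_def by eventually_elim blast
  define l\<^sub>0 where "l\<^sub>0 = \<mu>\<^sub>h 0"
  have l0: "l\<^sub>0 \<in> \<Lambda>\<^sub>0" "l\<^sub>0 \<in> \<Lambda>"
    using imageI[OF base(2), of "diff_covec A \<alpha>"] Lambda(2) unfolding l\<^sub>0_def Lambda(3) Lambda0 alpha(5) by auto
  have ref_ae: "AE t in lebesgue. t \<in> {0..T\<^sub>h} \<longrightarrow> differentiable_at CA (H t) (\<mu>\<^sub>h t) \<and>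
      has_velocity CA \<mu>\<^sub>h {0..T\<^sub>h} t (ham_vec A (H t) (\<mu>\<^sub>h t))"
    using A2' ref_parts(3) by eventually_elim auto
  have ref: "\<mu>\<^sub>h t = \<H> t l\<^sub>0" if "t \<in> {0..T\<^sub>h}" for t
    by (rule reference_flow[OF Th T0J(2) Q(1) l0(1) l\<^sub>0_def[symmetric] ref_parts(1) ref_ae that])
  have ThI: "T\<^sub>h \<in> I" using Th T1(1) by (simp add: I_def)
  have adm_ends: "\<xi>\<^sub>h 0 \<in> init_mfd P" "\<xi>\<^sub>h T\<^sub>h \<in> final_mfd P" "set_integrable lebesgue {0..T\<^sub>h} (\<lambda>t. run_cost P (\<xi>\<^sub>h t) (\<upsilon>\<^sub>h t))"
    using reference unfolding admissible_def by blast+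
  \<comment> \<open>Equality in the verification argument: along the reference the action density is the running cost.\<close>
  have ref_cost: "cost P T\<^sub>h \<xi>\<^sub>h \<upsilon>\<^sub>h = Phi A \<alpha> \<beta> H \<H> \<Lambda> (T\<^sub>h, \<xi>\<^sub>h T\<^sub>h)"
  proof -
    have "fst (\<H> T\<^sub>h l\<^sub>0) = \<xi>\<^sub>h T\<^sub>h" using ref[of "T\<^sub>h"] ref_parts(2)[of "T\<^sub>h"] Th by simp
    then have "inv_into \<Lambda> (\<lambda>l. fst (\<H> T\<^sub>h l)) (\<xi>\<^sub>h T\<^sub>h) = l\<^sub>0"
      using inv_into_f_f[OF injt[OF ThI] l0(2)] by simp
    moreover have "\<beta> (\<xi>\<^sub>h T\<^sub>h) = final_cost P (\<xi>\<^sub>h T\<^sub>h)" using beta(2,4) adm_ends(2) normal by simp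
    moreover have "fst l\<^sub>0 = \<xi>\<^sub>h 0" using ref_parts(2)[of 0] Th by (simp add: l\<^sub>0_def)
    moreover have "\<alpha> (\<xi>\<^sub>h 0) = init_cost P (\<xi>\<^sub>h 0)" using alpha(2,4) adm_ends(1) normal by simp
    moreover have "(\<integral>t. dens t l\<^sub>0 \<partial>lebesgue_on {0..T\<^sub>h}) = (LINT t:{0..T\<^sub>h}|lebesgue. run_cost P (\<xi>\<^sub>h t) (\<upsilon>\<^sub>h t))"
    proof -
      have "AE t in lebesgue. t \<in> {0..T\<^sub>h} \<longrightarrow> dens t l\<^sub>0 = run_cost P (\<xi>\<^sub>h t) (\<upsilon>\<^sub>h t)"
        using A2' ref_ae ref_vel
      proof eventually_elim
        case (elim t)
        show ?case
        proof
          assume t: "t \<in> {0..T\<^sub>h}"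
          have "\<mu>\<^sub>h t \<in> CX" using flow_D(5)[OF l0(1), of t] ref[OF t] T0J(3) t by auto
          then have "dens t l\<^sub>0 = snd (\<mu>\<^sub>h t) (vfield P (\<xi>\<^sub>h t) (\<upsilon>\<^sub>h t)) - H t (\<mu>\<^sub>h t)"
            by (rule density_of_projection[of "T\<^sub>h" t "\<mu>\<^sub>h" "l\<^sub>0" "\<xi>\<^sub>h", OF Th t _ ref[OF t] ref_parts(2)]) (use elim t in auto)
          then show "dens t l\<^sub>0 = run_cost P (\<xi>\<^sub>h t) (\<upsilon>\<^sub>h t)"
            using elim(1) t ref_parts(2)[OF t] by (simp add: ref_ham_def pre_ham_def normal)
        qed
      qed
      then obtain N where N: "\<And>t. t \<notin> N \<Longrightarrow> t \<in> {0..T\<^sub>h} \<Longrightarrow> dens t l\<^sub>0 = run_cost P (\<xi>\<^sub>h t) (\<upsilon>\<^sub>h t)" "N \<in> null_sets lebesgue"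
        by (rule AE_E3) auto
      have "((\<lambda>t. dens t l\<^sub>0) has_integral (LINT t:{0..T\<^sub>h}|lebesgue. run_cost P (\<xi>\<^sub>h t) (\<upsilon>\<^sub>h t))) {0..T\<^sub>h}"
        by (rule has_integral_spike[OF _ _ has_integral_set_lebesgue[OF adm_ends(3)], of N])
           (use N in \<open>auto simp: negligible_iff_null_sets\<close>)
      then show ?thesis
        by (rule has_integral_unique[rotated])
           (rule has_integral_integral_lebesgue_on[OF density_integrable[OF l0(1) T0J(3)]], simp)
    qed
    ultimately show ?thesis by (simp add: Phi_def cost_def theta_eq)
  qed

  have compare: "cost P T\<^sub>h \<xi>\<^sub>h \<upsilon>\<^sub>h \<le> cost P T \<xi> \<upsilon>"
    if adm: "admissible P T \<xi> \<upsilon>" and graph: "(\<lambda>t. (t, \<xi> t)) ` {0..T} \<subseteq> V" and fin: "(T, \<xi> T) \<in> W" for T \<xi> \<upsilon>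
  proof -
    have T: "T > 0" and ac: "ac_curve M A {0..T} \<xi>"
      and vel: "AE t in lebesgue. t \<in> {0..T} \<longrightarrow> has_velocity A \<xi> {0..T} t (vfield P (\<xi> t) (\<upsilon> t))"
      and cc: "AE t in lebesgue. t \<in> {0..T} \<longrightarrow> \<upsilon> t \<in> ctrl P"
      and ends: "\<xi> 0 \<in> init_mfd P" "\<xi> T \<in> final_mfd P"
      and int: "set_integrable lebesgue {0..T} (\<lambda>t. run_cost P (\<xi> t) (\<upsilon> t))"
      and ft: "\<forall>\<tau>. final_time P = Some \<tau> \<longrightarrow> T = \<tau>"
      using adm unfolding admissible_def M_def A_def by blast+
    have inV: "(t, \<xi> t) \<in> V" if "t \<in> {0..T}" for t using graph that by auto
    have TI: "{0..T} \<subseteq> I" using inV[of T] T by (auto simp: V_def I_def)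
    have inU: "(t, \<xi> t) \<in> flow_image I \<Lambda> \<H>" if "t \<in> {0..T}" for t
      using inV[OF that] TI that unfolding V0(2) V_def by auto
    define lft where "lft t = inv_into \<Lambda> (\<lambda>l. fst (\<H> t l)) (\<xi> t)" for t
    have img: "\<xi> t \<in> (\<lambda>l. fst (\<H> t l)) ` \<Lambda>" if "t \<in> {0..T}" for t
      using inU[OF that] unfolding flow_image_def by auto
    have lft: "lft t \<in> \<Lambda>" "fst (\<H> t (lft t)) = \<xi> t" if "t \<in> {0..T}" for t
      unfolding lft_def by (rule inv_into_into[OF img[OF that]], rule f_inv_into_f[OF img[OF that]])
    obtain L where L: "L \<ge> 0" "\<And>t t' l l'. \<lbrakk>t \<in> I; t' \<in> I; l \<in> \<Lambda>; l' \<in> \<Lambda>\<rbrakk> \<Longrightarrow>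
       riem_dist CX CA gT l l' \<le> L * (\<bar>t - t'\<bar> + \<bar>dM (fst (\<H> t l)) (fst (\<H> t' l'))\<bar>)"
      by (rule inverse_lipschitz[OF A3[unfolded dT_def]]) blast
    interpret lc: lifted_curve M A gT \<alpha> dom\<alpha> B\<^sub>0 J Q \<Lambda>\<^sub>0 H \<H> gM T \<xi> lft
    proof unfold_locales
      show "0 < T" by (rule T)
      show "T \<in> J" by (rule IJ[OF subsetD[OF TI]]) (use T in simp)
      show "continuous_map (top_of_set {0..T}) (mtop M A) \<xi>" using ac unfolding ac_curve_def by (rule conjunct1)
      show "lft t \<in> \<Lambda>\<^sub>0" "fst (\<H> t (lft t)) = \<xi> t" if "t \<in> {0..T}" for t using lft[OF that] LL by auto
      show "\<exists>L\<ge>0. \<forall>t\<in>{0..T}. \<forall>t'\<in>{0..T}. riem_dist CX CA gT (lft t) (lft t') \<le> L * (\<bar>t - t'\<bar> + \<bar>riem_dist M A gM (\<xi> t) (\<xi> t')\<bar>)"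
      proof (intro exI[of _ L] conjI ballI L(1))
        fix t t' assume t: "t \<in> {0..T}" "t' \<in> {0..T}"
        show "riem_dist CX CA gT (lft t) (lft t') \<le> L * (\<bar>t - t'\<bar> + \<bar>riem_dist M A gM (\<xi> t) (\<xi> t')\<bar>)"
          using L(2)[OF subsetD[OF TI t(1)] subsetD[OF TI t(2)] lft(1)[OF t(1)] lft(1)[OF t(2)]]
          unfolding lft(2)[OF t(1)] lft(2)[OF t(2)] dM_def .
      qed
    qed
    have "AE t in lebesgue. t \<in> {0..T} \<longrightarrow> (\<exists>\<phi> \<psi>. dominated \<phi> \<psi> \<and> has_velocity A \<xi> {0..T} t (\<phi> (\<xi> t)) \<and> \<psi> (\<xi> t) = run_cost P (\<xi> t) (\<upsilon> t))"
      using vel cc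
    proof eventually_elim
      case (elim t)
      then show ?case using dom[of "\<upsilon> t"] by blast
    qed
    from lc.lifted_action_le[OF ac int this]
    have incr: "tht T (lft T) - tht 0 (lft 0) \<le> (LINT t:{0..T}|lebesgue. run_cost P (\<xi> t) (\<upsilon> t))"
      unfolding lc.lifted_action_def .
    have z: "0 \<in> {0..T}" "T \<in> {0..T}" using T by auto
    have l00: "lft 0 \<in> \<Lambda>\<^sub>0" using lft(1)[OF z(1)] LL by blast
    have "fst (lft 0) = \<xi> 0" using lft(2)[OF z(1)] flow_D(1)[OF l00] by simp
    moreover have "fst (lft 0) \<in> B\<^sub>0" using l00 unfolding Lambda0 by (auto simp: diff_covec_def)
    moreover have "(\<integral>t. dens t (lft 0) \<partial>lebesgue_on {0..0}) = 0" using theta_diff[OF l00, of 0 0] T0J(1) by simp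
    ultimately have th0: "tht 0 (lft 0) = init_cost P (\<xi> 0)"
      using alpha(4) ends(1) base(3) normal by (auto simp: theta_eq)
    have "(T, \<xi> T) \<in> O'"
    proof -
      have "T \<in> (if final_time P = None then UNIV else {T\<^sub>h})"
        using ft reference unfolding admissible_def by (cases "final_time P") auto
      then show ?thesis unfolding W(2) using fin ends(2) by auto
    qed
    then have "Phi A \<alpha> \<beta> H \<H> \<Lambda> (T\<^sub>h, \<xi>\<^sub>h T\<^sub>h) \<le> Phi A \<alpha> \<beta> H \<H> \<Lambda> (T, \<xi> T)" and "\<xi> T \<in> dom\<beta>"
      using O'(4,5) by auto
    moreover from this(2) have "\<beta> (\<xi> T) = final_cost P (\<xi> T)" using beta(4) ends(2) normal by auto
    ultimately have "cost P T\<^sub>h \<xi>\<^sub>h \<upsilon>\<^sub>h \<le> final_cost P (\<xi> T) + tht T (lft T)"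
      unfolding ref_cost by (simp add: Phi_def lft_def)
    also have "\<dots> \<le> cost P T \<xi> \<upsilon>" using incr th0 by (simp add: cost_def)
    finally show ?thesis .
  qed
  have refV: "(\<lambda>t. (t, \<xi>\<^sub>h t)) ` {0..T\<^sub>h} \<subseteq> V"
    using Ugraph T1(1) unfolding V0(2) V_def by auto
  have refW: "(T\<^sub>h, \<xi>\<^sub>h T\<^sub>h) \<in> W" using O'(2) unfolding W(2) by blast
  show ?thesis
    unfolding strong_local_minimiser_def M_def[symmetric] A_def[symmetric]
    by (intro conjI[OF reference] exI[of _ V, OF exI[of _ W]] conjI allI impI Vopen W(1) refV refW)
       (elim conjE, rule compare)
qed

end
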